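(* Let $n\geq 4$ be an even integer, let $(M^n,c)$ be a conformal manifold and let $VM$ be a vector bundle over $M$. If $g_{\rm E}\in c$ is an Einstein metric and $A_{\rm YM}$ is a connection on $VM$ that is Yang--Mills with respect to $g_{\rm E}$, then the conformal Yang--Mills current of $A_{\rm YM}$ vanishes: $$ k[g_{\rm E},A_{\rm YM}]=0\, . $$
   Context: Conventions. All structures are smooth, manifolds are connected, metrics are Riemannian. $[\nabla_a,\nabla_b]v^c=R_{ab}{}^c{}_dv^d$, $R_{bc}=R_{ab}{}^a{}_c$; in dimension $m\geq3$ the Schouten tensor is $P_{ab}=\frac1{m-2}\big(R_{ab}-\frac{R}{2(m-1)}g_{ab}\big)$. A metric is Einstein if its trace-free Schouten tensor vanishes. The curvature $F$ of a connection $A$ on $VM$ is given by $[\nabla_a,\nabla_b]v^\alpha=F_{ab}{}^\alpha{}_\beta v^\beta$, where $\nabla$ is coupled to $A$ and the Levi--Civita connection of $g$. The Yang--Mills current is $j_a[g,A]=g^{bc}\nabla_bF_{ca}$, and $A$ is Yang--Mills with respect to $g$ if $j[g,A]=0$. $\mathcal O(s^\ell)$ means $s^\ell$ times a quantity smooth up to the boundary. Conformal Yang--Mills current. Let $n\ge4$ be even, $(M^n,c)$ conformal, $A$ a connection on $VM$. On a collar $X=[0,\varepsilon)\times M$ with boundary $M$ and interior $X_+$ there is a complete metric $g_+$ on $X_+$ such that, for a defining function $s$ of $M$ (zero locus $M$, $ds\neq0$ along $M$), $s^2g_+$ extends smoothly to a metric on $X$ inducing $c$ on $M$, and $P^{g_+}+\frac12g_+=\mathcal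 O(s^{n-2})$; it is determined by $c$ modulo terms of sufficiently high order. There is an extension of $A$ to a connection $\boldsymbol A$ on a bundle $VX$ extending $VM$ with $j[g_+,\boldsymbol A]=\mathcal O(s^{n-2})$. Then $k[g,A]:=s^{2-n}j[g_+,\boldsymbol A]\big|_M$, where $g\in c$ is the metric on $M$ induced by $s^2g_+$. This is a well-defined $1$-form on $M$ valued in $\operatorname{End}VM$, and $k[\Omega^2g,A]=\Omega^{2-n}k[g,A]$ for every smooth $\Omega>0$. *)

theory Defs
  imports "HOL-Analysis.Analysis"
begin

section \<open>Smooth functions on subsets of coordinate space\<close>

text \<open>Partial derivatives are taken within a set, so that they make sense at boundary points of
  half-space domains. On open sets they are the usual ones.\<close>

definition pd :: "(real^'k) set \<Rightarrow> (real^'k \<Rightarrow> 'b::real_normed_vector) \<Rightarrow> 'k::finite \<Rightarrow> real^'k \<Rightarrow> 'b" where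
  "pd S f k x = frechet_derivative f (at x within S) (axis k 1)"

abbreviation partial :: "'k::finite \<Rightarrow> (real^'k \<Rightarrow> 'b::real_normed_vector) \<Rightarrow> real^'k \<Rightarrow> 'b" where
  "partial k f x \<equiv> pd UNIV f k x"

primrec Ck_on :: "nat \<Rightarrow> (real^'k::finite) set \<Rightarrow> (real^'k \<Rightarrow> 'b::real_normed_vector) \<Rightarrow> bool" where
  "Ck_on 0 W f \<longleftrightarrow> continuous_on W f"
| "Ck_on (Suc m) W f \<longleftrightarrow> f differentiable_on W \<and> (\<forall>k. Ck_on m W (pd W f k))"

text \<open>Smoothness on an arbitrary set means local smooth extendability to open sets; for half-space
  domains this is smoothness up to the boundary.\<close>

definition smooth_on :: "(real^'k::finite) set \<Rightarrow> (real^'k \<Rightarrow> 'b::real_normed_vector) \<Rightarrow> bool" where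
  "smooth_on S f \<longleftrightarrow>
    (\<forall>x\<in>S. \<exists>W h. open W \<and> x \<in> W \<and> (\<forall>m. Ck_on m W h) \<and> (\<forall>y\<in>S \<inter> W. f y = h y))"

section \<open>Manifolds\<close>

text \<open>A chart is a pair of a domain and a coordinate map; the map is irrelevant off the domain.\<close>

type_synonym ('p, 'k) chart = "'p set \<times> ('p \<Rightarrow> real^'k)"

definition crd :: "('p, 'k::finite) chart \<Rightarrow> 'p set \<Rightarrow> (real^'k) set" where
  "crd c B = snd c ` (fst c \<inter> B)"

definition pt :: "('p, 'k::finite) chart \<Rightarrow> real^'k \<Rightarrow> 'p" where
  "pt c = inv_into (fst c) (snd c)"

definition change :: "('p, 'k::finite) chart \<Rightarrow> ('p, 'k) chart \<Rightarrow> real^'k \<Rightarrow> real^'k" where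
  "change c d = snd d \<circ> pt c"

definition jac :: "('p, 'k::finite) chart \<Rightarrow> ('p, 'k) chart \<Rightarrow> real^'k \<Rightarrow> real^'k^'k" where
  "jac c d x = matrix (frechet_derivative (change c d) (at x within crd c (fst d)))"

text \<open>The underlying space is the whole type. Its Hausdorff property and second countability are
  type class constraints.\<close>

definition smooth_manifold ::
    "('m::{t2_space, second_countable_topology}, 'n::finite) chart set \<Rightarrow> bool" where
  "smooth_manifold At \<longleftrightarrow>
    connected (UNIV :: 'm set) \<and>
    (\<Union>c\<in>At. fst c) = UNIV \<and>
    (\<forall>c\<in>At. open (fst c) \<and> open (crd c UNIV) \<and>
       homeomorphism (fst c) (crd c UNIV) (snd c) (pt c)) \<and>
    (\<forall>c\<in>At. \<forall>d\<in>At. smooth_on (crd c (fst d)) (change c d))"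

definition smooth_function :: "('p, 'k::finite) chart set \<Rightarrow> ('p \<Rightarrow> real) \<Rightarrow> bool" where
  "smooth_function Ch f \<longleftrightarrow> (\<forall>c\<in>Ch. smooth_on (crd c UNIV) (f \<circ> pt c))"

text \<open>The collar \<open>[0,\<epsilon>) \<times> M\<close>. Its coordinates are indexed by \<open>'n option\<close>, where \<open>None\<close> is the
  coordinate of \<open>[0,\<epsilon>)\<close> and \<open>Some i\<close> are the coordinates of \<open>M\<close>.\<close>

definition collar :: "real \<Rightarrow> (real \<times> 'm) set" where
  "collar \<epsilon> = {0..<\<epsilon>} \<times> UNIV"

definition collar_interior :: "real \<Rightarrow> (real \<times> 'm) set" where
  "collar_interior \<epsilon> = {0<..<\<epsilon>} \<times> UNIV"

definition cons_coord :: "real \<Rightarrow> real^'n::finite \<Rightarrow> real^'n option" where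
  "cons_coord t x = (\<chi> k. case k of None \<Rightarrow> t | Some i \<Rightarrow> x $ i)"

definition collar_chart :: "real \<Rightarrow> ('m, 'n::finite) chart \<Rightarrow> (real \<times> 'm, 'n option) chart" where
  "collar_chart \<epsilon> c = ({0..<\<epsilon>} \<times> fst c, \<lambda>(t, p). cons_coord t (snd c p))"

section \<open>Metrics and curvature\<close>

text \<open>A tensor is given by its components in every chart of the atlas; only the values on the
  coordinate image matter. The argument \<open>B\<close> is the part of the space on which the metric lives.\<close>

type_synonym ('p, 'k) metric = "('p, 'k) chart \<Rightarrow> real^'k \<Rightarrow> real^'k^'k"

definition riemannian_metric ::
    "('p, 'k::finite) chart set \<Rightarrow> 'p set \<Rightarrow> ('p, 'k) metric \<Rightarrow> bool" where
  "riemannian_metric Ch B g \<longleftrightarrow>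
    (\<forall>c\<in>Ch. smooth_on (crd c B) (g c) \<and>
       (\<forall>x\<in>crd c B. transpose (g c x) = g c x \<and> (\<forall>v. v \<noteq> 0 \<longrightarrow> v \<bullet> (g c x *v v) > 0))) \<and>
    (\<forall>c\<in>Ch. \<forall>d\<in>Ch. \<forall>x\<in>crd c (fst d \<inter> B).
       g c x = transpose (jac c d x) ** g d (change c d x) ** jac c d x)"

text \<open>Connection matrices act by \<open>\<nabla>\<^sub>a v = \<partial>\<^sub>a v + A\<^sub>a v\<close>. The curvature is the matrix of
  \<open>[\<nabla>\<^sub>a,\<nabla>\<^sub>b]\<close> (with \<open>\<nabla>\<close> coupled to a torsion-free connection), that is,
  \<open>[\<partial>\<^sub>a + A\<^sub>a, \<partial>\<^sub>b + A\<^sub>b]\<close>.\<close>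

definition curv ::
    "('k::finite \<Rightarrow> real^'k \<Rightarrow> real^'r^'r) \<Rightarrow> 'k \<Rightarrow> 'k \<Rightarrow> real^'k \<Rightarrow> real^'r^'r::finite" where
  "curv A a b x = partial a (A b) x - partial b (A a) x + A a x ** A b x - A b x ** A a x"

text \<open>The Levi-Civita connection as a connection on the tangent bundle:
  \<open>levi_civita g a x $ c $ b\<close> is the Christoffel symbol with upper index \<open>c\<close> and lower indices
  \<open>a\<close>, \<open>b\<close>.\<close>

definition levi_civita ::
    "(real^'k \<Rightarrow> real^'k^'k) \<Rightarrow> 'k::finite \<Rightarrow> real^'k \<Rightarrow> real^'k^'k" where
  "levi_civita g a x = (\<chi> c b. (1/2) * (\<Sum>d\<in>UNIV. matrix_inv (g x) $ c $ d *
     (partial a (\<lambda>y. g y $ d $ b) x + partial b (\<lambda>y. g y $ d $ a) x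
        - partial d (\<lambda>y. g y $ a $ b) x)))"

definition ricci :: "(real^'k \<Rightarrow> real^'k^'k) \<Rightarrow> real^'k \<Rightarrow> real^'k^'k::finite" where
  "ricci g x = (\<chi> b c. \<Sum>a\<in>UNIV. curv (levi_civita g) a b x $ a $ c)"

definition metric_trace :: "(real^'k \<Rightarrow> real^'k^'k) \<Rightarrow> (real^'k \<Rightarrow> real^'k^'k) \<Rightarrow> real^'k::finite \<Rightarrow> real" where
  "metric_trace g h x = (\<Sum>a\<in>UNIV. \<Sum>b\<in>UNIV. matrix_inv (g x) $ a $ b * h x $ a $ b)"

definition schouten :: "(real^'k \<Rightarrow> real^'k^'k) \<Rightarrow> real^'k \<Rightarrow> real^'k^'k::finite" where
  "schouten g x =
    (1 / (real CARD('k) - 2)) *\<^sub>R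
      (ricci g x - (metric_trace g (ricci g) x / (2 * (real CARD('k) - 1))) *\<^sub>R g x)"

definition einstein_metric :: "('m, 'n::finite) chart set \<Rightarrow> ('m, 'n) metric \<Rightarrow> bool" where
  "einstein_metric At g \<longleftrightarrow>
    (\<forall>c\<in>At. \<forall>x\<in>crd c UNIV.
       schouten (g c) x - (metric_trace (g c) (schouten (g c)) x / real CARD('n)) *\<^sub>R g c x = 0)"

definition conformal_class ::
    "('m, 'n::finite) chart set \<Rightarrow> ('m, 'n) metric \<Rightarrow> ('m, 'n) metric set" where
  "conformal_class At g =
    {h. riemannian_metric At UNIV h \<and>
        (\<exists>\<Omega>. smooth_function At \<Omega> \<and> (\<forall>p. \<Omega> p > 0) \<and>
           (\<forall>c\<in>At. \<forall>x\<in>crd c UNIV. h c x = (\<Omega> (pt c x))\<^sup>2 *\<^sub>R g c x))}"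

definition conformal_structure ::
    "('m, 'n::finite) chart set \<Rightarrow> ('m, 'n) metric set \<Rightarrow> bool" where
  "conformal_structure At C \<longleftrightarrow>
    (\<exists>g. riemannian_metric At UNIV g \<and> C = conformal_class At g)"

section \<open>Completeness\<close>

definition C1_curve ::
    "('p::topological_space, 'k::finite) chart set \<Rightarrow> 'p set \<Rightarrow> (real \<Rightarrow> 'p) \<Rightarrow> bool" where
  "C1_curve Ch B \<gamma> \<longleftrightarrow>
    \<gamma> ` {0..1} \<subseteq> B \<and> continuous_on {0..1} \<gamma> \<and>
    (\<forall>c\<in>Ch. let T = {t\<in>{0..1}. \<gamma> t \<in> fst c} in
       (\<forall>t\<in>T. (snd c \<circ> \<gamma>) differentiable (at t within {0..1})) \<and>
       continuous_on T (\<lambda>t. vector_derivative (snd c \<circ> \<gamma>) (at t within {0..1})))"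

text \<open>The speed does not depend on the chart used to compute it.\<close>

definition speed ::
    "('p, 'k::finite) chart set \<Rightarrow> ('p, 'k) metric \<Rightarrow> (real \<Rightarrow> 'p) \<Rightarrow> real \<Rightarrow> real" where
  "speed Ch g \<gamma> t =
    (let c = (SOME c. c \<in> Ch \<and> \<gamma> t \<in> fst c);
         v = vector_derivative (snd c \<circ> \<gamma>) (at t within {0..1})
     in sqrt (v \<bullet> (g c (snd c (\<gamma> t)) *v v)))"

definition riemannian_dist ::
    "('p::topological_space, 'k::finite) chart set \<Rightarrow> 'p set \<Rightarrow> ('p, 'k) metric \<Rightarrow> 'p \<Rightarrow> 'p \<Rightarrow> real" where
  "riemannian_dist Ch B g p q =
    Inf {integral {0..1} (speed Ch g \<gamma>) | \<gamma>. C1_curve Ch B \<gamma> \<and> \<gamma> 0 = p \<and> \<gamma> 1 = q}"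

definition complete_metric ::
    "('p::topological_space, 'k::finite) chart set \<Rightarrow> 'p set \<Rightarrow> ('p, 'k) metric \<Rightarrow> bool" where
  "complete_metric Ch B g \<longleftrightarrow>
    (\<forall>u :: nat \<Rightarrow> 'p. range u \<subseteq> B \<and>
        (\<forall>e>0. \<exists>N. \<forall>i\<ge>N. \<forall>j\<ge>N. riemannian_dist Ch B g (u i) (u j) < e) \<longrightarrow>
        (\<exists>p\<in>B. (\<lambda>i. riemannian_dist Ch B g (u i) p) \<longlonglongrightarrow> 0))"

section \<open>Vector bundles and connections\<close>

text \<open>A vector bundle is given by its total space (the whole type \<open>'e\<close>), its projection and a set of
  local trivialisations. A trivialisation over \<open>W\<close> is the pair of \<open>W\<close> and the fibre component
  of the trivialising map. The vector space structure of the fibres is the one induced by any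
  trivialisation.\<close>

type_synonym ('p, 'e, 'r) triv = "'p set \<times> ('e \<Rightarrow> real^'r)"

record ('p, 'e, 'r) vbundle =
  proj :: "'e \<Rightarrow> 'p"
  trivs :: "('p, 'e, 'r) triv set"

text \<open>The matrix of a fibrewise map \<open>f\<close> at the point \<open>p\<close>, relative to a trivialisation of the source
  and one of the target. For \<open>f = id\<close> this is the transition function.\<close>

definition fibre_matrix ::
    "('e \<Rightarrow> 'p) \<Rightarrow> ('p, 'e, 'r::finite) triv \<Rightarrow> ('q, 'f, 'r) triv \<Rightarrow> ('e \<Rightarrow> 'f) \<Rightarrow> 'p \<Rightarrow> real^'r^'r" where
  "fibre_matrix \<pi> \<tau> \<sigma> f p = matrix (\<lambda>v. snd \<sigma> (f (THE e. \<pi> e = p \<and> snd \<tau> e = v)))"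

definition vector_bundle ::
    "('p::topological_space, 'k::finite) chart set \<Rightarrow> 'p set \<Rightarrow> ('p, 'e, 'r::finite) vbundle \<Rightarrow> bool" where
  "vector_bundle Ch B E \<longleftrightarrow>
    range (proj E) = B \<and>
    (\<Union>\<tau>\<in>trivs E. fst \<tau>) = B \<and>
    (\<forall>\<tau>\<in>trivs E. openin (top_of_set B) (fst \<tau>) \<and>
       bij_betw (\<lambda>e. (proj E e, snd \<tau> e)) (proj E -` fst \<tau>) (fst \<tau> \<times> UNIV)) \<and>
    (\<forall>\<tau>\<in>trivs E. \<forall>\<sigma>\<in>trivs E.
       (\<forall>e. proj E e \<in> fst \<tau> \<inter> fst \<sigma> \<longrightarrow>
          snd \<sigma> e = fibre_matrix (proj E) \<tau> \<sigma> id (proj E e) *v snd \<tau> e) \<and>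
       (\<forall>c\<in>Ch. smooth_on (crd c (fst \<tau> \<inter> fst \<sigma>)) (fibre_matrix (proj E) \<tau> \<sigma> id \<circ> pt c)))"

text \<open>A connection is given by its matrices in every chart and trivialisation. The last condition is
  the gauge transformation law \<open>A\<^sub>\<sigma> = G A\<^sub>\<tau> G\<inverse> - dG G\<inverse>\<close> for \<open>v\<^sub>\<sigma> = G v\<^sub>\<tau>\<close>.\<close>

type_synonym ('p, 'k, 'e, 'r) connection =
  "('p, 'k) chart \<Rightarrow> ('p, 'e, 'r) triv \<Rightarrow> 'k \<Rightarrow> real^'k \<Rightarrow> real^'r^'r"

definition connection ::
    "('p, 'k::finite) chart set \<Rightarrow> ('p, 'e, 'r::finite) vbundle \<Rightarrow> ('p, 'k, 'e, 'r) connection \<Rightarrow> bool" where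
  "connection Ch E A \<longleftrightarrow>
    (\<forall>c\<in>Ch. \<forall>\<tau>\<in>trivs E. \<forall>a. smooth_on (crd c (fst \<tau>)) (A c \<tau> a)) \<and>
    (\<forall>c\<in>Ch. \<forall>d\<in>Ch. \<forall>\<tau>\<in>trivs E. \<forall>x\<in>crd c (fst d \<inter> fst \<tau>). \<forall>a.
       A c \<tau> a x = (\<Sum>b\<in>UNIV. jac c d x $ b $ a *\<^sub>R A d \<tau> b (change c d x))) \<and>
    (\<forall>c\<in>Ch. \<forall>\<tau>\<in>trivs E. \<forall>\<sigma>\<in>trivs E. \<forall>x\<in>crd c (fst \<tau> \<inter> fst \<sigma>). \<forall>a.
       let G = fibre_matrix (proj E) \<tau> \<sigma> id \<circ> pt c in
         pd (crd c (fst \<tau> \<inter> fst \<sigma>)) G a x = G x ** A c \<tau> a x - A c \<sigma> a x ** G x)"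

text \<open>\<open>cov_curv g A b c a\<close> is \<open>\<nabla>\<^sub>b F\<^sub>c\<^sub>a\<close>, with \<open>\<nabla>\<close> coupled to the Levi-Civita connection of
  \<open>g\<close> and to \<open>A\<close>.\<close>

definition cov_curv ::
    "(real^'k \<Rightarrow> real^'k^'k) \<Rightarrow> ('k::finite \<Rightarrow> real^'k \<Rightarrow> real^'r^'r) \<Rightarrow> 'k \<Rightarrow> 'k \<Rightarrow> 'k \<Rightarrow>
      real^'k \<Rightarrow> real^'r^'r::finite" where
  "cov_curv g A b c a x =
    partial b (curv A c a) x
      - (\<Sum>d\<in>UNIV. levi_civita g b x $ d $ c *\<^sub>R curv A d a x)
      - (\<Sum>d\<in>UNIV. levi_civita g b x $ d $ a *\<^sub>R curv A c d x)
      + A b x ** curv A c a x - curv A c a x ** A b x"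

definition ym_current ::
    "(real^'k \<Rightarrow> real^'k^'k) \<Rightarrow> ('k::finite \<Rightarrow> real^'k \<Rightarrow> real^'r^'r) \<Rightarrow> 'k \<Rightarrow> real^'k \<Rightarrow> real^'r^'r::finite" where
  "ym_current g A a x =
    (\<Sum>b\<in>UNIV. \<Sum>c\<in>UNIV. matrix_inv (g x) $ b $ c *\<^sub>R cov_curv g A b c a x)"

definition yang_mills ::
    "('p, 'k::finite) chart set \<Rightarrow> ('p, 'e, 'r::finite) vbundle \<Rightarrow> ('p, 'k) metric \<Rightarrow>
      ('p, 'k, 'e, 'r) connection \<Rightarrow> bool" where
  "yang_mills Ch E g A \<longleftrightarrow>
    (\<forall>c\<in>Ch. \<forall>\<tau>\<in>trivs E. \<forall>x\<in>crd c (fst \<tau>). \<forall>a. ym_current (g c) (A c \<tau>) a x = 0)"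

section \<open>The conformal Yang-Mills current\<close>

definition defining_function ::
    "('m, 'n::finite) chart set \<Rightarrow> real \<Rightarrow> (real \<times> 'm \<Rightarrow> real) \<Rightarrow> bool" where
  "defining_function At \<epsilon> s \<longleftrightarrow>
    smooth_function (collar_chart \<epsilon> ` At) s \<and>
    (\<forall>q\<in>collar \<epsilon>. s q = 0 \<longleftrightarrow> fst q = 0) \<and>
    (\<forall>c\<in>collar_chart \<epsilon> ` At. \<forall>x\<in>crd c ({0} \<times> UNIV). \<exists>a. pd (crd c UNIV) (s \<circ> pt c) a x \<noteq> 0)"

text \<open>The metric that a metric on the collar induces on \<open>M\<close> is \<open>g\<close>.\<close>

definition induces ::
    "('m, 'n::finite) chart set \<Rightarrow> real \<Rightarrow> (real \<times> 'm, 'n option) metric \<Rightarrow> ('m, 'n) metric \<Rightarrow> bool" where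
  "induces At \<epsilon> gbar g \<longleftrightarrow>
    (\<forall>c\<in>At. \<forall>x\<in>crd c UNIV. \<forall>i j.
       gbar (collar_chart \<epsilon> c) (cons_coord 0 x) $ Some i $ Some j = g c x $ i $ j)"

text \<open>\<open>gp\<close> is a complete metric on the interior of the collar that is asymptotically
  Poincare-Einstein for the conformal class \<open>C\<close> of metrics on \<open>M\<close>, and \<open>s\<^sup>2 gp\<close> induces the metric
  \<open>g \<in> C\<close>.\<close>

definition poincare_einstein ::
    "('m::topological_space, 'n::finite) chart set \<Rightarrow> ('m, 'n) metric set \<Rightarrow> ('m, 'n) metric \<Rightarrow> real \<Rightarrow>
      (real \<times> 'm \<Rightarrow> real) \<Rightarrow> (real \<times> 'm, 'n option) metric \<Rightarrow> bool" where
  "poincare_einstein At C g \<epsilon> s gp \<longleftrightarrow>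
    \<epsilon> > 0 \<and> defining_function At \<epsilon> s \<and>
    riemannian_metric (collar_chart \<epsilon> ` At) (collar_interior \<epsilon>) gp \<and>
    complete_metric (collar_chart \<epsilon> ` At) (collar_interior \<epsilon>) gp \<and>
    (\<exists>gbar. riemannian_metric (collar_chart \<epsilon> ` At) (collar \<epsilon>) gbar \<and>
       (\<forall>c\<in>collar_chart \<epsilon> ` At. \<forall>x\<in>crd c (collar_interior \<epsilon>).
          gbar c x = (s (pt c x))\<^sup>2 *\<^sub>R gp c x) \<and>
       g \<in> C \<and> induces At \<epsilon> gbar g) \<and>
    (\<forall>c\<in>collar_chart \<epsilon> ` At. \<exists>Q. smooth_on (crd c (collar \<epsilon>)) Q \<and>
       (\<forall>x\<in>crd c (collar_interior \<epsilon>).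
          schouten (gp c) x + (1/2) *\<^sub>R gp c x = s (pt c x) ^ (CARD('n) - 2) *\<^sub>R Q x))"

text \<open>The bundle \<open>VX\<close> over the collar extends \<open>VM\<close>: \<open>\<iota>\<close> is an isomorphism from \<open>VM\<close> to the
  restriction of \<open>VX\<close> to \<open>{0} \<times> M\<close>.\<close>

definition bundle_extension ::
    "('m::topological_space, 'n::finite) chart set \<Rightarrow> real \<Rightarrow> ('m, 'e, 'r::finite) vbundle \<Rightarrow>
      (real \<times> 'm, 'f, 'r) vbundle \<Rightarrow> ('e \<Rightarrow> 'f) \<Rightarrow> bool" where
  "bundle_extension At \<epsilon> VM VX \<iota> \<longleftrightarrow>
    vector_bundle (collar_chart \<epsilon> ` At) (collar \<epsilon>) VX \<and>
    (\<forall>e. proj VX (\<iota> e) = (0, proj VM e)) \<and>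
    bij_betw \<iota> UNIV (proj VX -` ({0} \<times> UNIV)) \<and>
    (\<forall>\<tau>\<in>trivs VM. \<forall>\<sigma>\<in>trivs VX.
       (\<forall>e. proj VM e \<in> fst \<tau> \<inter> Pair 0 -` fst \<sigma> \<longrightarrow>
          snd \<sigma> (\<iota> e) = fibre_matrix (proj VM) \<tau> \<sigma> \<iota> (proj VM e) *v snd \<tau> e) \<and>
       (\<forall>c\<in>At. smooth_on (crd c (fst \<tau> \<inter> Pair 0 -` fst \<sigma>))
          (fibre_matrix (proj VM) \<tau> \<sigma> \<iota> \<circ> pt c)))"

text \<open>The connection \<open>AX\<close> on \<open>VX\<close> restricts to the connection \<open>A\<close> on \<open>VM\<close>; compare the gauge
  transformation law above.\<close>

definition connection_extension ::
    "('m::topological_space, 'n::finite) chart set \<Rightarrow> real \<Rightarrow> ('m, 'e, 'r::finite) vbundle \<Rightarrow>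
      (real \<times> 'm, 'f, 'r) vbundle \<Rightarrow> ('e \<Rightarrow> 'f) \<Rightarrow> ('m, 'n, 'e, 'r) connection \<Rightarrow>
      (real \<times> 'm, 'n option, 'f, 'r) connection \<Rightarrow> bool" where
  "connection_extension At \<epsilon> VM VX \<iota> A AX \<longleftrightarrow>
    connection (collar_chart \<epsilon> ` At) VX AX \<and>
    (\<forall>c\<in>At. \<forall>\<tau>\<in>trivs VM. \<forall>\<sigma>\<in>trivs VX. \<forall>x\<in>crd c (fst \<tau> \<inter> Pair 0 -` fst \<sigma>). \<forall>i.
       let H = fibre_matrix (proj VM) \<tau> \<sigma> \<iota> \<circ> pt c in
         partial i H x =
           H x ** A c \<tau> i x - AX (collar_chart \<epsilon> c) \<sigma> (Some i) (cons_coord 0 x) ** H x)"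

text \<open>\<open>k\<close> is the conformal Yang-Mills current of \<open>(g, A)\<close>, computed from the Poincare-Einstein metric
  \<open>gp\<close> with defining function \<open>s\<close> and the extension \<open>AX\<close> of \<open>A\<close>. The existence of the functions \<open>q\<close>
  with \<open>j = s\<^bsup>n-2\<^esup> q\<close> says that the current \<open>j\<close> of \<open>AX\<close> is \<open>O(s\<^bsup>n-2\<^esup>)\<close>; as \<open>q\<close> is smooth up to the
  boundary, its boundary value is determined by \<open>j\<close>. The last clause says that \<open>k\<close> is the pullback
  of \<open>q\<close> to \<open>M\<close>, with values in the endomorphisms of \<open>VM\<close> by means of \<open>\<iota>\<close>.\<close>

definition conformal_ym_current ::
    "('m::topological_space, 'n::finite) chart set \<Rightarrow> ('m, 'n) metric set \<Rightarrow> ('m, 'e, 'r::finite) vbundle \<Rightarrow>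
      ('m, 'n) metric \<Rightarrow> ('m, 'n, 'e, 'r) connection \<Rightarrow>
      real \<Rightarrow> (real \<times> 'm \<Rightarrow> real) \<Rightarrow> (real \<times> 'm, 'n option) metric \<Rightarrow>
      (real \<times> 'm, 'f, 'r) vbundle \<Rightarrow> ('e \<Rightarrow> 'f) \<Rightarrow> (real \<times> 'm, 'n option, 'f, 'r) connection \<Rightarrow>
      (('m, 'n) chart \<Rightarrow> ('m, 'e, 'r) triv \<Rightarrow> 'n \<Rightarrow> real^'n \<Rightarrow> real^'r^'r) \<Rightarrow> bool" where
  "conformal_ym_current At C VM g A \<epsilon> s gp VX \<iota> AX k \<longleftrightarrow>
    poincare_einstein At C g \<epsilon> s gp \<and>
    bundle_extension At \<epsilon> VM VX \<iota> \<and>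
    connection_extension At \<epsilon> VM VX \<iota> A AX \<and>
    (\<forall>c\<in>At. \<forall>\<sigma>\<in>trivs VX. \<exists>q.
       (\<forall>a. smooth_on (crd (collar_chart \<epsilon> c) (fst \<sigma>)) (q a)) \<and>
       (\<forall>a. \<forall>x\<in>crd (collar_chart \<epsilon> c) (fst \<sigma> \<inter> collar_interior \<epsilon>).
          ym_current (gp (collar_chart \<epsilon> c)) (AX (collar_chart \<epsilon> c) \<sigma>) a x =
            s (pt (collar_chart \<epsilon> c) x) ^ (CARD('n) - 2) *\<^sub>R q a x) \<and>
       (\<forall>\<tau>\<in>trivs VM. \<forall>x\<in>crd c (fst \<tau> \<inter> Pair 0 -` fst \<sigma>). \<forall>i.
          let H = fibre_matrix (proj VM) \<tau> \<sigma> \<iota> (pt c x) in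
            q (Some i) (cons_coord 0 x) ** H = H ** k c \<tau> i x))"

end

theory Submission
  imports Defs
begin

text \<open>Everything takes place near a boundary point. In a chart, \<open>g\<^sub>+ = r\<^sup>-\<^sup>2 G\<close> with \<open>G\<close> smooth up to \<open>r = 0\<close>, and
  polynomial changes of coordinates and of gauge give \<open>G = dr\<^sup>2 + h\<close> and \<open>A\<^sub>r = 0\<close> modulo high powers of \<open>r\<close>,
  where \<open>h\<close> and \<open>A\<close> restrict to \<open>g\<^sub>E\<close> and \<open>A\<^sub>Y\<^sub>M\<close> on the boundary. The asymptotic Einstein equation is then an
  equation for \<open>h\<close> in \<open>r \<partial>\<^sub>r\<close> that determines its expansion below the order \<open>r\<^sup>n\<close>, and
  \<open>(1 - \<mu> r\<^sup>2/2)\<^sup>2 g\<^sub>E\<close> with \<open>P = \<mu> g\<^sub>E\<close> solves it; that \<open>\<mu>\<close> is constant follows from the mixed components.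
  Dividing the tangential components of the Yang-Mills current by \<open>r\<close> gives
  \<open>r \<partial>\<^sub>r F\<^sub>r\<^sub>i + (3 - n) F\<^sub>r\<^sub>i + r j\<^sub>i[h, A]\<close> up to terms of higher order. The slices are homothetic to \<open>g\<^sub>E\<close>, so
  that \<open>j[h, A]\<close> vanishes to the same order as \<open>A - A\<^sub>Y\<^sub>M\<close>, and inductively \<open>A = A\<^sub>Y\<^sub>M + O(r\<^bsup>n-2\<^esup>)\<close>. A term
  of order \<open>r\<^bsup>n-2\<^esup>\<close> in \<open>A\<close> does not contribute at the indicial root \<open>n - 3\<close> of \<open>F\<^sub>r\<^sub>i\<close>, so the coefficient
  of \<open>r\<^bsup>n-3\<^esup>\<close>, which is \<open>k\<close>, is zero.\<close>

section \<open>Germs of smooth functions\<close>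

text \<open>A normal form of this kind usually comes from the flow of a gradient field. Only
  expansions below order n matter here, so the flow is replaced by finitely many corrections, each
  verified modulo the next power of r. All fields are known only for r >= 0. They are extended to
  germs on both sides of r = 0; an identity valid for r > 0 forces every normal derivative of the
  difference of its sides to vanish on r = 0, so each equation is read as a congruence modulo
  O(r^m), whatever the extension. The main obstacle is that \<mu> is a priori a function. With
  variable \<mu> the model metric solves the Einstein equation only modulo O(r^4). The expansion is
  therefore fixed to order 4 first, where n >= 4 enters. At that stage r^2 times the mixed Ricci
  component is (n - 1) r^3 d\<mu> to leading order, hence d\<mu> = 0, and only then can the
  comparison with the model run on. It has to stop at order n: a term c r^m of h enters the equation
  with the factor m (m - n) on its trace-free part, and with m (m - 2 n) on its trace.\<close>

lemma pd_open: "open W \<Longrightarrow> x \<in> W \<Longrightarrow> pd W f k x = partial k f x"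
  unfolding pd_def by (simp only: at_within_open)

lemma partial_eq: "(f has_derivative f') (at x) \<Longrightarrow> partial k f x = f' (axis k 1)"
  unfolding pd_def by (drule frechet_derivative_at) simp

section \<open>Derivatives as invariants of germs\<close>

lemma has_derivative_cong_nhds:
  assumes "\<forall>\<^sub>F y in nhds x. f y = g y"
  shows "(f has_derivative D) (at x) \<longleftrightarrow> (g has_derivative D) (at x)"
proof -
  from assms obtain S where S: "open S" "x \<in> S" "\<And>y. y \<in> S \<Longrightarrow> f y = g y"
    unfolding eventually_nhds by blast
  show ?thesis
  proof
    show "(g has_derivative D) (at x)" if "(f has_derivative D) (at x)"
      using that S(1,2) by (rule has_derivative_transform_within_open) (rule S(3))
    show "(f has_derivative D) (at x)" if "(g has_derivative D) (at x)"
      using that S(1,2) by (rule has_derivative_transform_within_open) (rule S(3)[symmetric])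
  qed
qed

lemma partial_cong:
  assumes "\<forall>\<^sub>F y in nhds x. f y = g y"
  shows "partial k f x = partial k g x"
  by (simp add: pd_def frechet_derivative_def has_derivative_cong_nhds[OF assms])

lemma Ck_on_cong:
  assumes W: "open W" and eq: "\<And>x. x \<in> W \<Longrightarrow> f x = g x"
  shows "Ck_on m W f \<longleftrightarrow> Ck_on m W g"
  using eq
proof (induction m arbitrary: f g)
  case 0
  have "continuous_on W f = continuous_on W g"
    by (rule continuous_on_cong[OF refl 0])
  then show ?case by simp
next
  case (Suc m)
  have ev: "\<forall>\<^sub>F y in nhds x. f y = g y" if "x \<in> W" for x
    using eventually_nhds_in_open[OF W that] by eventually_elim (rule Suc.prems)
  have "pd W f k x = pd W g k x" if "x \<in> W" for k x
    unfolding pd_open[OF W that] by (rule partial_cong[OF ev[OF that]])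
  then have "Ck_on m W (pd W f k) = Ck_on m W (pd W g k)" for k
    by (rule Suc.IH)
  moreover have "f differentiable_on W \<longleftrightarrow> g differentiable_on W"
    unfolding differentiable_on_eq_differentiable_at[OF W] differentiable_def
    by (intro ball_cong ex_cong1 refl has_derivative_cong_nhds[OF ev])
  ultimately show ?case unfolding Ck_on.simps by blast
qed

text \<open>On an open set the derivative within the set is the full derivative, so the recursion
  can be stated with \<open>partial\<close>, which does not mention the set. This makes restriction
  to smaller open sets, and hence germs, manageable.\<close>

lemma Ck_on_Suc_open:
  assumes "open W"
  shows "Ck_on (Suc m) W f \<longleftrightarrow>
    (\<forall>x\<in>W. f differentiable (at x)) \<and> (\<forall>k. Ck_on m W (partial k f))"
proof -
  have "Ck_on m W (pd W f k) = Ck_on m W (partial k f)" for k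
    by (rule Ck_on_cong[OF assms]) (rule pd_open[OF assms])
  then show ?thesis
    by (simp add: differentiable_on_eq_differentiable_at[OF assms])
qed

lemma Ck_on_antimono:
  assumes W: "open W"
  shows "Ck_on (Suc m) W f \<Longrightarrow> Ck_on m W f"
proof (induction m arbitrary: f)
  case 0
  then show ?case by (auto intro: differentiable_imp_continuous_on)
next
  case (Suc m)
  from Suc.prems have "f differentiable_on W" "Ck_on (Suc m) W (pd W f k)" for k
    by simp_all
  with Suc.IH show ?case by simp
qed

declare Ck_on.simps(2) [simp del]

lemma Ck_on_subset:
  assumes W: "open W" and V: "open V" "V \<subseteq> W"
  shows "Ck_on m W f \<Longrightarrow> Ck_on m V f"
proof (induction m arbitrary: f)
  case 0
  then show ?case using V by (auto intro: continuous_on_subset)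
next
  case (Suc m)
  from Suc.prems have d: "\<forall>x\<in>W. f differentiable (at x)" and p: "Ck_on m W (partial k f)" for k
    unfolding Ck_on_Suc_open[OF W] by simp_all
  show ?case
    unfolding Ck_on_Suc_open[OF V(1)] using d Suc.IH[OF p] V(2) by auto
qed

text \<open>The pattern of the closure proofs below: exhibit a derivative whose values on the
  coordinate vectors are built from operations already covered at order m. The induction runs over m
  for arbitrary functions.\<close>

lemma Ck_on_SucI:
  assumes W: "open W" and D: "\<And>x. x \<in> W \<Longrightarrow> (f has_derivative D x) (at x)"
    and C: "\<And>k. Ck_on m W (\<lambda>x. D x (axis k 1))"
  shows "Ck_on (Suc m) W f"
  unfolding Ck_on_Suc_open[OF W]
proof (intro conjI allI ballI)
  show "f differentiable (at x)" if "x \<in> W" for x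
    using D[OF that] unfolding differentiable_def by blast
  show "Ck_on m W (partial k f)" for k
    by (rule Ck_on_cong[OF W, THEN iffD1, OF _ C]) (simp add: partial_eq[OF D])
qed

lemma Ck_on_SucD:
  assumes W: "open W" and f: "Ck_on (Suc m) W f"
  shows "x \<in> W \<Longrightarrow> (f has_derivative frechet_derivative f (at x)) (at x)"
    and "Ck_on m W (\<lambda>x. frechet_derivative f (at x) (axis k 1))"
    and "Ck_on m W f"
proof -
  show "x \<in> W \<Longrightarrow> (f has_derivative frechet_derivative f (at x)) (at x)"
    using f unfolding Ck_on_Suc_open[OF W] frechet_derivative_works by blast
  have "Ck_on m W (partial k f)"
    using f unfolding Ck_on_Suc_open[OF W] by blast
  then show "Ck_on m W (\<lambda>x. frechet_derivative f (at x) (axis k 1))"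
    by (simp add: pd_def[abs_def])
  show "Ck_on m W f" by (rule Ck_on_antimono[OF W f])
qed

section \<open>Closure of the classes C^m under algebraic operations and composition\<close>

lemma Ck_on_const:
  assumes W: "open W"
  shows "Ck_on m W (\<lambda>x. c)"
proof (induction m arbitrary: c)
  case (Suc m)
  show ?case by (rule Ck_on_SucI[OF W has_derivative_const Suc])
qed simp

lemma Ck_on_ident:
  assumes W: "open W"
  shows "Ck_on m W (\<lambda>x. x)"
proof (cases m)
  case (Suc m)
  show ?thesis unfolding Suc by (rule Ck_on_SucI[OF W has_derivative_ident Ck_on_const[OF W]])
qed simp

lemma Ck_on_linear:
  assumes L: "bounded_linear L" and W: "open W"
  shows "Ck_on m W f \<Longrightarrow> Ck_on m W (\<lambda>x. L (f x))"
proof (induction m arbitrary: f)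
  case 0
  then show ?case by (simp add: bounded_linear.continuous_on[OF L])
next
  case (Suc m)
  show ?case
    by (rule Ck_on_SucI[OF W bounded_linear.has_derivative[OF L Ck_on_SucD(1)[OF W Suc.prems]]])
      (assumption, rule Suc.IH[OF Ck_on_SucD(2)[OF W Suc.prems]])
qed

lemma Ck_on_add:
  assumes W: "open W"
  shows "Ck_on m W f \<Longrightarrow> Ck_on m W g \<Longrightarrow> Ck_on m W (\<lambda>x. f x + g x)"
proof (induction m arbitrary: f g)
  case 0
  then show ?case by (auto intro: continuous_intros)
next
  case (Suc m)
  show ?case
    by (rule Ck_on_SucI[OF W has_derivative_add[OF Ck_on_SucD(1)[OF W Suc.prems(1)] Ck_on_SucD(1)[OF W Suc.prems(2)]]])
      (auto intro: Suc.IH[OF Ck_on_SucD(2)[OF W Suc.prems(1)] Ck_on_SucD(2)[OF W Suc.prems(2)]])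
qed

lemma Ck_on_bilinear:
  assumes B: "bounded_bilinear prd" and W: "open W"
  shows "Ck_on m W f \<Longrightarrow> Ck_on m W g \<Longrightarrow> Ck_on m W (\<lambda>x. prd (f x) (g x))"
proof (induction m arbitrary: f g)
  case 0
  then show ?case by (auto intro: bounded_bilinear.continuous_on[OF B])
next
  case (Suc m)
  note f = Ck_on_SucD[OF W Suc.prems(1)] and g = Ck_on_SucD[OF W Suc.prems(2)]
  show ?case
    by (rule Ck_on_SucI[OF W bounded_bilinear.FDERIV[OF B f(1) g(1)]])
      (auto intro: Ck_on_add[OF W Suc.IH[OF f(3) g(2)] Suc.IH[OF f(2) g(3)]])
qed

lemma Ck_on_sum:
  assumes "open W"
  shows "(\<And>i. i \<in> I \<Longrightarrow> Ck_on m W (f i)) \<Longrightarrow> Ck_on m W (\<lambda>x. \<Sum>i\<in>I. f i x)"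
  by (induction I rule: infinite_finite_induct) (auto intro: Ck_on_const Ck_on_add assms)

lemma linear_axis_expand:
  fixes L :: "real^'k::finite \<Rightarrow> 'b::real_normed_vector"
  assumes "linear L"
  shows "L v = (\<Sum>j\<in>UNIV. v $ j *\<^sub>R L (axis j 1))"
proof -
  have "L v = L (\<Sum>j\<in>UNIV. v $ j *\<^sub>R axis j 1)"
    by (subst basis_expansion[symmetric, of v]) (simp only: scalar_mult_eq_scaleR)
  also have "\<dots> = (\<Sum>j\<in>UNIV. v $ j *\<^sub>R L (axis j 1))"
    unfolding linear_sum[OF assms] linear_scale[OF assms] ..
  finally show ?thesis .
qed

text \<open>The chain rule is expanded over coordinates so that the derivative is a sum of products.
  The induction in \<open>Ck_on_compose\<close> can then treat the components of the derivative of
  \<Phi> and the composed partial derivatives of f separately.\<close>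

lemma has_derivative_chain:
  fixes f :: "real^'l::finite \<Rightarrow> 'b::real_normed_vector" and \<Phi> :: "real^'k::finite \<Rightarrow> real^'l"
  assumes "\<Phi> differentiable (at x)" "f differentiable (at (\<Phi> x))"
  shows "((\<lambda>y. f (\<Phi> y)) has_derivative
    (\<lambda>h. \<Sum>j\<in>UNIV. frechet_derivative \<Phi> (at x) h $ j *\<^sub>R frechet_derivative f (at (\<Phi> x)) (axis j 1))) (at x)"
proof -
  have "((\<lambda>y. f (\<Phi> y)) has_derivative (\<lambda>h. frechet_derivative f (at (\<Phi> x)) (frechet_derivative \<Phi> (at x) h))) (at x)"
    by (rule has_derivative_compose[OF assms[unfolded frechet_derivative_works]])
  moreover have "(\<lambda>h. frechet_derivative f (at (\<Phi> x)) (frechet_derivative \<Phi> (at x) h)) =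
      (\<lambda>h. \<Sum>j\<in>UNIV. frechet_derivative \<Phi> (at x) h $ j *\<^sub>R frechet_derivative f (at (\<Phi> x)) (axis j 1))"
    by (rule ext, rule linear_axis_expand, rule linear_frechet_derivative, rule assms)
  ultimately show ?thesis by simp
qed

lemma Ck_on_compose:
  fixes f :: "real^'l::finite \<Rightarrow> 'b::real_normed_vector" and \<Phi> :: "real^'k::finite \<Rightarrow> real^'l"
  assumes W: "open W" and V: "open V" and sub: "\<And>x. x \<in> W \<Longrightarrow> \<Phi> x \<in> V"
  shows "Ck_on m W \<Phi> \<Longrightarrow> Ck_on m V f \<Longrightarrow> Ck_on m W (\<lambda>x. f (\<Phi> x))"
proof (induction m arbitrary: f)
  case 0
  then show ?case using sub by (auto intro: continuous_on_compose2)
next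
  case (Suc m)
  note \<Phi> = Ck_on_SucD[OF W Suc.prems(1)] and f = Ck_on_SucD[OF V Suc.prems(2)]
  have "((\<lambda>y. f (\<Phi> y)) has_derivative
    (\<lambda>h. \<Sum>j\<in>UNIV. frechet_derivative \<Phi> (at x) h $ j *\<^sub>R frechet_derivative f (at (\<Phi> x)) (axis j 1))) (at x)"
    if "x \<in> W" for x
    using \<Phi>(1)[OF that] f(1)[OF sub[OF that]] by (intro has_derivative_chain) (auto simp: differentiable_def)
  then show ?case
    by (rule Ck_on_SucI[OF W])
      (assumption, intro Ck_on_sum W Ck_on_bilinear[OF bounded_bilinear_scaleR] Ck_on_linear[OF bounded_linear_vec_nth]
        \<Phi>(2) Suc.IH[OF \<Phi>(3) f(2)])
qed

lemma Ck_on_inverse: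
  fixes f :: "real^'k::finite \<Rightarrow> real"
  assumes W: "open W" and nz: "\<And>x. x \<in> W \<Longrightarrow> f x \<noteq> 0"
  shows "Ck_on m W f \<Longrightarrow> Ck_on m W (\<lambda>x. inverse (f x))"
proof (induction m)
  case 0
  then show ?case using nz by (auto intro: continuous_intros)
next
  case (Suc m)
  note f = Ck_on_SucD[OF W Suc.prems]
  \<comment> \<open>Nested products, with the factor - 1 split off, let the rule for bilinear maps
    apply directly.\<close>
  have D: "((\<lambda>y. inverse (f y)) has_derivative
      (\<lambda>h. (- 1) * (inverse (f x) * (frechet_derivative f (at x) h * inverse (f x))))) (at x)" if "x \<in> W" for x
    using Deriv.has_derivative_inverse[OF nz[OF that] f(1)[OF that]] by (simp add: mult.assoc)
  show ?case
    by (rule Ck_on_SucI[OF W D])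
      (assumption, intro Ck_on_const[OF W] Ck_on_bilinear[OF bounded_bilinear_mult W] f(2) Suc.IH[OF f(3)])
qed

text \<open>One neighbourhood has to serve all orders m. This makes smoothness at a point an open
  condition (\<open>smooth_at_eventually\<close>), so that identities between germs can be
  differentiated.\<close>

definition smooth_at :: "real^'k::finite \<Rightarrow> (real^'k \<Rightarrow> 'b::real_normed_vector) \<Rightarrow> bool" where
  "smooth_at x f \<longleftrightarrow> (\<exists>W. open W \<and> x \<in> W \<and> (\<forall>m. Ck_on m W f))"

named_theorems smooth_intros

lemma smooth_at_eventually: "smooth_at x f \<Longrightarrow> \<forall>\<^sub>F y in nhds x. smooth_at y f"
  unfolding smooth_at_def eventually_nhds by blast

lemma smooth_at_cong:
  assumes "\<forall>\<^sub>F y in nhds x. f y = g y" "smooth_at x f"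
  shows "smooth_at x g"
proof -
  obtain W where W: "open W" "x \<in> W" "\<And>m. Ck_on m W f"
    using assms(2) smooth_at_def by blast
  obtain S where S: "open S" "x \<in> S" "\<And>y. y \<in> S \<Longrightarrow> f y = g y"
    using assms(1) unfolding eventually_nhds by blast
  have "Ck_on m (W \<inter> S) f" for m
    using W S by (intro Ck_on_subset[OF W(1) _ _ W(3)]) auto
  then have "Ck_on m (W \<inter> S) g" for m
    using Ck_on_cong[of "W \<inter> S" f g m] W S by (simp add: open_Int)
  then show ?thesis using W S unfolding smooth_at_def by (intro exI[of _ "W \<inter> S"]) auto
qed

lemma smooth_at2I:
  assumes "smooth_at x f" "smooth_at x g"
    and "\<And>W m. open W \<Longrightarrow> x \<in> W \<Longrightarrow> (\<And>m. Ck_on m W f) \<Longrightarrow> (\<And>m. Ck_on m W g) \<Longrightarrow> Ck_on m W h"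
  shows "smooth_at x h"
proof -
  obtain W V where *: "open W" "x \<in> W" "\<And>m. Ck_on m W f" "open V" "x \<in> V" "\<And>m. Ck_on m V g"
    using assms(1,2) unfolding smooth_at_def by metis
  have "Ck_on m (W \<inter> V) f" "Ck_on m (W \<inter> V) g" for m
    using * by (auto intro: Ck_on_subset[of W _ m f] Ck_on_subset[of V _ m g])
  then show ?thesis
    unfolding smooth_at_def using assms(3)[of "W \<inter> V"] * by (intro exI[of _ "W \<inter> V"]) auto
qed

lemma smooth_at_const [smooth_intros, simp]: "smooth_at x (\<lambda>y. c)"
  unfolding smooth_at_def by (intro exI[of _ UNIV]) (simp add: Ck_on_const)

lemma smooth_at_ident [smooth_intros, simp]: "smooth_at x (\<lambda>y. y)"
  unfolding smooth_at_def by (intro exI[of _ UNIV]) (simp add: Ck_on_ident)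

lemma smooth_at_linear: "bounded_linear L \<Longrightarrow> smooth_at x f \<Longrightarrow> smooth_at x (\<lambda>y. L (f y))"
  unfolding smooth_at_def using Ck_on_linear by blast

lemma smooth_at_nth [smooth_intros]: "smooth_at x f \<Longrightarrow> smooth_at x (\<lambda>y. f y $ i)"
  by (rule smooth_at_linear[OF bounded_linear_vec_nth])

lemma smooth_at_add [smooth_intros]: "smooth_at x f \<Longrightarrow> smooth_at x g \<Longrightarrow> smooth_at x (\<lambda>y. f y + g y)"
  by (erule smooth_at2I) (auto intro: Ck_on_add)

lemma smooth_at_bilinear:
  "bounded_bilinear prd \<Longrightarrow> smooth_at x f \<Longrightarrow> smooth_at x g \<Longrightarrow> smooth_at x (\<lambda>y. prd (f y) (g y))"
  by (erule smooth_at2I) (auto intro: Ck_on_bilinear)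

lemmas smooth_at_scaleR [smooth_intros] = smooth_at_bilinear[OF bounded_bilinear_scaleR]
lemmas smooth_at_mult [smooth_intros] = smooth_at_bilinear[OF bounded_bilinear_mult]

lemma smooth_at_minus [smooth_intros]: "smooth_at x f \<Longrightarrow> smooth_at x (\<lambda>y. - f y)"
  by (rule smooth_at_linear[OF bounded_linear_minus[OF bounded_linear_ident]])

lemma smooth_at_diff [smooth_intros]: "smooth_at x f \<Longrightarrow> smooth_at x g \<Longrightarrow> smooth_at x (\<lambda>y. f y - g y)"
  using smooth_at_add[OF _ smooth_at_minus, of x f g] by simp

lemma smooth_at_sum [smooth_intros]:
  "(\<And>i. i \<in> I \<Longrightarrow> smooth_at x (f i)) \<Longrightarrow> smooth_at x (\<lambda>y. \<Sum>i\<in>I. f i y)"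
  by (induction I rule: infinite_finite_induct) (auto intro: smooth_at_add)

lemma smooth_at_prod [smooth_intros]:
  fixes f :: "'i \<Rightarrow> real^'k::finite \<Rightarrow> real"
  shows "(\<And>i. i \<in> I \<Longrightarrow> smooth_at x (f i)) \<Longrightarrow> smooth_at x (\<lambda>y. \<Prod>i\<in>I. f i y)"
  by (induction I rule: infinite_finite_induct) (auto intro: smooth_at_mult)

lemma smooth_at_power [smooth_intros]:
  fixes f :: "real^'k::finite \<Rightarrow> real"
  shows "smooth_at x f \<Longrightarrow> smooth_at x (\<lambda>y. f y ^ k)"
  by (induction k) (auto intro: smooth_at_mult)

lemma smooth_at_continuous: "smooth_at x f \<Longrightarrow> isCont f x"
  unfolding smooth_at_def by (metis Ck_on.simps(1) continuous_on_eq_continuous_at)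

lemma smooth_at_differentiable: "smooth_at x f \<Longrightarrow> f differentiable (at x)"
  unfolding smooth_at_def using Ck_on_Suc_open[of _ 0 f] by blast

lemma smooth_at_partial [smooth_intros]: "smooth_at x f \<Longrightarrow> smooth_at x (partial k f)"
  unfolding smooth_at_def using Ck_on_Suc_open[of _ _ f] by blast

lemma smooth_at_compose:
  fixes f :: "real^'l::finite \<Rightarrow> 'b::real_normed_vector" and \<Phi> :: "real^'k::finite \<Rightarrow> real^'l"
  assumes "smooth_at x \<Phi>" "smooth_at (\<Phi> x) f"
  shows "smooth_at x (\<lambda>y. f (\<Phi> y))"
proof -
  obtain W V where *: "open W" "x \<in> W" "\<And>m. Ck_on m W \<Phi>" "open V" "\<Phi> x \<in> V" "\<And>m. Ck_on m V f"
    using assms unfolding smooth_at_def by metis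
  have c: "continuous_on W \<Phi>" using *(3)[of 0] by simp
  have o: "open (W \<inter> \<Phi> -` V)"
    using continuous_open_preimage[OF c *(1,4)] by simp
  have "Ck_on m (W \<inter> \<Phi> -` V) \<Phi>" for m
    using * o by (intro Ck_on_subset[OF *(1) _ _ *(3)]) auto
  then have "Ck_on m (W \<inter> \<Phi> -` V) (\<lambda>y. f (\<Phi> y))" for m
    using * o by (intro Ck_on_compose[OF o *(4) _ _ *(6)]) auto
  with o * show ?thesis unfolding smooth_at_def by (intro exI[of _ "W \<inter> \<Phi> -` V"]) auto
qed

lemma smooth_at_inverse [smooth_intros]:
  fixes f :: "real^'k::finite \<Rightarrow> real"
  assumes "smooth_at x f" "f x \<noteq> 0"
  shows "smooth_at x (\<lambda>y. inverse (f y))"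
proof -
  obtain W where *: "open W" "x \<in> W" "\<And>m. Ck_on m W f"
    using assms unfolding smooth_at_def by metis
  have c: "continuous_on W f" using *(3)[of 0] by simp
  have o: "open (W \<inter> f -` (- {0}))"
    using continuous_open_preimage[OF c *(1)] by blast
  have "Ck_on m (W \<inter> f -` (- {0})) f" for m
    using * o by (intro Ck_on_subset[OF *(1) _ _ *(3)]) auto
  then have "Ck_on m (W \<inter> f -` (- {0})) (\<lambda>y. inverse (f y))" for m
    by (intro Ck_on_inverse o) auto
  with o * assms(2) show ?thesis unfolding smooth_at_def by (intro exI[of _ "W \<inter> f -` (- {0})"]) auto
qed

lemma smooth_at_divide [smooth_intros]:
  fixes f g :: "real^'k::finite \<Rightarrow> real"
  shows "smooth_at x f \<Longrightarrow> smooth_at x g \<Longrightarrow> g x \<noteq> 0 \<Longrightarrow> smooth_at x (\<lambda>y. f y / g y)"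
  by (simp add: divide_inverse smooth_intros)

lemma bounded_linear_axis: "bounded_linear (\<lambda>v::'b::real_normed_vector. axis i v :: 'b^'j::finite)"
proof (rule bounded_linear_intro[of _ 1])
  show "norm (axis i x) \<le> norm x * 1" for x :: 'b
  proof -
    have "(\<Sum>k\<in>UNIV. (norm (axis i x $ k))\<^sup>2) = (\<Sum>k\<in>UNIV. if k = i then (norm x)\<^sup>2 else 0)"
      by (rule sum.cong) (auto simp: axis_def)
    then show ?thesis by (simp add: norm_vec_def L2_set_def)
  qed
qed (auto simp: axis_def vec_eq_iff)

lemma smooth_at_vecI:
  fixes f :: "real^'k::finite \<Rightarrow> 'b::real_normed_vector^'j::finite"
  assumes "\<And>i. smooth_at x (\<lambda>y. f y $ i)"
  shows "smooth_at x f"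
proof -
  have "f = (\<lambda>y. \<Sum>i\<in>UNIV. axis i (f y $ i))"
    by (auto simp: fun_eq_iff vec_eq_iff axis_def if_distrib cong: if_cong)
  moreover have "smooth_at x (\<lambda>y. \<Sum>i\<in>UNIV. axis i (f y $ i))"
    by (intro smooth_at_sum smooth_at_linear[OF bounded_linear_axis] assms)
  ultimately show ?thesis by simp
qed

lemma smooth_at_vec [smooth_intros]:
  fixes f :: "'j::finite \<Rightarrow> real^'k::finite \<Rightarrow> 'b::real_normed_vector"
  assumes "\<And>i. smooth_at x (f i)"
  shows "smooth_at x (\<lambda>y. \<chi> i. f i y)"
  by (rule smooth_at_vecI) (simp add: assms)

lemma smooth_at_matmul [smooth_intros]:
  fixes f :: "real^'k::finite \<Rightarrow> real^'b::finite^'a::finite" and g :: "real^'k::finite \<Rightarrow> real^'c::finite^'b"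
  shows "smooth_at x f \<Longrightarrow> smooth_at x g \<Longrightarrow> smooth_at x (\<lambda>y. f y ** g y)"
  unfolding matrix_matrix_mult_def by (intro smooth_intros)

lemma smooth_at_transpose [smooth_intros]:
  fixes f :: "real^'k::finite \<Rightarrow> real^'b::finite^'a::finite"
  shows "smooth_at x f \<Longrightarrow> smooth_at x (\<lambda>y. transpose (f y))"
  unfolding transpose_def by (intro smooth_intros)

lemma smooth_at_det [smooth_intros]:
  fixes f :: "real^'k::finite \<Rightarrow> real^'a::finite^'a"
  shows "smooth_at x f \<Longrightarrow> smooth_at x (\<lambda>y. det (f y))"
  unfolding det_def by (intro smooth_intros)

section \<open>Inverses of smooth matrix-valued functions\<close>

lemma matrix_inv_both:
  fixes B :: "real^'a::finite^'a"
  assumes "det B \<noteq> 0"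
  shows "B ** matrix_inv B = mat 1" "matrix_inv B ** B = mat 1"
proof -
  obtain C where C: "B ** C = mat 1 \<and> C ** B = mat 1"
    using assms unfolding invertible_det_nz[symmetric] invertible_def by blast
  from someI[of "\<lambda>C. B ** C = mat 1 \<and> C ** B = mat 1", OF C]
  show "B ** matrix_inv B = mat 1" "matrix_inv B ** B = mat 1"
    by (simp_all add: matrix_inv_def)
qed

lemma matrix_inv_unique:
  fixes B C :: "real^'a::finite^'a"
  assumes "B ** C = mat 1"
  shows "matrix_inv B = C" "det B \<noteq> 0"
proof -
  have "invertible B" using assms matrix_left_right_inverse by (auto simp: invertible_def)
  then show "det B \<noteq> 0" by (simp add: invertible_det_nz)
  then have "matrix_inv B ** (B ** C) = C"
    by (simp add: matrix_mul_assoc matrix_inv_both)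
  then show "matrix_inv B = C" using assms by simp
qed

text \<open>Cramer's rule exhibits the entries of the inverse as quotients of polynomials in the
  entries of \<open>B\<close>; smoothness of the matrix inverse is derived from this.\<close>

lemma matrix_inv_cramer:
  fixes B :: "real^'a::finite^'a"
  assumes "det B \<noteq> 0"
  shows "matrix_inv B $ k $ l = det (\<chi> i j. if j = k then axis l 1 $ i else B $ i $ j) / det B"
proof -
  have "B *v (matrix_inv B *v axis l 1) = axis l 1"
    using assms by (simp add: matrix_vector_mul_assoc matrix_inv_both)
  then have "matrix_inv B *v axis l 1 = (\<chi> k. det (\<chi> i j. if j = k then axis l 1 $ i else B $ i $ j) / det B)"
    using cramer[OF assms] by blast
  moreover have "(matrix_inv B *v axis l 1) $ k = matrix_inv B $ k $ l"
    by (simp add: matrix_vector_mul_component axis_def matrix_vector_mult_def if_distrib cong: if_cong)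
  ultimately show ?thesis by simp
qed

lemma eventually_nonzero:
  fixes f :: "real^'k::finite \<Rightarrow> real"
  assumes "smooth_at x f" "f x \<noteq> 0"
  shows "\<forall>\<^sub>F y in nhds x. f y \<noteq> 0"
proof -
  have "(f \<longlongrightarrow> f x) (nhds x)"
    using smooth_at_continuous[OF assms(1)] continuous_within tendsto_at_iff_tendsto_nhds by blast
  then show ?thesis using tendsto_imp_eventually_ne assms(2) by blast
qed

lemma smooth_at_matrix_inv [smooth_intros]:
  fixes f :: "real^'k::finite \<Rightarrow> real^'a::finite^'a"
  assumes "smooth_at x f" "det (f x) \<noteq> 0"
  shows "smooth_at x (\<lambda>y. matrix_inv (f y))"
proof (intro smooth_at_vecI)
  fix i j
  have ev: "\<forall>\<^sub>F y in nhds x. det (f y) \<noteq> 0"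
    using assms by (intro eventually_nonzero smooth_intros)
  have sm: "smooth_at x (\<lambda>y. if b then c else g y)" if "smooth_at x g" for b c and g :: "real^'k \<Rightarrow> real"
    using that by (cases b) simp_all
  show "smooth_at x (\<lambda>y. matrix_inv (f y) $ i $ j)"
  proof (rule smooth_at_cong)
    show "\<forall>\<^sub>F y in nhds x. det (\<chi> k l. if l = i then axis j 1 $ k else f y $ k $ l) / det (f y)
        = matrix_inv (f y) $ i $ j"
      using ev by eventually_elim (simp add: matrix_inv_cramer)
    show "smooth_at x (\<lambda>y. det (\<chi> k l. if l = i then axis j 1 $ k else f y $ k $ l) / det (f y))"
      using assms by (intro smooth_intros sm)
  qed
qed

section \<open>Rules of computation for partial derivatives of smooth germs\<close>

lemma partial_add: "smooth_at x f \<Longrightarrow> smooth_at x g \<Longrightarrow>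
    partial k (\<lambda>y. f y + g y) x = partial k f x + partial k g x"
  unfolding pd_def
  by (subst frechet_derivative_at[OF has_derivative_add, symmetric])
    (auto simp: frechet_derivative_works[symmetric] smooth_at_differentiable)

lemma partial_const [simp]: "partial k (\<lambda>y. c) x = 0"
  by (simp add: pd_def)

lemma partial_linear: "bounded_linear L \<Longrightarrow> smooth_at x f \<Longrightarrow> partial k (\<lambda>y. L (f y)) x = L (partial k f x)"
  unfolding pd_def
  by (subst frechet_derivative_at[OF bounded_linear.has_derivative, symmetric])
    (auto simp: frechet_derivative_works[symmetric] smooth_at_differentiable)

lemma partial_nth: "smooth_at x f \<Longrightarrow> partial k (\<lambda>y. f y $ i) x = partial k f x $ i"
  by (rule partial_linear[OF bounded_linear_vec_nth])

lemma partial_minus: "smooth_at x f \<Longrightarrow> partial k (\<lambda>y. - f y) x = - partial k f x"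
  by (rule partial_linear[OF bounded_linear_minus[OF bounded_linear_ident]])

lemma partial_diff: "smooth_at x f \<Longrightarrow> smooth_at x g \<Longrightarrow>
    partial k (\<lambda>y. f y - g y) x = partial k f x - partial k g x"
  using partial_add[OF _ smooth_at_minus, of x f g k] by (simp add: partial_minus)

lemma partial_sum: "(\<And>i. i \<in> I \<Longrightarrow> smooth_at x (f i)) \<Longrightarrow>
    partial k (\<lambda>y. \<Sum>i\<in>I. f i y) x = (\<Sum>i\<in>I. partial k (f i) x)"
  by (induction I rule: infinite_finite_induct) (auto simp: partial_add smooth_at_sum)

lemma partial_bilinear:
  "bounded_bilinear prd \<Longrightarrow> smooth_at x f \<Longrightarrow> smooth_at x g \<Longrightarrow>
    partial k (\<lambda>y. prd (f y) (g y)) x = prd (f x) (partial k g x) + prd (partial k f x) (g x)"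
  unfolding pd_def
  by (subst frechet_derivative_at[OF bounded_bilinear.FDERIV, symmetric])
    (auto simp: frechet_derivative_works[symmetric] smooth_at_differentiable)

lemmas partial_scaleR = partial_bilinear[OF bounded_bilinear_scaleR]
lemmas partial_mult = partial_bilinear[OF bounded_bilinear_mult]

lemma partial_matmul:
  fixes f :: "real^'k::finite \<Rightarrow> real^'b::finite^'a::finite" and g :: "real^'k::finite \<Rightarrow> real^'c::finite^'b"
  assumes "smooth_at x f" "smooth_at x g"
  shows "partial k (\<lambda>y. f y ** g y) x = f x ** partial k g x + partial k f x ** g x"
proof -
  have "partial k (\<lambda>y. f y ** g y) x $ i $ j = (f x ** partial k g x + partial k f x ** g x) $ i $ j" for i j
    using assms
    by (simp add: partial_nth[symmetric] smooth_intros matrix_matrix_mult_def partial_sum partial_mult sum.distrib)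
  then show ?thesis by (simp add: vec_eq_iff)
qed

lemma partial_inverse:
  fixes f :: "real^'k::finite \<Rightarrow> real"
  assumes "smooth_at x f" "f x \<noteq> 0"
  shows "partial k (\<lambda>y. inverse (f y)) x = - partial k f x / (f x)^2"
  using partial_eq[OF Deriv.has_derivative_inverse[OF assms(2) frechet_derivative_works[THEN iffD1, OF smooth_at_differentiable[OF assms(1)]]]]
  by (simp add: pd_def field_simps power2_eq_square)

lemma partial_comp:
  fixes f :: "real^'l::finite \<Rightarrow> 'b::real_normed_vector" and \<Phi> :: "real^'k::finite \<Rightarrow> real^'l"
  shows "smooth_at x \<Phi> \<Longrightarrow> smooth_at (\<Phi> x) f \<Longrightarrow>
    partial k (\<lambda>y. f (\<Phi> y)) x = (\<Sum>j\<in>UNIV. partial k (\<lambda>y. \<Phi> y $ j) x *\<^sub>R partial j f (\<Phi> x))"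
  by (simp add: partial_eq[OF has_derivative_chain] smooth_at_differentiable partial_nth)
    (simp add: pd_def)

lemma partial_ident [simp]: "partial k (\<lambda>y. y $ j) x = (if j = k then 1 else 0)"
proof -
  have "partial k (\<lambda>y. y $ j) x = partial k (\<lambda>y. y) x $ j" by (rule partial_nth) simp
  also have "\<dots> = (if j = k then 1 else 0)" by (simp add: pd_def axis_def)
  finally show ?thesis .
qed

lemma smooth_at_line:
  assumes "smooth_at (u + t *\<^sub>R axis a 1) f"
  shows "((\<lambda>s. f (u + s *\<^sub>R axis a 1)) has_vector_derivative partial a f (u + t *\<^sub>R axis a 1)) (at t)"
proof -
  let ?D = "frechet_derivative f (at (u + t *\<^sub>R axis a 1))"
  note d = smooth_at_differentiable[OF assms]
  have f: "(f has_derivative ?D) (at (u + t *\<^sub>R axis a 1))"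
    using d frechet_derivative_works by blast
  have "((\<lambda>s. u + s *\<^sub>R axis a 1) has_derivative (\<lambda>h. h *\<^sub>R axis a 1)) (at t)"
    by (auto intro!: derivative_eq_intros)
  from has_derivative_compose[OF this f]
  have "((\<lambda>s. f (u + s *\<^sub>R axis a 1)) has_derivative (\<lambda>h. ?D (h *\<^sub>R axis a 1))) (at t)" .
  moreover have "?D (h *\<^sub>R axis a 1) = h *\<^sub>R partial a f (u + t *\<^sub>R axis a 1)" for h
    using linear_scale[OF linear_frechet_derivative[OF d]] by (simp add: pd_def)
  ultimately show ?thesis by (simp add: has_vector_derivative_def)
qed

lemmas smooth_at_line_DERIV = smooth_at_line[where 'b = real, folded has_real_derivative_iff_has_vector_derivative]

section \<open>Mixed partial derivatives and division by a coordinate\<close>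

text \<open>The mean value theorem, applied along a and then along b, turns the second difference
  into h^2 times a mixed derivative at a nearby point. The second difference is symmetric in a and
  b, which is the source of the symmetry of second derivatives.\<close>

lemma second_difference:
  fixes f :: "real^'k::finite \<Rightarrow> real"
  assumes sm: "\<And>y. dist x y < d \<Longrightarrow> smooth_at y f" and h: "0 < h" "2 * h < d"
  shows "\<exists>y. dist x y \<le> 2 * h \<and>
    f (x + h *\<^sub>R axis a 1 + h *\<^sub>R axis b 1) - f (x + h *\<^sub>R axis a 1) - f (x + h *\<^sub>R axis b 1) + f x
      = h * h * partial b (partial a f) y"
proof -
  have near: "dist x (x + s *\<^sub>R axis a 1 + t *\<^sub>R axis b 1) \<le> 2 * h"
    if "0 \<le> s" "s \<le> h" "0 \<le> t" "t \<le> h" for s t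
  proof -
    have "norm (s *\<^sub>R axis a 1 + t *\<^sub>R axis b (1::real)) \<le> norm (s *\<^sub>R axis a (1::real)) + norm (t *\<^sub>R axis b (1::real))"
      by (rule norm_triangle_ineq)
    also have "\<dots> \<le> 2 * h" using that by simp
    moreover have "dist x (x + v) = norm v" for v :: "real^'k" by (simp add: dist_norm)
    ultimately show ?thesis unfolding add.assoc by simp
  qed
  have sm': "smooth_at (x + s *\<^sub>R axis a 1 + t *\<^sub>R axis b 1) f"
    if "0 \<le> s" "s \<le> h" "0 \<le> t" "t \<le> h" for s t
    using near[OF that] h by (intro sm) linarith
  define \<phi> where "\<phi> s = f (x + s *\<^sub>R axis a 1 + h *\<^sub>R axis b 1) - f (x + s *\<^sub>R axis a 1)" for s
  have "(\<phi> has_real_derivative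
      partial a f (x + s *\<^sub>R axis a 1 + h *\<^sub>R axis b 1) - partial a f (x + s *\<^sub>R axis a 1)) (at s)"
    if "0 \<le> s" "s \<le> h" for s
  proof -
    have e: "x + r *\<^sub>R axis a 1 + h *\<^sub>R axis b 1 = x + h *\<^sub>R axis b 1 + r *\<^sub>R axis a 1" for r
      by (simp add: algebra_simps)
    show ?thesis
      unfolding \<phi>_def e
      by (intro DERIV_diff smooth_at_line_DERIV)
        (use sm'[of s h] sm'[of s 0] that h in \<open>auto simp: e\<close>)
  qed
  then obtain \<xi> where \<xi>: "0 < \<xi>" "\<xi> < h" and
    1: "\<phi> h - \<phi> 0 = (h - 0) * (partial a f (x + \<xi> *\<^sub>R axis a 1 + h *\<^sub>R axis b 1) - partial a f (x + \<xi> *\<^sub>R axis a 1))"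
    using MVT2[OF h(1), of \<phi> "\<lambda>s. partial a f (x + s *\<^sub>R axis a 1 + h *\<^sub>R axis b 1) - partial a f (x + s *\<^sub>R axis a 1)"]
    by blast
  define \<psi> where "\<psi> t = partial a f (x + \<xi> *\<^sub>R axis a 1 + t *\<^sub>R axis b 1)" for t
  have "(\<psi> has_real_derivative partial b (partial a f) (x + \<xi> *\<^sub>R axis a 1 + t *\<^sub>R axis b 1)) (at t)"
    if "0 \<le> t" "t \<le> h" for t
    unfolding \<psi>_def using sm'[of \<xi> t] that \<xi> by (intro smooth_at_line_DERIV smooth_at_partial) auto
  then obtain \<eta> where \<eta>: "0 < \<eta>" "\<eta> < h" and
    2: "\<psi> h - \<psi> 0 = (h - 0) * partial b (partial a f) (x + \<xi> *\<^sub>R axis a 1 + \<eta> *\<^sub>R axis b 1)"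
    using MVT2[OF h(1), of \<psi> "\<lambda>t. partial b (partial a f) (x + \<xi> *\<^sub>R axis a 1 + t *\<^sub>R axis b 1)"] by blast
  have "f (x + h *\<^sub>R axis a 1 + h *\<^sub>R axis b 1) - f (x + h *\<^sub>R axis a 1) - f (x + h *\<^sub>R axis b 1) + f x
      = \<phi> h - \<phi> 0" by (simp add: \<phi>_def)
  also have "\<dots> = h * (\<psi> h - \<psi> 0)" using 1 by (simp add: \<psi>_def)
  also have "\<dots> = h * h * partial b (partial a f) (x + \<xi> *\<^sub>R axis a 1 + \<eta> *\<^sub>R axis b 1)"
    using 2 by simp
  finally show ?thesis using near[of \<xi> \<eta>] \<xi> \<eta> by (intro exI conjI) auto
qed

lemma partial_commute_real:
  fixes f :: "real^'k::finite \<Rightarrow> real"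
  assumes "smooth_at x f"
  shows "partial a (partial b f) x = partial b (partial a f) x"
proof (rule ccontr)
  define g1 where "g1 = partial b (partial a f)"
  define g2 where "g2 = partial a (partial b f)"
  assume "\<not> ?thesis"
  then have ne: "dist (g1 x) (g2 x) > 0" (is "?e > 0") by (simp add: g1_def g2_def)
  have c: "isCont g1 x" "isCont g2 x"
    using assms by (auto simp: g1_def g2_def intro!: smooth_at_continuous smooth_at_partial)
  obtain d0 where d0: "d0 > 0" "\<And>y. dist y x < d0 \<Longrightarrow> smooth_at y f"
    using smooth_at_eventually[OF assms] by (auto simp: eventually_nhds_metric)
  obtain d1 where d1: "d1 > 0" "\<And>y. dist y x < d1 \<Longrightarrow> dist (g1 y) (g1 x) < ?e / 2"
    using c(1) ne by (metis continuous_at half_gt_zero Lim_at isCont_def continuous_at_eps_delta)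
  obtain d2 where d2: "d2 > 0" "\<And>y. dist y x < d2 \<Longrightarrow> dist (g2 y) (g2 x) < ?e / 2"
    using c(2) ne by (metis continuous_at half_gt_zero Lim_at isCont_def continuous_at_eps_delta)
  \<comment> \<open>On the ball of this radius f is smooth and each mixed derivative stays within
    half of their alleged distance at x; h = d/4 keeps the points found by
    \<open>second_difference\<close> inside it.\<close>
  define d where "d = min d0 (min d1 d2)"
  define h where "h = d / 4"
  have d: "d > 0" "d \<le> d0" "d \<le> d1" "d \<le> d2" using d0(1) d1(1) d2(1) by (auto simp: d_def)
  then have h: "0 < h" "2 * h < d" by (auto simp: h_def)
  have sm: "smooth_at y f" if "dist x y < d" for y using that d d0(2) by (simp add: dist_commute)
  obtain y1 where y1: "dist x y1 \<le> 2 * h"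
    "f (x + h *\<^sub>R axis a 1 + h *\<^sub>R axis b 1) - f (x + h *\<^sub>R axis a 1) - f (x + h *\<^sub>R axis b 1) + f x = h * h * g1 y1"
    using second_difference[of x d f h a b, OF sm h] by (auto simp: g1_def)
  obtain y2 where y2: "dist x y2 \<le> 2 * h"
    "f (x + h *\<^sub>R axis b 1 + h *\<^sub>R axis a 1) - f (x + h *\<^sub>R axis b 1) - f (x + h *\<^sub>R axis a 1) + f x = h * h * g2 y2"
    using second_difference[of x d f h b a, OF sm h] by (auto simp: g2_def)
  have "h * h * g1 y1 = h * h * g2 y2"
    using y1(2) y2(2) by (simp add: algebra_simps)
  then have "g1 y1 = g2 y2" using h by simp
  moreover have "dist (g1 y1) (g1 x) < ?e / 2" "dist (g2 y2) (g2 x) < ?e / 2"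
    using d1(2)[of y1] d2(2)[of y2] y1(1) y2(1) h d by (auto simp: dist_commute)
  ultimately show False
    using dist_triangle[of "g1 x" "g2 x" "g1 y1"] by (simp add: dist_commute)
qed

lemma partial_commute:
  fixes f :: "real^'k::finite \<Rightarrow> 'b::euclidean_space"
  assumes "smooth_at x f"
  shows "partial a (partial b f) x = partial b (partial a f) x"
proof (rule euclidean_eqI)
  fix i :: 'b assume "i \<in> Basis"
  have *: "partial a (partial b f) x \<bullet> i = partial a (partial b (\<lambda>y. f y \<bullet> i)) x" for a b
  proof -
    have "\<forall>\<^sub>F y in nhds x. partial b f y \<bullet> i = partial b (\<lambda>y. f y \<bullet> i) y"
      using smooth_at_eventually[OF assms]
      by eventually_elim (rule partial_linear[OF bounded_linear_inner_left, symmetric])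
    from partial_cong[OF this] show ?thesis
      by (simp add: partial_linear[OF bounded_linear_inner_left] smooth_at_partial assms)
  qed
  show "partial a (partial b f) x \<bullet> i = partial b (partial a f) x \<bullet> i"
    unfolding * by (intro partial_commute_real smooth_at_linear[OF bounded_linear_inner_left] assms)
qed

text \<open>Moves a point along the normal line to the hyperplane where the coordinate
  \<open>None\<close> is 0: u = 0 gives the foot of the perpendicular, u = 1 the point
  itself.\<close>

definition scale_r :: "real \<Rightarrow> real^'n option \<Rightarrow> real^'n::finite option" where
  "scale_r u z = (\<chi> k. (if k = None then u else 1) * z $ k)"

lemma scale_r_nth: "scale_r u z $ k = (if k = None then u else 1) * z $ k"
  by (simp add: scale_r_def)

lemma scale_r_1 [simp]: "scale_r 1 z = z"
  by (simp add: vec_eq_iff scale_r_nth)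

lemma continuous_scale_r: "continuous_on S (\<lambda>(z, u). scale_r u z)"
proof -
  have "continuous_on S (\<lambda>x. scale_r (snd x) (fst x) $ k)" for k
    by (cases k) (auto simp: scale_r_nth intro!: continuous_intros)
  then have "continuous_on S (\<lambda>x. \<chi> k. scale_r (snd x) (fst x) $ k)"
    by (rule continuous_on_vec_lambda)
  then show ?thesis by (simp add: split_beta)
qed

text \<open>As the centre lies on the hyperplane, shrinking the normal coordinate moves no
  coordinate away from that of the centre. Such balls are therefore domains on which averages along
  normal segments make sense.\<close>

lemma scale_r_ball:
  assumes "p $ None = 0" "0 \<le> u" "u \<le> 1" "z \<in> ball p d"
  shows "scale_r u z \<in> ball p d"
proof -
  have "norm (scale_r u z - p) \<le> norm (z - p)"
  proof (rule norm_le_componentwise_cart)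
    show "norm ((scale_r u z - p) $ k) \<le> norm ((z - p) $ k)" for k
      using assms(1-3) by (cases k) (auto simp: scale_r_nth abs_mult mult_left_le_one_le)
  qed
  with assms(4) show ?thesis by (simp add: dist_norm norm_minus_commute)
qed

lemma has_derivative_scaled:
  fixes f :: "real^'n::finite option \<Rightarrow> real"
  assumes "f differentiable (at (scale_r u z))"
  shows "((\<lambda>z. f (scale_r u z)) has_derivative
    (\<lambda>h. \<Sum>j\<in>UNIV. h $ j * ((if j = None then u else 1) * partial j f (scale_r u z)))) (at z)"
proof -
  have l: "linear (scale_r u)"
    by (auto intro!: linearI simp: vec_eq_iff scale_r_nth algebra_simps)
  then have "(scale_r u has_derivative scale_r u) (at z)"
    by (intro bounded_linear_imp_has_derivative linear_conv_bounded_linear[THEN iffD1])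
  from has_derivative_compose[OF this assms[unfolded frechet_derivative_works]]
  have "((\<lambda>z. f (scale_r u z)) has_derivative
      (\<lambda>h. frechet_derivative f (at (scale_r u z)) (scale_r u h))) (at z)" .
  moreover have "frechet_derivative f (at (scale_r u z)) (scale_r u h) =
      (\<Sum>j\<in>UNIV. h $ j * ((if j = None then u else 1) * partial j f (scale_r u z)))" for h
    by (subst linear_axis_expand[OF linear_frechet_derivative[OF assms]])
      (auto simp: pd_def scale_r_nth algebra_simps intro!: sum.cong)
  ultimately show ?thesis by simp
qed

text \<open>If \<open>f\<close> vanishes for \<open>None\<close>-coordinate \<open>0\<close>, then \<open>radial_mean 0 (partial None f)\<close> is the smooth
  quotient of \<open>f\<close> by that coordinate; the weights \<open>u\<^sup>k\<close> come up in its derivatives.\<close>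

definition radial_mean :: "nat \<Rightarrow> (real^'n::finite option \<Rightarrow> real) \<Rightarrow> real^'n option \<Rightarrow> real" where
  "radial_mean k f z = integral {0..1} (\<lambda>u. u ^ k * f (scale_r u z))"

text \<open>Differentiation under the integral sign. A normal derivative of f
  (\<open>scale_r\<close> u z) brings out a factor u, which raises the weight; the family of radial
  means is thus closed under differentiation, and smoothness follows by induction.\<close>

lemma has_derivative_radial_mean:
  fixes f :: "real^'n::finite option \<Rightarrow> real"
  assumes p: "p $ None = 0" and f: "\<And>m. Ck_on m (ball p d) f" and z: "z \<in> ball p d"
  shows "(radial_mean k f has_derivative
    (\<lambda>h. \<Sum>j\<in>UNIV. h $ j * radial_mean (if j = None then Suc k else k) (partial j f) z)) (at z)"
proof -
  let ?U = "ball p d"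
  define c where "c j z u = u ^ k * ((if j = None then u else 1) * partial j f (scale_r u z))" for j z u
  \<comment> \<open>\<open>leibniz_rule\<close> asks for the derivative of the integrand as a
    continuous family of bounded linear maps, so the coordinate functionals are packaged as
    such.\<close>
  define B where "B j = Blinfun (\<lambda>h::real^'n option. h $ j)" for j
  have B: "blinfun_apply (B j) h = h $ j" for j h
    by (simp add: B_def bounded_linear_Blinfun_apply bounded_linear_vec_nth)
  have fd: "f differentiable (at y)" "continuous_on ?U (partial j f)" if "y \<in> ?U" for y j
    using f[of 1] that by (auto simp: Ck_on_Suc_open)
  have fc: "continuous_on ?U f" using f[of 0] by simp
  have sc: "continuous_on (?U \<times> {0..1}) (\<lambda>x. g (scale_r (snd x) (fst x)))" if "continuous_on ?U g" for g :: "_ \<Rightarrow> real"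
    by (rule continuous_on_compose2[OF that continuous_scale_r[unfolded split_beta]])
      (use scale_r_ball[OF p] in force)
  have cj: "continuous_on (?U \<times> {0..1}) (\<lambda>x. c j (fst x) (snd x))" for j
    using sc[OF fd(2)[OF z, of j]] unfolding c_def
    by (cases j) (auto intro!: continuous_intros)
  have cu: "continuous_on {0..1} (\<lambda>u. c j z u)" for j
    using continuous_on_compose2[OF cj[of j], of "{0..1}" "\<lambda>u. (z, u)"] z
    by (force intro!: continuous_intros)
  have ci: "(\<lambda>u. c j z u) integrable_on {0..1}" for j
    by (rule integrable_continuous_real[OF cu])
  have "((\<lambda>z. integral (cbox 0 1) (\<lambda>u. u ^ k * f (scale_r u z))) has_derivative
      blinfun_apply (integral (cbox 0 1) (\<lambda>u. \<Sum>j\<in>UNIV. c j z u *\<^sub>R B j))) (at z within ?U)"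
  proof (rule leibniz_rule)
    show "((\<lambda>z. u ^ k * f (scale_r u z)) has_derivative blinfun_apply (\<Sum>j\<in>UNIV. c j y u *\<^sub>R B j)) (at y within ?U)"
      if "y \<in> ?U" "u \<in> cbox 0 1" for y u
    proof -
      have "scale_r u y \<in> ?U" using scale_r_ball[OF p _ _ that(1)] that(2) by simp
      note d = has_derivative_mult_right[OF has_derivative_scaled[OF fd(1)[OF this]], of "u ^ k"]
      have "blinfun_apply (\<Sum>j\<in>UNIV. c j y u *\<^sub>R B j) =
          (\<lambda>h. u ^ k * (\<Sum>j\<in>UNIV. h $ j * ((if j = None then u else 1) * partial j f (scale_r u y))))"
        by (auto simp: fun_eq_iff blinfun.sum_left blinfun.scaleR_left B c_def sum_distrib_left algebra_simps intro!: sum.cong)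
      then show ?thesis using d by (simp add: has_derivative_at_withinI)
    qed
    show "(\<lambda>u. u ^ k * f (scale_r u y)) integrable_on cbox 0 1" if "y \<in> ?U" for y
    proof -
      have "continuous_on {0..1} (\<lambda>u. f (scale_r u y))"
        using continuous_on_compose2[OF sc[OF fc], of "{0..1}" "\<lambda>u. (y, u)"] that
        by (force intro!: continuous_intros)
      then show ?thesis
        by (auto intro!: integrable_continuous_real continuous_intros)
    qed
    show "continuous_on (?U \<times> cbox 0 1) (\<lambda>(y, u). \<Sum>j\<in>UNIV. c j y u *\<^sub>R B j)"
      using cj by (auto simp: split_beta intro!: continuous_intros)
  qed (use z in auto)
  moreover have eq: "blinfun_apply (integral (cbox 0 1) (\<lambda>u. \<Sum>j\<in>UNIV. c j z u *\<^sub>R B j)) h =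
      (\<Sum>j\<in>UNIV. h $ j * radial_mean (if j = None then Suc k else k) (partial j f) z)" for h
  proof -
    have "(\<lambda>u. \<Sum>j\<in>UNIV. c j z u *\<^sub>R B j) integrable_on {0..1}"
      by (intro integrable_continuous_real continuous_intros cu)
    then have "blinfun_apply (integral {0..1} (\<lambda>u. \<Sum>j\<in>UNIV. c j z u *\<^sub>R B j)) h =
        integral {0..1} (\<lambda>u. blinfun_apply (\<Sum>j\<in>UNIV. c j z u *\<^sub>R B j) h)"
      by (rule integral_linear[OF _ blinfun.bounded_linear_left[of h], unfolded o_def, symmetric])
    also have "\<dots> = integral {0..1} (\<lambda>u. \<Sum>j\<in>UNIV. h $ j * c j z u)"
      by (simp add: blinfun.sum_left blinfun.scaleR_left B mult.commute)
    also have "\<dots> = (\<Sum>j\<in>UNIV. integral {0..1} (\<lambda>u. h $ j * c j z u))"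
      by (rule integral_sum) (auto intro!: integrable_on_mult_right ci)
    also have "\<dots> = (\<Sum>j\<in>UNIV. h $ j * integral {0..1} (c j z))"
      by simp
    also have "\<dots> = (\<Sum>j\<in>UNIV. h $ j * radial_mean (if j = None then Suc k else k) (partial j f) z)"
    proof (rule sum.cong[OF refl])
      fix j
      have "c j z = (\<lambda>u. u ^ (if j = None then Suc k else k) * partial j f (scale_r u z))"
        by (cases j) (simp_all add: c_def fun_eq_iff)
      then show "h $ j * integral {0..1} (c j z) = h $ j * radial_mean (if j = None then Suc k else k) (partial j f) z"
        by (simp add: radial_mean_def)
    qed
    finally show ?thesis by simp
  qed
  moreover have "at z within ?U = at z" by (rule at_within_open[OF z open_ball])
  moreover have "blinfun_apply (integral (cbox 0 1) (\<lambda>u. \<Sum>j\<in>UNIV. c j z u *\<^sub>R B j)) =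
      (\<lambda>h. \<Sum>j\<in>UNIV. h $ j * radial_mean (if j = None then Suc k else k) (partial j f) z)"
    by (rule ext) (rule eq)
  moreover have "(\<lambda>z. integral (cbox 0 1) (\<lambda>u. u ^ k * f (scale_r u z))) = radial_mean k f"
    by (rule ext) (simp add: radial_mean_def)
  ultimately show ?thesis by simp
qed

lemma Ck_on_partial: "open W \<Longrightarrow> Ck_on (Suc m) W f \<Longrightarrow> Ck_on m W (partial k f)"
  by (simp add: Ck_on_Suc_open)

lemma sum_axis:
  fixes X :: "'k::finite \<Rightarrow> real"
  shows "(\<Sum>i\<in>UNIV. axis j 1 $ i * X i) = X j"
proof -
  have "(\<Sum>i\<in>UNIV. axis j 1 $ i * X i) = (\<Sum>i\<in>UNIV. if i = j then X i else 0)"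
    by (rule sum.cong) (auto simp: axis_def)
  then show ?thesis by simp
qed

lemma Ck_on_radial_mean:
  fixes f :: "real^'n::finite option \<Rightarrow> real"
  assumes p: "p $ None = 0"
  shows "(\<And>m. Ck_on m (ball p d) f) \<Longrightarrow> Ck_on m (ball p d) (radial_mean k f)"
proof (induction m arbitrary: f k)
  case 0
  have "isCont (radial_mean k f) z" if "z \<in> ball p d" for z
    by (rule has_derivative_continuous[OF has_derivative_radial_mean[OF p 0 that]])
  then show ?case by (simp add: continuous_at_imp_continuous_on)
next
  case (Suc m)
  have pf: "Ck_on m (ball p d) (partial j f)" for j m
    by (rule Ck_on_partial[OF open_ball Suc.prems])
  show ?case
  proof (rule Ck_on_SucI[OF open_ball has_derivative_radial_mean[OF p Suc.prems]])
    fix j :: "'n option"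
    have "(\<lambda>z. \<Sum>i\<in>UNIV. axis j 1 $ i * radial_mean (if i = None then Suc k else k) (partial i f) z) =
        (\<lambda>z. radial_mean (if j = None then Suc k else k) (partial j f) z)"
      by (rule ext) (rule sum_axis)
    then show "Ck_on m (ball p d) (\<lambda>z. \<Sum>i\<in>UNIV. axis j 1 $ i * radial_mean (if i = None then Suc k else k) (partial i f) z)"
      using Suc.IH[OF pf] by simp
  qed auto
qed

text \<open>Hadamard's lemma: by the fundamental theorem of calculus along the normal segment, f is
  the coordinate \<open>None\<close> times the mean of its normal derivative. It will split the
  defining function into r and a factor that does not vanish.\<close>

lemma smooth_at_factor:
  fixes f :: "real^'n::finite option \<Rightarrow> real"
  assumes p: "p $ None = 0" and f: "smooth_at p f"
    and zero: "\<forall>\<^sub>F z in nhds p. z $ None = 0 \<longrightarrow> f z = 0"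
  shows "\<exists>g. smooth_at p g \<and> (\<forall>\<^sub>F z in nhds p. f z = z $ None * g z)"
proof -
  obtain W where W: "open W" "p \<in> W" "\<And>m. Ck_on m W f" using f unfolding smooth_at_def by blast
  obtain S where S: "open S" "p \<in> S" "\<And>z. z \<in> S \<Longrightarrow> z $ None = 0 \<Longrightarrow> f z = 0"
    using zero unfolding eventually_nhds by blast
  have "open (W \<inter> S)" "p \<in> W \<inter> S" using W S by auto
  then obtain d where d: "d > 0" "ball p d \<subseteq> W \<inter> S" by (rule openE)
  have fb: "Ck_on m (ball p d) f" for m
    using d(2) by (intro Ck_on_subset[OF W(1) open_ball _ W(3)]) auto
  have pf: "Ck_on m (ball p d) (partial j f)" for j m
    by (rule Ck_on_partial[OF open_ball fb])
  have "f z = z $ None * radial_mean 0 (partial None f) z" if z: "z \<in> ball p d" for z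
  proof -
    have "((\<lambda>u. z $ None * partial None f (scale_r u z)) has_integral f (scale_r 1 z) - f (scale_r 0 z)) {0..1}"
    proof (rule fundamental_theorem_of_calculus)
      show "((\<lambda>u. f (scale_r u z)) has_vector_derivative z $ None * partial None f (scale_r u z)) (at u within {0..1})"
        if u: "u \<in> {0..1}" for u
      proof -
        have b: "scale_r u z \<in> ball p d" using scale_r_ball[OF p _ _ z] u by simp
        have e: "scale_r t z = scale_r 0 z + (t * z $ None) *\<^sub>R axis None 1" for t
          by (auto simp: vec_eq_iff scale_r_nth axis_def)
        have "smooth_at (scale_r u z) f"
          unfolding smooth_at_def using fb b by (intro exI[of _ "ball p d"]) simp
        then have "((\<lambda>s. f (scale_r 0 z + s *\<^sub>R axis None 1)) has_real_derivative partial None f (scale_r u z)) (at (u * z $ None))"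
          unfolding e[of u] by (rule smooth_at_line_DERIV)
        then have "((\<lambda>t. f (scale_r 0 z + (t * z $ None) *\<^sub>R axis None 1)) has_real_derivative
            partial None f (scale_r u z) * z $ None) (at u)"
          by (rule DERIV_chain2[where g = "\<lambda>t. t * z $ None"]) (auto intro!: derivative_eq_intros)
        moreover have "(\<lambda>t. f (scale_r 0 z + (t * z $ None) *\<^sub>R axis None 1)) = (\<lambda>t. f (scale_r t z))"
          by (rule ext, rule arg_cong[where f = f], rule e[symmetric])
        ultimately have "((\<lambda>t. f (scale_r t z)) has_real_derivative partial None f (scale_r u z) * z $ None) (at u)"
          by simp
        then show ?thesis
          unfolding has_real_derivative_iff_has_vector_derivative mult.commute[of "z $ None"]
          by (rule has_vector_derivative_at_within)
      qed
    qed simp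
    then have "integral {0..1} (\<lambda>u. z $ None * partial None f (scale_r u z)) = f (scale_r 1 z) - f (scale_r 0 z)"
      by (rule integral_unique)
    moreover have "f (scale_r 0 z) = 0"
      using scale_r_ball[OF p _ _ z, of 0] d(2) by (intro S(3)) (auto simp: scale_r_nth)
    ultimately show ?thesis by (simp add: radial_mean_def)
  qed
  then have "\<forall>\<^sub>F z in nhds p. f z = z $ None * radial_mean 0 (partial None f) z"
    using eventually_nhds_in_open[OF open_ball centre_in_ball[THEN iffD2, OF d(1)]]
    by (rule eventually_mono[rotated])
  moreover have "smooth_at p (radial_mean 0 (partial None f))"
    unfolding smooth_at_def using Ck_on_radial_mean[OF p pf] d(1) by (intro exI[of _ "ball p d"]) auto
  ultimately show ?thesis by blast
qed

section \<open>Changes of gauge and of coordinates\<close>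

lemma matmul_distribs:
  fixes A B :: "real^'b::finite^'c::finite" and C D :: "real^'a::finite^'b"
  shows "(A + B) ** C = A ** C + B ** C" "A ** (C + D) = A ** C + A ** D"
    "(A - B) ** C = A ** C - B ** C" "A ** (C - D) = A ** C - A ** D"
    "(- A) ** C = - (A ** C)" "A ** (- C) = - (A ** C)"
    "(r *\<^sub>R A) ** C = r *\<^sub>R (A ** C)" "A ** (r *\<^sub>R C) = r *\<^sub>R (A ** C)"
  by (simp_all add: vec_eq_iff matrix_matrix_mult_def sum.distrib sum_subtractf sum_negf
      sum_distrib_left algebra_simps)

lemma matmul_sum_left:
  fixes f :: "'i \<Rightarrow> real^'b::finite^'c::finite" and C :: "real^'a::finite^'b"
  shows "(\<Sum>i\<in>I. f i) ** C = (\<Sum>i\<in>I. f i ** C)"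
  by (induction I rule: infinite_finite_induct) (auto simp: matmul_distribs)

lemma matmul_sum_right:
  fixes f :: "'i \<Rightarrow> real^'a::finite^'b::finite" and C :: "real^'b^'c::finite"
  shows "C ** (\<Sum>i\<in>I. f i) = (\<Sum>i\<in>I. C ** f i)"
  by (induction I rule: infinite_finite_induct) (auto simp: matmul_distribs)

lemma transpose_distribs:
  fixes A B :: "real^'b::finite^'c::finite"
  shows "transpose (A + B) = transpose A + transpose B" "transpose (r *\<^sub>R A) = r *\<^sub>R transpose A"
    "transpose (\<Sum>i\<in>I. f i) = (\<Sum>i\<in>I. transpose (f i :: real^'b^'c))"
  by (simp_all add: vec_eq_iff transpose_def)

lemma matmul_nth: "(A ** B) $ i $ j = (\<Sum>k\<in>UNIV. A $ i $ k * B $ k $ j)"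
  by (simp add: matrix_matrix_mult_def)

lemma transpose_nth: "transpose A $ i $ j = A $ j $ i"
  by (simp add: transpose_def)

lemma matmul_left_cancel:
  fixes A :: "real^'a::finite^'a" and B C :: "real^'b::finite^'a"
  assumes "det A \<noteq> 0" "A ** B = A ** C"
  shows "B = C"
proof -
  have "matrix_inv A ** (A ** B) = matrix_inv A ** (A ** C)" using assms(2) by simp
  then show ?thesis by (simp add: matrix_mul_assoc matrix_inv_both[OF assms(1)])
qed

lemma partial_transpose:
  fixes f :: "real^'k::finite \<Rightarrow> real^'b::finite^'a::finite"
  assumes "smooth_at x f"
  shows "partial k (\<lambda>y. transpose (f y)) x = transpose (partial k f x)"
proof -
  have "partial k (\<lambda>y. transpose (f y)) x $ i $ j = transpose (partial k f x) $ i $ j" for i j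
    using assms by (simp add: partial_nth[symmetric] smooth_intros transpose_nth)
  then show ?thesis by (simp add: vec_eq_iff)
qed

lemma partial_nth2: "smooth_at x f \<Longrightarrow> partial k (\<lambda>y. f y $ i $ j) x = partial k f x $ i $ j"
  by (simp add: partial_nth smooth_at_nth)

section \<open>The Levi-Civita connection and its characterisation\<close>

lemma smooth_at_levi_civita [smooth_intros]:
  assumes "smooth_at x g" "det (g x) \<noteq> 0"
  shows "smooth_at x (levi_civita g a)"
  unfolding levi_civita_def[abs_def] using assms by (intro smooth_intros)

lemma smooth_at_curv [smooth_intros]:
  assumes "\<And>a. smooth_at x (A a)"
  shows "smooth_at x (curv A a b)"
  unfolding curv_def[abs_def] using assms by (intro smooth_intros)

lemma levi_civita_torsion: 
  assumes "\<forall>\<^sub>F y in nhds x. transpose (g y) = g y"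
  shows "levi_civita g a x $ c $ b = levi_civita g b x $ c $ a"
proof -
  have "partial d (\<lambda>y. g y $ a $ b) x = partial d (\<lambda>y. g y $ b $ a) x" for d
    by (rule partial_cong, use assms in eventually_elim) (metis transpose_nth)
  then show ?thesis by (simp add: levi_civita_def algebra_simps)
qed

text \<open>Christoffel symbols of the first kind; lowering the index removes the inverse metric
  from the computations.\<close>

lemma levi_civita_lower:
  assumes g: "smooth_at x g" "det (g x) \<noteq> 0"
  shows "(g x ** levi_civita g a x) $ d $ b =
    (1/2) * (partial a g x $ d $ b + partial b g x $ d $ a - partial d g x $ a $ b)"
proof -
  let ?S = "\<chi> d b. (1/2) * (partial a g x $ d $ b + partial b g x $ d $ a - partial d g x $ a $ b)"
  have "levi_civita g a x = matrix_inv (g x) ** ?S"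
    by (simp add: vec_eq_iff levi_civita_def matmul_nth partial_nth2[OF g(1)] sum_distrib_left)
  then have "g x ** levi_civita g a x = ?S"
    by (simp add: matrix_mul_assoc matrix_inv_both g(2))
  then show ?thesis by simp
qed

lemma levi_civita_metric:
  assumes g: "smooth_at x g" "det (g x) \<noteq> 0" and sym: "\<forall>\<^sub>F y in nhds x. transpose (g y) = g y"
  shows "partial a g x = transpose (levi_civita g a x) ** g x + g x ** levi_civita g a x"
proof -
  have ps: "partial d g x $ i $ j = partial d g x $ j $ i" for d i j
    unfolding partial_nth2[OF g(1), symmetric]
    by (rule partial_cong, use sym in eventually_elim) (metis transpose_nth)
  have "transpose (g x) = g x" using sym by (rule eventually_nhds_x_imp_x)
  then have "transpose (levi_civita g a x) ** g x = transpose (g x ** levi_civita g a x)"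
    by (simp add: matrix_transpose_mul)
  then have t: "(transpose (levi_civita g a x) ** g x) $ i $ j = (g x ** levi_civita g a x) $ j $ i" for i j
    by (simp add: transpose_nth)
  have "partial a g x $ i $ j = (transpose (levi_civita g a x) ** g x + g x ** levi_civita g a x) $ i $ j" for i j
    using ps[of a j i] ps[of i j a] ps[of j i a]
    unfolding vector_add_component t levi_civita_lower[OF g] by (simp add: field_simps)
  then show ?thesis by (simp add: vec_eq_iff)
qed

text \<open>Koszul's argument: in the alternating sum of three derivatives of g, vanishing torsion
  cancels all but twice one term. It replaces a direct computation of how Christoffel symbols
  transform.\<close>

lemma levi_civita_unique:
  assumes g: "smooth_at x g" "det (g x) \<noteq> 0" and sym: "transpose (g x) = g x"
    and tors: "\<And>a b c. \<Gamma> a $ c $ b = \<Gamma> b $ c $ a"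
    and met: "\<And>a. partial a g x = transpose (\<Gamma> a) ** g x + g x ** \<Gamma> a"
  shows "levi_civita g a x = \<Gamma> a"
proof (rule matmul_left_cancel[OF g(2)])
  have s: "g x $ i $ j = g x $ j $ i" for i j using sym by (metis transpose_nth)
  have p: "partial a g x $ d $ b = (g x ** \<Gamma> a) $ b $ d + (g x ** \<Gamma> a) $ d $ b" for a b d
    unfolding met by (simp add: matmul_nth transpose_nth) (subst s, simp add: mult.commute)
  have t: "(g x ** \<Gamma> a) $ d $ b = (g x ** \<Gamma> b) $ d $ a" for a b d
    unfolding matmul_nth by (subst tors) simp
  have "(g x ** levi_civita g a x) $ d $ b = (g x ** \<Gamma> a) $ d $ b" for d b
    unfolding levi_civita_lower[OF g] p using t[of a b d] t[of b a d] t[of a d b] by simp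
  then show "g x ** levi_civita g a x = g x ** \<Gamma> a"
    by (simp add: vec_eq_iff)
qed

text \<open>The equation for H says that H is a parallel map between the two connections. Its
  integrability condition, the symmetry of the second derivatives of H, is the claimed relation. The
  lemma serves for changes of trivialisation and, with H a Jacobian, for changes of
  coordinates.\<close>

lemma curv_gauge:
  fixes H :: "real^'k::finite \<Rightarrow> real^'r::finite^'r"
  assumes H: "smooth_at x H" and A: "\<And>a. smooth_at x (A a)" and A': "\<And>a. smooth_at x (A' a)"
    and E: "\<And>a. \<forall>\<^sub>F y in nhds x. partial a H y = H y ** A' a y - A a y ** H y"
  shows "H x ** curv A' a b x = curv A a b x ** H x"
proof -
  have E0: "partial a H x = H x ** A' a x - A a x ** H x" for a
    using E by (rule eventually_nhds_x_imp_x)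
  have "partial a (partial b H) x = H x ** partial a (A' b) x + (H x ** A' a x - A a x ** H x) ** A' b x
      - A b x ** (H x ** A' a x - A a x ** H x) - partial a (A b) x ** H x" for a b
    unfolding partial_cong[OF E[of b]]
    by (simp add: partial_diff partial_matmul smooth_intros H A A' E0)
  from this[of a b, unfolded partial_commute[OF H, of a b] this[of b a]] show ?thesis
    by (simp add: curv_def matmul_distribs matrix_mul_assoc algebra_simps)
qed

section \<open>Pullback of metrics, connections and their curvatures\<close>

definition jacm :: "(real^'k::finite \<Rightarrow> real^'k) \<Rightarrow> real^'k \<Rightarrow> real^'k^'k" where
  "jacm \<Phi> y = (\<chi> c b. partial b (\<lambda>z. \<Phi> z $ c) y)"

definition pull_conn :: "(real^'k::finite \<Rightarrow> real^'k) \<Rightarrow> ('k \<Rightarrow> real^'k \<Rightarrow> 'b::real_vector) \<Rightarrow> 'k \<Rightarrow> real^'k \<Rightarrow> 'b" where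
  "pull_conn \<Phi> A a y = (\<Sum>b\<in>UNIV. jacm \<Phi> y $ b $ a *\<^sub>R A b (\<Phi> y))"

definition pull_metric :: "(real^'k::finite \<Rightarrow> real^'k) \<Rightarrow> (real^'k \<Rightarrow> real^'k^'k) \<Rightarrow> real^'k \<Rightarrow> real^'k^'k" where
  "pull_metric \<Phi> g y = transpose (jacm \<Phi> y) ** g (\<Phi> y) ** jacm \<Phi> y"

lemma smooth_at_jacm [smooth_intros]: "smooth_at x \<Phi> \<Longrightarrow> smooth_at x (jacm \<Phi>)"
  unfolding jacm_def[abs_def] by (intro smooth_intros)

lemma smooth_at_pull_conn [smooth_intros]:
  assumes "smooth_at x \<Phi>" "\<And>b. smooth_at (\<Phi> x) (A b)"
  shows "smooth_at x (pull_conn \<Phi> A a)"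
  unfolding pull_conn_def[abs_def] using assms by (intro smooth_intros smooth_at_compose[OF assms])

lemma smooth_at_pull_metric [smooth_intros]:
  assumes "smooth_at x \<Phi>" "smooth_at (\<Phi> x) g"
  shows "smooth_at x (pull_metric \<Phi> g)"
  unfolding pull_metric_def[abs_def] using assms by (intro smooth_intros smooth_at_compose[OF assms])

lemma partial_jacm:
  assumes "smooth_at x \<Phi>"
  shows "partial a (\<lambda>y. jacm \<Phi> y $ c $ b) x = partial b (\<lambda>y. jacm \<Phi> y $ c $ a) x"
  unfolding jacm_def vec_lambda_beta by (intro partial_commute smooth_intros assms)

lemma partial_comp':
  fixes f :: "real^'k::finite \<Rightarrow> 'b::real_normed_vector"
  shows "smooth_at x \<Phi> \<Longrightarrow> smooth_at (\<Phi> x) f \<Longrightarrow>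
    partial k (\<lambda>y. f (\<Phi> y)) x = (\<Sum>j\<in>UNIV. jacm \<Phi> x $ j $ k *\<^sub>R partial j f (\<Phi> x))"
  by (simp add: partial_comp jacm_def)

text \<open>The second derivatives of \<Phi> enter symmetrically in a and b and cancel, so the
  curvature transforms as a two-form.\<close>

lemma curv_pullback:
  fixes \<Phi> :: "real^'k::finite \<Rightarrow> real^'k" and A :: "'k \<Rightarrow> real^'k \<Rightarrow> real^'r::finite^'r"
  assumes \<Phi>: "smooth_at x \<Phi>" and A: "\<And>b. smooth_at (\<Phi> x) (A b)"
  shows "curv (pull_conn \<Phi> A) a b x =
    (\<Sum>c\<in>UNIV. \<Sum>d\<in>UNIV. (jacm \<Phi> x $ c $ a * jacm \<Phi> x $ d $ b) *\<^sub>R curv A c d (\<Phi> x))"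
proof -
  let ?J = "jacm \<Phi> x"
  have AP: "smooth_at x (\<lambda>y. A d (\<Phi> y))" for d by (rule smooth_at_compose[OF \<Phi> A])
  have p: "partial a (pull_conn \<Phi> A b) x =
      (\<Sum>c\<in>UNIV. \<Sum>d\<in>UNIV. (?J $ c $ a * ?J $ d $ b) *\<^sub>R partial c (A d) (\<Phi> x))
      + (\<Sum>d\<in>UNIV. partial a (\<lambda>y. jacm \<Phi> y $ d $ b) x *\<^sub>R A d (\<Phi> x))" for a b
  proof -
    have "partial a (pull_conn \<Phi> A b) x =
      (\<Sum>d\<in>UNIV. ?J $ d $ b *\<^sub>R (\<Sum>c\<in>UNIV. ?J $ c $ a *\<^sub>R partial c (A d) (\<Phi> x))
        + partial a (\<lambda>y. jacm \<Phi> y $ d $ b) x *\<^sub>R A d (\<Phi> x))"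
      unfolding pull_conn_def[abs_def]
      by (simp add: partial_sum partial_scaleR smooth_intros \<Phi> AP partial_comp'[OF \<Phi> A])
    also have "\<dots> = (\<Sum>d\<in>UNIV. \<Sum>c\<in>UNIV. (?J $ c $ a * ?J $ d $ b) *\<^sub>R partial c (A d) (\<Phi> x))
      + (\<Sum>d\<in>UNIV. partial a (\<lambda>y. jacm \<Phi> y $ d $ b) x *\<^sub>R A d (\<Phi> x))"
      by (simp add: sum.distrib scaleR_sum_right mult.commute)
    finally show ?thesis by (subst sum.swap) simp
  qed
  have m: "pull_conn \<Phi> A a x ** pull_conn \<Phi> A b x =
      (\<Sum>c\<in>UNIV. \<Sum>d\<in>UNIV. (?J $ c $ a * ?J $ d $ b) *\<^sub>R (A c (\<Phi> x) ** A d (\<Phi> x)))" for a b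
    unfolding pull_conn_def by (simp add: matmul_sum_left matmul_sum_right matmul_distribs scaleR_sum_right)
      (subst sum.swap, simp add: mult.commute)
  have sw: "(\<Sum>c\<in>UNIV. \<Sum>d\<in>UNIV. (?J $ c $ b * ?J $ d $ a) *\<^sub>R X c d) =
      (\<Sum>c\<in>UNIV. \<Sum>d\<in>UNIV. (?J $ c $ a * ?J $ d $ b) *\<^sub>R X d c)" for X :: "'k \<Rightarrow> 'k \<Rightarrow> real^'r^'r"
    by (subst sum.swap) (simp add: mult.commute)
  show ?thesis
    unfolding curv_def p m partial_jacm[OF \<Phi>, of _ a b] sw
    by (simp add: sum.distrib[symmetric] sum_subtractf[symmetric] algebra_simps)
qed

text \<open>The transformation law of Christoffel symbols, written so that the Jacobian becomes a
  parallel map from the Levi-Civita connection of the pulled-back metric to the pulled-back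
  connection. This is the input that \<open>curv_gauge\<close> needs.\<close>

lemma levi_civita_pullback:
  fixes \<Phi> :: "real^'k::finite \<Rightarrow> real^'k"
  assumes \<Phi>: "smooth_at x \<Phi>" "det (jacm \<Phi> x) \<noteq> 0"
    and g: "smooth_at (\<Phi> x) g" "det (g (\<Phi> x)) \<noteq> 0" and sym: "\<forall>\<^sub>F y in nhds (\<Phi> x). transpose (g y) = g y"
  shows "partial a (jacm \<Phi>) x = jacm \<Phi> x ** levi_civita (pull_metric \<Phi> g) a x
    - pull_conn \<Phi> (levi_civita g) a x ** jacm \<Phi> x"
proof -
  let ?J = "jacm \<Phi> x" and ?P = "\<lambda>a. pull_conn \<Phi> (levi_civita g) a x"
  define S where "S a = ?P a ** ?J + partial a (jacm \<Phi>) x" for a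
  \<comment> \<open>The law solved for the new connection. It is torsion-free and metric, so
    \<open>levi_civita_unique\<close> identifies it.\<close>
  define \<Gamma> where "\<Gamma> a = matrix_inv ?J ** S a" for a
  have J\<Gamma>: "?J ** \<Gamma> a = S a" for a
    by (simp add: \<Gamma>_def matrix_mul_assoc matrix_inv_both \<Phi>)
  have gs: "transpose (g (\<Phi> x)) = g (\<Phi> x)" using sym by (rule eventually_nhds_x_imp_x)
  have gP: "smooth_at x (\<lambda>y. g (\<Phi> y))" by (rule smooth_at_compose[OF \<Phi>(1) g(1)])
  have SS: "S a $ c $ b = S b $ c $ a" for a b c
  proof -
    have "(?P a ** ?J) $ c $ b = (\<Sum>q\<in>UNIV. \<Sum>e\<in>UNIV. ?J $ e $ a * ?J $ q $ b * levi_civita g e (\<Phi> x) $ c $ q)" for a b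
      by (simp add: matmul_nth pull_conn_def sum_distrib_right sum_distrib_left mult_ac)
    moreover have "(\<Sum>q\<in>UNIV. \<Sum>e\<in>UNIV. ?J $ e $ a * ?J $ q $ b * levi_civita g e (\<Phi> x) $ c $ q) =
        (\<Sum>q\<in>UNIV. \<Sum>e\<in>UNIV. ?J $ e $ b * ?J $ q $ a * levi_civita g e (\<Phi> x) $ c $ q)"
      by (subst sum.swap, subst levi_civita_torsion[OF sym]) (simp add: mult_ac)
    moreover have "partial a (jacm \<Phi>) x $ c $ b = partial b (jacm \<Phi>) x $ c $ a"
      using partial_jacm[OF \<Phi>(1), of c b a] by (simp add: partial_nth2 smooth_intros \<Phi>(1))
    ultimately show ?thesis by (simp add: S_def)
  qed
  have tors: "\<Gamma> a $ c $ b = \<Gamma> b $ c $ a" for a b c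
    unfolding \<Gamma>_def matmul_nth by (subst SS) simp
  have gder: "partial a (\<lambda>y. g (\<Phi> y)) x = transpose (?P a) ** g (\<Phi> x) + g (\<Phi> x) ** ?P a" for a
    by (simp add: partial_comp'[OF \<Phi>(1) g(1)] levi_civita_metric[OF g sym] pull_conn_def
        transpose_distribs matmul_sum_left matmul_sum_right matmul_distribs scaleR_add_right sum.distrib)
  have met: "partial a (pull_metric \<Phi> g) x =
      transpose (\<Gamma> a) ** pull_metric \<Phi> g x + pull_metric \<Phi> g x ** \<Gamma> a" for a
  proof -
    have r: "pull_metric \<Phi> g x ** \<Gamma> a = transpose ?J ** g (\<Phi> x) ** S a"
      by (simp add: pull_metric_def matrix_mul_assoc[symmetric] J\<Gamma>)
    have "transpose (\<Gamma> a) ** pull_metric \<Phi> g x = transpose (?J ** \<Gamma> a) ** g (\<Phi> x) ** ?J"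
      by (simp add: pull_metric_def matrix_mul_assoc matrix_transpose_mul)
    then have l: "transpose (\<Gamma> a) ** pull_metric \<Phi> g x = transpose (S a) ** g (\<Phi> x) ** ?J"
      by (simp add: J\<Gamma>)
    have "partial a (pull_metric \<Phi> g) x = transpose ?J ** g (\<Phi> x) ** partial a (jacm \<Phi>) x +
        (transpose ?J ** partial a (\<lambda>y. g (\<Phi> y)) x + transpose (partial a (jacm \<Phi>) x) ** g (\<Phi> x)) ** ?J"
      unfolding pull_metric_def[abs_def]
      by (simp add: partial_matmul smooth_intros \<Phi>(1) gP partial_transpose)
    then show ?thesis
      unfolding r l gder S_def
      by (simp add: matmul_distribs transpose_distribs matrix_transpose_mul matrix_mul_assoc algebra_simps)
  qed
  have psym: "transpose (pull_metric \<Phi> g x) = pull_metric \<Phi> g x"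
    by (simp add: pull_metric_def matrix_transpose_mul gs matrix_mul_assoc)
  have pdet: "det (pull_metric \<Phi> g x) \<noteq> 0"
    using \<Phi>(2) g(2) by (simp add: pull_metric_def det_mul)
  have "levi_civita (pull_metric \<Phi> g) a x = \<Gamma> a"
    by (rule levi_civita_unique[OF _ pdet psym tors met]) (intro smooth_intros \<Phi> g)
  then show ?thesis by (simp add: J\<Gamma> S_def)
qed

lemma eventually_nhds_comp:
  assumes "smooth_at x \<Phi>" "\<forall>\<^sub>F y in nhds (\<Phi> x). P y"
  shows "\<forall>\<^sub>F y in nhds x. P (\<Phi> y)"
proof -
  have "(\<Phi> \<longlongrightarrow> \<Phi> x) (nhds x)"
    using smooth_at_continuous[OF assms(1)] continuous_within tendsto_at_iff_tendsto_nhds by blast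
  then show ?thesis using assms(2) by (auto simp: filterlim_iff)
qed

lemma levi_civita_pullback_eventually:
  fixes \<Phi> :: "real^'k::finite \<Rightarrow> real^'k"
  assumes \<Phi>: "smooth_at x \<Phi>" "det (jacm \<Phi> x) \<noteq> 0"
    and g: "smooth_at (\<Phi> x) g" "det (g (\<Phi> x)) \<noteq> 0" and sym: "\<forall>\<^sub>F y in nhds (\<Phi> x). transpose (g y) = g y"
  shows "\<forall>\<^sub>F y in nhds x. partial a (jacm \<Phi>) y = jacm \<Phi> y ** levi_civita (pull_metric \<Phi> g) a y
    - pull_conn \<Phi> (levi_civita g) a y ** jacm \<Phi> y"
proof -
  have "\<forall>\<^sub>F y in nhds x. det (jacm \<Phi> y) \<noteq> 0"
    using \<Phi> by (intro eventually_nonzero smooth_intros)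
  moreover have "\<forall>\<^sub>F y in nhds x. smooth_at y \<Phi>" by (rule smooth_at_eventually[OF \<Phi>(1)])
  moreover have "\<forall>\<^sub>F y in nhds x. smooth_at (\<Phi> y) g"
    by (rule eventually_nhds_comp[OF \<Phi>(1) smooth_at_eventually[OF g(1)]])
  moreover have "\<forall>\<^sub>F y in nhds (\<Phi> x). det (g y) \<noteq> 0"
    using g by (intro eventually_nonzero smooth_intros)
  then have "\<forall>\<^sub>F y in nhds x. det (g (\<Phi> y)) \<noteq> 0"
    by (rule eventually_nhds_comp[OF \<Phi>(1)])
  moreover have "\<forall>\<^sub>F y in nhds (\<Phi> x). \<forall>\<^sub>F z in nhds y. transpose (g z) = g z"
    using sym by (simp add: eventually_eventually)
  then have "\<forall>\<^sub>F y in nhds x. \<forall>\<^sub>F z in nhds (\<Phi> y). transpose (g z) = g z"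
    by (rule eventually_nhds_comp[OF \<Phi>(1)])
  ultimately show ?thesis
    by eventually_elim (rule levi_civita_pullback)
qed

lemma sum_rotate3: "(\<Sum>a\<in>A. \<Sum>b\<in>B. \<Sum>c\<in>C. f a b c) = (\<Sum>b\<in>B. \<Sum>c\<in>C. \<Sum>a\<in>A. f a b c)"
  by (subst sum.swap) (intro sum.cong refl sum.swap)

lemma sum_rotate5: "(\<Sum>a\<in>A. \<Sum>b\<in>B. \<Sum>c\<in>C. \<Sum>d\<in>D. \<Sum>e\<in>E. f a b c d e) =
    (\<Sum>b\<in>B. \<Sum>c\<in>C. \<Sum>d\<in>D. \<Sum>e\<in>E. \<Sum>a\<in>A. f a b c d e)"
  by (subst sum_rotate3) (intro sum.cong refl sum_rotate3)

lemma sum_reverse3: "(\<Sum>a\<in>A. \<Sum>b\<in>B. \<Sum>c\<in>C. f a b c) = (\<Sum>c\<in>C. \<Sum>b\<in>B. \<Sum>a\<in>A. f a b c)"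
  by (subst sum_rotate3) (rule sum.swap)

text \<open>Curvature takes two Jacobian factors as a two-form and is conjugated by the Jacobian as
  an endomorphism; in the trace one of the former cancels against the inverse Jacobian of the
  conjugation.\<close>

lemma ricci_pullback:
  fixes \<Phi> :: "real^'k::finite \<Rightarrow> real^'k"
  assumes \<Phi>: "smooth_at x \<Phi>" "det (jacm \<Phi> x) \<noteq> 0"
    and g: "smooth_at (\<Phi> x) g" "det (g (\<Phi> x)) \<noteq> 0" and sym: "\<forall>\<^sub>F y in nhds (\<Phi> x). transpose (g y) = g y"
  shows "ricci (pull_metric \<Phi> g) x = transpose (jacm \<Phi> x) ** ricci g (\<Phi> x) ** jacm \<Phi> x"
proof -
  let ?J = "jacm \<Phi> x" and ?L = "levi_civita (pull_metric \<Phi> g)" and ?K = "\<lambda>c d. curv (levi_civita g) c d (\<Phi> x)"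
  let ?I = "matrix_inv ?J"
  have d: "det (pull_metric \<Phi> g x) \<noteq> 0"
    using \<Phi>(2) g(2) by (simp add: pull_metric_def det_mul)
  have "?J ** curv ?L a b x = curv (pull_conn \<Phi> (levi_civita g)) a b x ** ?J" for a b
    by (rule curv_gauge[OF _ _ _ levi_civita_pullback_eventually[OF \<Phi> g sym]])
      (intro smooth_intros \<Phi> g d)+
  then have "?I ** (?J ** curv ?L a b x) = ?I ** (curv (pull_conn \<Phi> (levi_civita g)) a b x ** ?J)" for a b
    by simp
  then have C: "curv ?L a b x = ?I ** ((\<Sum>c\<in>UNIV. \<Sum>d\<in>UNIV. (?J $ c $ a * ?J $ d $ b) *\<^sub>R ?K c d) ** ?J)" for a b
    by (simp add: matrix_mul_assoc matrix_inv_both \<Phi>(2) curv_pullback[OF \<Phi>(1) smooth_at_levi_civita[OF g]])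
  have "ricci (pull_metric \<Phi> g) x $ b $ e = (transpose ?J ** ricci g (\<Phi> x) ** ?J) $ b $ e" for b e
  proof -
    have "curv ?L a b x $ a $ e = (\<Sum>c\<in>UNIV. \<Sum>d\<in>UNIV. \<Sum>p\<in>UNIV. \<Sum>q\<in>UNIV.
        (?J $ c $ a * ?I $ a $ p) * (?J $ d $ b * ?K c d $ p $ q * ?J $ q $ e))" for a
    proof -
      have "?I ** ((\<Sum>c\<in>UNIV. \<Sum>d\<in>UNIV. (?J $ c $ a * ?J $ d $ b) *\<^sub>R ?K c d) ** ?J) =
        (\<Sum>c\<in>UNIV. \<Sum>d\<in>UNIV. (?J $ c $ a * ?J $ d $ b) *\<^sub>R (?I ** (?K c d ** ?J)))"
        by (simp add: matmul_sum_left matmul_sum_right matmul_distribs)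
      then show ?thesis
        unfolding C by (simp add: matmul_nth sum_distrib_left mult_ac)
    qed
    then have "ricci (pull_metric \<Phi> g) x $ b $ e = (\<Sum>a\<in>UNIV. \<Sum>c\<in>UNIV. \<Sum>d\<in>UNIV. \<Sum>p\<in>UNIV. \<Sum>q\<in>UNIV.
        (?J $ c $ a * ?I $ a $ p) * (?J $ d $ b * ?K c d $ p $ q * ?J $ q $ e))"
      by (simp add: ricci_def)
    also have "\<dots> = (\<Sum>c\<in>UNIV. \<Sum>d\<in>UNIV. \<Sum>p\<in>UNIV. \<Sum>q\<in>UNIV.
        (?J ** ?I) $ c $ p * (?J $ d $ b * ?K c d $ p $ q * ?J $ q $ e))"
      unfolding matmul_nth sum_distrib_right
      by (rule sum_rotate5)
    also have "\<dots> = (\<Sum>c\<in>UNIV. \<Sum>d\<in>UNIV. \<Sum>q\<in>UNIV. ?J $ d $ b * ?K c d $ c $ q * ?J $ q $ e)"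
    proof (rule sum.cong[OF refl], rule sum.cong[OF refl])
      fix c d
      have "(\<Sum>p\<in>UNIV. \<Sum>q\<in>UNIV. (?J ** ?I) $ c $ p * (?J $ d $ b * ?K c d $ p $ q * ?J $ q $ e)) =
        (\<Sum>p\<in>UNIV. if p = c then (\<Sum>q\<in>UNIV. ?J $ d $ b * ?K c d $ p $ q * ?J $ q $ e) else 0)"
        by (rule sum.cong) (auto simp: matrix_inv_both \<Phi>(2) mat_def)
      then show "(\<Sum>p\<in>UNIV. \<Sum>q\<in>UNIV. (?J ** ?I) $ c $ p * (?J $ d $ b * ?K c d $ p $ q * ?J $ q $ e)) =
        (\<Sum>q\<in>UNIV. ?J $ d $ b * ?K c d $ c $ q * ?J $ q $ e)" by simp
    qed
    also have "\<dots> = (\<Sum>q\<in>UNIV. \<Sum>d\<in>UNIV. \<Sum>c\<in>UNIV. ?J $ d $ b * ?K c d $ c $ q * ?J $ q $ e)"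
      by (rule sum_reverse3)
    also have "\<dots> = (transpose ?J ** ricci g (\<Phi> x) ** ?J) $ b $ e"
      by (simp add: matmul_nth transpose_nth ricci_def sum_distrib_left sum_distrib_right mult_ac)
    finally show ?thesis .
  qed
  then show ?thesis by (simp add: vec_eq_iff)
qed

text \<open>Differentiating the relation of \<open>curv_gauge\<close> produces derivatives of H; by
  the equation for H they combine with the commutator terms of the two connections.\<close>

lemma cov_curv_gauge:
  fixes H :: "real^'k::finite \<Rightarrow> real^'r::finite^'r"
  assumes H: "smooth_at x H" and A: "\<And>a. smooth_at x (A a)" and A': "\<And>a. smooth_at x (A' a)"
    and E: "\<And>a. \<forall>\<^sub>F y in nhds x. partial a H y = H y ** A' a y - A a y ** H y"
  shows "H x ** cov_curv g A' b c a x = cov_curv g A b c a x ** H x"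
proof -
  have E0: "partial a H x = H x ** A' a x - A a x ** H x" for a
    using E by (rule eventually_nhds_x_imp_x)
  have ev: "\<forall>\<^sub>F y in nhds x. H y ** curv A' a b y = curv A a b y ** H y" for a b
  proof -
    have "\<forall>\<^sub>F y in nhds x. \<forall>a. smooth_at y (A a) \<and> smooth_at y (A' a) \<and>
        (\<forall>\<^sub>F z in nhds y. partial a H z = H z ** A' a z - A a z ** H z)"
      using smooth_at_eventually[OF A] smooth_at_eventually[OF A'] E
      by (intro eventually_all_finite eventually_conj) (simp_all add: eventually_eventually)
    then show ?thesis
      using smooth_at_eventually[OF H] by eventually_elim (rule curv_gauge; blast)
  qed
  have C0: "H x ** curv A' a b x = curv A a b x ** H x" for a b
    using ev by (rule eventually_nhds_x_imp_x)
  have C1: "H x ** partial b (curv A' c a) x + (H x ** A' b x - A b x ** H x) ** curv A' c a x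
      = curv A c a x ** (H x ** A' b x - A b x ** H x) + partial b (curv A c a) x ** H x"
    using partial_cong[OF ev[of c a], of b]
    by (simp add: partial_matmul smooth_intros H A A' E0)
  have C2: "H x ** partial b (curv A' c a) x = curv A c a x ** (H x ** A' b x - A b x ** H x)
      + partial b (curv A c a) x ** H x - (H x ** A' b x - A b x ** H x) ** curv A' c a x"
    using C1 by (simp add: algebra_simps)
  have C3: "H x ** (A' b x ** curv A' c a x) = H x ** A' b x ** curv A' c a x"
    "H x ** (curv A' c a x ** A' b x) = curv A c a x ** H x ** A' b x"
    "A b x ** (H x ** curv A' c a x) = A b x ** curv A c a x ** H x"
    by (simp_all only: matrix_mul_assoc C0)
  have C4: "A b x ** H x ** curv A' c a x = A b x ** curv A c a x ** H x"
    by (simp only: matrix_mul_assoc[symmetric] C0)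
  show ?thesis
    unfolding cov_curv_def
    by (simp add: matmul_distribs matmul_sum_left matmul_sum_right C2 C0 C3)
      (simp add: matrix_mul_assoc C4)
qed

lemma ym_current_gauge:
  fixes H :: "real^'k::finite \<Rightarrow> real^'r::finite^'r"
  assumes "smooth_at x H" "\<And>a. smooth_at x (A a)" "\<And>a. smooth_at x (A' a)"
    and "\<And>a. \<forall>\<^sub>F y in nhds x. partial a H y = H y ** A' a y - A a y ** H y"
  shows "H x ** ym_current g A' a x = ym_current g A a x ** H x"
  by (simp add: ym_current_def matmul_sum_left matmul_sum_right matmul_distribs cov_curv_gauge[OF assms])

section \<open>Curvature and current depend only on germs\<close>

lemma levi_civita_cong:
  assumes "\<forall>\<^sub>F y in nhds x. g y = h y"
  shows "levi_civita g a x = levi_civita h a x"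
proof -
  have "partial a (\<lambda>y. g y $ i $ j) x = partial a (\<lambda>y. h y $ i $ j) x" for a i j
    by (rule partial_cong, use assms in eventually_elim) simp
  moreover have "g x = h x" using assms by (rule eventually_nhds_x_imp_x)
  ultimately show ?thesis by (simp add: levi_civita_def)
qed

lemma curv_cong:
  assumes "\<And>a. \<forall>\<^sub>F y in nhds x. A a y = B a y"
  shows "curv A a b x = curv B a b x"
proof -
  have "A a x = B a x" for a using assms by (rule eventually_nhds_x_imp_x)
  then show ?thesis by (simp add: curv_def partial_cong[OF assms])
qed

lemma eventually_levi_civita_cong:
  assumes "\<forall>\<^sub>F y in nhds x. g y = h y"
  shows "\<forall>\<^sub>F y in nhds x. levi_civita g a y = levi_civita h a y"
proof -
  have "\<forall>\<^sub>F y in nhds x. \<forall>\<^sub>F z in nhds y. g z = h z"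
    using assms by (simp add: eventually_eventually)
  then show ?thesis by eventually_elim (rule levi_civita_cong)
qed

lemma eventually_curv_cong:
  fixes A B :: "'k::finite \<Rightarrow> real^'k \<Rightarrow> real^'r::finite^'r"
  assumes "\<And>a. \<forall>\<^sub>F y in nhds x. A a y = B a y"
  shows "\<forall>\<^sub>F y in nhds x. curv A a b y = curv B a b y"
proof -
  have "\<forall>\<^sub>F y in nhds x. \<forall>a. \<forall>\<^sub>F z in nhds y. A a z = B a z"
    using assms by (intro eventually_all_finite) (simp add: eventually_eventually)
  then show ?thesis by eventually_elim (rule curv_cong, blast)
qed

lemma ricci_cong:
  assumes "\<forall>\<^sub>F y in nhds x. g y = h y"
  shows "ricci g x = ricci h x"
  by (simp add: ricci_def curv_cong[OF eventually_levi_civita_cong[OF assms]])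

lemma ym_current_cong:
  fixes A B :: "'k::finite \<Rightarrow> real^'k \<Rightarrow> real^'r::finite^'r"
  assumes g: "\<forall>\<^sub>F y in nhds x. g y = h y" and A: "\<And>a. \<forall>\<^sub>F y in nhds x. A a y = B a y"
  shows "ym_current g A a x = ym_current h B a x"
proof -
  have "A a x = B a x" for a using A by (rule eventually_nhds_x_imp_x)
  moreover have "g x = h x" using g by (rule eventually_nhds_x_imp_x)
  ultimately show ?thesis
    by (simp add: ym_current_def cov_curv_def levi_civita_cong[OF g] curv_cong[OF A]
        partial_cong[OF eventually_curv_cong[OF A]])
qed

lemma smooth_at_ricci [smooth_intros]:
  assumes "smooth_at x g" "det (g x) \<noteq> 0"
  shows "smooth_at x (ricci g)"
  unfolding ricci_def[abs_def] using assms by (intro smooth_intros)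

lemma sum4_exchange: "(\<Sum>q\<in>A. \<Sum>r\<in>B. \<Sum>d\<in>C. \<Sum>p\<in>D. f q r d p) =
    (\<Sum>p\<in>D. \<Sum>d\<in>C. \<Sum>r\<in>B. \<Sum>q\<in>A. f q r d p)"
proof -
  have "(\<Sum>q\<in>A. \<Sum>r\<in>B. \<Sum>d\<in>C. \<Sum>p\<in>D. f q r d p) = (\<Sum>q\<in>A. \<Sum>p\<in>D. \<Sum>d\<in>C. \<Sum>r\<in>B. f q r d p)"
    by (intro sum.cong refl sum_reverse3)
  also have "\<dots> = (\<Sum>p\<in>D. \<Sum>d\<in>C. \<Sum>r\<in>B. \<Sum>q\<in>A. f q r d p)"
    by (subst sum_rotate3) (intro sum.cong refl sum.swap)
  finally show ?thesis .
qed

text \<open>The pulled-back curvature carries two Jacobian factors. Their derivatives cancel against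
  the inhomogeneous terms of the Christoffel symbols, one for each form index, and the tensorial
  part is left.\<close>

lemma cov_curv_pullback:
  fixes \<Phi> :: "real^'k::finite \<Rightarrow> real^'k" and A :: "'k \<Rightarrow> real^'k \<Rightarrow> real^'r::finite^'r"
  assumes \<Phi>: "smooth_at x \<Phi>" "det (jacm \<Phi> x) \<noteq> 0"
    and g: "smooth_at (\<Phi> x) g" "det (g (\<Phi> x)) \<noteq> 0" and sym: "\<forall>\<^sub>F y in nhds (\<Phi> x). transpose (g y) = g y"
    and A: "\<And>b. smooth_at (\<Phi> x) (A b)"
  shows "cov_curv (pull_metric \<Phi> g) (pull_conn \<Phi> A) b c a x =
    (\<Sum>p\<in>UNIV. \<Sum>q\<in>UNIV. \<Sum>r\<in>UNIV. (jacm \<Phi> x $ p $ b * jacm \<Phi> x $ q $ c * jacm \<Phi> x $ r $ a) *\<^sub>R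
      cov_curv g A p q r (\<Phi> x))"
proof -
  let ?J = "jacm \<Phi> x" and ?L = "\<lambda>b. levi_civita (pull_metric \<Phi> g) b x" and ?F = "\<lambda>q r. curv A q r (\<Phi> x)"
  let ?P = "\<lambda>b. pull_conn \<Phi> (levi_civita g) b x" and ?\<Gamma> = "\<lambda>p. levi_civita g p (\<Phi> x)"
  \<comment> \<open>Second derivatives of \<Phi>, kept under a name until those in D cancel against
    those in M1 and M2.\<close>
  define J' where "J' b q c = partial b (\<lambda>y. jacm \<Phi> y $ q $ c) x" for b q c
  have FC: "curv (pull_conn \<Phi> A) c a x = (\<Sum>q\<in>UNIV. \<Sum>r\<in>UNIV. (?J $ q $ c * ?J $ r $ a) *\<^sub>R ?F q r)" for c a
    by (rule curv_pullback[OF \<Phi>(1) A])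
  have Fsm: "smooth_at (\<Phi> x) (curv A q r)" for q r by (intro smooth_intros A)
  have Jsm: "smooth_at x (\<lambda>y. jacm \<Phi> y $ q $ c)" for q c by (intro smooth_intros \<Phi>)
  have "\<forall>\<^sub>F y in nhds x. smooth_at y \<Phi> \<and> (\<forall>b. smooth_at (\<Phi> y) (A b))"
    using smooth_at_eventually[OF \<Phi>(1)] eventually_nhds_comp[OF \<Phi>(1) smooth_at_eventually[OF A]]
    by (intro eventually_conj eventually_all_finite) auto
  then have "\<forall>\<^sub>F y in nhds x. curv (pull_conn \<Phi> A) c a y =
      (\<Sum>q\<in>UNIV. \<Sum>r\<in>UNIV. (jacm \<Phi> y $ q $ c * jacm \<Phi> y $ r $ a) *\<^sub>R curv A q r (\<Phi> y))"
    by eventually_elim (rule curv_pullback, auto)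
  from partial_cong[OF this, of b]
  have D: "partial b (curv (pull_conn \<Phi> A) c a) x =
      (\<Sum>q\<in>UNIV. \<Sum>r\<in>UNIV. (J' b q c * ?J $ r $ a) *\<^sub>R ?F q r) +
      (\<Sum>q\<in>UNIV. \<Sum>r\<in>UNIV. (?J $ q $ c * J' b r a) *\<^sub>R ?F q r) +
      (\<Sum>q\<in>UNIV. \<Sum>r\<in>UNIV. \<Sum>p\<in>UNIV. (?J $ p $ b * ?J $ q $ c * ?J $ r $ a) *\<^sub>R partial p (curv A q r) (\<Phi> x))"
    by (simp add: partial_sum partial_scaleR partial_mult smooth_intros Jsm smooth_at_compose[OF \<Phi>(1) Fsm]
        partial_comp'[OF \<Phi>(1) Fsm] J'_def[symmetric] scaleR_sum_right sum.distrib algebra_simps)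
  have JL: "(\<Sum>d\<in>UNIV. ?J $ q $ d * ?L b $ d $ c) =
      (\<Sum>d\<in>UNIV. \<Sum>p\<in>UNIV. ?J $ p $ b * ?\<Gamma> p $ q $ d * ?J $ d $ c) + J' b q c" for q c
  proof -
    have "partial b (jacm \<Phi>) x $ q $ c = (?J ** ?L b - ?P b ** ?J) $ q $ c"
      by (rule arg_cong[where f = "\<lambda>M. M $ q $ c"], rule levi_civita_pullback[OF \<Phi> g sym])
    then show ?thesis
      by (simp add: J'_def partial_nth2 smooth_intros \<Phi> matmul_nth pull_conn_def sum_distrib_right)
  qed
  have M1: "(\<Sum>d\<in>UNIV. ?L b $ d $ c *\<^sub>R curv (pull_conn \<Phi> A) d a x) =
      (\<Sum>q\<in>UNIV. \<Sum>r\<in>UNIV. (J' b q c * ?J $ r $ a) *\<^sub>R ?F q r) +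
      (\<Sum>p\<in>UNIV. \<Sum>q\<in>UNIV. \<Sum>r\<in>UNIV. (?J $ p $ b * ?J $ q $ c * ?J $ r $ a) *\<^sub>R (\<Sum>d\<in>UNIV. ?\<Gamma> p $ d $ q *\<^sub>R ?F d r))"
  proof -
    have "(\<Sum>d\<in>UNIV. ?L b $ d $ c *\<^sub>R curv (pull_conn \<Phi> A) d a x) =
        (\<Sum>d\<in>UNIV. \<Sum>q\<in>UNIV. \<Sum>r\<in>UNIV. (?J $ q $ d * ?L b $ d $ c * ?J $ r $ a) *\<^sub>R ?F q r)"
      unfolding FC by (simp add: scaleR_sum_right mult_ac)
    also have "\<dots> = (\<Sum>q\<in>UNIV. \<Sum>r\<in>UNIV. ((\<Sum>d\<in>UNIV. ?J $ q $ d * ?L b $ d $ c) * ?J $ r $ a) *\<^sub>R ?F q r)"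
      by (subst sum_rotate3) (simp add: sum_distrib_right scaleR_sum_left)
    also have "\<dots> = (\<Sum>q\<in>UNIV. \<Sum>r\<in>UNIV. \<Sum>d\<in>UNIV. \<Sum>p\<in>UNIV. (?J $ p $ b * ?J $ d $ c * ?J $ r $ a * ?\<Gamma> p $ q $ d) *\<^sub>R ?F q r)
        + (\<Sum>q\<in>UNIV. \<Sum>r\<in>UNIV. (J' b q c * ?J $ r $ a) *\<^sub>R ?F q r)"
      unfolding JL by (simp add: sum_distrib_right sum_distrib_left scaleR_sum_left scaleR_add_left sum.distrib algebra_simps)
    finally show ?thesis
      by (subst (asm) sum4_exchange) (simp add: scaleR_sum_right)
  qed
  have M2: "(\<Sum>d\<in>UNIV. ?L b $ d $ a *\<^sub>R curv (pull_conn \<Phi> A) c d x) =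
      (\<Sum>q\<in>UNIV. \<Sum>r\<in>UNIV. (?J $ q $ c * J' b r a) *\<^sub>R ?F q r) +
      (\<Sum>p\<in>UNIV. \<Sum>q\<in>UNIV. \<Sum>r\<in>UNIV. (?J $ p $ b * ?J $ q $ c * ?J $ r $ a) *\<^sub>R (\<Sum>d\<in>UNIV. ?\<Gamma> p $ d $ r *\<^sub>R ?F q d))"
  proof -
    have "(\<Sum>d\<in>UNIV. ?L b $ d $ a *\<^sub>R curv (pull_conn \<Phi> A) c d x) =
        (\<Sum>d\<in>UNIV. \<Sum>q\<in>UNIV. \<Sum>r\<in>UNIV. (?J $ r $ d * ?L b $ d $ a * ?J $ q $ c) *\<^sub>R ?F q r)"
      unfolding FC by (simp add: scaleR_sum_right mult_ac)
    also have "\<dots> = (\<Sum>q\<in>UNIV. \<Sum>r\<in>UNIV. ((\<Sum>d\<in>UNIV. ?J $ r $ d * ?L b $ d $ a) * ?J $ q $ c) *\<^sub>R ?F q r)"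
      by (subst sum_rotate3) (simp add: sum_distrib_right scaleR_sum_left)
    also have "\<dots> = (\<Sum>q\<in>UNIV. \<Sum>r\<in>UNIV. \<Sum>d\<in>UNIV. \<Sum>p\<in>UNIV. (?J $ p $ b * ?J $ q $ c * ?J $ d $ a * ?\<Gamma> p $ r $ d) *\<^sub>R ?F q r)
        + (\<Sum>q\<in>UNIV. \<Sum>r\<in>UNIV. (?J $ q $ c * J' b r a) *\<^sub>R ?F q r)"
      unfolding JL by (simp add: sum_distrib_right sum_distrib_left scaleR_sum_left scaleR_add_left sum.distrib algebra_simps)
    also have "(\<Sum>q\<in>UNIV. \<Sum>r\<in>UNIV. \<Sum>d\<in>UNIV. \<Sum>p\<in>UNIV. (?J $ p $ b * ?J $ q $ c * ?J $ d $ a * ?\<Gamma> p $ r $ d) *\<^sub>R ?F q r) =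
      (\<Sum>p\<in>UNIV. \<Sum>q\<in>UNIV. \<Sum>d\<in>UNIV. \<Sum>r\<in>UNIV. (?J $ p $ b * ?J $ q $ c * ?J $ d $ a * ?\<Gamma> p $ r $ d) *\<^sub>R ?F q r)"
      by (subst (2) sum.swap) (intro sum.cong refl sum_reverse3)
    finally show ?thesis
      by (simp add: scaleR_sum_right)
  qed
  have M3: "pull_conn \<Phi> A b x ** curv (pull_conn \<Phi> A) c a x =
      (\<Sum>p\<in>UNIV. \<Sum>q\<in>UNIV. \<Sum>r\<in>UNIV. (?J $ p $ b * ?J $ q $ c * ?J $ r $ a) *\<^sub>R (A p (\<Phi> x) ** ?F q r))"
    unfolding FC pull_conn_def
    by (simp add: matmul_sum_left matmul_sum_right matmul_distribs scaleR_sum_right)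
      (subst sum_rotate3[symmetric], simp add: mult_ac)
  have M4: "curv (pull_conn \<Phi> A) c a x ** pull_conn \<Phi> A b x =
      (\<Sum>p\<in>UNIV. \<Sum>q\<in>UNIV. \<Sum>r\<in>UNIV. (?J $ p $ b * ?J $ q $ c * ?J $ r $ a) *\<^sub>R (?F q r ** A p (\<Phi> x)))"
    unfolding FC pull_conn_def
    by (simp add: matmul_sum_left matmul_sum_right matmul_distribs scaleR_sum_right mult_ac)
  have sw: "(\<Sum>q\<in>UNIV. \<Sum>r\<in>UNIV. \<Sum>p\<in>UNIV. (?J $ p $ b * ?J $ q $ c * ?J $ r $ a) *\<^sub>R partial p (curv A q r) (\<Phi> x)) =
      (\<Sum>p\<in>UNIV. \<Sum>q\<in>UNIV. \<Sum>r\<in>UNIV. (?J $ p $ b * ?J $ q $ c * ?J $ r $ a) *\<^sub>R partial p (curv A q r) (\<Phi> x))"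
    by (rule sum_rotate3[symmetric])
  show ?thesis
    unfolding cov_curv_def[of "pull_metric \<Phi> g"] D M1 M2 M3 M4 sw
    unfolding cov_curv_def scaleR_add_right scaleR_diff_right sum.distrib sum_subtractf
    by simp
qed

text \<open>The inverse metric contracts the first two indices of the covariant derivative of the
  curvature, and its pullback absorbs their Jacobian factors; the third factor is that of a
  one-form.\<close>

lemma ym_current_pullback:
  fixes \<Phi> :: "real^'k::finite \<Rightarrow> real^'k" and A :: "'k \<Rightarrow> real^'k \<Rightarrow> real^'r::finite^'r"
  assumes \<Phi>: "smooth_at x \<Phi>" "det (jacm \<Phi> x) \<noteq> 0"
    and g: "smooth_at (\<Phi> x) g" "det (g (\<Phi> x)) \<noteq> 0" and sym: "\<forall>\<^sub>F y in nhds (\<Phi> x). transpose (g y) = g y"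
    and A: "\<And>b. smooth_at (\<Phi> x) (A b)"
  shows "ym_current (pull_metric \<Phi> g) (pull_conn \<Phi> A) a x = pull_conn \<Phi> (ym_current g A) a x"
proof -
  let ?J = "jacm \<Phi> x" and ?I = "matrix_inv (pull_metric \<Phi> g x)"
  let ?C = "\<lambda>p q r. cov_curv g A p q r (\<Phi> x)"
  have "pull_metric \<Phi> g x ** (matrix_inv ?J ** matrix_inv (g (\<Phi> x)) ** transpose (matrix_inv ?J)) =
      transpose ?J ** g (\<Phi> x) ** (?J ** matrix_inv ?J) ** matrix_inv (g (\<Phi> x)) ** transpose (matrix_inv ?J)"
    by (simp only: pull_metric_def matrix_mul_assoc)
  also have "\<dots> = transpose ?J ** (g (\<Phi> x) ** matrix_inv (g (\<Phi> x))) ** transpose (matrix_inv ?J)"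
    by (simp add: matrix_inv_both \<Phi>(2)) (simp only: matrix_mul_assoc)
  also have "\<dots> = transpose (matrix_inv ?J ** ?J)"
    by (simp add: matrix_inv_both g(2) matrix_transpose_mul)
  finally have "pull_metric \<Phi> g x ** (matrix_inv ?J ** matrix_inv (g (\<Phi> x)) ** transpose (matrix_inv ?J)) = mat 1"
    by (simp add: matrix_inv_both \<Phi>(2))
  then have "?I = matrix_inv ?J ** matrix_inv (g (\<Phi> x)) ** transpose (matrix_inv ?J)"
    by (rule matrix_inv_unique)
  then have "?J ** ?I ** transpose ?J = (?J ** matrix_inv ?J) ** matrix_inv (g (\<Phi> x)) ** transpose (?J ** matrix_inv ?J)"
    by (simp add: matrix_mul_assoc matrix_transpose_mul)
  then have "?J ** ?I ** transpose ?J = matrix_inv (g (\<Phi> x))"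
    by (simp add: matrix_inv_both \<Phi>(2))
  then have inv: "(\<Sum>b\<in>UNIV. \<Sum>c\<in>UNIV. ?I $ b $ c * ?J $ p $ b * ?J $ q $ c) = matrix_inv (g (\<Phi> x)) $ p $ q" for p q
    by (subst sum.swap) (simp add: matmul_nth transpose_nth sum_distrib_right sum_distrib_left mult_ac flip: \<open>?J ** ?I ** transpose ?J = matrix_inv (g (\<Phi> x))\<close>)
  have "ym_current (pull_metric \<Phi> g) (pull_conn \<Phi> A) a x =
      (\<Sum>b\<in>UNIV. \<Sum>c\<in>UNIV. \<Sum>p\<in>UNIV. \<Sum>q\<in>UNIV. \<Sum>r\<in>UNIV. (?I $ b $ c * ?J $ p $ b * ?J $ q $ c * ?J $ r $ a) *\<^sub>R ?C p q r)"
    by (simp add: ym_current_def cov_curv_pullback[OF assms] scaleR_sum_right mult_ac)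
  also have "\<dots> = (\<Sum>b\<in>UNIV. \<Sum>p\<in>UNIV. \<Sum>q\<in>UNIV. \<Sum>r\<in>UNIV. \<Sum>c\<in>UNIV. (?I $ b $ c * ?J $ p $ b * ?J $ q $ c * ?J $ r $ a) *\<^sub>R ?C p q r)"
    by (rule sum.cong[OF refl], subst sum_rotate3, intro sum.cong refl sum.swap)
  also have "\<dots> = (\<Sum>p\<in>UNIV. \<Sum>q\<in>UNIV. \<Sum>r\<in>UNIV. \<Sum>c\<in>UNIV. \<Sum>b\<in>UNIV. (?I $ b $ c * ?J $ p $ b * ?J $ q $ c * ?J $ r $ a) *\<^sub>R ?C p q r)"
    by (rule sum_rotate5)
  also have "\<dots> = (\<Sum>p\<in>UNIV. \<Sum>q\<in>UNIV. \<Sum>r\<in>UNIV. (matrix_inv (g (\<Phi> x)) $ p $ q * ?J $ r $ a) *\<^sub>R ?C p q r)"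
    unfolding inv[symmetric]
    by (intro sum.cong refl, subst sum.swap) (simp add: sum_distrib_right scaleR_sum_left)
  also have "\<dots> = (\<Sum>r\<in>UNIV. \<Sum>p\<in>UNIV. \<Sum>q\<in>UNIV. (matrix_inv (g (\<Phi> x)) $ p $ q * ?J $ r $ a) *\<^sub>R ?C p q r)"
    by (subst sum_rotate3[symmetric]) (rule refl)
  also have "\<dots> = pull_conn \<Phi> (ym_current g A) a x"
    by (simp add: pull_conn_def ym_current_def scaleR_sum_right mult_ac)
  finally show ?thesis .
qed

section \<open>Order of vanishing at the boundary\<close>

lemma smooth_at_coord [smooth_intros, simp]: "smooth_at p (\<lambda>z. z $ i)"
  by (intro smooth_intros)

lemma eventually_partial_cong:
  assumes "\<forall>\<^sub>F y in nhds x. f y = g y"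
  shows "\<forall>\<^sub>F y in nhds x. partial k f y = partial k g y"
proof -
  have "\<forall>\<^sub>F y in nhds x. \<forall>\<^sub>F z in nhds y. f z = g z" using assms by (simp add: eventually_eventually)
  then show ?thesis by eventually_elim (rule partial_cong)
qed

text \<open>\<open>vo m p f\<close>: near \<open>p\<close> the derivatives of order less than \<open>m\<close> in the direction of \<open>None\<close> vanish
  on the hyperplane where the coordinate \<open>None\<close> is \<open>0\<close>; for smooth functions this is \<open>f = O(r\<^sup>m)\<close>.\<close>

primrec vo :: "nat \<Rightarrow> real^'n::finite option \<Rightarrow> (real^'n option \<Rightarrow> 'b::euclidean_space) \<Rightarrow> bool" where
  "vo 0 p f \<longleftrightarrow> smooth_at p f"
| "vo (Suc m) p f \<longleftrightarrow> smooth_at p f \<and> (\<forall>\<^sub>F z in nhds p. z $ None = 0 \<longrightarrow> f z = 0) \<and> vo m p (partial None f)"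

lemma vo_smooth: "vo m p f \<Longrightarrow> smooth_at p f"
  by (cases m) auto

lemma vo_Suc_imp: "vo (Suc m) p f \<Longrightarrow> vo m p f"
proof (induction m arbitrary: f)
  case (Suc m)
  then show ?case using Suc.IH[of "partial None f"] by simp
qed simp

lemma vo_le: "vo m p f \<Longrightarrow> k \<le> m \<Longrightarrow> vo k p f"
  by (induction m) (auto simp: le_Suc_eq dest: vo_Suc_imp simp del: vo.simps)

lemma vo_cong: "\<forall>\<^sub>F z in nhds p. f z = g z \<Longrightarrow> vo m p f \<Longrightarrow> vo m p g"
proof (induction m arbitrary: f g)
  case 0
  then show ?case by (auto intro: smooth_at_cong)
next
  case (Suc m)
  have "vo m p (partial None g)"
    using Suc by (intro Suc.IH[OF eventually_partial_cong[OF Suc.prems(1)]]) simp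
  moreover have "\<forall>\<^sub>F z in nhds p. z $ None = 0 \<longrightarrow> g z = 0"
    using Suc.prems(1) Suc.prems(2)[unfolded vo.simps, THEN conjunct2, THEN conjunct1] by eventually_elim auto
  ultimately show ?case using Suc.prems by (auto intro: smooth_at_cong)
qed

lemma vo_zero [simp]: "vo m p (\<lambda>z. 0)"
proof (induction m)
  case (Suc m)
  moreover have "partial None (\<lambda>z. 0) = (\<lambda>z. 0)" by (rule ext) simp
  ultimately show ?case by simp
qed simp

lemma vo_linear: "bounded_linear L \<Longrightarrow> vo m p f \<Longrightarrow> vo m p (\<lambda>z. L (f z))"
proof (induction m arbitrary: f)
  case 0
  then show ?case by (simp add: smooth_at_linear)
next
  case (Suc m)
  have "\<forall>\<^sub>F z in nhds p. L (partial None f z) = partial None (\<lambda>z. L (f z)) z"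
    using smooth_at_eventually[OF vo_smooth[OF Suc.prems(2)]]
    by eventually_elim (simp add: partial_linear[OF Suc.prems(1)])
  from vo_cong[OF this Suc.IH] have "vo m p (partial None (\<lambda>z. L (f z)))" using Suc.prems by simp
  moreover have "\<forall>\<^sub>F z in nhds p. z $ None = 0 \<longrightarrow> L (f z) = 0"
    using Suc.prems(2)[unfolded vo.simps, THEN conjunct2, THEN conjunct1]
    by eventually_elim (use linear_0[OF bounded_linear.linear[OF Suc.prems(1)]] in auto)
  ultimately show ?case using Suc.prems by (auto intro: smooth_at_linear)
qed

lemma vo_add: "vo m p f \<Longrightarrow> vo m p g \<Longrightarrow> vo m p (\<lambda>z. f z + g z)"
proof (induction m arbitrary: f g)
  case 0
  then show ?case by (simp add: smooth_at_add)
next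
  case (Suc m)
  have "\<forall>\<^sub>F z in nhds p. partial None f z + partial None g z = partial None (\<lambda>z. f z + g z) z"
    using smooth_at_eventually[OF vo_smooth[OF Suc.prems(1)]] smooth_at_eventually[OF vo_smooth[OF Suc.prems(2)]]
    by eventually_elim (simp add: partial_add)
  from vo_cong[OF this Suc.IH] have "vo m p (partial None (\<lambda>z. f z + g z))" using Suc.prems by simp
  moreover have "\<forall>\<^sub>F z in nhds p. z $ None = 0 \<longrightarrow> f z + g z = 0"
    using Suc.prems(1)[unfolded vo.simps, THEN conjunct2, THEN conjunct1]
      Suc.prems(2)[unfolded vo.simps, THEN conjunct2, THEN conjunct1]
    by eventually_elim auto
  ultimately show ?case using Suc.prems by (auto intro: smooth_at_add)
qed

lemma vo_minus: "vo m p f \<Longrightarrow> vo m p (\<lambda>z. - f z)"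
  by (rule vo_linear[OF bounded_linear_minus[OF bounded_linear_ident]])

lemma vo_diff: "vo m p f \<Longrightarrow> vo m p g \<Longrightarrow> vo m p (\<lambda>z. f z - g z)"
  using vo_add[OF _ vo_minus, of m p f g] by simp

lemma vo_sum: "(\<And>i. i \<in> I \<Longrightarrow> vo m p (f i)) \<Longrightarrow> vo m p (\<lambda>z. \<Sum>i\<in>I. f i z)"
  by (induction I rule: infinite_finite_induct) (auto intro: vo_add simp del: vo.simps)

lemma vo_SucI:
  "smooth_at p f \<Longrightarrow> \<forall>\<^sub>F z in nhds p. z $ None = 0 \<longrightarrow> f z = 0 \<Longrightarrow> vo m p (partial None f) \<Longrightarrow> vo (Suc m) p f"
  by simp

lemma vo_SucD:
  assumes "vo (Suc m) p f"
  shows "\<forall>\<^sub>F z in nhds p. z $ None = 0 \<longrightarrow> f z = 0" "vo m p (partial None f)"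
  using assms by auto

text \<open>The Leibniz rule, with induction on the total order: each normal derivative costs one
  order in one of the factors.\<close>

lemma vo_bilinear:
  assumes B: "bounded_bilinear prd"
  shows "vo k p f \<Longrightarrow> vo m p g \<Longrightarrow> vo (k + m) p (\<lambda>z. prd (f z) (g z))"
proof (induction "k + m" arbitrary: k m f g)
  case 0
  then show ?case by (simp add: smooth_at_bilinear[OF B])
next
  case (Suc N)
  note sm = vo_smooth[OF Suc.prems(1)] vo_smooth[OF Suc.prems(2)]
  \<comment> \<open>If g has order 0, its derivative cannot lose an order; then f carries the whole
    order N + 1 and gives up one instead.\<close>
  have "vo N p (\<lambda>z. prd (f z) (partial None g z))"
  proof (cases m)
    case 0
    then have k: "k = Suc N" using Suc.hyps(2) by simp
    have "vo N p f" using Suc.prems(1) unfolding k by (rule vo_Suc_imp)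
    moreover have "vo 0 p (partial None g)" using sm by (simp add: smooth_at_partial)
    ultimately show ?thesis using Suc.hyps(1)[of N 0 f "partial None g"] by simp
  next
    case (Suc m')
    then have "vo m' p (partial None g)" using Suc.prems(2) vo_SucD(2) by blast
    moreover have N: "N = k + m'" using Suc \<open>Suc N = k + m\<close> by simp
    ultimately show ?thesis using Suc.hyps(1)[OF N Suc.prems(1)] by (simp only: N)
  qed
  moreover have "vo N p (\<lambda>z. prd (partial None f z) (g z))"
  proof (cases k)
    case 0
    then have m: "m = Suc N" using Suc.hyps(2) by simp
    have "vo N p g" using Suc.prems(2) unfolding m by (rule vo_Suc_imp)
    moreover have "vo 0 p (partial None f)" using sm by (simp add: smooth_at_partial)
    ultimately show ?thesis using Suc.hyps(1)[of 0 N "partial None f" g] by simp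
  next
    case (Suc k')
    then have "vo k' p (partial None f)" using Suc.prems(1) vo_SucD(2) by blast
    moreover have N: "N = k' + m" using Suc \<open>Suc N = k + m\<close> by simp
    ultimately show ?thesis using Suc.hyps(1)[OF N _ Suc.prems(2)] by (simp only: N)
  qed
  ultimately have s: "vo N p (\<lambda>z. prd (f z) (partial None g z) + prd (partial None f z) (g z))"
    by (rule vo_add)
  have "\<forall>\<^sub>F z in nhds p. prd (f z) (partial None g z) + prd (partial None f z) (g z) = partial None (\<lambda>z. prd (f z) (g z)) z"
    using smooth_at_eventually[OF sm(1)] smooth_at_eventually[OF sm(2)]
    by eventually_elim (simp add: partial_bilinear[OF B])
  from vo_cong[OF this s] have d: "vo N p (partial None (\<lambda>z. prd (f z) (g z)))" .
  have "\<forall>\<^sub>F z in nhds p. z $ None = 0 \<longrightarrow> f z = 0 \<or> g z = 0"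
  proof (cases k)
    case 0
    then obtain m' where "m = Suc m'" using Suc(2) by (cases m) auto
    then show ?thesis using vo_SucD(1)[of m' p g] Suc.prems(2) by (auto elim: eventually_mono)
  next
    case (Suc k')
    then show ?thesis using vo_SucD(1)[of k' p f] Suc.prems(1) by (auto elim: eventually_mono)
  qed
  then have "\<forall>\<^sub>F z in nhds p. z $ None = 0 \<longrightarrow> prd (f z) (g z) = 0"
    by eventually_elim (auto simp: bounded_bilinear.zero_left[OF B] bounded_bilinear.zero_right[OF B])
  then have "vo (Suc N) p (\<lambda>z. prd (f z) (g z))"
    using d sm by (intro vo_SucI smooth_at_bilinear[OF B])
  then show ?case using Suc(2) by simp
qed

lemmas vo_mult = vo_bilinear[OF bounded_bilinear_mult]
lemmas vo_scaleR = vo_bilinear[OF bounded_bilinear_scaleR]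

lemma bounded_bilinear_matmul:
  "bounded_bilinear (\<lambda>(A :: real^'b::finite^'c::finite) (C :: real^'a::finite^'b). A ** C)"
  by (rule bilinear_conv_bounded_bilinear[THEN iffD1])
    (auto simp: bilinear_def matmul_distribs intro!: linearI)

lemmas vo_matmul = vo_bilinear[OF bounded_bilinear_matmul]

lemma vo_mult_left: "vo m p f \<Longrightarrow> smooth_at p g \<Longrightarrow> vo m p (\<lambda>z. f z * g z)" for f g :: "real^'n::finite option \<Rightarrow> real"
  using vo_mult[of m p f 0 g] by simp

lemma vo_mult_right: "smooth_at p f \<Longrightarrow> vo m p g \<Longrightarrow> vo m p (\<lambda>z. f z * g z)" for f g :: "real^'n::finite option \<Rightarrow> real"
  using vo_mult[of 0 p f m g] by simp

lemma vo_scaleR_right: "smooth_at p f \<Longrightarrow> vo m p g \<Longrightarrow> vo m p (\<lambda>z. f z *\<^sub>R g z)"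
  using vo_scaleR[of 0 p f m g] by simp

lemma vo_scaleR_left: "vo m p f \<Longrightarrow> smooth_at p g \<Longrightarrow> vo m p (\<lambda>z. f z *\<^sub>R g z)"
  using vo_scaleR[of m p f 0 g] by simp

lemma vo_matmul_right: "smooth_at p f \<Longrightarrow> vo m p g \<Longrightarrow> vo m p (\<lambda>z. f z ** g z)"
  for f :: "real^'n::finite option \<Rightarrow> real^'b::finite^'c::finite" and g :: "real^'n option \<Rightarrow> real^'a::finite^'b"
  using vo_matmul[of 0 p f m g] by simp

lemma vo_matmul_left: "vo m p f \<Longrightarrow> smooth_at p g \<Longrightarrow> vo m p (\<lambda>z. f z ** g z)"
  for f :: "real^'n::finite option \<Rightarrow> real^'b::finite^'c::finite" and g :: "real^'n option \<Rightarrow> real^'a::finite^'b"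
  using vo_matmul[of m p f 0 g] by simp

lemma vo_nth: "vo m p f \<Longrightarrow> vo m p (\<lambda>z. f z $ i)" for f :: "real^'n::finite option \<Rightarrow> 'b::euclidean_space^'j::finite"
  by (rule vo_linear[OF bounded_linear_vec_nth])

lemma vo_vecI:
  fixes f :: "real^'n::finite option \<Rightarrow> 'b::euclidean_space^'j::finite"
  assumes "\<And>i. vo m p (\<lambda>z. f z $ i)"
  shows "vo m p f"
proof -
  have "f = (\<lambda>y. \<Sum>i\<in>UNIV. axis i (f y $ i))"
    by (auto simp: fun_eq_iff vec_eq_iff axis_def if_distrib cong: if_cong)
  moreover have "vo m p (\<lambda>y. \<Sum>i\<in>UNIV. axis i (f y $ i))"
    by (intro vo_sum vo_linear[OF bounded_linear_axis] assms)
  ultimately show ?thesis by simp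
qed

lemma vo_r: "vo (Suc 0) p (\<lambda>z::real^'n::finite option. z $ None)"
proof -
  have "partial None (\<lambda>z::real^'n option. z $ None) = (\<lambda>z. 1)" by (rule ext) simp
  then show ?thesis by simp
qed

lemma vo_r_power: "vo k p (\<lambda>z::real^'n::finite option. z $ None ^ k)"
  by (induction k) (use vo_mult[OF vo_r] in \<open>auto simp del: vo.simps(2)\<close>)

lemma vo_r_scaleR: "vo m p f \<Longrightarrow> vo (Suc m) p (\<lambda>z. z $ None *\<^sub>R f z)"
  using vo_scaleR[OF vo_r] by (simp del: vo.simps)

lemma vo_r_mult: "vo m p f \<Longrightarrow> vo (Suc m) p (\<lambda>z. z $ None * f z)" for f :: "real^'n::finite option \<Rightarrow> real"
  using vo_mult[OF vo_r] by (simp del: vo.simps)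

text \<open>\<open>vo\<close> asks for vanishing on the hyperplane near p, not just at p. So f
  vanishes along tangential lines, its tangential derivatives vanish there too, and these commute
  with the normal derivative.\<close>

lemma vo_partial_Some: "vo m p f \<Longrightarrow> vo m p (partial (Some i) f)"
proof (induction m arbitrary: f)
  case 0
  then show ?case by (simp add: smooth_at_partial)
next
  case (Suc m)
  have sm: "smooth_at p f" by (rule vo_smooth[OF Suc.prems])
  have "\<forall>\<^sub>F z in nhds p. partial (Some i) (partial None f) z = partial None (partial (Some i) f) z"
    using smooth_at_eventually[OF sm] by eventually_elim (rule partial_commute)
  from vo_cong[OF this Suc.IH[OF vo_SucD(2)[OF Suc.prems]]]
  have d: "vo m p (partial None (partial (Some i) f))" .
  have "\<forall>\<^sub>F z in nhds p. \<forall>\<^sub>F y in nhds z. y $ None = 0 \<longrightarrow> f y = 0"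
    using vo_SucD(1)[OF Suc.prems] by (simp add: eventually_eventually)
  then have "\<forall>\<^sub>F z in nhds p. z $ None = 0 \<longrightarrow> partial (Some i) f z = 0"
    using smooth_at_eventually[OF sm]
  proof eventually_elim
    fix z assume ev: "\<forall>\<^sub>F y in nhds z. y $ None = 0 \<longrightarrow> f y = 0" and z: "smooth_at z f"
    show "z $ None = 0 \<longrightarrow> partial (Some i) f z = 0"
    proof
      assume z0: "z $ None = 0"
      have "((\<lambda>s. z + s *\<^sub>R axis (Some i) 1) \<longlongrightarrow> z + 0 *\<^sub>R axis (Some i) 1) (nhds (0::real))"
        by (intro tendsto_intros filterlim_ident)
      then have "\<forall>\<^sub>F s in nhds (0::real). (z + s *\<^sub>R axis (Some i) 1) $ None = 0 \<longrightarrow> f (z + s *\<^sub>R axis (Some i) 1) = 0"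
        using ev by (auto simp: filterlim_iff)
      then have e: "\<forall>\<^sub>F s in nhds (0::real). f (z + s *\<^sub>R axis (Some i) 1) = 0"
        by eventually_elim (simp add: z0 axis_def)
      have "((\<lambda>s. f (z + s *\<^sub>R axis (Some i) 1)) has_vector_derivative partial (Some i) f z) (at 0)"
        using smooth_at_line[of z 0 "Some i" f] z by simp
      moreover have "((\<lambda>s. f (z + s *\<^sub>R axis (Some i) 1)) has_vector_derivative 0) (at (0::real))"
        unfolding has_vector_derivative_def has_derivative_cong_nhds[OF e] by simp
      ultimately show "partial (Some i) f z = 0" by (rule vector_derivative_unique_at)
    qed
  qed
  then show ?case using d sm by (intro vo_SucI smooth_at_partial)
qed

text \<open>The factor r makes up for the order lost to a normal derivative. This is why the
  singular geometry below is written with r times partial derivatives.\<close>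

lemma vo_D: "vo m p f \<Longrightarrow> vo m p (\<lambda>z. z $ None *\<^sub>R partial a f z)"
proof (cases a)
  case None
  assume v: "vo m p f"
  show ?thesis
  proof (cases m)
    case 0
    then show ?thesis using v None by (simp add: smooth_at_scaleR smooth_at_partial)
  next
    case (Suc k)
    then show ?thesis using vo_r_scaleR[OF vo_SucD(2)] v None by auto
  qed
next
  case (Some i)
  assume "vo m p f"
  then show ?thesis using Some vo_Suc_imp[OF vo_r_scaleR[OF vo_partial_Some]] by blast
qed

text \<open>On r^m c the operator r d/dr acts as multiplication by m up to the next order. The
  indicial factors of both equations arise in this way.\<close>

lemma vo_theta: "vo m p f \<Longrightarrow> vo (Suc m) p (\<lambda>z. z $ None *\<^sub>R partial None f z - real m *\<^sub>R f z)"
proof (induction m arbitrary: f)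
  case 0
  then show ?case using vo_r_scaleR[of 0 p "partial None f"] by (simp add: smooth_at_partial del: vo.simps(2))
next
  case (Suc m)
  have sm: "smooth_at p f" by (rule vo_smooth[OF Suc.prems])
  have "\<forall>\<^sub>F z in nhds p. z $ None *\<^sub>R partial None (partial None f) z - real m *\<^sub>R partial None f z =
      partial None (\<lambda>z. z $ None *\<^sub>R partial None f z - real (Suc m) *\<^sub>R f z) z"
    using smooth_at_eventually[OF sm]
    by eventually_elim (simp add: partial_diff partial_add partial_scaleR smooth_intros algebra_simps)
  from vo_cong[OF this Suc.IH[OF vo_SucD(2)[OF Suc.prems]]]
  have "vo (Suc m) p (partial None (\<lambda>z. z $ None *\<^sub>R partial None f z - real (Suc m) *\<^sub>R f z))" .
  moreover have "\<forall>\<^sub>F z in nhds p. z $ None = 0 \<longrightarrow> z $ None *\<^sub>R partial None f z - real (Suc m) *\<^sub>R f z = 0"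
    using vo_SucD(1)[OF Suc.prems] by eventually_elim auto
  moreover have "smooth_at p (\<lambda>z. z $ None *\<^sub>R partial None f z - real (Suc m) *\<^sub>R f z)"
    by (intro smooth_intros sm)
  ultimately show ?case by (intro vo_SucI[of p _ "Suc m"])
qed

lemma partial_r_power:
  "partial a (\<lambda>y::real^'n::finite option. y $ None ^ Suc m) z = (if a = None then real (Suc m) * z $ None ^ m else 0)"
proof (induction m)
  case (Suc m)
  have "partial a (\<lambda>y::real^'n option. y $ None ^ Suc (Suc m)) z =
      partial a (\<lambda>y::real^'n option. y $ None * y $ None ^ Suc m) z" by simp
  also have "\<dots> = (if a = None then real (Suc (Suc m)) * z $ None ^ Suc m else 0)"
    by (subst partial_mult) (auto simp: Suc smooth_intros algebra_simps simp del: power_Suc, simp_all add: algebra_simps)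
  finally show ?case .
qed simp

text \<open>The coefficient c is some smooth function near p with the right boundary values and may
  depend on r. It is the coefficient belonging to the normal derivative, divided by the
  exponent.\<close>

lemma vo_taylor:
  fixes f :: "real^'n::finite option \<Rightarrow> 'b::euclidean_space"
  shows "vo m p f \<Longrightarrow> \<exists>c. smooth_at p c \<and> vo (Suc m) p (\<lambda>z. f z - z $ None ^ m *\<^sub>R c z)"
proof (induction m arbitrary: f)
  case 0
  then show ?case by (intro exI[of _ f]) simp
next
  case (Suc m)
  have sm: "smooth_at p f" by (rule vo_smooth[OF Suc.prems])
  obtain c where c: "smooth_at p c" "vo (Suc m) p (\<lambda>z. partial None f z - z $ None ^ m *\<^sub>R c z)"
    using Suc.IH[OF vo_SucD(2)[OF Suc.prems]] by blast
  let ?c = "\<lambda>z. (1 / real (Suc m)) *\<^sub>R c z"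
  have c': "smooth_at p ?c" by (intro smooth_intros c)
  have "\<forall>\<^sub>F z in nhds p. (partial None f z - z $ None ^ m *\<^sub>R c z) - z $ None ^ Suc m *\<^sub>R partial None ?c z =
      partial None (\<lambda>z. f z - z $ None ^ Suc m *\<^sub>R ?c z) z"
    using smooth_at_eventually[OF c'] smooth_at_eventually[OF sm]
  proof eventually_elim
    fix z assume z: "smooth_at z ?c" "smooth_at z f"
    have "partial None (\<lambda>z. f z - z $ None ^ Suc m *\<^sub>R ?c z) z =
        partial None f z - (z $ None ^ Suc m *\<^sub>R partial None ?c z + partial None (\<lambda>z::real^'n option. z $ None ^ Suc m) z *\<^sub>R ?c z)"
      using z by (simp only: partial_diff partial_scaleR smooth_intros)
    then show "(partial None f z - z $ None ^ m *\<^sub>R c z) - z $ None ^ Suc m *\<^sub>R partial None ?c z =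
        partial None (\<lambda>z. f z - z $ None ^ Suc m *\<^sub>R ?c z) z"
      unfolding partial_r_power by simp
  qed
  moreover have "vo (Suc m) p (\<lambda>z. (partial None f z - z $ None ^ m *\<^sub>R c z) - z $ None ^ Suc m *\<^sub>R partial None ?c z)"
    by (intro vo_diff c(2) vo_scaleR_left vo_r_power smooth_at_partial c')
  ultimately have "vo (Suc m) p (partial None (\<lambda>z. f z - z $ None ^ Suc m *\<^sub>R ?c z))" by (rule vo_cong)
  moreover have "\<forall>\<^sub>F z in nhds p. z $ None = 0 \<longrightarrow> f z - z $ None ^ Suc m *\<^sub>R ?c z = 0"
    using vo_SucD(1)[OF Suc.prems] by eventually_elim auto
  moreover have "smooth_at p (\<lambda>z. f z - z $ None ^ Suc m *\<^sub>R ?c z)"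
    by (intro smooth_at_diff sm smooth_at_scaleR c' smooth_at_power smooth_at_coord)
  ultimately have "vo (Suc (Suc m)) p (\<lambda>z. f z - z $ None ^ Suc m *\<^sub>R ?c z)"
    by (intro vo_SucI[of p _ "Suc m"])
  then show ?case using c' by blast
qed

text \<open>By continuity, a smooth function that vanishes for r > 0 vanishes with all its normal
  derivatives on r = 0. This transfers the given equations, known only for r > 0, to arbitrary
  smooth extensions across r = 0.\<close>

lemma vo_half:
  fixes f :: "real^'n::finite option \<Rightarrow> 'b::euclidean_space"
  shows "smooth_at p f \<Longrightarrow> \<forall>\<^sub>F z in nhds p. z $ None > 0 \<longrightarrow> f z = 0 \<Longrightarrow> vo m p f"
proof (induction m arbitrary: f)
  case (Suc m)
  have ev2: "\<forall>\<^sub>F z in nhds p. \<forall>\<^sub>F y in nhds z. y $ None > 0 \<longrightarrow> f y = 0"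
    using Suc.prems(2) by (simp add: eventually_eventually)
  have "\<forall>\<^sub>F z in nhds p. z $ None > 0 \<longrightarrow> partial None f z = 0"
    using ev2
  proof eventually_elim
    fix z assume ev: "\<forall>\<^sub>F y in nhds z. y $ None > 0 \<longrightarrow> f y = 0"
    show "z $ None > 0 \<longrightarrow> partial None f z = 0"
    proof
      assume z: "z $ None > 0"
      have "open {y::real^'n option. y $ None > 0}"
        by (intro open_Collect_less continuous_intros)
      then have "\<forall>\<^sub>F y in nhds z. y $ None > 0"
        using z eventually_nhds_in_open[of "{y. y $ None > 0}" z] by simp
      with ev have "\<forall>\<^sub>F y in nhds z. f y = 0" by eventually_elim auto
      from partial_cong[OF this] show "partial None f z = 0" by simp
    qed
  qed
  then have "vo m p (partial None f)" by (rule Suc.IH[OF smooth_at_partial[OF Suc.prems(1)]])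
  moreover have "\<forall>\<^sub>F z in nhds p. z $ None = 0 \<longrightarrow> f z = 0"
    using ev2 smooth_at_eventually[OF Suc.prems(1)]
  proof eventually_elim
    fix z assume ev: "\<forall>\<^sub>F y in nhds z. y $ None > 0 \<longrightarrow> f y = 0" and z: "smooth_at z f"
    show "z $ None = 0 \<longrightarrow> f z = 0"
    proof
      assume z0: "z $ None = 0"
      let ?l = "\<lambda>s::real. z + s *\<^sub>R axis None 1"
      have l: "(?l \<longlongrightarrow> z) (at_right 0)"
        by (rule tendsto_eq_rhs[where x = "z + 0 *\<^sub>R axis None 1"]) (intro tendsto_intros, simp)
      have "((\<lambda>s. f (?l s)) \<longlongrightarrow> f z) (at_right 0)"
        by (rule isCont_tendsto_compose[OF smooth_at_continuous[OF z] l])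
      moreover have "\<forall>\<^sub>F s in at_right 0. f (?l s) = 0"
      proof -
        have "\<forall>\<^sub>F s in at_right 0. ?l s $ None > 0 \<longrightarrow> f (?l s) = 0"
          using l ev by (auto simp: filterlim_iff)
        then show ?thesis using eventually_at_right_less[of "0::real"]
          by eventually_elim (simp add: z0 axis_def)
      qed
      then have "((\<lambda>s. f (?l s)) \<longlongrightarrow> 0) (at_right 0)" by (rule tendsto_eventually)
      ultimately show "f z = 0" using tendsto_unique[of "at_right (0::real)"] by auto
    qed
  qed
  ultimately show ?case using Suc.prems(1) by (intro vo_SucI)
qed simp

text \<open>On r^k the operator c + r d/dr is multiplication by c + k > 0 to leading order, so it is
  injective on expansions. A derivative in r turns c into c + 1, which drives the induction.\<close>

lemma vo_cancel_theta:
  "smooth_at p g \<Longrightarrow> c > 0 \<Longrightarrow> vo m p (\<lambda>z. c *\<^sub>R g z + z $ None *\<^sub>R partial None g z) \<Longrightarrow> vo m p g"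
proof (induction m arbitrary: g c)
  case (Suc m)
  note sm = Suc.prems(1)
  have "\<forall>\<^sub>F z in nhds p. partial None (\<lambda>z. c *\<^sub>R g z + z $ None *\<^sub>R partial None g z) z =
      (c + 1) *\<^sub>R partial None g z + z $ None *\<^sub>R partial None (partial None g) z"
    using smooth_at_eventually[OF sm]
    by eventually_elim (simp add: partial_add partial_scaleR smooth_intros algebra_simps)
  from vo_cong[OF this vo_SucD(2)[OF Suc.prems(3)]] have "vo m p (partial None g)"
    using Suc.prems by (intro Suc.IH[of "partial None g" "c + 1"] smooth_at_partial) auto
  moreover have "\<forall>\<^sub>F z in nhds p. z $ None = 0 \<longrightarrow> g z = 0"
    using vo_SucD(1)[OF Suc.prems(3)] by eventually_elim (use Suc.prems(2) in auto)
  ultimately show ?case using sm by (intro vo_SucI)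
qed simp

text \<open>The normal derivative of r g is g + r dg/dr, the operator of
  \<open>vo_cancel_theta\<close> with c = 1.\<close>

lemma vo_cancel_r: 
  assumes "smooth_at p g" "vo (Suc m) p (\<lambda>z. z $ None *\<^sub>R g z)"
  shows "vo m p g"
proof (rule vo_cancel_theta[OF assms(1), of 1])
  have "\<forall>\<^sub>F z in nhds p. partial None (\<lambda>z. z $ None *\<^sub>R g z) z = 1 *\<^sub>R g z + z $ None *\<^sub>R partial None g z"
    using smooth_at_eventually[OF assms(1)] by eventually_elim (simp add: partial_scaleR smooth_intros)
  from vo_cong[OF this vo_SucD(2)[OF assms(2)]]
  show "vo m p (\<lambda>z. 1 *\<^sub>R g z + z $ None *\<^sub>R partial None g z)" .
qed simp

lemma vo_cancel_r_power:
  "smooth_at p g \<Longrightarrow> vo (k + m) p (\<lambda>z. z $ None ^ k *\<^sub>R g z) \<Longrightarrow> vo m p g"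
proof (induction k)
  case (Suc k)
  have "vo (Suc (k + m)) p (\<lambda>z. z $ None *\<^sub>R (z $ None ^ k *\<^sub>R g z))"
    using Suc.prems(2) by (simp del: vo.simps)
  then have "vo (k + m) p (\<lambda>z. z $ None ^ k *\<^sub>R g z)"
    by (rule vo_cancel_r[rotated]) (intro smooth_intros Suc.prems)
  then show ?case by (rule Suc.IH[OF Suc.prems(1)])
qed simp

text \<open>By the chain rule, the normal derivative of the difference consists of terms with a
  factor from the derivative of \<Psi> - id, and of the same difference for the normal derivative of
  f; hence the induction over k for arbitrary f.\<close>

lemma vo_compose:
  fixes \<Psi> :: "real^'n::finite option \<Rightarrow> real^'n option"
  assumes \<Psi>: "smooth_at p \<Psi>" "\<Psi> p = p" "\<And>a. vo (Suc m) p (\<lambda>z. \<Psi> z $ a - z $ a)"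
  shows "smooth_at p f \<Longrightarrow> k \<le> Suc m \<Longrightarrow> vo k p (\<lambda>z. f (\<Psi> z) - f z)"
proof (induction k arbitrary: f)
  case 0
  have "smooth_at p (\<lambda>z. f (\<Psi> z))" by (rule smooth_at_compose[OF \<Psi>(1)]) (simp add: \<Psi> 0)
  then show ?case using 0 by (simp add: smooth_at_diff)
next
  case (Suc k)
  have smP: "smooth_at p (\<lambda>z. h (\<Psi> z))" if "smooth_at p h" for h :: "real^'n option \<Rightarrow> 'c::euclidean_space"
    by (rule smooth_at_compose[OF \<Psi>(1)]) (simp add: \<Psi> that)
  have sf: "smooth_at (\<Psi> p) f" by (simp add: \<Psi> Suc.prems)
  have e0: "\<forall>\<^sub>F z in nhds p. smooth_at (\<Psi> z) f"
    by (rule eventually_nhds_comp[OF \<Psi>(1) smooth_at_eventually[OF sf]])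
  have "vo k p (\<lambda>z. (\<Sum>b\<in>UNIV. (partial None (\<lambda>z. \<Psi> z $ b - z $ b) z) *\<^sub>R partial b f (\<Psi> z)) + (partial None f (\<Psi> z) - partial None f z))"
  proof (intro vo_add vo_sum vo_scaleR_left)
    show "vo k p (partial None (\<lambda>z. \<Psi> z $ b - z $ b))" for b
      using vo_le[OF vo_SucD(2)[OF \<Psi>(3)]] Suc.prems(2) by simp
    show "smooth_at p (\<lambda>z. partial b f (\<Psi> z))" for b
      by (rule smP[OF smooth_at_partial[OF Suc.prems(1)]])
    show "vo k p (\<lambda>z. partial None f (\<Psi> z) - partial None f z)"
      using Suc.prems by (intro Suc.IH smooth_at_partial) auto
  qed
  moreover have "\<forall>\<^sub>F z in nhds p. (\<Sum>b\<in>UNIV. (partial None (\<lambda>z. \<Psi> z $ b - z $ b) z) *\<^sub>R partial b f (\<Psi> z)) + (partial None f (\<Psi> z) - partial None f z)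
      = partial None (\<lambda>z. f (\<Psi> z) - f z) z"
    using e0 smooth_at_eventually[OF \<Psi>(1)] smooth_at_eventually[OF Suc.prems(1)]
  proof eventually_elim
    fix z assume z: "smooth_at (\<Psi> z) f" "smooth_at z \<Psi>" "smooth_at z f"
    have "partial None (\<lambda>z. f (\<Psi> z) - f z) z = (\<Sum>b\<in>UNIV. partial None (\<lambda>z. \<Psi> z $ b) z *\<^sub>R partial b f (\<Psi> z)) - partial None f z"
      by (simp add: partial_diff partial_comp[OF z(2,1)] smooth_at_compose[OF z(2,1)] z)
    moreover have "(\<Sum>b\<in>UNIV. partial None (\<lambda>z. \<Psi> z $ b - z $ b) z *\<^sub>R partial b f (\<Psi> z)) =
        (\<Sum>b\<in>UNIV. partial None (\<lambda>z. \<Psi> z $ b) z *\<^sub>R partial b f (\<Psi> z)) - (\<Sum>b\<in>UNIV. if b = None then partial b f (\<Psi> z) else 0)"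
      unfolding sum_subtractf[symmetric]
      by (rule sum.cong) (auto simp: partial_diff smooth_intros z algebra_simps)
    ultimately show "(\<Sum>b\<in>UNIV. (partial None (\<lambda>z. \<Psi> z $ b - z $ b) z) *\<^sub>R partial b f (\<Psi> z)) + (partial None f (\<Psi> z) - partial None f z)
      = partial None (\<lambda>z. f (\<Psi> z) - f z) z" by simp
  qed
  ultimately have d: "vo k p (partial None (\<lambda>z. f (\<Psi> z) - f z))" by (rule vo_cong[rotated])
  have "\<forall>\<^sub>F z in nhds p. \<forall>a. z $ None = 0 \<longrightarrow> \<Psi> z $ a - z $ a = 0"
    using vo_SucD(1)[OF \<Psi>(3)] by (intro eventually_all_finite) auto
  then have "\<forall>\<^sub>F z in nhds p. z $ None = 0 \<longrightarrow> f (\<Psi> z) - f z = 0"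
  proof eventually_elim
    fix z assume "\<forall>a. z $ None = 0 \<longrightarrow> \<Psi> z $ a - z $ a = 0"
    then have "z $ None = 0 \<longrightarrow> \<Psi> z = z" by (simp add: vec_eq_iff)
    then show "z $ None = 0 \<longrightarrow> f (\<Psi> z) - f z = 0" by simp
  qed
  then show ?case using d Suc.prems(1) smP by (intro vo_SucI smooth_intros)
qed

text \<open>Congruence modulo O(r^m). Smoothness of both sides belongs to it so that congruences
  pass through products, derivatives and inverse matrices, and thereby through whole curvature
  formulas.\<close>

definition cg :: "nat \<Rightarrow> real^'n::finite option \<Rightarrow> (real^'n option \<Rightarrow> 'b::euclidean_space) \<Rightarrow> (real^'n option \<Rightarrow> 'b) \<Rightarrow> bool" where
  "cg m p f g \<longleftrightarrow> smooth_at p f \<and> smooth_at p g \<and> vo m p (\<lambda>z. f z - g z)"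

named_theorems cg_intros

lemma cgI: "smooth_at p f \<Longrightarrow> smooth_at p g \<Longrightarrow> vo m p (\<lambda>z. f z - g z) \<Longrightarrow> cg m p f g"
  by (simp add: cg_def)

lemma cgD: "cg m p f g \<Longrightarrow> smooth_at p f" "cg m p f g \<Longrightarrow> smooth_at p g" "cg m p f g \<Longrightarrow> vo m p (\<lambda>z. f z - g z)"
  by (simp_all add: cg_def)

lemma cg_refl: "smooth_at p f \<Longrightarrow> cg m p f f"
  by (simp add: cg_def)

lemma cg_sym: "cg m p f g \<Longrightarrow> cg m p g f"
  using vo_minus[of m p "\<lambda>z. f z - g z"] by (simp add: cg_def)

lemma cg_trans: "cg m p f g \<Longrightarrow> cg m p g h \<Longrightarrow> cg m p f h"
  using vo_add[of m p "\<lambda>z. f z - g z" "\<lambda>z. g z - h z"] by (simp add: cg_def)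

lemma cg_le: "cg m p f g \<Longrightarrow> k \<le> m \<Longrightarrow> cg k p f g"
  using vo_le by (auto simp: cg_def)

lemma cg_0_iff: "cg m p f (\<lambda>z. 0) \<longleftrightarrow> vo m p f"
  using vo_smooth by (auto simp: cg_def)

lemma cg_vo: "cg m p f g \<Longrightarrow> vo m p g \<Longrightarrow> vo m p f"
  using cg_trans[of m p f g "\<lambda>z. 0"] by (simp add: cg_0_iff)

lemma cg_eventually: "smooth_at p g \<Longrightarrow> \<forall>\<^sub>F z in nhds p. f z = g z \<Longrightarrow> cg m p f g"
proof -
  assume g: "smooth_at p g" and e: "\<forall>\<^sub>F z in nhds p. f z = g z"
  have "vo m p (\<lambda>z. f z - g z)"
    by (rule vo_cong[OF _ vo_zero]) (use e in eventually_elim, simp)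
  moreover have "smooth_at p f" by (rule smooth_at_cong[OF _ g]) (use e in eventually_elim, simp)
  ultimately show ?thesis using g by (simp add: cg_def)
qed

lemma cg_boundary:
  assumes "cg (Suc m) p f g"
  shows "\<forall>\<^sub>F z in nhds p. z $ None = 0 \<longrightarrow> f z = g z"
  using vo_SucD(1)[OF cgD(3)[OF assms]] by eventually_elim simp

lemma cg_Suc_0I:
  assumes "smooth_at p f" "smooth_at p g" "\<forall>\<^sub>F z in nhds p. z $ None = 0 \<longrightarrow> f z = g z"
  shows "cg (Suc 0) p f g"
  using assms by (auto simp: cg_def intro!: smooth_intros)

lemma cg_linear: "bounded_linear L \<Longrightarrow> cg m p f g \<Longrightarrow> cg m p (\<lambda>z. L (f z)) (\<lambda>z. L (g z))"
  using vo_linear[of L m p "\<lambda>z. f z - g z"]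
  by (auto simp: cg_def smooth_at_linear linear_diff bounded_linear.linear)

lemma cg_bilinear:
  assumes B: "bounded_bilinear prd" and "cg m p f f'" "cg m p g g'"
  shows "cg m p (\<lambda>z. prd (f z) (g z)) (\<lambda>z. prd (f' z) (g' z))"
proof -
  have "vo m p (\<lambda>z. prd (f z - f' z) (g z) + prd (f' z) (g z - g' z))"
    using vo_bilinear[OF B cgD(3)[OF assms(2)], of 0 g] vo_bilinear[OF B _ cgD(3)[OF assms(3)], of 0 f'] assms
    by (intro vo_add) (auto simp: cg_def)
  then show ?thesis
    using assms by (auto simp: cg_def smooth_at_bilinear[OF B] bounded_bilinear.diff_left[OF B] bounded_bilinear.diff_right[OF B])
qed

lemmas cg_mult [cg_intros] = cg_bilinear[OF bounded_bilinear_mult]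
lemmas cg_scaleR [cg_intros] = cg_bilinear[OF bounded_bilinear_scaleR]
lemmas cg_matmul [cg_intros] = cg_bilinear[OF bounded_bilinear_matmul]

lemma cg_add [cg_intros]: "cg m p f f' \<Longrightarrow> cg m p g g' \<Longrightarrow> cg m p (\<lambda>z. f z + g z) (\<lambda>z. f' z + g' z)"
  using vo_add[of m p "\<lambda>z. f z - f' z" "\<lambda>z. g z - g' z"]
  by (auto simp: cg_def smooth_at_add algebra_simps)

lemma cg_minus [cg_intros]: "cg m p f f' \<Longrightarrow> cg m p (\<lambda>z. - f z) (\<lambda>z. - f' z)"
  by (rule cg_linear[OF bounded_linear_minus[OF bounded_linear_ident]])

lemma cg_diff [cg_intros]: "cg m p f f' \<Longrightarrow> cg m p g g' \<Longrightarrow> cg m p (\<lambda>z. f z - g z) (\<lambda>z. f' z - g' z)"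
  using cg_add[OF _ cg_minus, of m p f f' g g'] by simp

lemma cg_sum [cg_intros]: "(\<And>i. i \<in> I \<Longrightarrow> cg m p (f i) (g i)) \<Longrightarrow> cg m p (\<lambda>z. \<Sum>i\<in>I. f i z) (\<lambda>z. \<Sum>i\<in>I. g i z)"
  by (induction I rule: infinite_finite_induct) (auto intro: cg_add cg_refl)

lemma cg_nth [cg_intros]: "cg m p f g \<Longrightarrow> cg m p (\<lambda>z. f z $ i) (\<lambda>z. g z $ i)"
  for f g :: "real^'n::finite option \<Rightarrow> 'b::euclidean_space^'j::finite"
  by (rule cg_linear[OF bounded_linear_vec_nth])

lemma cg_vecI:
  fixes f g :: "real^'n::finite option \<Rightarrow> 'b::euclidean_space^'j::finite"
  assumes "\<And>i. cg m p (\<lambda>z. f z $ i) (\<lambda>z. g z $ i)"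
  shows "cg m p f g"
  using assms by (auto simp: cg_def intro!: smooth_at_vecI vo_vecI[of m p "\<lambda>z. f z - g z"])

lemma cg_vec [cg_intros]:
  fixes f g :: "'j::finite \<Rightarrow> real^'n::finite option \<Rightarrow> 'b::euclidean_space"
  assumes "\<And>i. cg m p (f i) (g i)"
  shows "cg m p (\<lambda>z. \<chi> i. f i z) (\<lambda>z. \<chi> i. g i z)"
  by (rule cg_vecI) (simp add: assms)

lemma cg_transpose [cg_intros]:
  fixes f g :: "real^'n::finite option \<Rightarrow> real^'b::finite^'a::finite"
  shows "cg m p f g \<Longrightarrow> cg m p (\<lambda>z. transpose (f z)) (\<lambda>z. transpose (g z))"
  unfolding transpose_def by (intro cg_intros)

lemma eventually_partial_diff:
  assumes "smooth_at p f" "smooth_at p g"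
  shows "\<forall>\<^sub>F z in nhds p. partial a (\<lambda>z. f z - g z) z = partial a f z - partial a g z"
  using smooth_at_eventually[OF assms(1)] smooth_at_eventually[OF assms(2)]
  by eventually_elim (rule partial_diff)

lemma cg_partial_Some [cg_intros]: "cg m p f g \<Longrightarrow> cg m p (partial (Some i) f) (partial (Some i) g)"
  using vo_cong[OF eventually_partial_diff vo_partial_Some] by (auto simp: cg_def smooth_at_partial)

lemma cg_partial_None: "cg (Suc m) p f g \<Longrightarrow> cg m p (partial None f) (partial None g)"
  using vo_cong[OF eventually_partial_diff vo_SucD(2)] by (auto simp: cg_def smooth_at_partial simp del: vo.simps)

text \<open>The converse of \<open>cg_partial_None\<close>, with the boundary values as constant of
  integration. It lifts an estimate of the field strength to one of the connection.\<close>

lemma cg_partial_NoneD: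
  assumes "cg (Suc 0) p f g" "cg m p (partial None f) (partial None g)"
  shows "cg (Suc m) p f g"
proof (rule cgI)
  show sm: "smooth_at p f" "smooth_at p g" using assms(1) by (auto simp: cg_def)
  have "\<forall>\<^sub>F z in nhds p. partial None f z - partial None g z = partial None (\<lambda>z. f z - g z) z"
    using eventually_partial_diff[OF sm, of None] by eventually_elim simp
  from vo_cong[OF this cgD(3)[OF assms(2)]]
  show "vo (Suc m) p (\<lambda>z. f z - g z)"
    using vo_SucD(1)[OF cgD(3)[OF assms(1)]] sm by (intro vo_SucI[of p _ m] smooth_at_diff)
qed

lemma cg_D [cg_intros]: 
  assumes "cg m p f g"
  shows "cg m p (\<lambda>z. z $ None *\<^sub>R partial a f z) (\<lambda>z. z $ None *\<^sub>R partial a g z)"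
proof (rule cgI)
  have sm: "smooth_at p f" "smooth_at p g" using assms by (auto simp: cg_def)
  then show "smooth_at p (\<lambda>z. z $ None *\<^sub>R partial a f z)" "smooth_at p (\<lambda>z. z $ None *\<^sub>R partial a g z)"
    by (simp_all add: smooth_intros)
  have "\<forall>\<^sub>F z in nhds p. z $ None *\<^sub>R partial a (\<lambda>z. f z - g z) z = z $ None *\<^sub>R partial a f z - z $ None *\<^sub>R partial a g z"
    using eventually_partial_diff[OF sm, of a] by eventually_elim (simp add: scaleR_diff_right)
  from vo_cong[OF this vo_D[OF cgD(3)[OF assms]]]
  show "vo m p (\<lambda>z. z $ None *\<^sub>R partial a f z - z $ None *\<^sub>R partial a g z)" .
qed

lemma cg_matrix_inv [cg_intros]:
  fixes f g :: "real^'n::finite option \<Rightarrow> real^'a::finite^'a"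
  assumes c: "cg m p f g" and d: "det (f p) \<noteq> 0" "det (g p) \<noteq> 0"
  shows "cg m p (\<lambda>z. matrix_inv (f z)) (\<lambda>z. matrix_inv (g z))"
proof (rule cgI)
  note sm = cgD(1,2)[OF c]
  show si: "smooth_at p (\<lambda>z. matrix_inv (f z))" "smooth_at p (\<lambda>z. matrix_inv (g z))"
    using sm d by (simp_all add: smooth_intros)
  have "\<forall>\<^sub>F z in nhds p. det (f z) \<noteq> 0" "\<forall>\<^sub>F z in nhds p. det (g z) \<noteq> 0"
    using sm d by (auto intro!: eventually_nonzero smooth_intros)
  then have "\<forall>\<^sub>F z in nhds p. - (matrix_inv (f z) ** (f z - g z) ** matrix_inv (g z)) = matrix_inv (f z) - matrix_inv (g z)"
  proof eventually_elim
    fix z assume z: "det (f z) \<noteq> 0" "det (g z) \<noteq> 0"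
    have "matrix_inv (f z) ** (f z - g z) ** matrix_inv (g z) =
        matrix_inv (f z) ** f z ** matrix_inv (g z) - matrix_inv (f z) ** (g z ** matrix_inv (g z))"
      by (simp add: matmul_distribs matrix_mul_assoc)
    then show "- (matrix_inv (f z) ** (f z - g z) ** matrix_inv (g z)) = matrix_inv (f z) - matrix_inv (g z)"
      by (simp add: matrix_inv_both z)
  qed
  moreover have "vo m p (\<lambda>z. - (matrix_inv (f z) ** (f z - g z) ** matrix_inv (g z)))"
    by (intro vo_minus vo_matmul_left vo_matmul_right si cgD(3)[OF c])
  ultimately show "vo m p (\<lambda>z. matrix_inv (f z) - matrix_inv (g z))" by (rule vo_cong)
qed

section \<open>Metrics with a double pole at the boundary\<close>

definition sing :: "(real^'n::finite option \<Rightarrow> 'b::real_normed_vector) \<Rightarrow> real^'n option \<Rightarrow> 'b" where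
  "sing G z = (1 / (z $ None)\<^sup>2) *\<^sub>R G z"

text \<open>For the metric \<open>r\<^sup>-\<^sup>2 G\<close>, where \<open>r\<close> is the coordinate \<open>None\<close>, the following are \<open>r\<close> times the Levi-Civita
  connection, \<open>r\<^sup>2\<close> times the curvature of the connection \<open>r\<^sup>-\<^sup>1 L\<close>, \<open>r\<^sup>2\<close> times the Ricci tensor and
  \<open>r\<^sup>-\<^sup>1\<close> times the Yang-Mills current. They are smooth up to \<open>r = 0\<close>.\<close>

definition sing_lc :: "(real^'n::finite option \<Rightarrow> real^'n option^'n option) \<Rightarrow> 'n option \<Rightarrow> real^'n option \<Rightarrow> real^'n option^'n option" where
  "sing_lc G a z = (\<chi> c b. (1/2) * (\<Sum>d\<in>UNIV. matrix_inv (G z) $ c $ d *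
      (z $ None *\<^sub>R partial a (\<lambda>y. G y $ d $ b) z + z $ None *\<^sub>R partial b (\<lambda>y. G y $ d $ a) z
        - z $ None *\<^sub>R partial d (\<lambda>y. G y $ a $ b) z))
    - (if a = None \<and> c = b then 1 else 0) - (if b = None \<and> c = a then 1 else 0)
    + matrix_inv (G z) $ c $ None * G z $ a $ b)"

definition sing_curv :: "('n::finite option \<Rightarrow> real^'n option \<Rightarrow> real^'r::finite^'r) \<Rightarrow> 'n option \<Rightarrow> 'n option \<Rightarrow> real^'n option \<Rightarrow> real^'r^'r" where
  "sing_curv L a b z = z $ None *\<^sub>R partial a (L b) z - z $ None *\<^sub>R partial b (L a) z
    - (if a = None then 1 else 0) *\<^sub>R L b z + (if b = None then 1 else 0) *\<^sub>R L a z
    + L a z ** L b z - L b z ** L a z"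

definition sing_ricci :: "(real^'n::finite option \<Rightarrow> real^'n option^'n option) \<Rightarrow> real^'n option \<Rightarrow> real^'n option^'n option" where
  "sing_ricci G z = (\<chi> b c. \<Sum>a\<in>UNIV. sing_curv (sing_lc G) a b z $ a $ c)"

definition sing_ym :: "(real^'n::finite option \<Rightarrow> real^'n option^'n option) \<Rightarrow> ('n option \<Rightarrow> real^'n option \<Rightarrow> real^'r::finite^'r) \<Rightarrow>
    'n option \<Rightarrow> real^'n option \<Rightarrow> real^'r^'r" where
  "sing_ym G A a z = (\<Sum>b\<in>UNIV. \<Sum>c\<in>UNIV. matrix_inv (G z) $ b $ c *\<^sub>R
    (z $ None *\<^sub>R partial b (curv A c a) z
      - (\<Sum>d\<in>UNIV. sing_lc G b z $ d $ c *\<^sub>R curv A d a z)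
      - (\<Sum>d\<in>UNIV. sing_lc G b z $ d $ a *\<^sub>R curv A c d z)
      + z $ None *\<^sub>R (A b z ** curv A c a z - curv A c a z ** A b z)))"

lemma matrix_inv_scaleR:
  fixes M :: "real^'a::finite^'a"
  assumes "c \<noteq> 0" "det M \<noteq> 0"
  shows "matrix_inv (c *\<^sub>R M) = (1 / c) *\<^sub>R matrix_inv M"
  by (rule matrix_inv_unique) (simp add: matmul_distribs matrix_inv_both assms)

lemma det_scaleR_nz:
  fixes M :: "real^'a::finite^'a"
  assumes "c \<noteq> 0" "det M \<noteq> 0"
  shows "det (c *\<^sub>R M) \<noteq> 0"
  by (rule matrix_inv_unique(2)[of _ "(1 / c) *\<^sub>R matrix_inv M"]) (simp add: matmul_distribs matrix_inv_both assms)

lemma smooth_at_inverse_square [smooth_intros]: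
  "z $ None \<noteq> 0 \<Longrightarrow> smooth_at z (\<lambda>y::real^'n::finite option. 1 / (y $ None)\<^sup>2)"
  by (intro smooth_intros) auto

lemma smooth_at_sing [smooth_intros]: "z $ None \<noteq> 0 \<Longrightarrow> smooth_at z G \<Longrightarrow> smooth_at z (sing G)"
  unfolding sing_def[abs_def] by (intro smooth_intros)

lemma partial_inverse_square:
  "z $ None \<noteq> 0 \<Longrightarrow> partial a (\<lambda>y::real^'n::finite option. 1 / (y $ None)\<^sup>2) z = (if a = None then - 2 / (z $ None)^3 else 0)"
  using partial_inverse[of z "\<lambda>y. (y $ None)\<^sup>2" a]
  by (simp add: inverse_eq_divide smooth_intros power2_eq_square partial_mult eval_nat_numeral) 

text \<open>Differentiating r^(-2) contributes only for the index \<open>None\<close>; these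
  contributions, contracted with the inverse of G, are the terms of \<open>sing_lc\<close> without
  derivatives.\<close>

lemma levi_civita_sing:
  fixes G :: "real^'n::finite option \<Rightarrow> real^'n option^'n option"
  assumes z: "z $ None \<noteq> 0" and G: "smooth_at z G" "det (G z) \<noteq> 0"
  shows "levi_civita (sing G) a z = (1 / z $ None) *\<^sub>R sing_lc G a z"
proof -
  let ?r = "z $ None" and ?I = "matrix_inv (G z)"
  have inv: "matrix_inv (sing G z) = ?r\<^sup>2 *\<^sub>R ?I"
    by (simp add: sing_def matrix_inv_scaleR z G)
  have p: "partial a (\<lambda>y. sing G y $ d $ b) z =
      (1 / ?r\<^sup>2) * partial a (\<lambda>y. G y $ d $ b) z + (if a = None then - 2 / ?r^3 else 0) * G z $ d $ b" for a d b
  proof -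
    have "(\<lambda>y. sing G y $ d $ b) = (\<lambda>y. 1 / (y $ None)\<^sup>2 * G y $ d $ b)"
      by (simp add: sing_def fun_eq_iff)
    then show ?thesis
      by (simp only: partial_mult[OF smooth_at_inverse_square[OF z] smooth_at_nth[OF smooth_at_nth[OF G(1)]]]
          partial_inverse_square[OF z])
  qed
  have I: "(\<Sum>d\<in>UNIV. ?I $ c $ d * G z $ d $ b) = (if c = b then 1 else 0)" for c b
    using matrix_inv_both(2)[OF G(2)] by (simp add: matmul_nth[symmetric] mat_def)
  have split: "(\<Sum>d\<in>UNIV. X d - k * (s * Y d + t * Z d - (if d = None then W d else 0))) =
      (\<Sum>d\<in>UNIV. X d) - k * (s * (\<Sum>d\<in>UNIV. Y d) + t * (\<Sum>d\<in>UNIV. Z d) - W None)"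
    for X Y Z W :: "'n option \<Rightarrow> real" and k s t
    by (simp add: sum_subtractf sum.distrib sum_distrib_left[symmetric])
  have "levi_civita (sing G) a z $ c $ b = ((1 / ?r) *\<^sub>R sing_lc G a z) $ c $ b" for c b
  proof -
    have "levi_civita (sing G) a z $ c $ b = (1/2) * (\<Sum>d\<in>UNIV. ?r\<^sup>2 * ?I $ c $ d *
        ((1 / ?r\<^sup>2) * (partial a (\<lambda>y. G y $ d $ b) z + partial b (\<lambda>y. G y $ d $ a) z - partial d (\<lambda>y. G y $ a $ b) z)
          - (2 / ?r^3) * ((if a = None then 1 else 0) * G z $ d $ b + (if b = None then 1 else 0) * G z $ d $ a
            - (if d = None then 1 else 0) * G z $ a $ b)))"
      unfolding levi_civita_def inv p by (auto simp: algebra_simps intro!: sum.cong)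
    also have "\<dots> = (1/2) * (\<Sum>d\<in>UNIV. ?I $ c $ d *
        (partial a (\<lambda>y. G y $ d $ b) z + partial b (\<lambda>y. G y $ d $ a) z - partial d (\<lambda>y. G y $ a $ b) z)
          - (2 / ?r) * ((if a = None then 1 else 0) * (?I $ c $ d * G z $ d $ b) + (if b = None then 1 else 0) * (?I $ c $ d * G z $ d $ a)
            - (if d = None then ?I $ c $ d * G z $ a $ b else 0)))"
      using z by (intro arg_cong[where f = "(*) (1/2)"] sum.cong refl)
        (simp add: field_simps power2_eq_square power3_eq_cube)
    also have "\<dots> = (1/2) * (\<Sum>d\<in>UNIV. ?I $ c $ d *
        (partial a (\<lambda>y. G y $ d $ b) z + partial b (\<lambda>y. G y $ d $ a) z - partial d (\<lambda>y. G y $ a $ b) z))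
          - (1 / ?r) * ((if a = None then 1 else 0) * (if c = b then 1 else 0) + (if b = None then 1 else 0) * (if c = a then 1 else 0)
            - ?I $ c $ None * G z $ a $ b)"
      unfolding split I by (simp add: right_diff_distrib)
    also have "\<dots> = ((1 / ?r) *\<^sub>R sing_lc G a z) $ c $ b"
      using z unfolding sing_lc_def
      by (auto simp: sum_distrib_left field_simps)
    finally show ?thesis .
  qed
  then show ?thesis by (simp add: vec_eq_iff)
qed

lemma eventually_levi_civita_sing:
  assumes z: "z $ None \<noteq> 0" and G: "smooth_at z G" "det (G z) \<noteq> 0"
  shows "\<forall>\<^sub>F y in nhds z. levi_civita (sing G) a y = (1 / y $ None) *\<^sub>R sing_lc G a y"
proof -
  have "\<forall>\<^sub>F y in nhds z. y $ None \<noteq> 0" "\<forall>\<^sub>F y in nhds z. det (G y) \<noteq> 0"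
    using assms by (auto intro!: eventually_nonzero smooth_intros)
  then show ?thesis using smooth_at_eventually[OF G(1)]
    by eventually_elim (rule levi_civita_sing)
qed

lemma smooth_at_sing_lc [smooth_intros]:
  assumes "smooth_at z G" "det (G z) \<noteq> 0"
  shows "smooth_at z (sing_lc G a)"
  unfolding sing_lc_def[abs_def] using assms by (intro smooth_intros)

lemma smooth_at_sing_curv [smooth_intros]:
  assumes "\<And>a. smooth_at z (L a)"
  shows "smooth_at z (sing_curv L a b)"
  unfolding sing_curv_def[abs_def] using assms by (intro smooth_intros)

lemma smooth_at_sing_ricci [smooth_intros]:
  assumes "smooth_at z G" "det (G z) \<noteq> 0"
  shows "smooth_at z (sing_ricci G)"
  unfolding sing_ricci_def[abs_def] using assms by (intro smooth_intros)

lemma smooth_at_sing_ym [smooth_intros]: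
  assumes "smooth_at z G" "det (G z) \<noteq> 0" "\<And>a. smooth_at z (A a)"
  shows "smooth_at z (sing_ym G A a)"
  unfolding sing_ym_def[abs_def] using assms by (intro smooth_intros)

text \<open>The factor 1/r in front of \<open>sing_lc\<close> is differentiated as well, which
  accounts for the undifferentiated linear terms in \<open>sing_curv\<close>.\<close>

lemma curv_levi_civita_sing:
  fixes G :: "real^'n::finite option \<Rightarrow> real^'n option^'n option"
  assumes z: "z $ None \<noteq> 0" and G: "smooth_at z G" "det (G z) \<noteq> 0"
  shows "(z $ None)\<^sup>2 *\<^sub>R curv (levi_civita (sing G)) a b z = sing_curv (sing_lc G) a b z"
proof -
  let ?r = "z $ None"
  have p: "partial a (levi_civita (sing G) b) z =
      (1 / ?r) *\<^sub>R partial a (sing_lc G b) z - (if a = None then 1 / ?r\<^sup>2 else 0) *\<^sub>R sing_lc G b z" for a b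
  proof -
    have "partial a (\<lambda>y::real^'n option. 1 / y $ None) z = - (if a = None then 1 / ?r\<^sup>2 else 0)"
      using partial_inverse[of z "\<lambda>y. y $ None" a] z by (simp add: inverse_eq_divide)
    moreover have "smooth_at z (\<lambda>y::real^'n option. 1 / y $ None)" using z by (intro smooth_intros)
    ultimately show ?thesis
      unfolding partial_cong[OF eventually_levi_civita_sing[OF assms]]
      by (simp add: partial_scaleR smooth_intros G)
  qed
  have "?r\<^sup>2 *\<^sub>R ((1 / ?r) *\<^sub>R X) = ?r *\<^sub>R X" "?r\<^sup>2 *\<^sub>R ((1 / ?r\<^sup>2) *\<^sub>R X) = X" for X :: "real^'n option^'n option"
    using z by (simp_all add: power2_eq_square)
  then show ?thesis
    unfolding curv_def p sing_curv_def levi_civita_sing[OF assms] using z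
    by (simp add: algebra_simps matmul_distribs power2_eq_square)
qed

lemma ricci_sing:
  assumes "z $ None \<noteq> 0" "smooth_at z G" "det (G z) \<noteq> 0"
  shows "(z $ None)\<^sup>2 *\<^sub>R ricci (sing G) z = sing_ricci G z"
  by (simp add: vec_eq_iff ricci_def sing_ricci_def curv_levi_civita_sing[OF assms, symmetric] sum_distrib_left)

text \<open>The inverse metric supplies r^2 and the Christoffel symbols cost one r, so a single
  factor r splits off.\<close>

lemma ym_current_sing:
  assumes z: "z $ None \<noteq> 0" and G: "smooth_at z G" "det (G z) \<noteq> 0"
  shows "ym_current (sing G) A a z = z $ None *\<^sub>R sing_ym G A a z"
proof -
  let ?r = "z $ None"
  have inv: "matrix_inv (sing G z) = ?r\<^sup>2 *\<^sub>R matrix_inv (G z)"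
    by (simp add: sing_def matrix_inv_scaleR z G)
  have "cov_curv (sing G) A b c a z = (1 / ?r) *\<^sub>R (?r *\<^sub>R partial b (curv A c a) z
      - (\<Sum>d\<in>UNIV. sing_lc G b z $ d $ c *\<^sub>R curv A d a z)
      - (\<Sum>d\<in>UNIV. sing_lc G b z $ d $ a *\<^sub>R curv A c d z)
      + ?r *\<^sub>R (A b z ** curv A c a z - curv A c a z ** A b z))" for b c
    using z by (simp add: cov_curv_def levi_civita_sing[OF assms] scaleR_add_right scaleR_diff_right scaleR_sum_right)
  then show ?thesis
    using z by (simp add: ym_current_def sing_ym_def inv scaleR_sum_right power2_eq_square)
qed

section \<open>Congruent metrics have congruent rescaled curvature\<close>

lemma cg_sing_lc [cg_intros]:
  assumes "cg m p G G'" "det (G p) \<noteq> 0" "det (G' p) \<noteq> 0"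
  shows "cg m p (sing_lc G a) (sing_lc G' a)"
  unfolding sing_lc_def[abs_def] using assms by (intro cg_intros cg_refl smooth_at_const)

lemma cg_sing_curv [cg_intros]:
  assumes "\<And>a. cg m p (L a) (L' a)"
  shows "cg m p (sing_curv L a b) (sing_curv L' a b)"
  unfolding sing_curv_def[abs_def] using assms by (intro cg_intros cg_refl smooth_at_const)

lemma cg_sing_ricci [cg_intros]:
  assumes "cg m p G G'" "det (G p) \<noteq> 0" "det (G' p) \<noteq> 0"
  shows "cg m p (sing_ricci G) (sing_ricci G')"
  unfolding sing_ricci_def[abs_def] using assms by (intro cg_intros)

lemma cg_sing_ym:
  assumes "cg m p G G'" "det (G p) \<noteq> 0" "det (G' p) \<noteq> 0" "\<And>a. smooth_at p (A a)"
  shows "cg m p (sing_ym G A a) (sing_ym G' A a)"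
  unfolding sing_ym_def[abs_def] using assms by (intro cg_intros cg_refl smooth_intros)

text \<open>The germ of \<open>g\<^sub>+ = r\<^sup>-\<^sup>2 G\<close> and \<open>A\<close> at a boundary point, with \<open>j = r\<^bsup>n-2\<^esup> q\<close>. The condition on the
  Schouten tensor is replaced by the equivalent one on the Ricci tensor.\<close>

definition datum :: "real^'n::finite option \<Rightarrow> (real^'n option \<Rightarrow> real^'n option^'n option) \<Rightarrow>
    ('n option \<Rightarrow> real^'n option \<Rightarrow> real^'r::finite^'r) \<Rightarrow> ('n option \<Rightarrow> real^'n option \<Rightarrow> real^'r^'r) \<Rightarrow> bool" where
  "datum p G A q \<longleftrightarrow> p $ None = 0 \<and> smooth_at p G \<and> (\<forall>\<^sub>F z in nhds p. transpose (G z) = G z) \<and>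
    (\<forall>v. v \<noteq> 0 \<longrightarrow> v \<bullet> (G p *v v) > 0) \<and> (\<forall>a. smooth_at p (A a)) \<and> (\<forall>a. smooth_at p (q a)) \<and>
    (\<exists>Q. smooth_at p Q \<and> (\<forall>\<^sub>F z in nhds p. z $ None > 0 \<longrightarrow>
      ricci (sing G) z + real CARD('n) *\<^sub>R sing G z = z $ None ^ (CARD('n) - 2) *\<^sub>R Q z)) \<and>
    (\<forall>a. \<forall>\<^sub>F z in nhds p. z $ None > 0 \<longrightarrow>
      ym_current (sing G) A a z = z $ None ^ (CARD('n) - 2) *\<^sub>R q a z)"

lemma posdef_det_nz:
  fixes B :: "real^'a::finite^'a"
  assumes "\<And>v. v \<noteq> 0 \<Longrightarrow> v \<bullet> (B *v v) > 0"
  shows "det B \<noteq> 0"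
proof -
  have "B *v v = 0 \<Longrightarrow> v = 0" for v using assms[of v] by fastforce
  then show ?thesis
    unfolding invertible_det_nz[symmetric] invertible_left_inverse matrix_left_invertible_ker by blast
qed

lemma datumD:
  fixes G :: "real^'n::finite option \<Rightarrow> real^'n option^'n option"
  assumes "datum p G A q"
  shows "p $ None = 0" "smooth_at p G" "\<forall>\<^sub>F z in nhds p. transpose (G z) = G z"
    "v \<noteq> 0 \<Longrightarrow> v \<bullet> (G p *v v) > 0" "det (G p) \<noteq> 0" "smooth_at p (A a)" "smooth_at p (q a)"
  using assms by (auto simp: datum_def intro!: posdef_det_nz)

lemma datum_near:
  assumes "datum p G A q"
  shows "\<forall>\<^sub>F z in nhds p. smooth_at z G \<and> det (G z) \<noteq> 0"
  using smooth_at_eventually[OF datumD(2)[OF assms]]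
    eventually_nonzero[OF smooth_at_det[OF datumD(2)[OF assms]] datumD(5)[OF assms]]
  by (rule eventually_conj)

text \<open>Multiplication by r^2 makes every term smooth and turns the error O(r^(n-2)) into
  O(r^n); the identity for r > 0 then extends by \<open>vo_half\<close>.\<close>

lemma datum_sing_ricci:
  fixes G :: "real^'n::finite option \<Rightarrow> real^'n option^'n option"
  assumes d: "datum p G A q" and n: "2 \<le> CARD('n)"
  shows "vo CARD('n) p (\<lambda>z. sing_ricci G z + real CARD('n) *\<^sub>R G z)"
proof -
  let ?n = "CARD('n)"
  obtain Q where Q: "smooth_at p Q" "\<forall>\<^sub>F z in nhds p. z $ None > 0 \<longrightarrow>
      ricci (sing G) z + real ?n *\<^sub>R sing G z = z $ None ^ (?n - 2) *\<^sub>R Q z"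
    using d by (auto simp: datum_def)
  have sm: "smooth_at p (\<lambda>z. sing_ricci G z + real ?n *\<^sub>R G z)" "smooth_at p (\<lambda>z. z $ None ^ ?n *\<^sub>R Q z)"
    by (intro smooth_intros datumD[OF d] Q)+
  have "vo ?n p (\<lambda>z. (sing_ricci G z + real ?n *\<^sub>R G z) - z $ None ^ ?n *\<^sub>R Q z)"
  proof (rule vo_half)
    show "smooth_at p (\<lambda>z. (sing_ricci G z + real ?n *\<^sub>R G z) - z $ None ^ ?n *\<^sub>R Q z)"
      by (rule smooth_at_diff[OF sm])
    show "\<forall>\<^sub>F z in nhds p. z $ None > 0 \<longrightarrow> (sing_ricci G z + real ?n *\<^sub>R G z) - z $ None ^ ?n *\<^sub>R Q z = 0"
      using Q(2) datum_near[OF d]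
    proof eventually_elim
      fix z assume z: "z $ None > 0 \<longrightarrow> ricci (sing G) z + real ?n *\<^sub>R sing G z = z $ None ^ (?n - 2) *\<^sub>R Q z"
        and G: "smooth_at z G \<and> det (G z) \<noteq> 0"
      show "z $ None > 0 \<longrightarrow> (sing_ricci G z + real ?n *\<^sub>R G z) - z $ None ^ ?n *\<^sub>R Q z = 0"
      proof
        assume r: "z $ None > 0"
        have "(z $ None)\<^sup>2 *\<^sub>R (ricci (sing G) z + real ?n *\<^sub>R sing G z) = sing_ricci G z + real ?n *\<^sub>R G z"
          using r ricci_sing[of z G] G by (simp add: scaleR_add_right sing_def)
        moreover have "(z $ None)\<^sup>2 * z $ None ^ (?n - 2) = z $ None ^ ?n"
          unfolding power_add[symmetric] using n by (simp only: le_add_diff_inverse)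
        ultimately show "(sing_ricci G z + real ?n *\<^sub>R G z) - z $ None ^ ?n *\<^sub>R Q z = 0"
          using z r by simp
      qed
    qed
  qed
  moreover have "vo ?n p (\<lambda>z. z $ None ^ ?n *\<^sub>R Q z)" by (rule vo_scaleR_left[OF vo_r_power Q(1)])
  ultimately have "vo ?n p (\<lambda>z. ((sing_ricci G z + real ?n *\<^sub>R G z) - z $ None ^ ?n *\<^sub>R Q z) + z $ None ^ ?n *\<^sub>R Q z)"
    by (rule vo_add)
  then show ?thesis by simp
qed

text \<open>For r > 0 the two sides are equal, so the congruence holds to every order m.\<close>

lemma datum_sing_ym:
  fixes G :: "real^'n::finite option \<Rightarrow> real^'n option^'n option"
  assumes d: "datum p G A q" and n: "3 \<le> CARD('n)"
  shows "cg m p (sing_ym G A a) (\<lambda>z. z $ None ^ (CARD('n) - 3) *\<^sub>R q a z)"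
proof (rule cgI)
  let ?n = "CARD('n)"
  show sm: "smooth_at p (sing_ym G A a)" "smooth_at p (\<lambda>z. z $ None ^ (?n - 3) *\<^sub>R q a z)"
    by (intro smooth_intros datumD[OF d])+
  have sm': "smooth_at p (\<lambda>z. sing_ym G A a z - z $ None ^ (?n - 3) *\<^sub>R q a z)" by (rule smooth_at_diff[OF sm])
  \<comment> \<open>One order more than required, since \<open>vo_cancel_r\<close> gives one
    up.\<close>
  have "vo (Suc m) p (\<lambda>z. z $ None *\<^sub>R (sing_ym G A a z - z $ None ^ (?n - 3) *\<^sub>R q a z))"
  proof (rule vo_half)
    have "\<forall>\<^sub>F z in nhds p. z $ None > 0 \<longrightarrow> ym_current (sing G) A a z = z $ None ^ (CARD('n) - 2) *\<^sub>R q a z"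
      using d by (simp add: datum_def)
    then show "\<forall>\<^sub>F z in nhds p. z $ None > 0 \<longrightarrow> z $ None *\<^sub>R (sing_ym G A a z - z $ None ^ (?n - 3) *\<^sub>R q a z) = 0"
      using datum_near[OF d]
    proof eventually_elim
      fix z assume z: "z $ None > 0 \<longrightarrow> ym_current (sing G) A a z = z $ None ^ (?n - 2) *\<^sub>R q a z"
        and G: "smooth_at z G \<and> det (G z) \<noteq> 0"
      have "?n - 2 = Suc (?n - 3)" using n by simp
      then show "z $ None > 0 \<longrightarrow> z $ None *\<^sub>R (sing_ym G A a z - z $ None ^ (?n - 3) *\<^sub>R q a z) = 0"
        using z ym_current_sing[of z G A a] G by (auto simp: scaleR_diff_right)
    qed
  qed (intro smooth_intros sm')
  then show "vo m p (\<lambda>z. sing_ym G A a z - z $ None ^ (?n - 3) *\<^sub>R q a z)" by (rule vo_cancel_r[OF sm'])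
qed

section \<open>Normal forms at the boundary\<close>

lemma eventually_pos:
  fixes f :: "real^'k::finite \<Rightarrow> real"
  assumes "smooth_at x f" "f x > 0"
  shows "\<forall>\<^sub>F y in nhds x. f y > 0"
proof -
  have "(f \<longlongrightarrow> f x) (nhds x)"
    using smooth_at_continuous[OF assms(1)] continuous_within tendsto_at_iff_tendsto_nhds by blast
  then show ?thesis using assms(2) by (rule order_tendstoD(1))
qed

section \<open>Transformation of the data under changes of coordinates that preserve the
  boundary\<close>

lemma sing_pull:
  assumes "\<Psi> y $ None = y $ None * \<zeta> y"
  shows "sing (\<lambda>z. (1 / (\<zeta> z)\<^sup>2) *\<^sub>R pull_metric \<Psi> G z) y = pull_metric \<Psi> (sing G) y"
  by (simp add: sing_def pull_metric_def assms matmul_distribs power_mult_distrib)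

text \<open>Since \<zeta> > 0, \<Psi> preserves the side r > 0 where the equations hold. The factor
  r^(-2) becomes r^(-2) \<zeta>^(-2), and likewise r^(n-2) passes a factor \<zeta>^(n-2) to q; the
  rest is naturality of the Ricci tensor and of the current.\<close>

lemma datum_pull:
  fixes G :: "real^'n::finite option \<Rightarrow> real^'n option^'n option" and A :: "'n option \<Rightarrow> real^'n option \<Rightarrow> real^'r::finite^'r"
  assumes d: "datum p G A q"
    and \<Psi>: "smooth_at p \<Psi>" "\<Psi> p = p" "det (jacm \<Psi> p) \<noteq> 0"
    and \<zeta>: "smooth_at p \<zeta>" "\<zeta> p > 0" "\<forall>\<^sub>F z in nhds p. \<Psi> z $ None = z $ None * \<zeta> z"
  shows "datum p (\<lambda>z. (1 / (\<zeta> z)\<^sup>2) *\<^sub>R pull_metric \<Psi> G z) (pull_conn \<Psi> A)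
    (\<lambda>a z. \<zeta> z ^ (CARD('n) - 2) *\<^sub>R pull_conn \<Psi> q a z)"
proof -
  let ?n = "CARD('n)" and ?G = "\<lambda>z. (1 / (\<zeta> z)\<^sup>2) *\<^sub>R pull_metric \<Psi> G z"
  note D = datumD[OF d]
  have sm: "smooth_at (\<Psi> p) G" "\<And>b. smooth_at (\<Psi> p) (A b)" "\<And>b. smooth_at (\<Psi> p) (q b)" using D \<Psi>(2) by simp_all
  have e1: "\<forall>\<^sub>F z in nhds p. smooth_at z \<Psi>" by (rule smooth_at_eventually[OF \<Psi>(1)])
  have e2: "\<forall>\<^sub>F z in nhds p. det (jacm \<Psi> z) \<noteq> 0"
    using \<Psi> by (intro eventually_nonzero smooth_intros)
  have comp: "\<forall>\<^sub>F z in nhds p. P (\<Psi> z)" if "\<forall>\<^sub>F z in nhds p. P z" for P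
    using eventually_nhds_comp[OF \<Psi>(1)] that \<Psi>(2) by simp
  have e3: "\<forall>\<^sub>F z in nhds p. smooth_at (\<Psi> z) G \<and> det (G (\<Psi> z)) \<noteq> 0"
    by (rule comp[OF datum_near[OF d]])
  have "\<forall>\<^sub>F z in nhds p. \<forall>\<^sub>F y in nhds z. transpose (G y) = G y"
    using D(3) by (simp add: eventually_eventually)
  then have e4: "\<forall>\<^sub>F z in nhds p. \<forall>\<^sub>F y in nhds (\<Psi> z). transpose (G y) = G y" by (rule comp)
  have e4': "\<forall>\<^sub>F z in nhds p. transpose (G (\<Psi> z)) = G (\<Psi> z)" by (rule comp[OF D(3)])
  have e5: "\<forall>\<^sub>F z in nhds p. \<zeta> z > 0" by (rule eventually_pos[OF \<zeta>(1,2)])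
  have e6: "\<forall>\<^sub>F z in nhds p. \<forall>\<^sub>F y in nhds z. \<Psi> y $ None = y $ None * \<zeta> y"
    using \<zeta>(3) by (simp add: eventually_eventually)
  have e7: "\<forall>\<^sub>F z in nhds p. \<forall>b. smooth_at (\<Psi> z) (A b)"
    using comp[OF smooth_at_eventually[OF D(6)]] by (intro eventually_all_finite)
  have sG: "smooth_at p ?G"
    using \<zeta>(2) by (intro smooth_intros \<zeta>(1) \<Psi>(1) sm) auto
  have sym: "\<forall>\<^sub>F z in nhds p. transpose (?G z) = ?G z"
    using e4' by eventually_elim (simp add: pull_metric_def transpose_distribs matrix_transpose_mul matrix_mul_assoc)
  have pos: "v \<bullet> (?G p *v v) > 0" if "v \<noteq> 0" for v
  proof -
    let ?w = "jacm \<Psi> p *v v"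
    have "matrix_inv (jacm \<Psi> p) *v ?w = v"
      by (simp add: matrix_vector_mul_assoc matrix_inv_both \<Psi>(3))
    then have "?w \<noteq> 0" using that by auto
    then have "?w \<bullet> (G p *v ?w) > 0" by (rule D(4))
    moreover have "v \<bullet> (?G p *v v) = (1 / (\<zeta> p)\<^sup>2) * (?w \<bullet> (G p *v ?w))"
    proof -
      have "v \<bullet> (?G p *v v) = (1 / (\<zeta> p)\<^sup>2) * (v \<bullet> (transpose (jacm \<Psi> p) *v (G p *v ?w)))"
        by (simp add: pull_metric_def \<Psi>(2) scaleR_matrix_vector_assoc[symmetric] matrix_vector_mul_assoc matrix_mul_assoc)
      moreover have "v \<bullet> (transpose (jacm \<Psi> p) *v u) = ?w \<bullet> u" for u
        by (metis dot_lmul_matrix inner_commute transpose_matrix_vector)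
      ultimately show ?thesis by simp
    qed
    ultimately show ?thesis using \<zeta>(2) by simp
  qed
  obtain Q where Q: "smooth_at p Q" and Qe: "\<forall>\<^sub>F z in nhds p. z $ None > 0 \<longrightarrow>
      ricci (sing G) z + real ?n *\<^sub>R sing G z = z $ None ^ (?n - 2) *\<^sub>R Q z"
    using d by (auto simp: datum_def)
  define Q' where "Q' z = \<zeta> z ^ (?n - 2) *\<^sub>R pull_metric \<Psi> Q z" for z
  have Q': "smooth_at p Q'"
    unfolding Q'_def[abs_def] using Q \<Psi>(2) by (intro smooth_intros \<zeta>(1) \<Psi>(1)) simp
  have "\<forall>\<^sub>F z in nhds p. z $ None > 0 \<longrightarrow>
      ricci (sing ?G) z + real ?n *\<^sub>R sing ?G z = z $ None ^ (?n - 2) *\<^sub>R Q' z"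
    using e1 e2 e3 e4 e5 e6 comp[OF Qe]
  proof eventually_elim
    case (elim z)
    have ev: "\<forall>\<^sub>F y in nhds z. sing ?G y = pull_metric \<Psi> (sing G) y"
      using elim(6) by eventually_elim (rule sing_pull)
    have pz: "\<Psi> z $ None = z $ None * \<zeta> z" using elim(6) by (rule eventually_nhds_x_imp_x)
    show ?case
    proof
      assume r: "z $ None > 0"
      then have r': "\<Psi> z $ None > 0" using pz elim(5) by simp
      have sG: "smooth_at (\<Psi> z) (sing G)" using r' elim(3) by (intro smooth_intros) auto
      have dG: "det (sing G (\<Psi> z)) \<noteq> 0" using r' elim(3) by (simp add: sing_def det_scaleR_nz)
      have yG: "\<forall>\<^sub>F y in nhds (\<Psi> z). transpose (sing G y) = sing G y"
        using elim(4) by eventually_elim (simp add: sing_def transpose_distribs)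
      have "ricci (sing ?G) z + real ?n *\<^sub>R sing ?G z =
          ricci (pull_metric \<Psi> (sing G)) z + real ?n *\<^sub>R pull_metric \<Psi> (sing G) z"
        using ricci_cong[OF ev] eventually_nhds_x_imp_x[OF ev] by simp
      also have "\<dots> = transpose (jacm \<Psi> z) ** (ricci (sing G) (\<Psi> z) + real ?n *\<^sub>R sing G (\<Psi> z)) ** jacm \<Psi> z"
        by (simp add: ricci_pullback[OF elim(1,2) sG dG yG] pull_metric_def matmul_distribs)
      also have "\<dots> = z $ None ^ (?n - 2) *\<^sub>R Q' z"
        using elim(7) r' by (simp add: pz Q'_def pull_metric_def matmul_distribs power_mult_distrib)
      finally show "ricci (sing ?G) z + real ?n *\<^sub>R sing ?G z = z $ None ^ (?n - 2) *\<^sub>R Q' z" .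
    qed
  qed
  moreover have "\<forall>\<^sub>F z in nhds p. z $ None > 0 \<longrightarrow>
      ym_current (sing ?G) (pull_conn \<Psi> A) a z = z $ None ^ (?n - 2) *\<^sub>R (\<zeta> z ^ (?n - 2) *\<^sub>R pull_conn \<Psi> q a z)" for a
  proof -
    have "\<forall>\<^sub>F z in nhds p. \<forall>b. z $ None > 0 \<longrightarrow> ym_current (sing G) A b z = z $ None ^ (?n - 2) *\<^sub>R q b z"
      using d by (intro eventually_all_finite) (simp add: datum_def)
    from e1 e2 e3 e4 e5 e6 e7 comp[OF this] show ?thesis
    proof eventually_elim
      case (elim z)
      have ev: "\<forall>\<^sub>F y in nhds z. sing ?G y = pull_metric \<Psi> (sing G) y"
        using elim(6) by eventually_elim (rule sing_pull)
      have pz: "\<Psi> z $ None = z $ None * \<zeta> z" using elim(6) by (rule eventually_nhds_x_imp_x)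
      show ?case
      proof
        assume r: "z $ None > 0"
        then have r': "\<Psi> z $ None > 0" using pz elim(5) by simp
        have sG: "smooth_at (\<Psi> z) (sing G)" using r' elim(3) by (intro smooth_intros) auto
        have dG: "det (sing G (\<Psi> z)) \<noteq> 0" using r' elim(3) by (simp add: sing_def det_scaleR_nz)
        have yG: "\<forall>\<^sub>F y in nhds (\<Psi> z). transpose (sing G y) = sing G y"
          using elim(4) by eventually_elim (simp add: sing_def transpose_distribs)
        have "ym_current (sing ?G) (pull_conn \<Psi> A) a z = ym_current (pull_metric \<Psi> (sing G)) (pull_conn \<Psi> A) a z"
          by (rule ym_current_cong[OF ev]) simp
        also have "\<dots> = pull_conn \<Psi> (ym_current (sing G) A) a z"
          using elim(7) by (intro ym_current_pullback[OF elim(1,2) sG dG yG]) auto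
        also have "\<dots> = z $ None ^ (?n - 2) *\<^sub>R (\<zeta> z ^ (?n - 2) *\<^sub>R pull_conn \<Psi> q a z)"
          using elim(8) r' by (simp add: pz pull_conn_def power_mult_distrib scaleR_sum_right mult_ac)
        finally show "ym_current (sing ?G) (pull_conn \<Psi> A) a z = z $ None ^ (?n - 2) *\<^sub>R (\<zeta> z ^ (?n - 2) *\<^sub>R pull_conn \<Psi> q a z)" .
      qed
    qed
  qed
  moreover have "smooth_at p (pull_conn \<Psi> A a)" "smooth_at p (\<lambda>z. \<zeta> z ^ (?n - 2) *\<^sub>R pull_conn \<Psi> q a z)" for a
    by (intro smooth_intros \<zeta>(1) \<Psi>(1) sm)+
  ultimately show ?thesis
    unfolding datum_def using D(1) sG sym pos Q' by blast
qed

lemma sum_option: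
  "(\<Sum>a\<in>UNIV. f a) = f None + (\<Sum>i\<in>UNIV. f (Some i))" for f :: "'n::finite option \<Rightarrow> 'b::comm_monoid_add"
proof -
  have "(\<Sum>a\<in>UNIV. f a) = f None + (\<Sum>a\<in>range Some. f a)"
    unfolding UNIV_option_conv by (rule sum.insert) auto
  also have "(\<Sum>a\<in>range Some. f a) = (\<Sum>i\<in>UNIV. f (Some i))"
    by (simp add: sum.reindex)
  finally show ?thesis .
qed

text \<open>The shape of the Jacobians of the stage maps to leading order: the normal vector goes to
  s times itself plus the tangential vector t, and tangential vectors stay fixed.\<close>

definition blockm :: "real \<Rightarrow> ('n \<Rightarrow> real) \<Rightarrow> real^'n::finite option^'n option" where
  "blockm s t = (\<chi> c a. case c of None \<Rightarrow> (case a of None \<Rightarrow> s | Some j \<Rightarrow> 0)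
    | Some i \<Rightarrow> (case a of None \<Rightarrow> t i | Some j \<Rightarrow> if i = j then 1 else 0))"

lemma blockm_nth [simp]:
  "blockm s t $ None $ None = s" "blockm s t $ None $ Some j = 0"
  "blockm s t $ Some i $ None = t i" "blockm s t $ Some i $ Some j = (if i = j then 1 else 0)"
  by (simp_all add: blockm_def)

lemma blockm_det_nz:
  assumes "s \<noteq> 0"
  shows "det (blockm s t :: real^'n::finite option^'n option) \<noteq> 0"
proof -
  have "v = 0" if "blockm s t *v v = 0" for v :: "real^'n option"
  proof -
    have "(\<Sum>a\<in>UNIV. blockm s t $ c $ a * v $ a) = 0" for c
      using that by (simp add: vec_eq_iff matrix_vector_mult_def)
    then have e: "blockm s t $ c $ None * v $ None + (\<Sum>j\<in>UNIV. blockm s t $ c $ Some j * v $ Some j) = 0" for c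
      by (simp add: sum_option)
    have 0: "v $ None = 0" using e[of None] assms by simp
    have "v $ Some i = 0" for i
      using e[of "Some i"] 0 by (simp add: if_distrib if_distribR cong: if_cong)
    with 0 show "v = 0" unfolding vec_eq_iff by (metis not_None_eq zero_index)
  qed
  then show ?thesis
    unfolding invertible_det_nz[symmetric] invertible_left_inverse matrix_left_invertible_ker by blast
qed

lemma blockm_congruence:
  fixes G :: "real^'n::finite option^'n option"
  shows "(transpose (blockm s t) ** G ** blockm s t) $ Some i $ Some j = G $ Some i $ Some j"
    and "(transpose (blockm s t) ** G ** blockm s t) $ None $ Some j = s * G $ None $ Some j + (\<Sum>i\<in>UNIV. t i * G $ Some i $ Some j)"
    and "(transpose (blockm s t) ** G ** blockm s t) $ None $ None = s\<^sup>2 * G $ None $ None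
      + s * (\<Sum>i\<in>UNIV. t i * (G $ None $ Some i + G $ Some i $ None)) + (\<Sum>i\<in>UNIV. \<Sum>j\<in>UNIV. t i * t j * G $ Some i $ Some j)"
proof -
  have d: "(\<Sum>k\<in>UNIV. f k * (if k = j then 1 else 0)) = f j" "(\<Sum>k\<in>UNIV. (if k = j then 1 else 0) * f k) = f j"
    for f :: "'n \<Rightarrow> real" and j
    by (simp_all add: if_distrib if_distribR cong: if_cong)
  show "(transpose (blockm s t) ** G ** blockm s t) $ Some i $ Some j = G $ Some i $ Some j"
    by (simp add: matmul_nth transpose_nth sum_option d)
  show "(transpose (blockm s t) ** G ** blockm s t) $ None $ Some j = s * G $ None $ Some j + (\<Sum>i\<in>UNIV. t i * G $ Some i $ Some j)"
    by (simp add: matmul_nth transpose_nth sum_option d)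
  show "(transpose (blockm s t) ** G ** blockm s t) $ None $ None = s\<^sup>2 * G $ None $ None
      + s * (\<Sum>i\<in>UNIV. t i * (G $ None $ Some i + G $ Some i $ None)) + (\<Sum>i\<in>UNIV. \<Sum>j\<in>UNIV. t i * t j * G $ Some i $ Some j)"
    by (simp add: matmul_nth transpose_nth sum_option power2_eq_square distrib_right distrib_left sum.distrib
        sum_distrib_left sum_distrib_right mult_ac) (subst sum.swap, simp add: mult_ac)
qed

text \<open>Stage \<open>0\<close> makes \<open>\<partial>\<^sub>r\<close> orthogonal to the boundary and changes the metric induced on it by the factor
  \<open>\<zeta>\<^sup>-\<^sup>2\<close>; stage \<open>m\<close> then removes the terms of order \<open>r\<^sup>m\<close> from \<open>G\<^sub>0\<^sub>0 - 1\<close> and \<open>G\<^sub>0\<^sub>i\<close>.\<close>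

definition stage_map :: "nat \<Rightarrow> (real^'n::finite option \<Rightarrow> real) \<Rightarrow> ('n \<Rightarrow> real^'n option \<Rightarrow> real) \<Rightarrow> real^'n option \<Rightarrow> real^'n option" where
  "stage_map m \<zeta> b z = (\<chi> k. case k of None \<Rightarrow> z $ None * \<zeta> z | Some i \<Rightarrow> z $ Some i + z $ None ^ Suc m * b i z)"

lemma stage_map_nth [simp]: "stage_map m \<zeta> b z $ None = z $ None * \<zeta> z"
  "stage_map m \<zeta> b z $ Some i = z $ Some i + z $ None ^ Suc m * b i z"
  by (simp_all add: stage_map_def)

text \<open>The hypotheses cover stage 0, where \<zeta> is prescribed and s = \<zeta>, and stage m,
  where \<zeta> = 1 + r^m a and s = 1 + (m + 1) r^m a. In both cases the row \<open>None\<close> of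
  the Jacobian is (s, 0) modulo O(r^(m+1)).\<close>

context
  fixes p :: "real^'n::finite option" and m :: nat and \<zeta> :: "real^'n option \<Rightarrow> real" and b :: "'n \<Rightarrow> real^'n option \<Rightarrow> real"
    and \<Psi> s
  assumes p: "p $ None = 0" and \<zeta>: "smooth_at p \<zeta>" and b: "\<And>i. smooth_at p (b i)"
    and close: "vo (Suc m) p (\<lambda>z. z $ None * (\<zeta> z - 1))"
    and s: "cg (Suc m) p (\<lambda>z. \<zeta> z + z $ None * partial None \<zeta> z) s"
    and s': "\<And>i. vo (Suc m) p (\<lambda>z. z $ None * partial (Some i) \<zeta> z)"
  defines "\<Psi> \<equiv> stage_map m \<zeta> b"
begin

lemma stage_smooth: "smooth_at p \<Psi>"
proof (rule smooth_at_vecI)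
  show "smooth_at p (\<lambda>y. \<Psi> y $ k)" for k
    by (cases k) (auto simp: \<Psi>_def intro!: smooth_intros \<zeta> b simp del: power_Suc)
qed

lemma stage_fixed: "\<Psi> p = p"
proof -
  have "\<Psi> p $ k = p $ k" for k by (cases k) (simp_all add: \<Psi>_def p)
  then show ?thesis by (simp add: vec_eq_iff)
qed

lemma stage_close: "vo (Suc m) p (\<lambda>z. \<Psi> z $ k - z $ k)"
proof (cases k)
  case None
  then show ?thesis using close by (simp add: \<Psi>_def algebra_simps del: vo.simps)
next
  case (Some i)
  have "vo (Suc m) p (\<lambda>z. z $ None ^ Suc m * b i z)" by (rule vo_mult_left[OF vo_r_power b])
  then show ?thesis using Some by (simp add: \<Psi>_def del: vo.simps power_Suc)
qed

lemma stage_comp: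
  assumes "smooth_at p f"
  shows "cg (Suc m) p (\<lambda>z. f (\<Psi> z)) f"
proof (rule cgI)
  show "smooth_at p (\<lambda>z. f (\<Psi> z))" by (rule smooth_at_compose[OF stage_smooth]) (simp add: stage_fixed assms)
  show "vo (Suc m) p (\<lambda>z. f (\<Psi> z) - f z)"
    by (rule vo_compose[OF stage_smooth stage_fixed stage_close assms]) simp
qed (rule assms)

text \<open>Among the derivatives of r^(m+1) b, only the normal derivative of the power is of order
  r^m.\<close>

lemma stage_jacm: "cg (Suc m) p (jacm \<Psi>) (\<lambda>z. blockm (s z) (\<lambda>i. real (Suc m) * z $ None ^ m * b i z))"
proof (rule cg_vecI, rule cg_vecI)
  fix c a
  note ev = smooth_at_eventually[OF \<zeta>]
  have bs: "smooth_at p (partial a (b i))" for i a by (rule smooth_at_partial[OF b])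
  show "cg (Suc m) p (\<lambda>z. jacm \<Psi> z $ c $ a) (\<lambda>z. blockm (s z) (\<lambda>i. real (Suc m) * z $ None ^ m * b i z) $ c $ a)"
  proof (cases c)
    case None
    have "\<forall>\<^sub>F z in nhds p. jacm \<Psi> z $ c $ a = (if a = None then \<zeta> z else 0) + z $ None * partial a \<zeta> z"
      using ev by eventually_elim (auto simp: None jacm_def \<Psi>_def partial_mult)
    moreover have sm: "smooth_at p (\<lambda>z. (if a = None then \<zeta> z else 0) + z $ None * partial a \<zeta> z)"
      using \<zeta> by (cases a) (auto intro!: smooth_intros)
    ultimately have "cg (Suc m) p (\<lambda>z. jacm \<Psi> z $ c $ a) (\<lambda>z. (if a = None then \<zeta> z else 0) + z $ None * partial a \<zeta> z)"
      by (intro cg_eventually)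
    moreover have "cg (Suc m) p (\<lambda>z. (if a = None then \<zeta> z else 0) + z $ None * partial a \<zeta> z)
        (\<lambda>z. blockm (s z) (\<lambda>i. real (Suc m) * z $ None ^ m * b i z) $ c $ a)"
      using s s' by (cases a) (simp_all add: None cg_0_iff del: vo.simps)
    ultimately show ?thesis by (rule cg_trans)
  next
    case (Some i)
    have "\<forall>\<^sub>F z in nhds p. jacm \<Psi> z $ c $ a = (if a = c then 1 else 0) +
        ((if a = None then real (Suc m) * z $ None ^ m * b i z else 0) + z $ None ^ Suc m * partial a (b i) z)"
      using smooth_at_eventually[OF b[of i]]
      by eventually_elim (auto simp: Some jacm_def \<Psi>_def partial_add partial_mult smooth_intros partial_r_power simp del: power_Suc)
    then have "cg (Suc m) p (\<lambda>z. jacm \<Psi> z $ c $ a) (\<lambda>z. (if a = c then 1 else 0) +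
        ((if a = None then real (Suc m) * z $ None ^ m * b i z else 0) + z $ None ^ Suc m * partial a (b i) z))"
      by (rule cg_eventually[rotated]) (cases a; auto intro!: smooth_intros b bs simp del: power_Suc)
    moreover have "cg (Suc m) p (\<lambda>z. (if a = c then 1 else 0) +
        ((if a = None then real (Suc m) * z $ None ^ m * b i z else 0) + z $ None ^ Suc m * partial a (b i) z))
        (\<lambda>z. (if a = c then 1 else 0) + ((if a = None then real (Suc m) * z $ None ^ m * b i z else 0) + 0))"
    proof (intro cg_add cg_refl)
      show "cg (Suc m) p (\<lambda>z. z $ None ^ Suc m * partial a (b i) z) (\<lambda>z. 0)"
        unfolding cg_0_iff by (rule vo_mult_left[OF vo_r_power bs])
      show "smooth_at p (\<lambda>z. if a = None then real (Suc m) * z $ None ^ m * b i z else 0)"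
        by (cases a) (auto intro!: smooth_intros b)
    qed simp
    moreover have "(\<lambda>z. (if a = c then 1 else 0) + ((if a = None then real (Suc m) * z $ None ^ m * b i z else 0) + 0)) =
        (\<lambda>z. blockm (s z) (\<lambda>i. real (Suc m) * z $ None ^ m * b i z) $ c $ a)"
      by (cases a) (auto simp: fun_eq_iff Some)
    ultimately show ?thesis by (metis (no_types, lifting) cg_trans)
  qed
qed

lemma stage_jacm_p: "jacm \<Psi> p = blockm (s p) (\<lambda>i. real (Suc m) * p $ None ^ m * b i p)"
  using eventually_nhds_x_imp_x[OF cg_boundary[OF stage_jacm]] p by simp

lemma stage_pull_metric:
  assumes "smooth_at p G"
  shows "cg (Suc m) p (pull_metric \<Psi> G) (\<lambda>z. transpose (blockm (s z) (\<lambda>i. real (Suc m) * z $ None ^ m * b i z)) ** G z **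
    blockm (s z) (\<lambda>i. real (Suc m) * z $ None ^ m * b i z))"
  unfolding pull_metric_def[abs_def] by (intro cg_intros stage_jacm stage_comp assms)

lemma stage_pull_conn:
  assumes "\<And>a. smooth_at p (A a)"
  shows "cg (Suc 0) p (pull_conn \<Psi> A (Some j)) (A (Some j))"
proof -
  have "cg (Suc m) p (pull_conn \<Psi> A (Some j)) (\<lambda>z. \<Sum>a\<in>UNIV. blockm (s z) (\<lambda>i. real (Suc m) * z $ None ^ m * b i z) $ a $ Some j *\<^sub>R A a z)"
    unfolding pull_conn_def[abs_def] by (intro cg_intros stage_jacm stage_comp assms)
  then show ?thesis
    by (auto simp: sum_option if_distrib if_distribR cong: if_cong intro: cg_le)
qed

lemma stage_pull_conn_p: "pull_conn \<Psi> q (Some j) p = q (Some j) p"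
  by (simp add: pull_conn_def stage_jacm_p stage_fixed sum_option if_distrib if_distribR cong: if_cong)

end

section \<open>Improving the normal form order by order\<close>

definition normal :: "nat \<Rightarrow> real^'n::finite option \<Rightarrow> (real^'n option \<Rightarrow> real^'n option^'n option) \<Rightarrow> bool" where
  "normal m p G \<longleftrightarrow> cg m p (\<lambda>z. G z $ None $ None) (\<lambda>z. 1) \<and> (\<forall>i. vo m p (\<lambda>z. G z $ None $ Some i))"

definition tang :: "(real^'n::finite option \<Rightarrow> real^'n option^'n option) \<Rightarrow> real^'n option \<Rightarrow> real^'n^'n" where
  "tang G z = (\<chi> i j. G z $ Some i $ Some j)"

lemma smooth_at_tang [smooth_intros]: "smooth_at p G \<Longrightarrow> smooth_at p (tang G)"
  unfolding tang_def[abs_def] by (intro smooth_intros)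

lemma tang_posdef:
  fixes B :: "real^'n::finite option^'n option"
  assumes "\<And>v. v \<noteq> 0 \<Longrightarrow> v \<bullet> (B *v v) > 0"
  shows "det (\<chi> i j. B $ Some i $ Some j) \<noteq> 0"
proof (rule posdef_det_nz)
  fix v :: "real^'n" assume v: "v \<noteq> 0"
  define w :: "real^'n option" where "w = (\<chi> k. case k of None \<Rightarrow> 0 | Some i \<Rightarrow> v $ i)"
  have w: "w $ None = 0" "w $ Some i = v $ i" for i by (simp_all add: w_def)
  from v obtain i where "v $ i \<noteq> 0" by (auto simp: vec_eq_iff)
  then have "w \<noteq> 0" using w(2)[of i] by auto
  then have "w \<bullet> (B *v w) > 0" by (rule assms)
  then show "v \<bullet> ((\<chi> i j. B $ Some i $ Some j) *v v) > 0"
    by (simp add: inner_vec_def matrix_vector_mult_def sum_option w)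
qed

lemma datum_tang_det: "datum p G A q \<Longrightarrow> det (tang G p) \<noteq> 0"
  unfolding tang_def by (rule tang_posdef) (rule datumD(4))

lemma datum_sym_nth:
  assumes "datum p G A q"
  shows "\<forall>\<^sub>F z in nhds p. G z $ a $ b = G z $ b $ a"
  using datumD(3)[OF assms] by eventually_elim (metis transpose_nth)

text \<open>The factor \<zeta> is left free: its later choice makes the metric induced on the
  boundary equal to the given representative of the conformal class.\<close>

lemma stage_zero:
  fixes G :: "real^'n::finite option \<Rightarrow> real^'n option^'n option" and A :: "'n option \<Rightarrow> real^'n option \<Rightarrow> real^'r::finite^'r"
  assumes d: "datum p G A q" and \<zeta>: "smooth_at p \<zeta>" "\<zeta> p > 0"
  shows "\<exists>G' A' q'. datum p G' A' q' \<and> (\<forall>i. vo (Suc 0) p (\<lambda>z. G' z $ None $ Some i)) \<and>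
    cg (Suc 0) p (tang G') (\<lambda>z. (1 / (\<zeta> z)\<^sup>2) *\<^sub>R tang G z) \<and> (\<forall>i. cg (Suc 0) p (A' (Some i)) (A (Some i))) \<and>
    (\<forall>i. q' (Some i) p = \<zeta> p ^ (CARD('n) - 2) *\<^sub>R q (Some i) p)"
proof -
  note D = datumD[OF d]
  let ?H = "\<lambda>z. matrix_inv (tang G z)"
  have H: "smooth_at p ?H" by (intro smooth_intros D(2) datum_tang_det[OF d])
  \<comment> \<open>The solution of \<zeta> G_0j + sum_i b_i G_ij = 0, which makes the new normal
    direction orthogonal to the tangential ones.\<close>
  define b where "b i z = - \<zeta> z * (\<Sum>j\<in>UNIV. G z $ None $ Some j * ?H z $ j $ i)" for i z
  have b: "smooth_at p (b i)" for i
    unfolding b_def[abs_def] by (intro smooth_intros \<zeta>(1) D(2) H)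
  let ?s = "\<zeta>"
  have close: "vo (Suc 0) p (\<lambda>z. z $ None * (\<zeta> z - 1))"
    by (rule vo_mult_left[OF vo_r]) (intro smooth_intros \<zeta>)
  have v: "vo (Suc 0) p (\<lambda>z. z $ None * partial a \<zeta> z)" for a
    by (rule vo_mult_left[OF vo_r]) (intro smooth_intros \<zeta>)
  have s: "cg (Suc 0) p (\<lambda>z. \<zeta> z + z $ None * partial None \<zeta> z) ?s"
    using v[of None] \<zeta> by (intro cgI smooth_intros) auto
  note st = D(1) \<zeta>(1) b close s v
  let ?\<Psi> = "stage_map 0 \<zeta> b" and ?B = "\<lambda>z. blockm (\<zeta> z) (\<lambda>i. real (Suc 0) * z $ None ^ 0 * b i z)"
  have \<Psi>: "smooth_at p ?\<Psi>" "?\<Psi> p = p"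
    using stage_smooth[OF st] stage_fixed[OF st] by auto
  have det: "det (jacm ?\<Psi> p) \<noteq> 0"
    unfolding stage_jacm_p[OF st] by (rule blockm_det_nz) (use \<zeta>(2) in simp)
  have ev: "\<forall>\<^sub>F z in nhds p. ?\<Psi> z $ None = z $ None * \<zeta> z" by simp
  let ?G = "\<lambda>z. (1 / (\<zeta> z)\<^sup>2) *\<^sub>R pull_metric ?\<Psi> G z"
  have d': "datum p ?G (pull_conn ?\<Psi> A) (\<lambda>a z. \<zeta> z ^ (CARD('n) - 2) *\<^sub>R pull_conn ?\<Psi> q a z)"
    by (rule datum_pull[OF d \<Psi> det \<zeta> ev])
  have \<zeta>2: "smooth_at p (\<lambda>z. 1 / (\<zeta> z)\<^sup>2)" using \<zeta> by (intro smooth_intros) auto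
  have c: "cg (Suc 0) p ?G (\<lambda>z. (1 / (\<zeta> z)\<^sup>2) *\<^sub>R (transpose (?B z) ** G z ** ?B z))"
    by (intro cg_scaleR cg_refl \<zeta>2 stage_pull_metric[OF st] D(2))
  have "vo (Suc 0) p (\<lambda>z. ?G z $ None $ Some j)" for j
  proof -
    have "cg (Suc 0) p (\<lambda>z. ?G z $ None $ Some j) (\<lambda>z. ((1 / (\<zeta> z)\<^sup>2) *\<^sub>R (transpose (?B z) ** G z ** ?B z)) $ None $ Some j)"
      by (intro cg_nth c)
    moreover have "\<forall>\<^sub>F z in nhds p. 0 = ((1 / (\<zeta> z)\<^sup>2) *\<^sub>R (transpose (?B z) ** G z ** ?B z)) $ None $ Some j"
      using eventually_nonzero[OF smooth_at_det[OF smooth_at_tang[OF D(2)]] datum_tang_det[OF d]]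
    proof eventually_elim
      fix z assume z: "det (tang G z) \<noteq> 0"
      have "(\<Sum>i\<in>UNIV. b i z * G z $ Some i $ Some j) = - \<zeta> z * (\<Sum>k\<in>UNIV. G z $ None $ Some k * (\<Sum>i\<in>UNIV. ?H z $ k $ i * tang G z $ i $ j))"
        unfolding b_def tang_def by (simp add: sum_distrib_left sum_distrib_right mult_ac sum_negf) (rule sum.swap)
      also have "\<dots> = - \<zeta> z * (\<Sum>k\<in>UNIV. G z $ None $ Some k * (?H z ** tang G z) $ k $ j)"
        by (simp add: matmul_nth)
      also have "\<dots> = - \<zeta> z * G z $ None $ Some j"
        by (simp add: matrix_inv_both z mat_def if_distrib if_distribR cong: if_cong)
      finally show "0 = ((1 / (\<zeta> z)\<^sup>2) *\<^sub>R (transpose (?B z) ** G z ** ?B z)) $ None $ Some j"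
        by (simp add: blockm_congruence)
    qed
    then have "vo (Suc 0) p (\<lambda>z. ((1 / (\<zeta> z)\<^sup>2) *\<^sub>R (transpose (?B z) ** G z ** ?B z)) $ None $ Some j)"
      by (rule vo_cong) simp
    ultimately show ?thesis by (rule cg_vo)
  qed
  moreover have "cg (Suc 0) p (tang ?G) (\<lambda>z. (1 / (\<zeta> z)\<^sup>2) *\<^sub>R tang G z)"
  proof (rule cg_vecI, rule cg_vecI)
    fix i j
    have "cg (Suc 0) p (\<lambda>z. ?G z $ Some i $ Some j) (\<lambda>z. ((1 / (\<zeta> z)\<^sup>2) *\<^sub>R (transpose (?B z) ** G z ** ?B z)) $ Some i $ Some j)"
      by (intro cg_nth c)
    then show "cg (Suc 0) p (\<lambda>z. tang ?G z $ i $ j) (\<lambda>z. ((1 / (\<zeta> z)\<^sup>2) *\<^sub>R tang G z) $ i $ j)"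
      by (simp add: tang_def blockm_congruence)
  qed
  moreover have "cg (Suc 0) p (pull_conn ?\<Psi> A (Some i)) (A (Some i))" for i
    by (rule stage_pull_conn[OF st]) (rule D(6))
  moreover have "\<zeta> p ^ (CARD('n) - 2) *\<^sub>R pull_conn ?\<Psi> q (Some i) p = \<zeta> p ^ (CARD('n) - 2) *\<^sub>R q (Some i) p" for i
    by (simp add: stage_pull_conn_p[OF st])
  ultimately show ?thesis using d'
    by (intro exI[of _ ?G] exI[of _ "pull_conn ?\<Psi> A"]
        exI[of _ "\<lambda>a z. \<zeta> z ^ (CARD('n) - 2) *\<^sub>R pull_conn ?\<Psi> q a z"] conjI allI)
qed

text \<open>Replacing r by r (1 + r^m a) changes G_00 by 2 (m + 1) a r^m through the Jacobian and by
  - 2 a r^m through the factor r^(-2), in total by 2 m a r^m. Hence m >= 1 is required, and the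
  boundary value of G_00 has to come from elsewhere, namely from \<open>normal_one\<close>.\<close>

lemma stage_step:
  fixes G :: "real^'n::finite option \<Rightarrow> real^'n option^'n option" and A :: "'n option \<Rightarrow> real^'n option \<Rightarrow> real^'r::finite^'r"
  assumes d: "datum p G A q" and m: "m \<ge> 1" and N: "normal m p G"
  shows "\<exists>G' A' q'. datum p G' A' q' \<and> normal (Suc m) p G' \<and>
    cg (Suc 0) p (tang G') (tang G) \<and> (\<forall>i. cg (Suc 0) p (A' (Some i)) (A (Some i))) \<and>
    (\<forall>i. q' (Some i) p = q (Some i) p)"
proof -
  note D = datumD[OF d]
  let ?H = "\<lambda>z. matrix_inv (tang G z)"
  have H: "smooth_at p ?H" by (intro smooth_intros D(2) datum_tang_det[OF d])
  have n0: "vo m p (\<lambda>z. G z $ None $ None - 1)" and ni: "vo m p (\<lambda>z. G z $ None $ Some i)" for i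
    using cgD(3)[OF conjunct1[OF N[unfolded normal_def]]] conjunct2[OF N[unfolded normal_def]] by blast+
  have ni': "vo m p (\<lambda>z. G z $ Some i $ None)" for i
    by (rule vo_cong[OF datum_sym_nth[OF d] ni])
  obtain \<alpha> where \<alpha>: "smooth_at p \<alpha>" "vo (Suc m) p (\<lambda>z. (G z $ None $ None - 1) - z $ None ^ m *\<^sub>R \<alpha> z)"
    using vo_taylor[OF n0] by (elim exE conjE)
  have "\<forall>i. \<exists>\<beta>. smooth_at p \<beta> \<and> vo (Suc m) p (\<lambda>z. G z $ None $ Some i - z $ None ^ m *\<^sub>R \<beta> z)"
    by (intro allI vo_taylor[OF ni])
  from choice[OF this] obtain \<beta> where
    "\<forall>i. smooth_at p (\<beta> i) \<and> vo (Suc m) p (\<lambda>z. G z $ None $ Some i - z $ None ^ m *\<^sub>R \<beta> i z)" ..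
  then have \<beta>: "smooth_at p (\<beta> i)" "vo (Suc m) p (\<lambda>z. G z $ None $ Some i - z $ None ^ m *\<^sub>R \<beta> i z)" for i
    by simp_all
  \<comment> \<open>The solution of \<alpha> + 2 m a = 0.\<close>
  define a where "a z = - \<alpha> z / (2 * real m)" for z
  define \<zeta> where "\<zeta> z = 1 + z $ None ^ m * a z" for z
  \<comment> \<open>The solution of \<beta>_j + (m + 1) sum_i b_i G_ij = 0; the factor m + 1 comes
    from differentiating r^(m+1).\<close>
  define b where "b i z = - (1 / real (Suc m)) * (\<Sum>j\<in>UNIV. \<beta> j z * ?H z $ j $ i)" for i z
  have a: "smooth_at p a" unfolding a_def[abs_def] using m by (intro smooth_intros \<alpha>) simp
  have ra: "vo m p (\<lambda>z. z $ None ^ m * a z)" by (rule vo_mult_left[OF vo_r_power a])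
  have \<zeta>: "smooth_at p \<zeta>" unfolding \<zeta>_def[abs_def] by (intro smooth_intros a)
  have \<zeta>p: "\<zeta> p = 1" using D(1) m by (simp add: \<zeta>_def)
  have b: "smooth_at p (b i)" for i
    unfolding b_def[abs_def] by (intro smooth_intros \<beta> H)
  define s where "s z = 1 + real (Suc m) * (z $ None ^ m * a z)" for z
  have close: "vo (Suc m) p (\<lambda>z. z $ None * (\<zeta> z - 1))"
    using vo_r_mult[OF ra] by (simp add: \<zeta>_def del: vo.simps)
  have p\<zeta>: "\<forall>\<^sub>F z in nhds p. partial k (\<lambda>z. z $ None ^ m * a z) z = partial k \<zeta> z" for k
    using smooth_at_eventually[OF vo_smooth[OF ra]] unfolding \<zeta>_def
    by eventually_elim (simp add: partial_add)
  have s: "cg (Suc m) p (\<lambda>z. \<zeta> z + z $ None * partial None \<zeta> z) s"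
  proof (rule cgI)
    show "smooth_at p (\<lambda>z. \<zeta> z + z $ None * partial None \<zeta> z)" "smooth_at p s"
      unfolding s_def[abs_def] by (intro smooth_intros \<zeta> a)+
    have "\<forall>\<^sub>F z in nhds p. z $ None *\<^sub>R partial None (\<lambda>z. z $ None ^ m * a z) z - real m *\<^sub>R (z $ None ^ m * a z) =
        \<zeta> z + z $ None * partial None \<zeta> z - s z"
      using p\<zeta>[of None] by eventually_elim (simp add: \<zeta>_def s_def algebra_simps)
    from vo_cong[OF this vo_theta[OF ra]]
    show "vo (Suc m) p (\<lambda>z. \<zeta> z + z $ None * partial None \<zeta> z - s z)" .
  qed
  have v: "vo (Suc m) p (\<lambda>z. z $ None * partial (Some i) \<zeta> z)" for i
    by (rule vo_r_mult[OF vo_cong[OF p\<zeta> vo_partial_Some[OF ra]]])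
  note st = D(1) \<zeta> b close s v
  let ?\<Psi> = "stage_map m \<zeta> b" and ?B = "\<lambda>z. blockm (s z) (\<lambda>i. real (Suc m) * z $ None ^ m * b i z)"
  have \<Psi>: "smooth_at p ?\<Psi>" "?\<Psi> p = p"
    using stage_smooth[OF st] stage_fixed[OF st] by auto
  have det: "det (jacm ?\<Psi> p) \<noteq> 0"
    unfolding stage_jacm_p[OF st] by (rule blockm_det_nz) (use D(1) m in \<open>simp add: s_def power_0_left\<close>)
  have ev: "\<forall>\<^sub>F z in nhds p. ?\<Psi> z $ None = z $ None * \<zeta> z" by simp
  let ?G = "\<lambda>z. (1 / (\<zeta> z)\<^sup>2) *\<^sub>R pull_metric ?\<Psi> G z"
  have d': "datum p ?G (pull_conn ?\<Psi> A) (\<lambda>a z. \<zeta> z ^ (CARD('n) - 2) *\<^sub>R pull_conn ?\<Psi> q a z)"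
    using \<zeta>p by (intro datum_pull[OF d \<Psi> det \<zeta> _ ev]) simp
  have \<zeta>2: "smooth_at p (\<lambda>z. 1 / (\<zeta> z)\<^sup>2)" using \<zeta> \<zeta>p by (intro smooth_intros) auto
  have Bs: "smooth_at p ?B"
    using cgD(2)[OF stage_jacm[OF st]] .
  have Gc: "smooth_at p (\<lambda>z. G z $ c $ e)" for c e by (intro smooth_intros D(2))
  have c: "cg (Suc m) p ?G (\<lambda>z. (1 / (\<zeta> z)\<^sup>2) *\<^sub>R (transpose (?B z) ** G z ** ?B z))"
    by (intro cg_scaleR cg_refl \<zeta>2 stage_pull_metric[OF st] D(2))
  have rb: "vo m p (\<lambda>z. real (Suc m) * z $ None ^ m * b i z)" for i
    by (intro vo_mult_left vo_mult_right vo_r_power b smooth_at_const)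
  \<comment> \<open>Products of two corrections of order m are negligible because m >= 1.\<close>
  have up: "vo (m + m) p f \<Longrightarrow> vo (Suc m) p f" for f :: "real^'n option \<Rightarrow> real" by (rule vo_le) (use m in auto)
  have "cg (Suc m) p (\<lambda>z. ?G z $ None $ None) (\<lambda>z. 1)"
  proof -
    have "cg (Suc m) p (\<lambda>z. ?G z $ None $ None) (\<lambda>z. ((1 / (\<zeta> z)\<^sup>2) *\<^sub>R (transpose (?B z) ** G z ** ?B z)) $ None $ None)"
      by (intro cg_nth c)
    moreover have "cg (Suc m) p (\<lambda>z. ((1 / (\<zeta> z)\<^sup>2) *\<^sub>R (transpose (?B z) ** G z ** ?B z)) $ None $ None) (\<lambda>z. 1)"
    proof (rule cgI)
      show "smooth_at p (\<lambda>z. ((1 / (\<zeta> z)\<^sup>2) *\<^sub>R (transpose (?B z) ** G z ** ?B z)) $ None $ None)"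
        by (intro smooth_intros \<zeta>2 Bs D(2))
      let ?t = "\<lambda>i z. real (Suc m) * z $ None ^ m * b i z"
      \<comment> \<open>The expansion of s^2 G_00 - \<zeta>^2 together with the terms in b. By the
        choice of a the contributions of order r^m cancel, and each summand is O(r^(m+1)).\<close>
      define E where "E z = ((G z $ None $ None - 1) - z $ None ^ m *\<^sub>R \<alpha> z)
        + (z $ None ^ m * (real (Suc m) * a z * (2 + real (Suc m) * (z $ None ^ m * a z)))) * (G z $ None $ None - 1)
        + z $ None ^ (m + m) * (((real (Suc m))\<^sup>2 - 1) * (a z)\<^sup>2)
        + s z * (\<Sum>i\<in>UNIV. ?t i z * (G z $ None $ Some i + G z $ Some i $ None))
        + (\<Sum>i\<in>UNIV. \<Sum>j\<in>UNIV. ?t i z * ?t j z * G z $ Some i $ Some j)" for z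
      have ss: "smooth_at p s" by (rule cgD(2)[OF s])
      have E: "vo (Suc m) p E"
        unfolding E_def
      proof (intro vo_add)
        show "vo (Suc m) p (\<lambda>z. (G z $ None $ None - 1) - z $ None ^ m *\<^sub>R \<alpha> z)" by (rule \<alpha>(2))
        show "vo (Suc m) p (\<lambda>z. (z $ None ^ m * (real (Suc m) * a z * (2 + real (Suc m) * (z $ None ^ m * a z)))) * (G z $ None $ None - 1))"
          by (rule up[OF vo_mult[OF vo_mult_left[OF vo_r_power] n0]]) (intro smooth_intros a)
        show "vo (Suc m) p (\<lambda>z. z $ None ^ (m + m) * (((real (Suc m))\<^sup>2 - 1) * (a z)\<^sup>2))"
          by (rule up[OF vo_mult_left[OF vo_r_power]]) (intro smooth_intros a)
        show "vo (Suc m) p (\<lambda>z. s z * (\<Sum>i\<in>UNIV. ?t i z * (G z $ None $ Some i + G z $ Some i $ None)))"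
          by (rule vo_mult_right[OF ss vo_sum[OF up[OF vo_mult[OF rb vo_add[OF ni ni']]]]])
        show "vo (Suc m) p (\<lambda>z. \<Sum>i\<in>UNIV. \<Sum>j\<in>UNIV. ?t i z * ?t j z * G z $ Some i $ Some j)"
          by (rule vo_sum[OF vo_sum[OF up[OF vo_mult_left[OF vo_mult[OF rb rb] Gc]]]])
      qed
      have "\<forall>\<^sub>F z in nhds p. \<zeta> z \<noteq> 0" using \<zeta> \<zeta>p by (intro eventually_nonzero) auto
      then have "\<forall>\<^sub>F z in nhds p. (1 / (\<zeta> z)\<^sup>2) * E z = ((1 / (\<zeta> z)\<^sup>2) *\<^sub>R (transpose (?B z) ** G z ** ?B z)) $ None $ None - 1"
      proof eventually_elim
        fix z assume z: "\<zeta> z \<noteq> 0"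
        have al: "\<alpha> z = - (2 * real m * a z)" using m by (simp add: a_def)
        have "(s z)\<^sup>2 * G z $ None $ None - (\<zeta> z)\<^sup>2 = ((G z $ None $ None - 1) - z $ None ^ m *\<^sub>R \<alpha> z)
        + (z $ None ^ m * (real (Suc m) * a z * (2 + real (Suc m) * (z $ None ^ m * a z)))) * (G z $ None $ None - 1)
        + z $ None ^ (m + m) * (((real (Suc m))\<^sup>2 - 1) * (a z)\<^sup>2)"
          unfolding al s_def \<zeta>_def power_add by (simp add: power2_eq_square algebra_simps)
        then have "(s z)\<^sup>2 * G z $ None $ None - (\<zeta> z)\<^sup>2
          + s z * (\<Sum>i\<in>UNIV. ?t i z * (G z $ None $ Some i + G z $ Some i $ None))
          + (\<Sum>i\<in>UNIV. \<Sum>j\<in>UNIV. ?t i z * ?t j z * G z $ Some i $ Some j) = E z"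
          unfolding E_def by linarith
        then have "(transpose (?B z) ** G z ** ?B z) $ None $ None = E z + (\<zeta> z)\<^sup>2"
          unfolding blockm_congruence by linarith
        then show "(1 / (\<zeta> z)\<^sup>2) * E z = ((1 / (\<zeta> z)\<^sup>2) *\<^sub>R (transpose (?B z) ** G z ** ?B z)) $ None $ None - 1"
          using z by (simp add: add_divide_distrib)
      qed
      from vo_cong[OF this vo_mult_right[OF \<zeta>2 E]]
      show "vo (Suc m) p (\<lambda>z. ((1 / (\<zeta> z)\<^sup>2) *\<^sub>R (transpose (?B z) ** G z ** ?B z)) $ None $ None - 1)" .
    qed simp
    ultimately show ?thesis by (rule cg_trans)
  qed
  moreover have "vo (Suc m) p (\<lambda>z. ?G z $ None $ Some j)" for j
  proof -
    have "cg (Suc m) p (\<lambda>z. ?G z $ None $ Some j) (\<lambda>z. ((1 / (\<zeta> z)\<^sup>2) *\<^sub>R (transpose (?B z) ** G z ** ?B z)) $ None $ Some j)"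
      by (intro cg_nth c)
    moreover have "vo (Suc m) p (\<lambda>z. ((1 / (\<zeta> z)\<^sup>2) *\<^sub>R (transpose (?B z) ** G z ** ?B z)) $ None $ Some j)"
    proof -
      define E where "E z = (G z $ None $ Some j - z $ None ^ m *\<^sub>R \<beta> j z) + (z $ None ^ m * (real (Suc m) * a z)) * G z $ None $ Some j" for z
      have E: "vo (Suc m) p E"
        unfolding E_def
        by (rule vo_add[OF \<beta>(2) up[OF vo_mult[OF vo_mult_left[OF vo_r_power] ni]]]) (intro smooth_intros a)
      have "\<forall>\<^sub>F z in nhds p. (1 / (\<zeta> z)\<^sup>2) * E z = ((1 / (\<zeta> z)\<^sup>2) *\<^sub>R (transpose (?B z) ** G z ** ?B z)) $ None $ Some j"
        using eventually_nonzero[OF smooth_at_det[OF smooth_at_tang[OF D(2)]] datum_tang_det[OF d]]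
      proof eventually_elim
        fix z assume z: "det (tang G z) \<noteq> 0"
        have "(\<Sum>i\<in>UNIV. real (Suc m) * z $ None ^ m * b i z * G z $ Some i $ Some j) =
            - (z $ None ^ m) * (\<Sum>k\<in>UNIV. \<beta> k z * (\<Sum>i\<in>UNIV. ?H z $ k $ i * tang G z $ i $ j))"
          unfolding b_def tang_def by (simp add: sum_distrib_left sum_distrib_right mult_ac sum_negf) (rule sum.swap)
        also have "\<dots> = - (z $ None ^ m) * (\<Sum>k\<in>UNIV. \<beta> k z * (?H z ** tang G z) $ k $ j)"
          by (simp add: matmul_nth)
        also have "\<dots> = - (z $ None ^ m) * \<beta> j z"
          by (simp add: matrix_inv_both z mat_def if_distrib if_distribR cong: if_cong)
        finally have "(transpose (?B z) ** G z ** ?B z) $ None $ Some j = E z"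
          unfolding blockm_congruence by (simp add: E_def s_def algebra_simps)
        then show "(1 / (\<zeta> z)\<^sup>2) * E z = ((1 / (\<zeta> z)\<^sup>2) *\<^sub>R (transpose (?B z) ** G z ** ?B z)) $ None $ Some j"
          by simp
      qed
      from vo_cong[OF this vo_mult_right[OF \<zeta>2 E]] show ?thesis .
    qed
    ultimately show ?thesis by (rule cg_vo)
  qed
  moreover have "cg (Suc 0) p (tang ?G) (tang G)"
  proof (rule cg_vecI, rule cg_vecI)
    fix i j
    have "cg (Suc m) p (\<lambda>z. ?G z $ Some i $ Some j) (\<lambda>z. ((1 / (\<zeta> z)\<^sup>2) *\<^sub>R (transpose (?B z) ** G z ** ?B z)) $ Some i $ Some j)"
      by (intro cg_nth c)
    then have "cg (Suc m) p (\<lambda>z. ?G z $ Some i $ Some j) (\<lambda>z. (1 / (\<zeta> z)\<^sup>2) * G z $ Some i $ Some j)"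
      by (simp add: blockm_congruence)
    then have "cg (Suc 0) p (\<lambda>z. ?G z $ Some i $ Some j) (\<lambda>z. (1 / (\<zeta> z)\<^sup>2) * G z $ Some i $ Some j)"
      by (rule cg_le) simp
    moreover have "cg (Suc 0) p (\<lambda>z. (1 / (\<zeta> z)\<^sup>2) * G z $ Some i $ Some j) (\<lambda>z. G z $ Some i $ Some j)"
    proof (rule cg_Suc_0I)
      show "smooth_at p (\<lambda>z. (1 / (\<zeta> z)\<^sup>2) * G z $ Some i $ Some j)" by (rule smooth_at_mult[OF \<zeta>2 Gc])
      show "\<forall>\<^sub>F z in nhds p. z $ None = 0 \<longrightarrow> (1 / (\<zeta> z)\<^sup>2) * G z $ Some i $ Some j = G z $ Some i $ Some j"
        by (rule always_eventually) (use m in \<open>simp add: \<zeta>_def power_0_left\<close>)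
    qed (rule Gc)
    ultimately show "cg (Suc 0) p (\<lambda>z. tang ?G z $ i $ j) (\<lambda>z. tang G z $ i $ j)"
      unfolding tang_def vec_lambda_beta by (rule cg_trans)
  qed
  moreover have "cg (Suc 0) p (pull_conn ?\<Psi> A (Some i)) (A (Some i))" for i
    by (rule stage_pull_conn[OF st]) (rule D(6))
  moreover have "\<zeta> p ^ (CARD('n) - 2) *\<^sub>R pull_conn ?\<Psi> q (Some i) p = q (Some i) p" for i
    by (simp add: stage_pull_conn_p[OF st] \<zeta>p)
  ultimately show ?thesis using d' unfolding normal_def
    by (intro exI[of _ ?G] exI[of _ "pull_conn ?\<Psi> A"]
        exI[of _ "\<lambda>a z. \<zeta> z ^ (CARD('n) - 2) *\<^sub>R pull_conn ?\<Psi> q a z"] conjI allI)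
qed

text \<open>For H = 1 + r^(m+1) c the new normal component is A_0 + (m + 1) r^m c modulo O(r^(m+1)),
  so c is chosen to cancel the leading coefficient \<beta>. On the boundary H = 1, which preserves
  the tangential components and q there.\<close>

lemma gauge_step:
  fixes G :: "real^'n::finite option \<Rightarrow> real^'n option^'n option" and A :: "'n option \<Rightarrow> real^'n option \<Rightarrow> real^'r::finite^'r"
  assumes d: "datum p G A q" and A0: "vo m p (A None)"
  shows "\<exists>A' q'. datum p G A' q' \<and> vo (Suc m) p (A' None) \<and>
    (\<forall>i. cg (Suc 0) p (A' (Some i)) (A (Some i))) \<and> (\<forall>a. q' a p = q a p)"
proof -
  note D = datumD[OF d]
  have "\<exists>\<beta>. smooth_at p \<beta> \<and> vo (Suc m) p (\<lambda>z. A None z - z $ None ^ m *\<^sub>R \<beta> z)" by (rule vo_taylor[OF A0])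
  then obtain \<beta> where \<beta>: "smooth_at p \<beta>" "vo (Suc m) p (\<lambda>z. A None z - z $ None ^ m *\<^sub>R \<beta> z)"
    by (elim exE conjE)
  define c where "c z = (- (1 / real (Suc m))) *\<^sub>R \<beta> z" for z
  define H where "H z = mat 1 + z $ None ^ Suc m *\<^sub>R c z" for z
  define Hi where "Hi z = matrix_inv (H z)" for z
  define A' where "A' a z = Hi z ** (A a z ** H z + partial a H z)" for a z
  define q' where "q' a z = Hi z ** q a z ** H z" for a z
  have c: "smooth_at p c" unfolding c_def[abs_def] by (intro smooth_intros \<beta>)
  have rc: "vo (Suc m) p (\<lambda>z. z $ None ^ Suc m *\<^sub>R c z)" by (rule vo_scaleR_left[OF vo_r_power c])
  have H: "smooth_at p H" unfolding H_def[abs_def] by (intro smooth_intros c)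
  have Hp: "H p = mat 1" using D(1) by (simp add: H_def)
  have Hi: "smooth_at p Hi" unfolding Hi_def[abs_def] by (intro smooth_intros H) (simp add: Hp)
  have "matrix_inv (mat 1) = (mat 1 :: real^'r^'r)" by (rule matrix_inv_unique) simp
  then have Hip: "Hi p = mat 1" by (simp add: Hi_def Hp)
  have A': "smooth_at p (A' a)" for a unfolding A'_def[abs_def] by (intro smooth_intros Hi D(6) H)
  have q': "smooth_at p (q' a)" for a unfolding q'_def[abs_def] by (intro smooth_intros Hi D(7) H)
  have Hc: "cg (Suc m) p H (\<lambda>z. mat 1)"
    by (rule cgI[OF H]) (use rc in \<open>simp_all add: H_def del: vo.simps power_Suc\<close>)
  have Hic: "cg (Suc m) p Hi (\<lambda>z. mat 1)"
    using cg_matrix_inv[OF Hc] by (simp add: Hi_def[abs_def] Hp \<open>matrix_inv (mat 1) = mat 1\<close> cong: if_cong)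
  have evH: "\<forall>\<^sub>F z in nhds p. det (H z) \<noteq> 0"
    using H Hp by (intro eventually_nonzero smooth_intros) auto
  have E: "\<forall>\<^sub>F z in nhds p. partial a H z = H z ** A' a z - A a z ** H z" for a
    using evH by eventually_elim (simp add: A'_def Hi_def matrix_mul_assoc matrix_inv_both)
  have E2: "\<forall>\<^sub>F z in nhds p. \<forall>a. \<forall>\<^sub>F y in nhds z. partial a H y = H y ** A' a y - A a y ** H y"
    using E by (intro eventually_all_finite) (simp add: eventually_eventually)
  have sA: "\<forall>\<^sub>F z in nhds p. \<forall>a. smooth_at z (A a)" "\<forall>\<^sub>F z in nhds p. \<forall>a. smooth_at z (A' a)"
    using smooth_at_eventually[OF D(6)] smooth_at_eventually[OF A'] by (intro eventually_all_finite; simp)+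
  have "\<forall>\<^sub>F z in nhds p. z $ None > 0 \<longrightarrow> ym_current (sing G) A' a z = z $ None ^ (CARD('n) - 2) *\<^sub>R q' a z" for a
  proof -
    have "\<forall>\<^sub>F z in nhds p. z $ None > 0 \<longrightarrow> ym_current (sing G) A a z = z $ None ^ (CARD('n) - 2) *\<^sub>R q a z"
      using d by (simp add: datum_def)
    then show ?thesis using smooth_at_eventually[OF H] evH E2 sA
    proof eventually_elim
      case (elim z)
      have "H z ** ym_current (sing G) A' a z = ym_current (sing G) A a z ** H z"
        by (rule ym_current_gauge[OF elim(2)]) (use elim in blast)+
      then have "Hi z ** (H z ** ym_current (sing G) A' a z) = Hi z ** (ym_current (sing G) A a z ** H z)" by simp
      then have "ym_current (sing G) A' a z = Hi z ** (ym_current (sing G) A a z ** H z)"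
        using elim(3) by (simp add: Hi_def matrix_mul_assoc matrix_inv_both)
      then show ?case using elim(1) by (simp add: q'_def matmul_distribs matrix_mul_assoc)
    qed
  qed
  then have "datum p G A' q'" using d A' q' unfolding datum_def by simp
  moreover have "vo (Suc m) p (A' None)"
  proof -
    have "cg (Suc m) p (partial None H) (\<lambda>z. - (z $ None ^ m *\<^sub>R \<beta> z))"
    proof -
      have "\<forall>\<^sub>F z in nhds p. partial None H z = z $ None ^ Suc m *\<^sub>R partial None c z + - (z $ None ^ m *\<^sub>R \<beta> z)"
        using smooth_at_eventually[OF c] smooth_at_eventually[OF vo_smooth[OF rc]]
      proof eventually_elim
        case (elim z)
        have "partial None H z = partial None (\<lambda>z. z $ None ^ Suc m *\<^sub>R c z) z"
          unfolding H_def using elim by (simp add: partial_add del: power_Suc)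
        also have "\<dots> = z $ None ^ Suc m *\<^sub>R partial None c z + (real (Suc m) * z $ None ^ m) *\<^sub>R c z"
          using elim by (subst partial_scaleR) (simp_all only: smooth_intros partial_r_power if_True simp_thms)
        finally show ?case by (simp add: c_def del: power_Suc)
      qed
      then have "cg (Suc m) p (partial None H) (\<lambda>z. z $ None ^ Suc m *\<^sub>R partial None c z + - (z $ None ^ m *\<^sub>R \<beta> z))"
        by (rule cg_eventually[rotated]) (intro smooth_intros c \<beta>)
      moreover have "cg (Suc m) p (\<lambda>z. z $ None ^ Suc m *\<^sub>R partial None c z + - (z $ None ^ m *\<^sub>R \<beta> z)) (\<lambda>z. 0 + - (z $ None ^ m *\<^sub>R \<beta> z))"
      proof (intro cg_add cg_refl)
        show "cg (Suc m) p (\<lambda>z. z $ None ^ Suc m *\<^sub>R partial None c z) (\<lambda>z. 0)"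
          unfolding cg_0_iff by (rule vo_scaleR_left[OF vo_r_power smooth_at_partial[OF c]])
      qed (intro smooth_intros \<beta>)
      ultimately have "cg (Suc m) p (partial None H) (\<lambda>z. 0 + - (z $ None ^ m *\<^sub>R \<beta> z))"
        by (rule cg_trans)
      then show ?thesis by simp
    qed
    then have "cg (Suc m) p (A' None) (\<lambda>z. mat 1 ** (A None z ** mat 1 + - (z $ None ^ m *\<^sub>R \<beta> z)))"
      unfolding A'_def[abs_def] by (intro cg_matmul cg_add Hic Hc cg_refl D(6))
    then show ?thesis by (rule cg_vo) (use \<beta>(2) in \<open>simp del: vo.simps\<close>)
  qed
  moreover have "cg (Suc 0) p (A' (Some i)) (A (Some i))" for i
  proof -
    have "cg (Suc m) p (A' (Some i)) (\<lambda>z. mat 1 ** (A (Some i) z ** mat 1 + partial (Some i) (\<lambda>z. mat 1) z))"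
      unfolding A'_def[abs_def] by (intro cg_matmul cg_add Hic Hc cg_refl D(6) cg_partial_Some)
    then have "cg (Suc m) p (A' (Some i)) (A (Some i))" by simp
    then show ?thesis by (rule cg_le) simp
  qed
  moreover have "q' a p = q a p" for a by (simp add: q'_def Hp Hip)
  ultimately show ?thesis by (intro exI[of _ A'] exI[of _ q'] conjI allI)
qed

lemma normalize_metric:
  fixes G :: "real^'n::finite option \<Rightarrow> real^'n option^'n option" and A :: "'n option \<Rightarrow> real^'n option \<Rightarrow> real^'r::finite^'r"
  assumes d: "datum p G A q" and N: "normal (Suc 0) p G"
  shows "\<exists>G' A' q'. datum p G' A' q' \<and> normal (Suc m) p G' \<and>
    cg (Suc 0) p (tang G') (tang G) \<and> (\<forall>i. cg (Suc 0) p (A' (Some i)) (A (Some i))) \<and>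
    (\<forall>i. q' (Some i) p = q (Some i) p)"
proof (induction m)
  case 0
  have "cg (Suc 0) p (tang G) (tang G)" "cg (Suc 0) p (A (Some i)) (A (Some i))" for i
    using datumD(2,6)[OF d] by (auto intro!: cg_refl smooth_intros)
  then show ?case using d N by (intro exI conjI allI) (assumption | rule refl)+
next
  case (Suc m)
  then obtain G1 A1 q1 where 1: "datum p G1 A1 q1" "normal (Suc m) p G1"
    "cg (Suc 0) p (tang G1) (tang G)" "\<forall>i. cg (Suc 0) p (A1 (Some i)) (A (Some i))"
    "\<forall>i. q1 (Some i) p = q (Some i) p" by (elim exE conjE)
  have "1 \<le> Suc m" by simp
  from stage_step[OF 1(1) this 1(2)] obtain G2 A2 q2 where 2: "datum p G2 A2 q2" "normal (Suc (Suc m)) p G2"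
    "cg (Suc 0) p (tang G2) (tang G1)" "\<forall>i. cg (Suc 0) p (A2 (Some i)) (A1 (Some i))"
    "\<forall>i. q2 (Some i) p = q1 (Some i) p" by (elim exE conjE)
  have "cg (Suc 0) p (A2 (Some i)) (A (Some i))" for i
    using cg_trans[OF 2(4)[rule_format] 1(4)[rule_format]] .
  moreover have "q2 (Some i) p = q (Some i) p" for i using 1(5) 2(5) by simp
  ultimately show ?case using 2(1,2) cg_trans[OF 2(3) 1(3)]
    by (intro exI[of _ G2] exI[of _ A2] exI[of _ q2] conjI allI)
qed

lemma normalize_connection:
  fixes G :: "real^'n::finite option \<Rightarrow> real^'n option^'n option" and A :: "'n option \<Rightarrow> real^'n option \<Rightarrow> real^'r::finite^'r"
  assumes d: "datum p G A q"
  shows "\<exists>A' q'. datum p G A' q' \<and> vo m p (A' None) \<and>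
    (\<forall>i. cg (Suc 0) p (A' (Some i)) (A (Some i))) \<and> (\<forall>a. q' a p = q a p)"
proof (induction m)
  case 0
  have "cg (Suc 0) p (A (Some i)) (A (Some i))" "vo 0 p (A None)" for i
    using datumD(6)[OF d] by (auto intro!: cg_refl)
  then show ?case using d by (intro exI conjI allI) (assumption | rule refl)+
next
  case (Suc m)
  then obtain A1 q1 where 1: "datum p G A1 q1" "vo m p (A1 None)"
    "\<forall>i. cg (Suc 0) p (A1 (Some i)) (A (Some i))" "\<forall>a. q1 a p = q a p" by (elim exE conjE)
  from gauge_step[OF 1(1,2)] obtain A2 q2 where 2: "datum p G A2 q2" "vo (Suc m) p (A2 None)"
    "\<forall>i. cg (Suc 0) p (A2 (Some i)) (A1 (Some i))" "\<forall>a. q2 a p = q1 a p" by (elim exE conjE)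
  have "cg (Suc 0) p (A2 (Some i)) (A (Some i))" for i
    using cg_trans[OF 2(3)[rule_format] 1(3)[rule_format]] .
  moreover have "q2 a p = q a p" for a using 1(4) 2(4) by simp
  ultimately show ?case using 2(1,2) by (intro exI[of _ A2] exI[of _ q2] conjI allI)
qed

text \<open>The boundary value G_00 = 1 is no matter of coordinates but a consequence of the
  Einstein equation: at r = 0 the component \<open>None\<close>, \<open>None\<close> of r^2 Ric is -
  n, whatever the value of G_00.\<close>

lemma normal_one:
  fixes G :: "real^'n::finite option \<Rightarrow> real^'n option^'n option" and A :: "'n option \<Rightarrow> real^'n option \<Rightarrow> real^'r::finite^'r"
  assumes d: "datum p G A q" and n: "2 \<le> CARD('n)" and G0: "\<And>i. vo (Suc 0) p (\<lambda>z. G z $ None $ Some i)"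
  shows "normal (Suc 0) p G"
  unfolding normal_def
proof (intro conjI allI G0 cg_Suc_0I smooth_at_nth datumD(2)[OF d] smooth_at_const)
  have "vo (Suc 0) p (\<lambda>z. sing_ricci G z + real CARD('n) *\<^sub>R G z)"
    by (rule vo_le[OF datum_sing_ricci[OF d n]]) (use n in simp)
  note R = vo_SucD(1)[OF this]
  have G0e: "\<forall>\<^sub>F z in nhds p. \<forall>i. z $ None = 0 \<longrightarrow> G z $ None $ Some i = 0"
    using vo_SucD(1)[OF G0] by (intro eventually_all_finite)
  have sym: "\<forall>\<^sub>F z in nhds p. \<forall>i. G z $ Some i $ None = G z $ None $ Some i"
    using datum_sym_nth[OF d] by (intro eventually_all_finite)
  show "\<forall>\<^sub>F z in nhds p. z $ None = 0 \<longrightarrow> G z $ None $ None = 1"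
    using R G0e sym datum_near[OF d]
  proof eventually_elim
    case (elim z)
    show ?case
    proof
      assume z: "z $ None = 0"
      let ?I = "matrix_inv (G z)" and ?s = "G z $ None $ None"
      have g: "G z $ None $ Some i = 0" "G z $ Some i $ None = 0" for i using elim z by auto
      have "(?I ** G z) $ c $ None = ?I $ c $ None * ?s" for c
        by (simp add: matmul_nth sum_option g)
      then have I: "?I $ c $ None * ?s = (if c = None then 1 else 0)" for c
        using elim(4) by (simp add: matrix_inv_both mat_def)
      have s: "?s \<noteq> 0" using I[of None] by auto
      have I0: "?I $ Some i $ None = 0" for i using I[of "Some i"] s by simp
      \<comment> \<open>At r = 0 all derivatives drop out of \<open>sing_lc\<close>, and the
        computation becomes algebraic.\<close>
      have L: "sing_lc G a z $ c $ b = ?I $ c $ None * G z $ a $ b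
          - (if a = None \<and> c = b then 1 else 0) - (if b = None \<and> c = a then 1 else 0)" for a c b
        by (simp add: sing_lc_def z)
      have L0: "sing_lc G None z $ None $ None = - 1" "sing_lc G None z $ Some i $ None = 0"
        "sing_lc G None z $ Some i $ Some j = (if i = j then - 1 else 0)" for i j
        using I[of None] by (simp_all add: L I0 g)
      have Lk: "sing_lc G (Some k) z $ Some j $ None = (if j = k then - 1 else 0)" for k j
        by (simp add: L I0 g)
      have "sing_curv (sing_lc G) None None z = 0" by (simp add: sing_curv_def)
      moreover have "sing_curv (sing_lc G) (Some k) None z $ Some k $ None = - 1" for k
      proof -
        have "(sing_lc G (Some k) z ** sing_lc G None z) $ Some k $ None = 1"
          by (simp add: matmul_nth sum_option L0 Lk)
        moreover have "(sing_lc G None z ** sing_lc G (Some k) z) $ Some k $ None = (\<Sum>j\<in>UNIV. if j = k then 1 else 0)"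
          unfolding matmul_nth sum_option L0 Lk mult_zero_left add_0 by (rule sum.cong) auto
        ultimately show ?thesis by (simp add: sing_curv_def z Lk)
      qed
      ultimately have "sing_ricci G z $ None $ None = (\<Sum>i\<in>(UNIV::'n set). - 1)"
        by (simp add: sing_ricci_def sum_option)
      moreover have "sing_ricci G z $ None $ None + real CARD('n) * ?s = 0"
        using arg_cong[OF elim(1)[rule_format, OF z], of "\<lambda>X. X $ None $ None"] by simp
      ultimately have "real CARD('n) * (?s - 1) = 0" by (simp add: algebra_simps)
      then show "?s = 1" using n by simp
    qed
  qed
qed

section \<open>The Einstein equation in normal form\<close>

definition collar_metric :: "(real^'n::finite option \<Rightarrow> real^'n^'n) \<Rightarrow> real^'n option \<Rightarrow> real^'n option^'n option" where
  "collar_metric h z = (\<chi> a b. case a of None \<Rightarrow> (case b of None \<Rightarrow> 1 | Some j \<Rightarrow> 0)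
    | Some i \<Rightarrow> (case b of None \<Rightarrow> 0 | Some j \<Rightarrow> h z $ i $ j))"

lemma collar_metric_nth [simp]:
  "collar_metric h z $ None $ None = 1" "collar_metric h z $ None $ Some j = 0"
  "collar_metric h z $ Some i $ None = 0" "collar_metric h z $ Some i $ Some j = h z $ i $ j"
  by (simp_all add: collar_metric_def)

lemma smooth_at_collar_metric [smooth_intros]: "smooth_at p h \<Longrightarrow> smooth_at p (collar_metric h)"
proof (rule smooth_at_vecI, rule smooth_at_vecI)
  show "smooth_at p (\<lambda>z. collar_metric h z $ a $ b)" if "smooth_at p h" for a b
    using that by (cases a; cases b) (auto intro!: smooth_intros)
qed

lemma collar_metric_inv:
  assumes "det (h z) \<noteq> 0"
  shows "matrix_inv (collar_metric h z) = collar_metric (\<lambda>z. matrix_inv (h z)) z" "det (collar_metric h z) \<noteq> 0"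
proof -
  have "(collar_metric h z ** collar_metric (\<lambda>z. matrix_inv (h z)) z) $ a $ b = mat 1 $ a $ b" for a b
  proof (cases a; cases b)
    fix i j assume ij: "a = Some i" "b = Some j"
    have "(collar_metric h z ** collar_metric (\<lambda>z. matrix_inv (h z)) z) $ a $ b = (h z ** matrix_inv (h z)) $ i $ j"
      by (simp add: ij matmul_nth sum_option)
    then show ?thesis by (simp add: matrix_inv_both assms ij mat_def)
  qed (simp_all add: matmul_nth sum_option mat_def)
  then have "collar_metric h z ** collar_metric (\<lambda>z. matrix_inv (h z)) z = mat 1" by (simp add: vec_eq_iff)
  then show "matrix_inv (collar_metric h z) = collar_metric (\<lambda>z. matrix_inv (h z)) z" "det (collar_metric h z) \<noteq> 0"
    by (rule matrix_inv_unique)+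
qed

definition euler :: "(real^'n::finite option \<Rightarrow> 'b::real_normed_vector) \<Rightarrow> real^'n option \<Rightarrow> 'b" where
  "euler f z = z $ None *\<^sub>R partial None f z"

lemma smooth_at_euler [smooth_intros]: "smooth_at p f \<Longrightarrow> smooth_at p (euler f)"
  unfolding euler_def[abs_def] by (intro smooth_intros)

text \<open>The Levi-Civita connection, curvature and Ricci tensor along the slices of constant \<open>r\<close>.\<close>

definition tlc :: "(real^'n::finite option \<Rightarrow> real^'n^'n) \<Rightarrow> 'n \<Rightarrow> real^'n option \<Rightarrow> real^'n^'n" where
  "tlc h i z = (\<chi> l j. (1/2) * (\<Sum>m\<in>UNIV. matrix_inv (h z) $ l $ m *
    (partial (Some i) (\<lambda>y. h y $ m $ j) z + partial (Some j) (\<lambda>y. h y $ m $ i) z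
      - partial (Some m) (\<lambda>y. h y $ i $ j) z)))"

definition tcurv :: "('n::finite \<Rightarrow> real^'n option \<Rightarrow> real^'r::finite^'r) \<Rightarrow> 'n \<Rightarrow> 'n \<Rightarrow> real^'n option \<Rightarrow> real^'r^'r" where
  "tcurv A i j z = partial (Some i) (A j) z - partial (Some j) (A i) z + A i z ** A j z - A j z ** A i z"

definition tric :: "(real^'n::finite option \<Rightarrow> real^'n^'n) \<Rightarrow> real^'n option \<Rightarrow> real^'n^'n" where
  "tric h z = (\<chi> i j. \<Sum>k\<in>UNIV. tcurv (tlc h) k i z $ k $ j)"

definition tau :: "(real^'n::finite option \<Rightarrow> real^'n^'n) \<Rightarrow> real^'n option \<Rightarrow> real" where
  "tau h z = (\<Sum>i\<in>UNIV. (matrix_inv (h z) ** euler h z) $ i $ i)"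

text \<open>The tangential part of r^2 (Ric + n g) for g = r^(-2) (dr^2 + h), see
  \<open>sing_ricci_collar_metric_tang\<close>. Written with r d/dr, it is an equation of Fuchsian
  type for h.\<close>

definition einstein_expr :: "(real^'n::finite option \<Rightarrow> real^'n^'n) \<Rightarrow> real^'n option \<Rightarrow> real^'n^'n" where
  "einstein_expr h z = (- 1/2) *\<^sub>R (euler (euler h) z - real CARD('n) *\<^sub>R euler h z - euler h z ** matrix_inv (h z) ** euler h z
    - tau h z *\<^sub>R h z + (tau h z / 2) *\<^sub>R euler h z) + (z $ None)\<^sup>2 *\<^sub>R tric h z"

text \<open>The covariant derivative along the slices of their unit normal field r d/dr with respect
  to r^(-2) (dr^2 + h), that is, their Weingarten map up to sign. The identity matrix comes from the
  factor r^(-2).\<close>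

definition shape :: "(real^'n::finite option \<Rightarrow> real^'n^'n) \<Rightarrow> real^'n option \<Rightarrow> real^'n^'n" where
  "shape h z = (1/2) *\<^sub>R (matrix_inv (h z) ** euler h z) - mat 1"

lemma smooth_at_tlc [smooth_intros]: "smooth_at p h \<Longrightarrow> det (h p) \<noteq> 0 \<Longrightarrow> smooth_at p (tlc h i)"
  unfolding tlc_def[abs_def] by (intro smooth_intros)

lemma smooth_at_tau [smooth_intros]: "smooth_at p h \<Longrightarrow> det (h p) \<noteq> 0 \<Longrightarrow> smooth_at p (tau h)"
  unfolding tau_def[abs_def] by (intro smooth_intros)

lemma smooth_at_shape [smooth_intros]: "smooth_at p h \<Longrightarrow> det (h p) \<noteq> 0 \<Longrightarrow> smooth_at p (shape h)"
  unfolding shape_def[abs_def] by (intro smooth_intros)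

lemma partial_collar_metric:
  assumes "smooth_at z h"
  shows "partial e (\<lambda>y. collar_metric h y $ a $ b) z = (case a of None \<Rightarrow> 0 | Some i \<Rightarrow> (case b of None \<Rightarrow> 0 | Some j \<Rightarrow> partial e h z $ i $ j))"
  by (cases a; cases b) (simp_all add: partial_nth2 assms)

lemma sing_lc_collar_metric:
  fixes h :: "real^'n::finite option \<Rightarrow> real^'n^'n"
  assumes h: "smooth_at z h" "det (h z) \<noteq> 0"
  shows "sing_lc (collar_metric h) None z $ None $ None = - 1" "sing_lc (collar_metric h) None z $ None $ Some j = 0"
    "sing_lc (collar_metric h) None z $ Some i $ None = 0" "sing_lc (collar_metric h) None z $ Some i $ Some j = shape h z $ i $ j"
    "sing_lc (collar_metric h) (Some k) z $ None $ None = 0" "sing_lc (collar_metric h) (Some k) z $ None $ Some j = h z $ k $ j - (1/2) * euler h z $ k $ j"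
    "sing_lc (collar_metric h) (Some k) z $ Some i $ None = shape h z $ i $ k"
    "sing_lc (collar_metric h) (Some k) z $ Some i $ Some j = z $ None * tlc h k z $ i $ j"
  by (simp_all add: sing_lc_def collar_metric_inv[where h = h and z = z, OF h(2)] partial_collar_metric[OF h(1)] sum_option shape_def matmul_nth euler_def mat_def
      sum_distrib_left tlc_def partial_nth2[OF h(1)] algebra_simps)

lemma sing_lc_collar_metric_eventually:
  fixes h :: "real^'n::finite option \<Rightarrow> real^'n^'n"
  assumes h: "smooth_at z h" "det (h z) \<noteq> 0"
  shows "\<forall>\<^sub>F y in nhds z. smooth_at y h \<and> det (h y) \<noteq> 0"
  using smooth_at_eventually[OF h(1)] eventually_nonzero[OF smooth_at_det[OF h(1)] h(2)] by (rule eventually_conj)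

lemma partial_sing_lc_collar_metric:
  fixes h :: "real^'n::finite option \<Rightarrow> real^'n^'n"
  assumes h: "smooth_at z h" "det (h z) \<noteq> 0"
  shows "partial a (sing_lc (collar_metric h) None) z $ None $ None = 0" "partial a (sing_lc (collar_metric h) None) z $ None $ Some j = 0"
    "partial a (sing_lc (collar_metric h) None) z $ Some i $ Some j = partial a (shape h) z $ i $ j"
    "partial a (sing_lc (collar_metric h) (Some k)) z $ None $ Some j = partial a h z $ k $ j - (1/2) * partial a (euler h) z $ k $ j"
    "partial a (sing_lc (collar_metric h) (Some k)) z $ Some i $ Some j =
      z $ None * partial a (tlc h k) z $ i $ j + (if a = None then tlc h k z $ i $ j else 0)"
proof -
  note ev = sing_lc_collar_metric_eventually[OF h]
  have sB: "smooth_at z (sing_lc (collar_metric h) b)" for b by (intro smooth_intros h collar_metric_inv(2)[where h = h and z = z, OF h(2)])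
  have P: "partial a (sing_lc (collar_metric h) b) z $ i $ j = partial a f z" if "\<forall>\<^sub>F y in nhds z. sing_lc (collar_metric h) b y $ i $ j = f y" for b i j f
    using partial_cong[OF that, of a] by (simp add: partial_nth2[OF sB])
  show "partial a (sing_lc (collar_metric h) None) z $ None $ None = 0"
    by (subst P[of _ _ _ "\<lambda>y. -1"]) (use ev in \<open>eventually_elim, simp add: sing_lc_collar_metric\<close>, simp)
  show "partial a (sing_lc (collar_metric h) None) z $ None $ Some j = 0"
    by (subst P[of _ _ _ "\<lambda>y. 0"]) (use ev in \<open>eventually_elim, simp add: sing_lc_collar_metric\<close>, simp)
  have sM: "smooth_at z (shape h)" by (intro smooth_intros h)
  show "partial a (sing_lc (collar_metric h) None) z $ Some i $ Some j = partial a (shape h) z $ i $ j"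
    by (subst P[of _ _ _ "\<lambda>y. shape h y $ i $ j"]) (use ev in \<open>eventually_elim, simp add: sing_lc_collar_metric\<close>, simp add: partial_nth2 sM)
  have sh: "smooth_at z (\<lambda>y. h y $ k $ j)" "smooth_at z (\<lambda>y. (1/2) * euler h y $ k $ j)" by (intro smooth_intros h)+
  have st: "smooth_at z (euler h)" by (intro smooth_intros h)
  have "partial a (\<lambda>y. (1/2) * euler h y $ k $ j) z = (1/2) * partial a (\<lambda>y. euler h y $ k $ j) z"
    by (rule partial_linear[OF bounded_linear_mult_right]) (intro smooth_intros st)
  then have "partial a (\<lambda>y. (1/2) * euler h y $ k $ j) z = (1/2) * partial a (euler h) z $ k $ j"
    by (simp only: partial_nth2[OF st])
  then show "partial a (sing_lc (collar_metric h) (Some k)) z $ None $ Some j = partial a h z $ k $ j - (1/2) * partial a (euler h) z $ k $ j"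
    by (subst P[of _ _ _ "\<lambda>y. h y $ k $ j - (1/2) * euler h y $ k $ j"])
      (use ev in \<open>eventually_elim, simp add: sing_lc_collar_metric\<close>, simp only: partial_diff[OF sh] partial_nth2[OF h(1)])
  have sT: "smooth_at z (tlc h k)" by (intro smooth_intros h)
  show "partial a (sing_lc (collar_metric h) (Some k)) z $ Some i $ Some j =
      z $ None * partial a (tlc h k) z $ i $ j + (if a = None then tlc h k z $ i $ j else 0)"
    by (subst P[of _ _ _ "\<lambda>y. y $ None * tlc h k y $ i $ j"])
      (use ev in \<open>eventually_elim, simp add: sing_lc_collar_metric\<close>, simp add: partial_mult smooth_intros sT partial_nth2)
qed

lemma euler_nth: "euler f z $ i = z $ None *\<^sub>R partial None f z $ i"
  by (simp add: euler_def)

lemma transpose_diff: "transpose (X - Y) = transpose X - transpose Y" for X Y :: "real^'b::finite^'c::finite"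
  by (simp add: vec_eq_iff transpose_def)

lemma sing_ricci_collar_metric_tang:
  fixes h :: "real^'n::finite option \<Rightarrow> real^'n^'n"
  assumes h: "smooth_at z h" "det (h z) \<noteq> 0" and sym: "\<forall>\<^sub>F y in nhds z. transpose (h y) = h y"
  shows "tang (sing_ricci (collar_metric h)) z + real CARD('n) *\<^sub>R h z = einstein_expr h z"
proof -
  let ?I = "matrix_inv (h z)" and ?k = "euler h z" and ?r = "z $ None"
  \<comment> \<open>r times the Christoffel symbols with upper index \<open>None\<close>: the second
    fundamental form of the slices up to normalisation.\<close>
  define B where "B = h z - (1/2) *\<^sub>R ?k"
  define M where "M = shape h z"
  have hs: "transpose (h z) = h z" using sym by (rule eventually_nhds_x_imp_x)
  have "transpose (partial None h z) = partial None h z"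
    using partial_cong[OF sym, of None] by (simp add: partial_transpose[OF h(1)])
  then have ks: "transpose ?k = ?k" by (simp add: euler_def transpose_distribs)
  have Is: "transpose ?I = ?I"
  proof -
    have "h z ** transpose ?I = transpose (?I ** h z)" by (simp add: matrix_transpose_mul hs)
    then have "matrix_inv (h z) = transpose ?I" by (intro matrix_inv_unique(1)) (simp add: matrix_inv_both h(2))
    then show ?thesis by simp
  qed
  have BM: "B ** M = ?k - h z - (1/4) *\<^sub>R (?k ** ?I ** ?k)"
    by (simp add: B_def M_def shape_def matmul_distribs matrix_mul_assoc matrix_inv_both h(2) scaleR_diff_right)
  \<comment> \<open>The product B M turns out to be symmetric, so the two products that occur in the
    Ricci tensor coincide.\<close>
  have "transpose B = B" by (simp add: B_def transpose_diff hs ks transpose_distribs)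
  then have "transpose M ** B = transpose (B ** M)" by (simp add: matrix_transpose_mul)
  also have "transpose (B ** M) = B ** M"
    unfolding BM by (simp add: transpose_diff transpose_distribs matrix_transpose_mul hs ks Is matrix_mul_assoc)
  finally have MB: "transpose M ** B = ?k - h z - (1/4) *\<^sub>R (?k ** ?I ** ?k)" unfolding BM .
  have trM: "(\<Sum>k\<in>UNIV. M $ k $ k) = tau h z / 2 - real CARD('n)"
    by (simp add: M_def shape_def tau_def mat_def sum_subtractf sum_divide_distrib)
  have "tang (sing_ricci (collar_metric h)) z $ i $ j = (euler h z - (1/2) *\<^sub>R euler (euler h) z - 2 *\<^sub>R B - B ** M
      + (\<Sum>k\<in>UNIV. M $ k $ k) *\<^sub>R B - transpose M ** B + ?r\<^sup>2 *\<^sub>R tric h z) $ i $ j" for i j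
  proof -
    have "sing_curv (sing_lc (collar_metric h)) None (Some i) z $ None $ Some j =
        (euler h z $ i $ j - (1/2) * euler (euler h) z $ i $ j) - 2 * B $ i $ j - (B ** M) $ i $ j"
      by (simp add: sing_curv_def partial_sing_lc_collar_metric[OF h] matmul_nth sum_option sing_lc_collar_metric[OF h] B_def M_def euler_nth algebra_simps)
    moreover have "sing_curv (sing_lc (collar_metric h)) (Some k) (Some i) z $ Some k $ Some j =
        M $ k $ k * B $ i $ j - M $ k $ i * B $ k $ j + ?r\<^sup>2 * tcurv (tlc h) k i z $ k $ j" for k
      by (simp add: sing_curv_def partial_sing_lc_collar_metric[OF h] matmul_nth sum_option sing_lc_collar_metric[OF h] B_def[symmetric] M_def[symmetric]
          tcurv_def sum_distrib_left power2_eq_square algebra_simps)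
        (simp add: B_def algebra_simps)
    ultimately have "tang (sing_ricci (collar_metric h)) z $ i $ j = (euler h z $ i $ j - (1/2) * euler (euler h) z $ i $ j) - 2 * B $ i $ j - (B ** M) $ i $ j
       + (\<Sum>k\<in>UNIV. M $ k $ k * B $ i $ j - M $ k $ i * B $ k $ j + ?r\<^sup>2 * tcurv (tlc h) k i z $ k $ j)"
      by (simp add: tang_def sing_ricci_def sum_option)
    then show ?thesis
      by (simp add: sum.distrib sum_subtractf sum_distrib_left sum_distrib_right matmul_nth[of "transpose M"] transpose_nth tric_def)
  qed
  then have "tang (sing_ricci (collar_metric h)) z = euler h z - (1/2) *\<^sub>R euler (euler h) z - 2 *\<^sub>R B - B ** M
      + (\<Sum>k\<in>UNIV. M $ k $ k) *\<^sub>R B - transpose M ** B + ?r\<^sup>2 *\<^sub>R tric h z"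
    by (simp add: vec_eq_iff)
  from this[unfolded trM BM MB] show ?thesis
    by (simp add: einstein_expr_def B_def vec_eq_iff algebra_simps)
qed

text \<open>The Codazzi equation of the slices. The sum over k of
  \<open>euler (tlc h k) z $ k $ j\<close> is the derivative of the trace of \<open>shape\<close> in
  another form, since contracted Christoffel symbols are derivatives of half the logarithm of det
  h.\<close>

lemma sing_ricci_collar_metric_mixed:
  fixes h :: "real^'n::finite option \<Rightarrow> real^'n^'n"
  assumes h: "smooth_at z h" "det (h z) \<noteq> 0"
  shows "sing_ricci (collar_metric h) z $ None $ Some j = z $ None * (\<Sum>k\<in>UNIV. partial (Some k) (shape h) z $ k $ j - euler (tlc h k) z $ k $ j
    + (tlc h k z ** shape h z - shape h z ** tlc h k z) $ k $ j)"
proof -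
  have "sing_curv (sing_lc (collar_metric h)) None None z = 0" by (simp add: sing_curv_def)
  moreover have "sing_curv (sing_lc (collar_metric h)) (Some k) None z $ Some k $ Some j = z $ None * (partial (Some k) (shape h) z $ k $ j - euler (tlc h k) z $ k $ j
    + (tlc h k z ** shape h z - shape h z ** tlc h k z) $ k $ j)" for k
    by (simp add: sing_curv_def partial_sing_lc_collar_metric[OF h] matmul_nth sum_option sing_lc_collar_metric[OF h] euler_nth
        sum_distrib_left algebra_simps)
  ultimately show ?thesis
    by (simp add: sing_ricci_def sum_option sum_distrib_left)
qed

section \<open>Boundary fields as fields that do not depend on r\<close>

definition tl_coord :: "real^'n::finite option \<Rightarrow> real^'n" where
  "tl_coord z = (\<chi> i. z $ Some i)"

lemma tl_coord_nth [simp]: "tl_coord z $ i = z $ Some i"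
  by (simp add: tl_coord_def)

lemma smooth_at_tl_coord [smooth_intros]: "smooth_at p tl_coord"
  unfolding tl_coord_def[abs_def] by (intro smooth_intros)

lemma smooth_at_tl_comp: "smooth_at (tl_coord p) f \<Longrightarrow> smooth_at p (\<lambda>z. f (tl_coord z))"
  by (rule smooth_at_compose[OF smooth_at_tl_coord])

lemma partial_tl_comp:
  assumes "smooth_at (tl_coord z) f"
  shows "partial a (\<lambda>y. f (tl_coord y)) z = (case a of None \<Rightarrow> 0 | Some i \<Rightarrow> partial i f (tl_coord z))"
proof -
  have "partial a (\<lambda>y. f (tl_coord y)) z = (\<Sum>j\<in>UNIV. (if Some j = a then 1 else 0) *\<^sub>R partial j f (tl_coord z))"
    by (simp add: partial_comp[OF smooth_at_tl_coord assms])
  also have "\<dots> = (case a of None \<Rightarrow> 0 | Some i \<Rightarrow> partial i f (tl_coord z))"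
    by (cases a) (simp_all add: if_distrib if_distribR cong: if_cong)
  finally show ?thesis .
qed

lemma eventually_tl: "\<forall>\<^sub>F x in nhds (tl_coord p). P x \<Longrightarrow> \<forall>\<^sub>F z in nhds p. P (tl_coord z)"
  by (rule eventually_nhds_comp[OF smooth_at_tl_coord])

lemma tlc_tl:
  fixes g :: "real^'n::finite \<Rightarrow> real^'n^'n"
  assumes "smooth_at (tl_coord z) g"
  shows "tlc (\<lambda>z. g (tl_coord z)) i z = levi_civita g i (tl_coord z)"
proof -
  have "partial (Some i) (\<lambda>y. g (tl_coord y) $ a $ b) z = partial i (\<lambda>x. g x $ a $ b) (tl_coord z)" for i a b
    by (subst partial_tl_comp[where f = "\<lambda>x. g x $ a $ b"]) (auto intro!: smooth_intros assms)
  then show ?thesis by (simp add: tlc_def levi_civita_def)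
qed

lemma tcurv_tl:
  fixes A :: "'n::finite \<Rightarrow> real^'n \<Rightarrow> real^'r::finite^'r"
  assumes "\<And>i. smooth_at (tl_coord z) (A i)"
  shows "tcurv (\<lambda>i z. A i (tl_coord z)) i j z = curv A i j (tl_coord z)"
  by (simp add: tcurv_def curv_def partial_tl_comp assms)

lemma tcurv_cong:
  assumes "\<And>i. \<forall>\<^sub>F y in nhds z. A i y = B i y"
  shows "tcurv A i j z = tcurv B i j z"
proof -
  have "A i z = B i z" for i using assms by (rule eventually_nhds_x_imp_x)
  then show ?thesis by (simp add: tcurv_def partial_cong[OF assms])
qed

lemma tric_tl:
  fixes g :: "real^'n::finite \<Rightarrow> real^'n^'n"
  assumes g: "smooth_at (tl_coord z) g" "det (g (tl_coord z)) \<noteq> 0"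
  shows "tric (\<lambda>z. g (tl_coord z)) z = ricci g (tl_coord z)"
proof -
  have ev: "\<forall>\<^sub>F y in nhds z. tlc (\<lambda>z. g (tl_coord z)) i y = levi_civita g i (tl_coord y)" for i
    using eventually_tl[OF smooth_at_eventually[OF g(1)]] by eventually_elim (rule tlc_tl)
  show ?thesis
    by (simp add: tric_def ricci_def tcurv_cong[OF ev] tcurv_tl smooth_at_levi_civita g)
qed

text \<open>Conformal change along the slices. It is used for the factor (1 - \<mu> r^2/2)^2, whose
  tangential derivatives come from those of \<mu>.\<close>

lemma tlc_scale:
  fixes h :: "real^'n::finite option \<Rightarrow> real^'n^'n" and \<psi> :: "real^'n option \<Rightarrow> real"
  assumes h: "smooth_at z h" "det (h z) \<noteq> 0" and \<psi>: "smooth_at z \<psi>" "\<psi> z \<noteq> 0"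
  shows "tlc (\<lambda>y. \<psi> y *\<^sub>R h y) i z $ l $ j = tlc h i z $ l $ j + (1 / (2 * \<psi> z)) *
    ((if l = j then partial (Some i) \<psi> z else 0) + (if l = i then partial (Some j) \<psi> z else 0)
      - h z $ i $ j * (\<Sum>m\<in>UNIV. matrix_inv (h z) $ l $ m * partial (Some m) \<psi> z))"
proof -
  let ?I = "matrix_inv (h z)"
  have p: "partial a (\<lambda>y. (\<psi> y *\<^sub>R h y) $ m $ j) z = \<psi> z * partial a (\<lambda>y. h y $ m $ j) z + partial a \<psi> z * h z $ m $ j" for a m j
  proof -
    have "partial a (\<lambda>y. \<psi> y * (h y $ m $ j)) z = \<psi> z * partial a (\<lambda>y. h y $ m $ j) z + partial a \<psi> z * h z $ m $ j"
      by (rule partial_mult) (intro smooth_intros h \<psi>)+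
    then show ?thesis by simp
  qed
  have I: "(\<Sum>m\<in>UNIV. ?I $ l $ m * h z $ m $ j) = (if l = j then 1 else 0)" for l j
    using matrix_inv_both(2)[OF h(2)] by (simp add: matmul_nth[symmetric] mat_def)
  have "tlc (\<lambda>y. \<psi> y *\<^sub>R h y) i z $ l $ j = (1/2) * (\<Sum>m\<in>UNIV. ?I $ l $ m *
      (partial (Some i) (\<lambda>y. h y $ m $ j) z + partial (Some j) (\<lambda>y. h y $ m $ i) z - partial (Some m) (\<lambda>y. h y $ i $ j) z)
      + (1 / \<psi> z) * (partial (Some i) \<psi> z * (?I $ l $ m * h z $ m $ j) + partial (Some j) \<psi> z * (?I $ l $ m * h z $ m $ i)
        - h z $ i $ j * (?I $ l $ m * partial (Some m) \<psi> z)))"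
    using \<psi>(2) unfolding tlc_def vec_lambda_beta p matrix_inv_scaleR[OF \<psi>(2) h(2)]
    by (intro arg_cong[where f = "(*) (1/2)"] sum.cong refl) (simp add: field_simps)
  also have "\<dots> = tlc h i z $ l $ j + (1/2) * (1 / \<psi> z) *
     (partial (Some i) \<psi> z * (\<Sum>m\<in>UNIV. ?I $ l $ m * h z $ m $ j) + partial (Some j) \<psi> z * (\<Sum>m\<in>UNIV. ?I $ l $ m * h z $ m $ i)
        - h z $ i $ j * (\<Sum>m\<in>UNIV. ?I $ l $ m * partial (Some m) \<psi> z))"
    unfolding tlc_def vec_lambda_beta sum.distrib sum_distrib_left[symmetric] sum_subtractf by (simp add: algebra_simps)
  finally show ?thesis unfolding I by (simp add: if_distrib cong: if_cong)
qed

lemma cg_euler [cg_intros]: "cg m p f g \<Longrightarrow> cg m p (euler f) (euler g)"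
  unfolding euler_def[abs_def] by (rule cg_D)

lemma cg_tlc [cg_intros]:
  assumes "cg m p h h'" "det (h p) \<noteq> 0" "det (h' p) \<noteq> 0"
  shows "cg m p (tlc h i) (tlc h' i)"
  unfolding tlc_def[abs_def] using assms by (intro cg_intros cg_refl smooth_at_const)

lemma cg_tcurv [cg_intros]:
  assumes "\<And>i. cg m p (A i) (A' i)"
  shows "cg m p (tcurv A i j) (tcurv A' i j)"
  unfolding tcurv_def[abs_def] using assms by (intro cg_intros)

lemma cg_tric [cg_intros]:
  assumes "cg m p h h'" "det (h p) \<noteq> 0" "det (h' p) \<noteq> 0"
  shows "cg m p (tric h) (tric h')"
  unfolding tric_def[abs_def] using assms by (intro cg_intros)

section \<open>Uniqueness of the expansion of h below order n\<close>

lemma vo_euler: "vo m p f \<Longrightarrow> vo (Suc m) p (\<lambda>z. euler f z - real m *\<^sub>R f z)"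
  unfolding euler_def by (rule vo_theta)

lemma vo_1_euler: "smooth_at p f \<Longrightarrow> vo (Suc 0) p (euler f)"
  using vo_euler[of 0 p f] by (simp del: vo.simps(2))

lemma euler_diff_eventually:
  assumes "smooth_at p f" "smooth_at p g"
  shows "\<forall>\<^sub>F z in nhds p. euler (\<lambda>z. f z - g z) z = euler f z - euler g z"
  using eventually_partial_diff[OF assms, of None] by eventually_elim (simp add: euler_def scaleR_diff_right)

lemma tau_diff_vo:
  fixes X Y :: "real^'n::finite option \<Rightarrow> real^'n^'n"
  shows "vo m p X \<Longrightarrow> vo m p (\<lambda>z. \<Sum>i\<in>UNIV. X z $ i $ i)"
  by (intro vo_sum vo_nth)

lemma vo_eq: "vo m p f \<Longrightarrow> (\<And>z. f z = g z) \<Longrightarrow> vo m p g"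
  by (simp add: ext[of f g])

lemma vo_cancel_const:
  assumes "c \<noteq> 0" "vo m p (\<lambda>z. c *\<^sub>R f z)"
  shows "vo m p f"
  by (rule vo_eq[OF vo_scaleR_right[OF smooth_at_const[of p "1 / c"] assms(2)]]) (use assms(1) in simp)

text \<open>The term \<open>c r\<^sup>m\<close> of \<open>h\<close> contributes \<open>-1/2 (m (m - n) c - m tr(c) h) r\<^sup>m\<close>, which determines \<open>c\<close> for
  \<open>0 < m < n\<close>.\<close>

lemma einstein_expr_step:
  fixes h h' :: "real^'n::finite option \<Rightarrow> real^'n^'n"
  assumes c: "cg m p h h'" and m: "1 \<le> m" "m < CARD('n)"
    and d: "det (h p) \<noteq> 0" "det (h' p) \<noteq> 0"
    and E: "vo (Suc m) p (einstein_expr h)" "vo (Suc m) p (einstein_expr h')"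
  shows "cg (Suc m) p h h'"
proof -
  let ?n = "real CARD('n)"
  define D where "D z = h z - h' z" for z
  define I where "I z = matrix_inv (h z)" for z
  define I' where "I' z = matrix_inv (h' z)" for z
  define t where "t z = (\<Sum>i\<in>UNIV. (I z ** D z) $ i $ i)" for z
  note s = cgD(1,2)[OF c]
  have D: "vo m p D" unfolding D_def[abs_def] by (rule cgD(3)[OF c])
  have sD: "smooth_at p D" by (rule vo_smooth[OF D])
  have sI: "smooth_at p I" "smooth_at p I'" unfolding I_def[abs_def] I'_def[abs_def] by (intro smooth_intros s d)+
  have st: "smooth_at p t" unfolding t_def[abs_def] by (intro smooth_intros sI sD)
  have cI: "cg m p I I'" unfolding I_def[abs_def] I'_def[abs_def] by (intro cg_intros c d)
  have vI: "vo m p (\<lambda>z. I z - I' z)" by (rule cgD(3)[OF cI])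
  have thd: "\<forall>\<^sub>F z in nhds p. euler h z - euler h' z = euler D z"
    using euler_diff_eventually[OF s] by eventually_elim (simp add: D_def[abs_def])
  have T1: "vo (Suc m) p (\<lambda>z. (euler h z - euler h' z) - real m *\<^sub>R D z)"
    by (rule vo_cong[OF _ vo_euler[OF D]]) (use thd in eventually_elim, simp)
  have T1m: "vo m p (\<lambda>z. euler h z - euler h' z)"
    by (rule cgD(3)[OF cg_euler[OF c]])
  \<comment> \<open>The operator (r d/dr)^2 - m^2 is written as (r d/dr + m) (r d/dr - m), and the
    last factor is controlled by T1.\<close>
  have T2: "vo (Suc m) p (\<lambda>z. (euler (euler h) z - euler (euler h') z) - (real m)\<^sup>2 *\<^sub>R D z)"
  proof -
    have "vo (Suc m) p (\<lambda>z. euler (\<lambda>z. (euler h z - euler h' z) - real m *\<^sub>R D z) z + real m *\<^sub>R ((euler h z - euler h' z) - real m *\<^sub>R D z))"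
      by (intro vo_add vo_scaleR_right smooth_at_const T1) (use vo_D[OF T1, of None] in \<open>simp only: euler_def[abs_def]\<close>)
    moreover have "\<forall>\<^sub>F z in nhds p. euler (\<lambda>z. (euler h z - euler h' z) - real m *\<^sub>R D z) z + real m *\<^sub>R ((euler h z - euler h' z) - real m *\<^sub>R D z)
        = (euler (euler h) z - euler (euler h') z) - (real m)\<^sup>2 *\<^sub>R D z"
      using smooth_at_eventually[OF s(1)] smooth_at_eventually[OF s(2)] smooth_at_eventually[OF sD] thd
    proof eventually_elim
      case (elim z)
      have "euler (\<lambda>z. (euler h z - euler h' z) - real m *\<^sub>R D z) z = euler (euler h) z - euler (euler h') z - real m *\<^sub>R euler D z"
        unfolding euler_def[of "\<lambda>z. (euler h z - euler h' z) - real m *\<^sub>R D z"]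
        using elim by (simp add: partial_diff smooth_intros partial_linear[OF bounded_linear_scaleR_right] euler_def[of "euler _"] euler_def[of D] scaleR_diff_right)
      then show ?case using elim(4) by (simp add: power2_eq_square algebra_simps)
    qed
    ultimately show ?thesis by (rule vo_cong[rotated])
  qed
  have v1: "vo (Suc 0) p (euler h)" "vo (Suc 0) p (euler h')" by (rule vo_1_euler, rule s)+
  have sth: "smooth_at p (euler h)" "smooth_at p (euler h')" by (intro smooth_intros s)+
  have up: "vo (m + Suc 0) p f \<Longrightarrow> vo (Suc m) p f" "vo (Suc 0 + m) p f \<Longrightarrow> vo (Suc m) p f" for f :: "real^'n option \<Rightarrow> 'z::euclidean_space" by simp_all
  \<comment> \<open>As r dh/dr is O(r), a quadratic term gains one order over D and does not affect
    the coefficient of r^m.\<close>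
  have Q: "vo (Suc m) p (\<lambda>z. euler h z ** I z ** euler h z - euler h' z ** I' z ** euler h' z)"
  proof -
    have "vo (Suc m) p (\<lambda>z. (euler h z - euler h' z) ** I z ** euler h z + euler h' z ** (I z - I' z) ** euler h z + euler h' z ** I' z ** (euler h z - euler h' z))"
      by (intro vo_add up(1)[OF vo_matmul[OF vo_matmul_left[OF T1m sI(1)] v1(1)]]
          vo_matmul_left[OF up(2)[OF vo_matmul[OF v1(2) vI]] sth(1)]
          up(2)[OF vo_matmul[OF vo_matmul_left[OF v1(2) sI(2)] T1m]])
    then show ?thesis by (simp add: matmul_distribs del: vo.simps)
  qed
  have tau: "tau h z = (\<Sum>i\<in>UNIV. (I z ** euler h z) $ i $ i)" "tau h' z = (\<Sum>i\<in>UNIV. (I' z ** euler h' z) $ i $ i)" for z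
    by (simp_all add: tau_def I_def I'_def)
  have stau: "smooth_at p (tau h)" "smooth_at p (tau h')" by (intro smooth_intros s d)+
  have tv1: "vo (Suc 0) p (tau h')"
    unfolding tau by (intro tau_diff_vo vo_matmul_right sI v1)
  have ta: "vo (Suc m) p (\<lambda>z. (tau h z - tau h' z) - real m * t z)"
  proof -
    have "vo (Suc m) p (\<lambda>z. \<Sum>i\<in>UNIV. (I z ** ((euler h z - euler h' z) - real m *\<^sub>R D z) + (I z - I' z) ** euler h' z) $ i $ i)"
      by (intro tau_diff_vo vo_add vo_matmul_right[OF sI(1) T1] up(1)[OF vo_matmul[OF vI v1(2)]])
    moreover have "(\<Sum>i\<in>UNIV. (I z ** ((euler h z - euler h' z) - real m *\<^sub>R D z) + (I z - I' z) ** euler h' z) $ i $ i)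
        = (tau h z - tau h' z) - real m * t z" for z
      unfolding tau t_def by (simp add: matmul_distribs sum.distrib sum_subtractf sum_negf sum_distrib_left)
    ultimately show ?thesis by (rule vo_eq)
  qed
  have tam: "vo m p (\<lambda>z. tau h z - tau h' z)"
  proof -
    have "vo m p (\<lambda>z. \<Sum>i\<in>UNIV. (I z ** (euler h z - euler h' z) + (I z - I' z) ** euler h' z) $ i $ i)"
      by (intro tau_diff_vo vo_add vo_matmul_right[OF sI(1) T1m] vo_matmul_left[OF vI sth(2)])
    moreover have "(\<Sum>i\<in>UNIV. (I z ** (euler h z - euler h' z) + (I z - I' z) ** euler h' z) $ i $ i) = tau h z - tau h' z" for z
      unfolding tau by (simp add: matmul_distribs sum.distrib sum_subtractf)
    ultimately show ?thesis by (rule vo_eq)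
  qed
  have th1: "vo (Suc m) p (\<lambda>z. (tau h z *\<^sub>R h z - tau h' z *\<^sub>R h' z) - (real m * t z) *\<^sub>R h z)"
  proof -
    have "vo (Suc m) p (\<lambda>z. ((tau h z - tau h' z) - real m * t z) *\<^sub>R h z + tau h' z *\<^sub>R D z)"
      by (intro vo_add vo_scaleR_left[OF ta s(1)] up(2)[OF vo_scaleR[OF tv1 D]])
    then show ?thesis by (simp add: D_def algebra_simps del: vo.simps)
  qed
  have th2: "vo (Suc m) p (\<lambda>z. (tau h z / 2) *\<^sub>R euler h z - (tau h' z / 2) *\<^sub>R euler h' z)"
  proof -
    have "vo (Suc m) p (\<lambda>z. (1/2) *\<^sub>R ((tau h z - tau h' z) *\<^sub>R euler h z + tau h' z *\<^sub>R (euler h z - euler h' z)))"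
      by (intro vo_scaleR_right smooth_at_const vo_add up(1)[OF vo_scaleR[OF tam v1(1)]] up(2)[OF vo_scaleR[OF tv1 T1m]])
    then show ?thesis by (simp add: algebra_simps del: vo.simps)
  qed
  have R: "vo (Suc m) p (\<lambda>z. (z $ None)\<^sup>2 *\<^sub>R (tric h z - tric h' z))"
    by (rule vo_le[OF vo_scaleR[OF vo_r_power cgD(3)[OF cg_tric[OF c d]]]]) simp
  have "vo (Suc m) p (\<lambda>z. (- 2) *\<^sub>R (einstein_expr h z - einstein_expr h' z - (z $ None)\<^sup>2 *\<^sub>R (tric h z - tric h' z))
      - ((euler (euler h) z - euler (euler h') z) - (real m)\<^sup>2 *\<^sub>R D z)
      + ?n *\<^sub>R ((euler h z - euler h' z) - real m *\<^sub>R D z)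
      + (euler h z ** I z ** euler h z - euler h' z ** I' z ** euler h' z)
      + ((tau h z *\<^sub>R h z - tau h' z *\<^sub>R h' z) - (real m * t z) *\<^sub>R h z)
      - ((tau h z / 2) *\<^sub>R euler h z - (tau h' z / 2) *\<^sub>R euler h' z))"
    by (intro vo_add vo_diff vo_scaleR_right smooth_at_const E R T1 T2 Q th1 th2)
  moreover have "(- 2) *\<^sub>R (einstein_expr h z - einstein_expr h' z - (z $ None)\<^sup>2 *\<^sub>R (tric h z - tric h' z))
      - ((euler (euler h) z - euler (euler h') z) - (real m)\<^sup>2 *\<^sub>R D z)
      + ?n *\<^sub>R ((euler h z - euler h' z) - real m *\<^sub>R D z)
      + (euler h z ** I z ** euler h z - euler h' z ** I' z ** euler h' z)
      + ((tau h z *\<^sub>R h z - tau h' z *\<^sub>R h' z) - (real m * t z) *\<^sub>R h z)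
      - ((tau h z / 2) *\<^sub>R euler h z - (tau h' z / 2) *\<^sub>R euler h' z) = ((real m)\<^sup>2 - ?n * real m) *\<^sub>R D z - (real m * t z) *\<^sub>R h z" for z
    by (simp add: einstein_expr_def I_def I'_def vec_eq_iff algebra_simps)
  ultimately have X: "vo (Suc m) p (\<lambda>z. ((real m)\<^sup>2 - ?n * real m) *\<^sub>R D z - (real m * t z) *\<^sub>R h z)"
    by (rule vo_eq)
  \<comment> \<open>The trace decouples: since the trace of I h is n, the relation becomes m (m - n)
    t - n m t = m (m - 2 n) t with a nonzero factor. Once t is of higher order, the factor m (m - n)
    determines all of D.\<close>
  have "vo (Suc m) p (\<lambda>z. \<Sum>i\<in>UNIV. (I z ** (((real m)\<^sup>2 - ?n * real m) *\<^sub>R D z - (real m * t z) *\<^sub>R h z)) $ i $ i)"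
    by (intro tau_diff_vo vo_matmul_right[OF sI(1) X])
  moreover have "\<forall>\<^sub>F z in nhds p. (\<Sum>i\<in>UNIV. (I z ** (((real m)\<^sup>2 - ?n * real m) *\<^sub>R D z - (real m * t z) *\<^sub>R h z)) $ i $ i)
      = (real m * (real m - 2 * ?n)) * t z"
    using eventually_nonzero[OF smooth_at_det[OF s(1)] d(1)]
    by eventually_elim (simp add: matmul_distribs I_def matrix_inv_both t_def sum_subtractf sum_distrib_left[symmetric] mat_def
        power2_eq_square algebra_simps sum.distrib)
  ultimately have "vo (Suc m) p (\<lambda>z. (real m * (real m - 2 * ?n)) * t z)" by (rule vo_cong[rotated])
  moreover have "real m * (real m - 2 * ?n) \<noteq> 0" using m by auto
  ultimately have vt: "vo (Suc m) p t"
    using vo_cancel_const[of "real m * (real m - 2 * ?n)" "Suc m" p t] unfolding real_scaleR_def by blast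
  have "vo (Suc m) p (\<lambda>z. (((real m)\<^sup>2 - ?n * real m) *\<^sub>R D z - (real m * t z) *\<^sub>R h z) + (real m * t z) *\<^sub>R h z)"
    by (intro vo_add X vo_scaleR_left[OF vo_mult_right[OF smooth_at_const vt] s(1)])
  then have "vo (Suc m) p (\<lambda>z. ((real m)\<^sup>2 - ?n * real m) *\<^sub>R D z)" by (rule vo_eq) simp
  moreover have "(real m)\<^sup>2 - ?n * real m \<noteq> 0"
    using m by (simp add: power2_eq_square algebra_simps)
  ultimately have "vo (Suc m) p D" by (rule vo_cancel_const[rotated])
  then show ?thesis using s by (simp add: cg_def D_def[abs_def])
qed

lemma tlc_scale_trace:
  fixes h :: "real^'n::finite option \<Rightarrow> real^'n^'n" and \<psi> :: "real^'n option \<Rightarrow> real"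
  assumes h: "smooth_at z h" "det (h z) \<noteq> 0" "transpose (h z) = h z" and \<psi>: "smooth_at z \<psi>" "\<psi> z \<noteq> 0"
  shows "(\<Sum>k\<in>UNIV. tlc (\<lambda>y. \<psi> y *\<^sub>R h y) k z $ k $ j) =
    (\<Sum>k\<in>UNIV. tlc h k z $ k $ j) + real CARD('n) * (partial (Some j) \<psi> z / (2 * \<psi> z))"
proof -
  let ?I = "matrix_inv (h z)"
  have "(\<Sum>k\<in>UNIV. h z $ k $ j * (\<Sum>m\<in>UNIV. ?I $ k $ m * partial (Some m) \<psi> z)) =
      (\<Sum>m\<in>UNIV. \<Sum>k\<in>UNIV. h z $ k $ j * ?I $ k $ m * partial (Some m) \<psi> z)"
    by (simp add: sum_distrib_left mult.assoc) (rule sum.swap)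
  also have "\<dots> = (\<Sum>m\<in>UNIV. (transpose (h z) ** ?I) $ j $ m * partial (Some m) \<psi> z)"
    by (simp add: matmul_nth transpose_nth sum_distrib_right)
  also have "\<dots> = partial (Some j) \<psi> z"
    by (simp add: h(3) matrix_inv_both h(2) mat_def if_distrib if_distribR cong: if_cong)
  finally have "(\<Sum>k\<in>UNIV. h z $ k $ j * (\<Sum>m\<in>UNIV. ?I $ k $ m * partial (Some m) \<psi> z)) = partial (Some j) \<psi> z" .
  then show ?thesis
    unfolding tlc_scale[OF h(1,2) \<psi>] sum.distrib sum_distrib_left[symmetric] sum_subtractf by simp
qed

lemma euler_tl_add:
  assumes "smooth_at (tl_coord z) f" "smooth_at z e"
  shows "euler (\<lambda>z. f (tl_coord z) + c *\<^sub>R e z) z = c *\<^sub>R euler e z"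
  by (simp add: euler_def partial_add smooth_at_tl_comp assms smooth_intros partial_tl_comp
      partial_linear[OF bounded_linear_scaleR_right])

section \<open>Einstein boundary metrics\<close>

text \<open>\<open>gmod\<close> is the tangential metric of the Poincare-Einstein metric with Einstein boundary metric \<open>g\<close>,
  where \<open>P = \<mu> g\<close>.\<close>

definition phi :: "(real^'n::finite \<Rightarrow> real) \<Rightarrow> real^'n option \<Rightarrow> real" where
  "phi \<mu> z = 1 - \<mu> (tl_coord z) * (z $ None)\<^sup>2 / 2"

definition gmod :: "(real^'n::finite \<Rightarrow> real) \<Rightarrow> (real^'n \<Rightarrow> real^'n^'n) \<Rightarrow> real^'n option \<Rightarrow> real^'n^'n" where
  "gmod \<mu> g z = (phi \<mu> z)\<^sup>2 *\<^sub>R g (tl_coord z)"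

lemma partial_r_square: "partial a (\<lambda>y::real^'n::finite option. (y $ None)\<^sup>2) z = (if a = None then 2 * z $ None else 0)"
  unfolding power2_eq_square by (auto simp: partial_mult)

lemma partial_phi:
  assumes "smooth_at (tl_coord z) \<mu>"
  shows "partial None (phi \<mu>) z = - \<mu> (tl_coord z) * z $ None"
    and "partial (Some i) (phi \<mu>) z = - partial i \<mu> (tl_coord z) * (z $ None)\<^sup>2 / 2"
proof -
  have m: "smooth_at z (\<lambda>y. \<mu> (tl_coord y))" by (rule smooth_at_tl_comp[OF assms])
  have P: "partial a (phi \<mu>) z = - (\<mu> (tl_coord z) * partial a (\<lambda>y. (y $ None)\<^sup>2) z + partial a (\<lambda>y. \<mu> (tl_coord y)) z * (z $ None)\<^sup>2) / 2" for a
  proof -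
    have "partial a (phi \<mu>) z = partial a (\<lambda>y. 1 - \<mu> (tl_coord y) * ((1/2) * (y $ None)\<^sup>2)) z"
      by (rule arg_cong[where f = "\<lambda>f. partial a f z"]) (simp add: phi_def fun_eq_iff)
    also have "\<dots> = - (\<mu> (tl_coord z) * partial a (\<lambda>y. (1/2) * (y $ None)\<^sup>2) z + partial a (\<lambda>y. \<mu> (tl_coord y)) z * ((1/2) * (z $ None)\<^sup>2))"
      by (simp only: partial_diff partial_mult smooth_intros m partial_const diff_0)
    also have "partial a (\<lambda>y::real^'a option. (1/2) * (y $ None)\<^sup>2) z = (1/2) * partial a (\<lambda>y. (y $ None)\<^sup>2) z"
      by (rule partial_linear[OF bounded_linear_mult_right]) (intro smooth_intros)
    finally show ?thesis by (simp add: field_simps)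
  qed
  show "partial None (phi \<mu>) z = - \<mu> (tl_coord z) * z $ None"
    and "partial (Some i) (phi \<mu>) z = - partial i \<mu> (tl_coord z) * (z $ None)\<^sup>2 / 2"
    using P[of None] P[of "Some i"] by (simp_all add: partial_tl_comp assms partial_r_square)
qed

lemma smooth_at_phi [smooth_intros]: "smooth_at (tl_coord z) \<mu> \<Longrightarrow> smooth_at z (phi \<mu>)"
  unfolding phi_def[abs_def] by (intro smooth_intros smooth_at_tl_comp) auto

lemma smooth_at_gmod [smooth_intros]:
  "smooth_at (tl_coord z) \<mu> \<Longrightarrow> smooth_at (tl_coord z) g \<Longrightarrow> smooth_at z (gmod \<mu> g)"
  unfolding gmod_def[abs_def] by (intro smooth_intros smooth_at_tl_comp)

text \<open>All derivatives in r are expressed through u = \<mu> r^2, for which r d\<phi>/dr = - u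
  and r du/dr = 2 u, where \<phi> is \<open>phi \<mu>\<close>.\<close>

lemma euler_phi_gmod:
  fixes g :: "real^'n::finite \<Rightarrow> real^'n^'n"
  assumes \<mu>: "smooth_at (tl_coord z) \<mu>" and g: "smooth_at (tl_coord z) g"
  defines "u \<equiv> \<mu> (tl_coord z) * (z $ None)\<^sup>2"
  shows "euler (gmod \<mu> g) z = (- 2 * phi \<mu> z * u) *\<^sub>R g (tl_coord z)"
    and "euler (euler (gmod \<mu> g)) z = (2 * u\<^sup>2 - 4 * phi \<mu> z * u) *\<^sub>R g (tl_coord z)"
proof -
  let ?U = "\<lambda>z. \<mu> (tl_coord z) * (z $ None)\<^sup>2"
  have 1: "euler (gmod \<mu> g) z = (- 2 * phi \<mu> z * ?U z) *\<^sub>R g (tl_coord z)"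
    if \<mu>: "smooth_at (tl_coord z) \<mu>" and g: "smooth_at (tl_coord z) g" for z
  proof -
    have "partial None (\<lambda>z. (phi \<mu> z)\<^sup>2 *\<^sub>R g (tl_coord z)) z = (phi \<mu> z)\<^sup>2 *\<^sub>R partial None (\<lambda>z. g (tl_coord z)) z
        + partial None (\<lambda>z. (phi \<mu> z)\<^sup>2) z *\<^sub>R g (tl_coord z)"
      by (rule partial_scaleR) (intro smooth_intros \<mu> smooth_at_tl_comp g)+
    also have "partial None (\<lambda>z. (phi \<mu> z)\<^sup>2) z = 2 * phi \<mu> z * partial None (phi \<mu>) z"
      unfolding power2_eq_square by (simp add: partial_mult smooth_intros \<mu>)
    finally show ?thesis
      by (simp add: euler_def gmod_def[abs_def] partial_tl_comp g partial_phi \<mu> power2_eq_square)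
  qed
  show "euler (gmod \<mu> g) z = (- 2 * phi \<mu> z * u) *\<^sub>R g (tl_coord z)" unfolding u_def by (rule 1[OF \<mu> g])
  have ev: "\<forall>\<^sub>F y in nhds z. euler (gmod \<mu> g) y = (- 2 * phi \<mu> y * ?U y) *\<^sub>R g (tl_coord y)"
    using eventually_tl[OF smooth_at_eventually[OF \<mu>]] eventually_tl[OF smooth_at_eventually[OF g]]
    by eventually_elim (rule 1)
  have m: "smooth_at z (\<lambda>y. \<mu> (tl_coord y))" by (rule smooth_at_tl_comp[OF \<mu>])
  have sU: "smooth_at z ?U" by (intro smooth_intros m)
  have sp: "smooth_at z (phi \<mu>)" by (intro smooth_intros \<mu>)
  have pU: "partial None ?U z = \<mu> (tl_coord z) * (2 * z $ None)"
    by (simp add: partial_mult smooth_intros m partial_tl_comp \<mu> partial_r_square)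
  have "partial None (\<lambda>y. (- 2 * phi \<mu> y * ?U y) *\<^sub>R g (tl_coord y)) z =
      (- 2 * phi \<mu> z * ?U z) *\<^sub>R partial None (\<lambda>y. g (tl_coord y)) z + partial None (\<lambda>y. - 2 * phi \<mu> y * ?U y) z *\<^sub>R g (tl_coord z)"
    by (rule partial_scaleR) (intro smooth_intros sp m smooth_at_tl_comp g)+
  also have "partial None (\<lambda>y. - 2 * phi \<mu> y * ?U y) z = (- 2 * phi \<mu> z) * partial None ?U z + partial None (\<lambda>y. - 2 * phi \<mu> y) z * ?U z"
    by (rule partial_mult) (intro smooth_intros sp m)+
  also have "partial None (\<lambda>y. - 2 * phi \<mu> y) z = - 2 * partial None (phi \<mu>) z"
    by (rule partial_linear[OF bounded_linear_mult_right sp])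
  finally show "euler (euler (gmod \<mu> g)) z = (2 * u\<^sup>2 - 4 * phi \<mu> z * u) *\<^sub>R g (tl_coord z)"
    unfolding euler_def[of "euler (gmod \<mu> g)"] partial_cong[OF ev] pU partial_phi(1)[OF \<mu>] u_def
    by (simp add: partial_tl_comp g power2_eq_square) (simp add: algebra_simps)
qed

text \<open>The constant is that of Ric = 2 (n - 1) \<mu> g, which is P = \<mu> g in terms of the
  Ricci tensor. What remains of the equation compares the Ricci tensor of the slices with that of
  g.\<close>

lemma einstein_expr_gmod:
  fixes g :: "real^'n::finite \<Rightarrow> real^'n^'n"
  assumes \<mu>: "smooth_at (tl_coord z) \<mu>" and g: "smooth_at (tl_coord z) g" "det (g (tl_coord z)) \<noteq> 0"
    and \<phi>: "phi \<mu> z \<noteq> 0"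
  shows "einstein_expr (gmod \<mu> g) z = (z $ None)\<^sup>2 *\<^sub>R (tric (gmod \<mu> g) z - (2 * (real CARD('n) - 1) * \<mu> (tl_coord z)) *\<^sub>R g (tl_coord z))"
proof -
  let ?n = "real CARD('n)" and ?G = "g (tl_coord z)" and ?\<phi> = "phi \<mu> z"
  define u where "u = \<mu> (tl_coord z) * (z $ None)\<^sup>2"
  note T = euler_phi_gmod[OF \<mu> g(1), folded u_def]
  have inv: "matrix_inv (gmod \<mu> g z) = (1 / ?\<phi>\<^sup>2) *\<^sub>R matrix_inv ?G"
    using \<phi> g by (simp add: gmod_def matrix_inv_scaleR)
  have hk: "matrix_inv (gmod \<mu> g z) ** euler (gmod \<mu> g) z = (- 2 * u / ?\<phi>) *\<^sub>R mat 1"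
    using \<phi> by (simp add: inv T matmul_distribs matrix_inv_both g power2_eq_square)
  have tau: "tau (gmod \<mu> g) z = - 2 * ?n * u / ?\<phi>"
    by (simp add: tau_def hk mat_def)
  have q: "euler (gmod \<mu> g) z ** matrix_inv (gmod \<mu> g z) ** euler (gmod \<mu> g) z = (4 * u\<^sup>2) *\<^sub>R ?G"
    unfolding matrix_mul_assoc[symmetric] hk using \<phi> by (simp add: T matmul_distribs power2_eq_square)
  \<comment> \<open>The relation between \<phi> and u that removes \<phi> from the scalar
    factor.\<close>
  have p2: "2 * ?\<phi> = 2 - u" by (simp add: phi_def u_def)
  have "(2 * u\<^sup>2 - 4 * ?\<phi> * u) - ?n * (- 2 * ?\<phi> * u) - 4 * u\<^sup>2 - (- 2 * ?n * u / ?\<phi>) * ?\<phi>\<^sup>2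
      + (- 2 * ?n * u / ?\<phi> / 2) * (- 2 * ?\<phi> * u) = (?n - 1) * u * (2 * (2 * ?\<phi>) + 2 * u)"
    using \<phi> by (simp add: power2_eq_square field_simps)
  also have "\<dots> = 4 * (?n - 1) * u" unfolding p2 by (simp add: algebra_simps)
  finally have e: "(2 * u\<^sup>2 - 4 * ?\<phi> * u) - ?n * (- 2 * ?\<phi> * u) - 4 * u\<^sup>2 - (- 2 * ?n * u / ?\<phi>) * ?\<phi>\<^sup>2
      + (- 2 * ?n * u / ?\<phi> / 2) * (- 2 * ?\<phi> * u) = 4 * (?n - 1) * u" .
  have "einstein_expr (gmod \<mu> g) z = (- 1/2) *\<^sub>R (((2 * u\<^sup>2 - 4 * ?\<phi> * u) - ?n * (- 2 * ?\<phi> * u) - 4 * u\<^sup>2 - (- 2 * ?n * u / ?\<phi>) * ?\<phi>\<^sup>2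
      + (- 2 * ?n * u / ?\<phi> / 2) * (- 2 * ?\<phi> * u)) *\<^sub>R ?G) + (z $ None)\<^sup>2 *\<^sub>R tric (gmod \<mu> g) z"
    unfolding einstein_expr_def q tau unfolding T gmod_def[of \<mu> g z] scaleR_diff_left scaleR_add_left scaleR_scaleR by simp
  then show ?thesis
    unfolding e by (simp add: u_def scaleR_diff_right algebra_simps)
qed

text \<open>In terms of the Schouten tensor, \<open>ein\<close> says \<open>P = \<mu> g\<close>.\<close>

locale einstein_boundary =
  fixes p :: "real^'n::finite option" and g :: "real^'n \<Rightarrow> real^'n^'n" and \<mu> :: "real^'n \<Rightarrow> real"
  assumes p: "p $ None = 0" and g: "smooth_at (tl_coord p) g" and dg: "det (g (tl_coord p)) \<noteq> 0"
    and \<mu>: "smooth_at (tl_coord p) \<mu>"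
    and ein: "\<forall>\<^sub>F x in nhds (tl_coord p). ricci g x = (2 * (real CARD('n) - 1) * \<mu> x) *\<^sub>R g x"
    and sym: "\<forall>\<^sub>F x in nhds (tl_coord p). transpose (g x) = g x"
    and n4: "4 \<le> CARD('n)"
begin

lemma near: "\<forall>\<^sub>F z in nhds p. smooth_at (tl_coord z) g \<and> smooth_at (tl_coord z) \<mu> \<and> det (g (tl_coord z)) \<noteq> 0
    \<and> phi \<mu> z \<noteq> 0 \<and> transpose (g (tl_coord z)) = g (tl_coord z) \<and> ricci g (tl_coord z) = (2 * (real CARD('n) - 1) * \<mu> (tl_coord z)) *\<^sub>R g (tl_coord z)"
proof -
  have "\<forall>\<^sub>F x in nhds (tl_coord p). det (g x) \<noteq> 0" using g dg by (intro eventually_nonzero smooth_intros)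
  moreover have "\<forall>\<^sub>F z in nhds p. phi \<mu> z \<noteq> 0"
    by (intro eventually_nonzero smooth_intros \<mu>) (simp add: phi_def p)
  ultimately show ?thesis
    using smooth_at_eventually[OF g] smooth_at_eventually[OF \<mu>] ein sym
    by (intro eventually_conj eventually_tl)
qed

lemma gmod_smooth: "smooth_at p (gmod \<mu> g)" by (rule smooth_at_gmod[OF \<mu> g])

lemma g_smooth: "smooth_at p (\<lambda>z. g (tl_coord z))" by (rule smooth_at_tl_comp[OF g])

lemma phi_smooth: "smooth_at p (phi \<mu>)" by (rule smooth_at_phi[OF \<mu>])

lemma phi_p: "phi \<mu> p = 1" and gmod_det: "det (gmod \<mu> g p) \<noteq> 0"
  by (simp_all add: gmod_def phi_def p dg)

lemma phi_vo: "vo 2 p (\<lambda>z. (phi \<mu> z)\<^sup>2 - 1)"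
proof -
  have "smooth_at p (\<lambda>z. \<mu> (tl_coord z))" by (rule smooth_at_tl_comp[OF \<mu>])
  then have s: "smooth_at p (\<lambda>z. \<mu> (tl_coord z) * (\<mu> (tl_coord z) * (z $ None)\<^sup>2 / 4 - 1))"
    by (intro smooth_intros) auto
  have "vo 2 p (\<lambda>z. (z $ None)\<^sup>2 * (\<mu> (tl_coord z) * (\<mu> (tl_coord z) * (z $ None)\<^sup>2 / 4 - 1)))"
    by (rule vo_mult_left[OF vo_r_power s])
  moreover have "(z $ None)\<^sup>2 * (\<mu> (tl_coord z) * (\<mu> (tl_coord z) * (z $ None)\<^sup>2 / 4 - 1)) = (phi \<mu> z)\<^sup>2 - 1" for z
    by (simp add: phi_def power2_eq_square field_simps)
  ultimately show ?thesis by simp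
qed

lemma gmod_cg: "cg 2 p (gmod \<mu> g) (\<lambda>z. g (tl_coord z))"
proof (rule cgI[OF gmod_smooth g_smooth])
  have "vo 2 p (\<lambda>z. ((phi \<mu> z)\<^sup>2 - 1) *\<^sub>R g (tl_coord z))" by (rule vo_scaleR_left[OF phi_vo g_smooth])
  then show "vo 2 p (\<lambda>z. gmod \<mu> g z - g (tl_coord z))" by (simp add: gmod_def algebra_simps)
qed

text \<open>As long as \<mu> may vary, the slices are conformal to g with a factor 1 + O(r^2), so
  their Ricci tensor agrees with that of g only modulo O(r^2); the prefactor r^2 gives order
  4.\<close>

lemma einstein_expr_gmod_vo4: "vo 4 p (einstein_expr (gmod \<mu> g))"
proof -
  have "cg 2 p (tric (gmod \<mu> g)) (tric (\<lambda>z. g (tl_coord z)))"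
    by (intro cg_tric gmod_cg gmod_det dg)
  moreover have "\<forall>\<^sub>F z in nhds p. tric (\<lambda>z. g (tl_coord z)) z = (2 * (real CARD('n) - 1) * \<mu> (tl_coord z)) *\<^sub>R g (tl_coord z)"
    using near by eventually_elim (simp add: tric_tl)
  then have "cg 2 p (tric (\<lambda>z. g (tl_coord z))) (\<lambda>z. (2 * (real CARD('n) - 1) * \<mu> (tl_coord z)) *\<^sub>R g (tl_coord z))"
    by (rule cg_eventually[rotated]) (intro smooth_intros g_smooth smooth_at_tl_comp \<mu>)
  ultimately have "cg 2 p (tric (gmod \<mu> g)) (\<lambda>z. (2 * (real CARD('n) - 1) * \<mu> (tl_coord z)) *\<^sub>R g (tl_coord z))"
    by (rule cg_trans)
  from vo_scaleR[OF vo_r_power[of 2] cgD(3)[OF this]]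
  have "vo 4 p (\<lambda>z. (z $ None)\<^sup>2 *\<^sub>R (tric (gmod \<mu> g) z - (2 * (real CARD('n) - 1) * \<mu> (tl_coord z)) *\<^sub>R g (tl_coord z)))"
    by (simp del: vo.simps)
  moreover have "\<forall>\<^sub>F z in nhds p. (z $ None)\<^sup>2 *\<^sub>R (tric (gmod \<mu> g) z - (2 * (real CARD('n) - 1) * \<mu> (tl_coord z)) *\<^sub>R g (tl_coord z)) = einstein_expr (gmod \<mu> g) z"
    using near by eventually_elim (simp add: einstein_expr_gmod)
  ultimately show ?thesis by (rule vo_cong[rotated])
qed

text \<open>The steps m = 1, 2, 3 of \<open>einstein_expr_step\<close>. They are available because n
  >= 4 and because the model solves the equation to order 4 even for variable \<mu>.\<close>

lemma expansion_four:
  assumes h: "cg (Suc 0) p h (\<lambda>z. g (tl_coord z))" "det (h p) \<noteq> 0" "vo CARD('n) p (einstein_expr h)"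
  shows "cg 4 p h (gmod \<mu> g)"
proof -
  have "cg (Suc k) p h (gmod \<mu> g)" if "k \<le> 3" for k
    using that
  proof (induction k)
    case 0
    show ?case by (rule cg_trans[OF h(1) cg_sym[OF cg_le[OF gmod_cg]]]) simp
  next
    case (Suc k)
    then have c: "cg (Suc k) p h (gmod \<mu> g)" by simp
    have "vo (Suc (Suc k)) p (einstein_expr h)" by (rule vo_le[OF h(3)]) (use Suc.prems n4 in simp)
    moreover have "vo (Suc (Suc k)) p (einstein_expr (gmod \<mu> g))" by (rule vo_le[OF einstein_expr_gmod_vo4]) (use Suc.prems in simp)
    ultimately show ?case using Suc.prems n4 by (intro einstein_expr_step[OF c _ _ h(2) gmod_det]) auto
  qed
  from this[of 3] show ?thesis by (simp add: eval_nat_numeral)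
qed

lemma shape_gmod:
  assumes "smooth_at (tl_coord z) \<mu>" "smooth_at (tl_coord z) g" "det (g (tl_coord z)) \<noteq> 0" "phi \<mu> z \<noteq> 0"
  shows "shape (gmod \<mu> g) z = (- 1 - \<mu> (tl_coord z) * (z $ None)\<^sup>2 / phi \<mu> z) *\<^sub>R mat 1"
  using assms(3,4)
  by (simp add: shape_def gmod_def[of \<mu> g z] matrix_inv_scaleR euler_phi_gmod[OF assms(1,2)] matmul_distribs matrix_inv_both
      power2_eq_square algebra_simps)

text \<open>This takes the place of the contracted Bianchi identity. The mixed component is r S; the
  divergence of \<open>shape\<close> contributes - r^2 d\<mu> to S, and the term with the contracted
  Christoffel symbols contributes n r^2 d\<mu>. So the leading term of S is (n - 1) r^2 d\<mu>,
  while the hypothesis makes S an O(r^3).\<close>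

lemma mixed_component:
  assumes v: "vo 4 p (\<lambda>z. sing_ricci (collar_metric (gmod \<mu> g)) z $ None $ Some j)"
  shows "\<forall>\<^sub>F z in nhds p. z $ None = 0 \<longrightarrow> partial j \<mu> (tl_coord z) = 0"
proof -
  let ?h = "gmod \<mu> g" and ?n = "real CARD('n)"
  let ?u = "\<lambda>z. \<mu> (tl_coord z) * (z $ None)\<^sup>2" and ?l = "\<lambda>z. partial j \<mu> (tl_coord z)"
  have sm: "smooth_at p (\<lambda>z. \<mu> (tl_coord z))" by (rule smooth_at_tl_comp[OF \<mu>])
  have sl: "smooth_at p ?l" by (rule smooth_at_tl_comp[OF smooth_at_partial[OF \<mu>]])
  have su: "smooth_at p ?u" by (intro smooth_intros sm)
  define S where "S z = (\<Sum>k\<in>UNIV. partial (Some k) (shape ?h) z $ k $ j - euler (tlc ?h k) z $ k $ j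
    + (tlc ?h k z ** shape ?h z - shape ?h z ** tlc ?h k z) $ k $ j)" for z
  have sS: "smooth_at p S"
    unfolding S_def[abs_def] by (intro smooth_intros gmod_smooth gmod_det)
  have "\<forall>\<^sub>F z in nhds p. sing_ricci (collar_metric ?h) z $ None $ Some j = z $ None *\<^sub>R S z"
    using near
  proof eventually_elim
    case (elim z)
    have "smooth_at z ?h" by (intro smooth_intros) (use elim in auto)
    moreover have "det (?h z) \<noteq> 0" using elim by (simp add: gmod_def det_scaleR_nz)
    ultimately show ?case by (simp add: sing_ricci_collar_metric_mixed S_def)
  qed
  from vo_cong[OF this v] have "vo (Suc 3) p (\<lambda>z. z $ None *\<^sub>R S z)" by (simp add: eval_nat_numeral del: vo.simps)
  then have S3: "vo 3 p S" by (rule vo_cancel_r[OF sS])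
  text \<open>Each of the three parts of \<open>S\<close> is evaluated modulo \<open>O(r\<^sup>4)\<close>; the commutator vanishes since \<open>shape\<close> is scalar.\<close>
  have c1: "cg 4 p (\<lambda>z. \<Sum>k\<in>UNIV. partial (Some k) (shape ?h) z $ k $ j) (\<lambda>z. - ((z $ None)\<^sup>2 * ?l z))"
  proof -
    have "cg 4 p (shape ?h) (\<lambda>z. (- 1 - ?u z) *\<^sub>R mat 1)"
    proof (rule cgI)
      show "smooth_at p (shape ?h)" "smooth_at p (\<lambda>z. (- 1 - ?u z) *\<^sub>R mat 1)"
        by (intro smooth_intros gmod_smooth gmod_det su)+
      have "vo 4 p (\<lambda>z. ((z $ None)^4 * (- (\<mu> (tl_coord z))\<^sup>2 / (2 * phi \<mu> z))) *\<^sub>R mat 1)"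
        by (intro vo_scaleR_left vo_mult_left vo_r_power smooth_intros sm phi_smooth) (simp add: phi_p)
      moreover have "\<forall>\<^sub>F z in nhds p. ((z $ None)^4 * (- (\<mu> (tl_coord z))\<^sup>2 / (2 * phi \<mu> z))) *\<^sub>R mat 1
          = shape ?h z - (- 1 - ?u z) *\<^sub>R mat 1"
        using near
      proof eventually_elim
        case (elim z)
        have "?u z / phi \<mu> z - ?u z = ?u z * (1 - phi \<mu> z) / phi \<mu> z" using elim by (simp add: field_simps)
        also have "1 - phi \<mu> z = ?u z / 2" by (simp add: phi_def)
        finally have "?u z / phi \<mu> z - ?u z = (z $ None)^4 * ((\<mu> (tl_coord z))\<^sup>2 / (2 * phi \<mu> z))"
          by (simp add: eval_nat_numeral)
        moreover have "shape ?h z - (- 1 - ?u z) *\<^sub>R mat 1 = - (?u z / phi \<mu> z - ?u z) *\<^sub>R mat 1"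
          using elim by (simp add: shape_gmod flip: scaleR_diff_left)
        ultimately show ?case by simp
      qed
      ultimately show "vo 4 p (\<lambda>z. shape ?h z - (- 1 - ?u z) *\<^sub>R mat 1)" by (rule vo_cong[rotated])
    qed
    then have "cg 4 p (\<lambda>z. \<Sum>k\<in>UNIV. partial (Some k) (shape ?h) z $ k $ j) (\<lambda>z. \<Sum>k\<in>UNIV. partial (Some k) (\<lambda>z. (- 1 - ?u z) *\<^sub>R mat 1 :: real^'n^'n) z $ k $ j)"
      by (intro cg_intros)
    moreover have "\<forall>\<^sub>F z in nhds p. (\<Sum>k\<in>UNIV. partial (Some k) (\<lambda>z. (- 1 - ?u z) *\<^sub>R mat 1 :: real^'n^'n) z $ k $ j) = - ((z $ None)\<^sup>2 * ?l z)"
      using near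
    proof eventually_elim
      case (elim z)
      have sz: "smooth_at z (\<lambda>z. \<mu> (tl_coord z))" by (rule smooth_at_tl_comp) (use elim in simp)
      have "partial (Some k) (\<lambda>z. (- 1 - ?u z) *\<^sub>R mat 1 :: real^'n^'n) z = (- (partial k \<mu> (tl_coord z) * (z $ None)\<^sup>2)) *\<^sub>R mat 1" for k
        using elim by (simp add: partial_scaleR smooth_intros sz partial_diff partial_mult partial_tl_comp partial_r_square)
      then show ?case by (simp add: mat_def if_distrib mult.commute cong: if_cong)
    qed
    then have "cg 4 p (\<lambda>z. \<Sum>k\<in>UNIV. partial (Some k) (\<lambda>z. (- 1 - ?u z) *\<^sub>R mat 1 :: real^'n^'n) z $ k $ j) (\<lambda>z. - ((z $ None)\<^sup>2 * ?l z))"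
      by (rule cg_eventually[rotated]) (intro smooth_intros sl)
    ultimately show ?thesis by (rule cg_trans)
  qed
  \<comment> \<open>The derivative of log \<phi>; scaling the metric by \<phi>^2 adds n times this
    to the contracted Christoffel symbols.\<close>
  define e where "e z = (1 / (phi \<mu> z)) * partial (Some j) (phi \<mu>) z" for z
  have se: "smooth_at p e" unfolding e_def[abs_def] by (intro smooth_intros phi_smooth) (simp add: phi_p)
  have ce: "cg 4 p e (\<lambda>z. - (1/2) * ((z $ None)\<^sup>2 * ?l z))"
  proof (rule cgI[OF se])
    show "smooth_at p (\<lambda>z. - (1/2) * ((z $ None)\<^sup>2 * ?l z))" by (intro smooth_intros sl)
    have "vo 4 p (\<lambda>z. (z $ None)^4 * (- ?l z * \<mu> (tl_coord z) / (4 * phi \<mu> z)))"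
      by (intro vo_mult_left vo_r_power smooth_intros sm sl phi_smooth) (simp add: phi_p)
    moreover have "\<forall>\<^sub>F z in nhds p. (z $ None)^4 * (- ?l z * \<mu> (tl_coord z) / (4 * phi \<mu> z)) = e z - (- (1/2) * ((z $ None)\<^sup>2 * ?l z))"
      using near
    proof eventually_elim
      case (elim z)
      have "e z - (- (1/2) * ((z $ None)\<^sup>2 * ?l z)) = (- (1/2) * ((z $ None)\<^sup>2 * ?l z)) * (1 - phi \<mu> z) / phi \<mu> z"
        using elim by (simp add: e_def partial_phi field_simps)
      also have "1 - phi \<mu> z = ?u z / 2" by (simp add: phi_def)
      finally show ?case by (simp add: eval_nat_numeral)
    qed
    ultimately show "vo 4 p (\<lambda>z. e z - (- (1/2) * ((z $ None)\<^sup>2 * ?l z)))" by (rule vo_cong[rotated])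
  qed
  have c2: "cg 4 p (\<lambda>z. \<Sum>k\<in>UNIV. euler (tlc ?h k) z $ k $ j) (\<lambda>z. - (?n * ((z $ None)\<^sup>2 * ?l z)))"
  proof -
    define tr where "tr x = (\<Sum>k\<in>UNIV. levi_civita g k x $ k $ j)" for x
    have tr: "smooth_at (tl_coord p) tr" unfolding tr_def[abs_def] by (intro smooth_intros g dg)
    have trace: "\<forall>\<^sub>F z in nhds p. (\<Sum>k\<in>UNIV. tlc ?h k z $ k $ j) = tr (tl_coord z) + ?n * e z"
      using near
    proof eventually_elim
      case (elim z)
      let ?g = "\<lambda>z. g (tl_coord z)"
      have sz: "smooth_at z (phi \<mu>)" "smooth_at z ?g" "smooth_at z (\<lambda>z. (phi \<mu> z)\<^sup>2)"
        using elim by (auto intro!: smooth_intros smooth_at_tl_comp)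
      have "partial (Some j) (\<lambda>z. (phi \<mu> z)\<^sup>2) z / (2 * (phi \<mu> z)\<^sup>2) = e z"
        using elim unfolding power2_eq_square by (simp add: partial_mult sz e_def)
      moreover have "(\<Sum>k\<in>UNIV. tlc ?h k z $ k $ j) = (\<Sum>k\<in>UNIV. tlc ?g k z $ k $ j) +
          ?n * (partial (Some j) (\<lambda>z. (phi \<mu> z)\<^sup>2) z / (2 * (phi \<mu> z)\<^sup>2))"
        unfolding gmod_def[abs_def] using elim by (intro tlc_scale_trace sz) auto
      ultimately show ?case using elim by (simp add: tr_def tlc_tl)
    qed
    have sT: "smooth_at p (tlc ?h k)" for k by (intro smooth_intros gmod_smooth gmod_det)
    have "\<forall>\<^sub>F z in nhds p. (\<Sum>k\<in>UNIV. euler (tlc ?h k) z $ k $ j) = ?n *\<^sub>R euler e z"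
    proof -
      have "\<forall>\<^sub>F z in nhds p. \<forall>k. smooth_at z (tlc ?h k)"
        using smooth_at_eventually[OF sT] by (intro eventually_all_finite)
      moreover have "\<forall>\<^sub>F z in nhds p. \<forall>\<^sub>F y in nhds z. (\<Sum>k\<in>UNIV. tlc ?h k y $ k $ j) = tr (tl_coord y) + ?n *\<^sub>R e y"
        using trace by (simp add: eventually_eventually)
      ultimately show ?thesis
        using eventually_tl[OF smooth_at_eventually[OF tr]] smooth_at_eventually[OF se]
      proof eventually_elim
        case (elim z)
        have "(\<Sum>k\<in>UNIV. euler (tlc ?h k) z $ k $ j) = euler (\<lambda>z. \<Sum>k\<in>UNIV. tlc ?h k z $ k $ j) z"
          using elim(1) by (simp add: euler_def partial_sum smooth_intros partial_nth2 sum_distrib_left)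
        also have "\<dots> = euler (\<lambda>z. tr (tl_coord z) + ?n *\<^sub>R e z) z"
          unfolding euler_def partial_cong[OF elim(2)] ..
        also have "\<dots> = ?n *\<^sub>R euler e z" by (rule euler_tl_add[OF elim(3,4)])
        finally show ?case .
      qed
    qed
    then have "cg 4 p (\<lambda>z. \<Sum>k\<in>UNIV. euler (tlc ?h k) z $ k $ j) (\<lambda>z. ?n *\<^sub>R euler e z)"
      by (rule cg_eventually[rotated]) (intro smooth_intros se)
    moreover have "cg 4 p (\<lambda>z. ?n *\<^sub>R euler e z) (\<lambda>z. ?n *\<^sub>R euler (\<lambda>z. - (1/2) * ((z $ None)\<^sup>2 * ?l z)) z)"
      by (intro cg_scaleR cg_refl smooth_at_const cg_euler ce)
    moreover have "\<forall>\<^sub>F z in nhds p. ?n *\<^sub>R euler (\<lambda>z. - (1/2) * ((z $ None)\<^sup>2 * ?l z)) z = - (?n * ((z $ None)\<^sup>2 * ?l z))"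
      using near
    proof eventually_elim
      case (elim z)
      have pj: "smooth_at (tl_coord z) (partial j \<mu>)" using elim by (intro smooth_intros) auto
      have lz: "smooth_at z ?l" by (rule smooth_at_tl_comp[OF pj])
      have "partial None (\<lambda>z. - (1/2) * ((z $ None)\<^sup>2 * ?l z)) z = - (1/2) * partial None (\<lambda>z. (z $ None)\<^sup>2 * ?l z) z"
        by (rule partial_linear[OF bounded_linear_mult_right]) (intro smooth_intros lz)
      also have "partial None (\<lambda>z. (z $ None)\<^sup>2 * ?l z) z = 2 * z $ None * ?l z"
        by (simp add: partial_mult smooth_intros lz partial_r_square partial_tl_comp pj)
      finally show ?case by (simp add: euler_def power2_eq_square)
    qed
    then have "cg 4 p (\<lambda>z. ?n *\<^sub>R euler (\<lambda>z. - (1/2) * ((z $ None)\<^sup>2 * ?l z)) z) (\<lambda>z. - (?n * ((z $ None)\<^sup>2 * ?l z)))"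
      by (rule cg_eventually[rotated]) (intro smooth_intros sl)
    ultimately show ?thesis by (metis (no_types, lifting) cg_trans)
  qed
  have "\<forall>\<^sub>F z in nhds p. S z = (\<Sum>k\<in>UNIV. partial (Some k) (shape ?h) z $ k $ j) - (\<Sum>k\<in>UNIV. euler (tlc ?h k) z $ k $ j)"
    using near
  proof eventually_elim
    case (elim z)
    then have "tlc ?h k z ** shape ?h z - shape ?h z ** tlc ?h k z = 0" for k
      by (simp add: shape_gmod matmul_distribs)
    then show ?case by (simp add: S_def sum_subtractf)
  qed
  then have "cg 4 p S (\<lambda>z. (\<Sum>k\<in>UNIV. partial (Some k) (shape ?h) z $ k $ j) - (\<Sum>k\<in>UNIV. euler (tlc ?h k) z $ k $ j))"
    by (rule cg_eventually[rotated]) (rule smooth_at_diff[OF cgD(1)[OF c1] cgD(1)[OF c2]])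
  then have "cg 4 p S (\<lambda>z. - ((z $ None)\<^sup>2 * ?l z) - - (?n * ((z $ None)\<^sup>2 * ?l z)))"
    by (rule cg_trans[OF _ cg_diff[OF c1 c2]])
  then have "cg 3 p (\<lambda>z. - ((z $ None)\<^sup>2 * ?l z) - - (?n * ((z $ None)\<^sup>2 * ?l z))) S"
    by (rule cg_le[OF cg_sym]) simp
  from cg_vo[OF this S3] have "vo 3 p (\<lambda>z. (1 / (?n - 1)) * (- ((z $ None)\<^sup>2 * ?l z) - - (?n * ((z $ None)\<^sup>2 * ?l z))))"
    by (rule vo_mult_right[OF smooth_at_const])
  moreover have "(1 / (?n - 1)) * (- ((z $ None)\<^sup>2 * ?l z) - - (?n * ((z $ None)\<^sup>2 * ?l z))) = (z $ None)\<^sup>2 *\<^sub>R ?l z" for z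
    using n4 by (simp add: field_simps)
  ultimately have "vo (2 + Suc 0) p (\<lambda>z. (z $ None)\<^sup>2 *\<^sub>R ?l z)" by (simp add: eval_nat_numeral del: vo.simps)
  then have "vo (Suc 0) p ?l" by (rule vo_cancel_r_power[OF sl])
  then show ?thesis by (rule vo_SucD(1))
qed

end

section \<open>From order 4 to order n\<close>

lemma smooth_at_cons_coord: "smooth_at x (cons_coord t)"
proof (rule smooth_at_vecI)
  show "smooth_at x (\<lambda>y. cons_coord t y $ k)" for k
    by (cases k) (simp_all add: cons_coord_def smooth_intros)
qed

lemma cons_coord_nth [simp]: "cons_coord t x $ None = t" "cons_coord t x $ Some i = x $ i"
  by (simp_all add: cons_coord_def)

lemma tl_cons_coord [simp]: "tl_coord (cons_coord t x) = x"
  by (simp add: vec_eq_iff)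

lemma cons_tl_coord: "cons_coord (z $ None) (tl_coord z) = z"
proof -
  have "cons_coord (z $ None) (tl_coord z) $ k = z $ k" for k by (cases k) simp_all
  then show ?thesis by (simp add: vec_eq_iff)
qed

lemma cg_collar_metric [cg_intros]:
  assumes "cg m p h h'"
  shows "cg m p (collar_metric h) (collar_metric h')"
proof (rule cg_vecI, rule cg_vecI)
  show "cg m p (\<lambda>z. collar_metric h z $ a $ b) (\<lambda>z. collar_metric h' z $ a $ b)" for a b
    using assms by (cases a; cases b) (auto intro!: cg_intros cg_refl)
qed

lemma cg_tang [cg_intros]: "cg m p G G' \<Longrightarrow> cg m p (tang G) (tang G')"
  unfolding tang_def[abs_def] by (intro cg_intros)

lemma normal_cg_collar_metric:
  assumes d: "datum p G A q" and N: "normal m p G"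
  shows "cg m p G (collar_metric (tang G))"
proof (rule cg_vecI, rule cg_vecI)
  fix a b
  have n0: "cg m p (\<lambda>z. G z $ None $ None) (\<lambda>z. 1)" and ni: "vo m p (\<lambda>z. G z $ None $ Some i)" for i
    using N by (simp_all add: normal_def)
  have ni': "vo m p (\<lambda>z. G z $ Some i $ None)" for i
    by (rule vo_cong[OF datum_sym_nth[OF d] ni])
  have sm: "smooth_at p (\<lambda>z. G z $ a $ b)" by (intro smooth_intros datumD(2)[OF d])
  show "cg m p (\<lambda>z. G z $ a $ b) (\<lambda>z. collar_metric (tang G) z $ a $ b)"
    using n0 ni ni' sm by (cases a; cases b) (simp_all add: tang_def cg_0_iff cg_refl)
qed

context einstein_boundary
begin

text \<open>If \<mu> is locally constant, each slice is near the point a constant multiple of g. It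
  then has the same Christoffel symbols and Ricci tensor as g, and the model solves the equation
  exactly.\<close>

lemma einstein_expr_gmod_zero:
  assumes c: "\<And>j. \<forall>\<^sub>F x in nhds (tl_coord p). partial j \<mu> x = 0"
  shows "\<forall>\<^sub>F z in nhds p. \<forall>i. tlc (gmod \<mu> g) i z = levi_civita g i (tl_coord z)"
    and "\<forall>\<^sub>F z in nhds p. einstein_expr (gmod \<mu> g) z = 0"
proof -
  have cz: "\<forall>\<^sub>F z in nhds p. \<forall>j. partial j \<mu> (tl_coord z) = 0"
    using eventually_tl[OF c] by (intro eventually_all_finite)
  have T: "\<forall>\<^sub>F z in nhds p. \<forall>i. tlc (gmod \<mu> g) i z = levi_civita g i (tl_coord z)"
    using near cz
  proof eventually_elim
    case (elim z)
    have sz: "smooth_at z (phi \<mu>)" "smooth_at z (\<lambda>z. g (tl_coord z))" "smooth_at z (\<lambda>z. (phi \<mu> z)\<^sup>2)"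
      using elim by (auto intro!: smooth_intros smooth_at_tl_comp)
    have "partial (Some j) (\<lambda>z. (phi \<mu> z)\<^sup>2) z = 0" for j
      using elim unfolding power2_eq_square by (simp add: partial_mult sz partial_phi)
    then have "tlc (gmod \<mu> g) i z $ l $ j = tlc (\<lambda>z. g (tl_coord z)) i z $ l $ j" for i l j
      unfolding gmod_def[abs_def] using elim by (subst tlc_scale[OF sz(2) _ sz(3)]) simp_all
    then show ?case using elim by (simp add: vec_eq_iff tlc_tl[symmetric])
  qed
  then show "\<forall>\<^sub>F z in nhds p. \<forall>i. tlc (gmod \<mu> g) i z = levi_civita g i (tl_coord z)" .
  then have "\<forall>\<^sub>F z in nhds p. \<forall>\<^sub>F y in nhds z. \<forall>i. tlc (gmod \<mu> g) i y = levi_civita g i (tl_coord y)"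
    by (simp add: eventually_eventually)
  then show "\<forall>\<^sub>F z in nhds p. einstein_expr (gmod \<mu> g) z = 0"
    using near
  proof eventually_elim
    case (elim z)
    have ev: "\<forall>\<^sub>F y in nhds z. tlc (gmod \<mu> g) i y = levi_civita g i (tl_coord y)" for i
      using elim(1) by eventually_elim simp
    have "tric (gmod \<mu> g) z = ricci g (tl_coord z)"
      using elim(2) by (simp add: tric_def ricci_def tcurv_cong[OF ev] tcurv_tl smooth_at_levi_civita)
    then show ?case using elim(2) by (simp add: einstein_expr_gmod)
  qed
qed

text \<open>The second conclusion depends on the first: beyond order 4 the model can serve for
  comparison only once \<mu> is known to be locally constant.\<close>

lemma expansion:
  fixes G :: "real^'n option \<Rightarrow> real^'n option^'n option"
  assumes d: "datum p G A q" and N: "normal CARD('n) p G" and b: "cg (Suc 0) p (tang G) (\<lambda>z. g (tl_coord z))"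
  shows "\<forall>\<^sub>F x in nhds (tl_coord p). partial j \<mu> x = 0" and "cg CARD('n) p (tang G) (gmod \<mu> g)"
proof -
  let ?n = "CARD('n)" and ?h = "tang G"
  note dh = datum_tang_det[OF d]
  have sh: "smooth_at p ?h" by (intro smooth_intros datumD(2)[OF d])
  have cG: "cg ?n p G (collar_metric ?h)" by (rule normal_cg_collar_metric[OF d N])
  have db: "det (collar_metric ?h p) \<noteq> 0" by (rule collar_metric_inv(2)[where h = ?h and z = p, OF dh])
  have cR: "cg ?n p (sing_ricci G) (sing_ricci (collar_metric ?h))" by (rule cg_sing_ricci[OF cG datumD(5)[OF d] db])
  have RG: "vo ?n p (\<lambda>z. sing_ricci G z + real ?n *\<^sub>R G z)" by (rule datum_sing_ricci[OF d]) (use n4 in simp)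
  have sym_h: "\<forall>\<^sub>F z in nhds p. transpose (?h z) = ?h z"
    using datumD(3)[OF d]
  proof eventually_elim
    case (elim z)
    have "G z $ a $ b = G z $ b $ a" for a b using elim by (metis transpose_nth)
    then show ?case by (simp add: tang_def vec_eq_iff transpose_def)
  qed
  have "cg ?n p (\<lambda>z. tang (sing_ricci (collar_metric ?h)) z + real ?n *\<^sub>R ?h z) (\<lambda>z. tang (sing_ricci G) z + real ?n *\<^sub>R ?h z)"
    by (intro cg_add cg_refl cg_tang cg_sym[OF cR] smooth_intros sh)
  moreover have "vo ?n p (\<lambda>z. tang (sing_ricci G) z + real ?n *\<^sub>R ?h z)"
  proof (rule vo_vecI, rule vo_vecI)
    show "vo ?n p (\<lambda>z. (tang (sing_ricci G) z + real ?n *\<^sub>R ?h z) $ i $ j)" for i j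
      using vo_nth[OF vo_nth[OF RG], of "Some i" "Some j"] by (simp add: tang_def)
  qed
  ultimately have "vo ?n p (\<lambda>z. tang (sing_ricci (collar_metric ?h)) z + real ?n *\<^sub>R ?h z)" by (rule cg_vo)
  moreover have "\<forall>\<^sub>F z in nhds p. tang (sing_ricci (collar_metric ?h)) z + real ?n *\<^sub>R ?h z = einstein_expr ?h z"
  proof -
    have "\<forall>\<^sub>F z in nhds p. \<forall>\<^sub>F y in nhds z. transpose (?h y) = ?h y" using sym_h by (simp add: eventually_eventually)
    then show ?thesis using sing_lc_collar_metric_eventually[OF sh dh] by eventually_elim (auto intro: sing_ricci_collar_metric_tang)
  qed
  ultimately have E: "vo ?n p (einstein_expr ?h)" by (rule vo_cong[rotated])
  have c4: "cg 4 p ?h (gmod \<mu> g)" by (rule expansion_four[OF b dh E])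
  have db': "det (collar_metric (gmod \<mu> g) p) \<noteq> 0" by (rule collar_metric_inv(2)[where h = "gmod \<mu> g" and z = p, OF gmod_det])
  have mu0: "\<forall>\<^sub>F x in nhds (tl_coord p). partial j \<mu> x = 0" for j
  proof -
    have "vo ?n p (\<lambda>z. (sing_ricci G z + real ?n *\<^sub>R G z) $ None $ Some j - real ?n *\<^sub>R G z $ None $ Some j)"
    proof (rule vo_diff)
      show "vo ?n p (\<lambda>z. (sing_ricci G z + real ?n *\<^sub>R G z) $ None $ Some j)" by (rule vo_nth[OF vo_nth[OF RG]])
      have "vo ?n p (\<lambda>z. G z $ None $ Some j)" using N by (simp add: normal_def)
      then show "vo ?n p (\<lambda>z. real ?n *\<^sub>R G z $ None $ Some j)" by (intro vo_scaleR_right smooth_at_const)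
    qed
    then have "vo ?n p (\<lambda>z. sing_ricci G z $ None $ Some j)" by (rule vo_eq) simp
    then have "vo ?n p (\<lambda>z. sing_ricci (collar_metric ?h) z $ None $ Some j)" by (rule cg_vo[OF cg_nth[OF cg_nth[OF cg_sym[OF cR]]]])
    then have v4: "vo 4 p (\<lambda>z. sing_ricci (collar_metric ?h) z $ None $ Some j)" by (rule vo_le) (rule n4)
    have "cg 4 p (sing_ricci (collar_metric (gmod \<mu> g))) (sing_ricci (collar_metric ?h))"
      by (intro cg_sing_ricci cg_collar_metric cg_sym[OF c4] db db')
    from cg_vo[OF cg_nth[OF cg_nth[OF this]] v4]
    have "\<forall>\<^sub>F z in nhds p. z $ None = 0 \<longrightarrow> partial j \<mu> (tl_coord z) = 0"
      by (rule mixed_component)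
    \<comment> \<open>\<open>mixed_component\<close> speaks of points of the hyperplane; inserting
      \<open>cons_coord 0\<close> turns this into a statement about a neighbourhood of
      \<open>tl_coord p\<close>.\<close>
    moreover have "cons_coord 0 (tl_coord p) = p" using cons_tl_coord[of p] p by simp
    ultimately have "\<forall>\<^sub>F x in nhds (tl_coord p). cons_coord 0 x $ None = (0::real) \<longrightarrow> partial j \<mu> (tl_coord (cons_coord 0 x)) = 0"
      by (intro eventually_nhds_comp[OF smooth_at_cons_coord]) simp
    then show ?thesis by simp
  qed
  then show "\<forall>\<^sub>F x in nhds (tl_coord p). partial j \<mu> x = 0" .
  have Eg: "vo m p (einstein_expr (gmod \<mu> g))" for m
    by (rule vo_cong[OF _ vo_zero]) (use einstein_expr_gmod_zero(2)[OF mu0] in eventually_elim, simp)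
  have "cg k p ?h (gmod \<mu> g)" if "4 \<le> k" "k \<le> ?n" for k
    using that
  proof (induction k rule: dec_induct)
    case base
    show ?case by (rule c4)
  next
    case (step m)
    have c: "cg m p ?h (gmod \<mu> g)" using step by simp
    show ?case
      by (rule einstein_expr_step[OF c _ _ dh gmod_det vo_le[OF E] Eg]) (use step in auto)
  qed
  from this[OF n4] show "cg ?n p ?h (gmod \<mu> g)" by simp
qed

end

section \<open>The Yang-Mills current in normal form\<close>

text \<open>The prefix stands for tangential: this is the current of a slice of constant r, with
  metric h and the tangential part of the connection.\<close>

definition tym :: "(real^'n::finite option \<Rightarrow> real^'n^'n) \<Rightarrow> ('n \<Rightarrow> real^'n option \<Rightarrow> real^'r::finite^'r) \<Rightarrow>
    'n \<Rightarrow> real^'n option \<Rightarrow> real^'r^'r" where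
  "tym h A i z = (\<Sum>j\<in>UNIV. \<Sum>k\<in>UNIV. matrix_inv (h z) $ j $ k *\<^sub>R
    (partial (Some j) (tcurv A k i) z
      - (\<Sum>l\<in>UNIV. tlc h j z $ l $ k *\<^sub>R tcurv A l i z)
      - (\<Sum>l\<in>UNIV. tlc h j z $ l $ i *\<^sub>R tcurv A k l z)
      + A j z ** tcurv A k i z - tcurv A k i z ** A j z))"

lemma cg_tym [cg_intros]:
  assumes "cg m p h h'" "det (h p) \<noteq> 0" "det (h' p) \<noteq> 0" "\<And>i. cg m p (A i) (A' i)"
  shows "cg m p (tym h A i) (tym h' A' i)"
  unfolding tym_def[abs_def] using assms by (intro cg_intros)

lemma curv_Some: "curv A (Some k) (Some i) = tcurv (\<lambda>j. A (Some j)) k i"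
  by (rule ext) (simp add: curv_def tcurv_def)

lemma curv_swap: "curv A a b z = - curv A b a z"
  by (simp add: curv_def)

text \<open>The coefficient 3 - n of F_0i consists of 2 from the Christoffel symbols with lower
  index \<open>None\<close>, of - n from the trace of the second fundamental form and of 1 from its
  contraction with F. Apart from r dF/dr, all other terms contain a factor r or r dh/dr.\<close>

lemma sing_ym_collar_metric:
  fixes h :: "real^'n::finite option \<Rightarrow> real^'n^'n" and A :: "'n option \<Rightarrow> real^'n option \<Rightarrow> real^'r::finite^'r"
  assumes h: "smooth_at z h" "det (h z) \<noteq> 0" and hs: "transpose (h z) = h z"
  shows "sing_ym (collar_metric h) A (Some i) z = euler (curv A None (Some i)) z + (3 - real CARD('n)) *\<^sub>R curv A None (Some i) z
    - (\<Sum>l\<in>UNIV. (matrix_inv (h z) ** euler h z) $ l $ i *\<^sub>R curv A None (Some l) z)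
    + (tau h z / 2) *\<^sub>R curv A None (Some i) z
    + z $ None *\<^sub>R (A None z ** curv A None (Some i) z - curv A None (Some i) z ** A None z)
    + z $ None *\<^sub>R tym h (\<lambda>j. A (Some j)) i z"
proof -
  let ?I = "matrix_inv (h z)" and ?r = "z $ None" and ?K = "matrix_inv (h z) ** euler h z"
  define W where "W = h z - (1/2) *\<^sub>R euler h z"
  let ?F = "\<lambda>l. curv A None (Some l) z"
  have Is: "?I $ j $ k = ?I $ k $ j" for j k
  proof -
    have "h z ** transpose ?I = transpose (?I ** h z)" by (simp add: matrix_transpose_mul hs)
    then have "matrix_inv (h z) = transpose ?I" by (intro matrix_inv_unique(1)) (simp add: matrix_inv_both h(2))
    then show ?thesis by (metis transpose_nth)
  qed
  have IW: "?I ** W = mat 1 - (1/2) *\<^sub>R ?K"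
    by (simp add: W_def matmul_distribs matrix_inv_both h(2))
  have IW1: "(\<Sum>j\<in>UNIV. ?I $ j $ k * W $ j $ l) = (if k = l then 1 else 0) - (1/2) * ?K $ k $ l" for k l
  proof -
    have "(\<Sum>j\<in>UNIV. ?I $ j $ k * W $ j $ l) = (?I ** W) $ k $ l" by (simp add: matmul_nth Is[of _ k])
    then show ?thesis by (simp add: IW mat_def)
  qed
  have N: "(\<Sum>d\<in>UNIV. sing_lc (collar_metric h) None z $ d $ None *\<^sub>R curv A d (Some i) z) = - ?F i"
    by (simp add: sum_option sing_lc_collar_metric[OF h])
  have "(\<Sum>d\<in>UNIV. sing_lc (collar_metric h) None z $ d $ Some i *\<^sub>R curv A None d z) = (\<Sum>l\<in>UNIV. shape h z $ l $ i *\<^sub>R ?F l)"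
    by (simp add: sum_option sing_lc_collar_metric[OF h])
  also have "\<dots> = (\<Sum>l\<in>UNIV. (1/2) *\<^sub>R (?K $ l $ i *\<^sub>R ?F l) - (if l = i then ?F l else 0))"
    by (rule sum.cong) (auto simp: shape_def mat_def scaleR_diff_left)
  also have "\<dots> = (1/2) *\<^sub>R (\<Sum>l\<in>UNIV. ?K $ l $ i *\<^sub>R ?F l) - ?F i"
    by (simp add: sum_subtractf scaleR_sum_right)
  finally have N2: "(\<Sum>d\<in>UNIV. sing_lc (collar_metric h) None z $ d $ Some i *\<^sub>R curv A None d z)
      = (1/2) *\<^sub>R (\<Sum>l\<in>UNIV. ?K $ l $ i *\<^sub>R ?F l) - ?F i" .
  have S1: "(\<Sum>d\<in>UNIV. sing_lc (collar_metric h) (Some j) z $ d $ Some k *\<^sub>R curv A d (Some i) z)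
      = W $ j $ k *\<^sub>R ?F i + ?r *\<^sub>R (\<Sum>l\<in>UNIV. tlc h j z $ l $ k *\<^sub>R tcurv (\<lambda>j. A (Some j)) l i z)" for j k
    by (simp add: sum_option sing_lc_collar_metric[OF h] W_def curv_Some scaleR_sum_right)
  have S2: "(\<Sum>d\<in>UNIV. sing_lc (collar_metric h) (Some j) z $ d $ Some i *\<^sub>R curv A (Some k) d z)
      = - (W $ j $ i *\<^sub>R ?F k) + ?r *\<^sub>R (\<Sum>l\<in>UNIV. tlc h j z $ l $ i *\<^sub>R tcurv (\<lambda>j. A (Some j)) k l z)" for j k
    by (simp add: sum_option sing_lc_collar_metric[OF h] W_def curv_Some scaleR_sum_right curv_swap[of A "Some k" None])
  let ?t = "\<lambda>j k. partial (Some j) (tcurv (\<lambda>j. A (Some j)) k i) z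
      - (\<Sum>l\<in>UNIV. tlc h j z $ l $ k *\<^sub>R tcurv (\<lambda>j. A (Some j)) l i z)
      - (\<Sum>l\<in>UNIV. tlc h j z $ l $ i *\<^sub>R tcurv (\<lambda>j. A (Some j)) k l z)
      + A (Some j) z ** tcurv (\<lambda>j. A (Some j)) k i z - tcurv (\<lambda>j. A (Some j)) k i z ** A (Some j) z"
  have W1: "(\<Sum>j\<in>UNIV. \<Sum>k\<in>UNIV. (?I $ j $ k * W $ j $ k) *\<^sub>R ?F i) = (real CARD('n) - tau h z / 2) *\<^sub>R ?F i"
  proof -
    have "(\<Sum>j\<in>UNIV. \<Sum>k\<in>UNIV. (?I $ j $ k * W $ j $ k) *\<^sub>R ?F i) = (\<Sum>k\<in>UNIV. \<Sum>j\<in>UNIV. ?I $ j $ k * W $ j $ k) *\<^sub>R ?F i"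
      by (subst sum.swap) (simp add: scaleR_sum_left)
    then show ?thesis by (simp add: IW1 tau_def sum_subtractf sum_divide_distrib)
  qed
  have W2: "(\<Sum>j\<in>UNIV. \<Sum>k\<in>UNIV. (?I $ j $ k * W $ j $ i) *\<^sub>R ?F k) = ?F i - (1/2) *\<^sub>R (\<Sum>l\<in>UNIV. ?K $ l $ i *\<^sub>R ?F l)"
  proof -
    have "(\<Sum>j\<in>UNIV. \<Sum>k\<in>UNIV. (?I $ j $ k * W $ j $ i) *\<^sub>R ?F k) = (\<Sum>k\<in>UNIV. (\<Sum>j\<in>UNIV. ?I $ j $ k * W $ j $ i) *\<^sub>R ?F k)"
      by (subst sum.swap) (simp add: scaleR_sum_left)
    also have "\<dots> = (\<Sum>k\<in>UNIV. (if k = i then ?F k else 0) - (1/2) *\<^sub>R (?K $ k $ i *\<^sub>R ?F k))"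
      by (rule sum.cong) (auto simp: IW1 scaleR_diff_left)
    finally show ?thesis by (simp add: sum_subtractf scaleR_sum_right)
  qed
  define T where "T b c = z $ None *\<^sub>R partial b (curv A c (Some i)) z
      - (\<Sum>d\<in>UNIV. sing_lc (collar_metric h) b z $ d $ c *\<^sub>R curv A d (Some i) z)
      - (\<Sum>d\<in>UNIV. sing_lc (collar_metric h) b z $ d $ Some i *\<^sub>R curv A c d z)
      + z $ None *\<^sub>R (A b z ** curv A c (Some i) z - curv A c (Some i) z ** A b z)" for b c
  have T0: "T None None = euler (curv A None (Some i)) z + ?F i
      - ((1/2) *\<^sub>R (\<Sum>l\<in>UNIV. ?K $ l $ i *\<^sub>R ?F l) - ?F i)
      + ?r *\<^sub>R (A None z ** ?F i - ?F i ** A None z)"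
    unfolding T_def N N2 by (simp only: euler_def) simp
  have Tjk: "T (Some j) (Some k) = ?r *\<^sub>R ?t j k - W $ j $ k *\<^sub>R ?F i + W $ j $ i *\<^sub>R ?F k" for j k
    unfolding T_def S1 S2 curv_Some by (simp only: scaleR_diff_right scaleR_add_right) simp
  have "sing_ym (collar_metric h) A (Some i) z = T None None + (\<Sum>j\<in>UNIV. \<Sum>k\<in>UNIV. ?I $ j $ k *\<^sub>R T (Some j) (Some k))"
    unfolding sing_ym_def T_def[symmetric] by (simp add: sum_option collar_metric_inv(1)[where h = h, OF h(2)])
  also have "\<dots> = T None None + (\<Sum>j\<in>UNIV. \<Sum>k\<in>UNIV. ?r *\<^sub>R ?I $ j $ k *\<^sub>R ?t j k - (?I $ j $ k * W $ j $ k) *\<^sub>R ?F i + (?I $ j $ k * W $ j $ i) *\<^sub>R ?F k)"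
    unfolding Tjk by (simp only: scaleR_diff_right scaleR_add_right scaleR_scaleR mult.commute)
  also have "\<dots> = T None None + ((\<Sum>j\<in>UNIV. \<Sum>k\<in>UNIV. ?r *\<^sub>R ?I $ j $ k *\<^sub>R ?t j k)
      - (real CARD('n) - tau h z / 2) *\<^sub>R ?F i + (?F i - (1/2) *\<^sub>R (\<Sum>l\<in>UNIV. ?K $ l $ i *\<^sub>R ?F l)))"
    unfolding W1[symmetric] W2[symmetric] by (simp only: sum.distrib sum_subtractf)
  also have "(\<Sum>j\<in>UNIV. \<Sum>k\<in>UNIV. ?r *\<^sub>R ?I $ j $ k *\<^sub>R ?t j k) = ?r *\<^sub>R tym h (\<lambda>j. A (Some j)) i z"
    by (simp only: tym_def scaleR_sum_right)
  finally show ?thesis unfolding T0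
    by (simp add: scaleR_diff_left scaleR_add_left scaleR_add_right scaleR_diff_right vec_eq_iff)
qed

context einstein_boundary
begin

text \<open>With \<mu> locally constant the slices are homothetic to g, and a homothety only
  rescales the current, here by \<phi>^(-2).\<close>

lemma tym_gmod_zero:
  fixes a :: "'n \<Rightarrow> real^'n \<Rightarrow> real^'r::finite^'r"
  assumes c: "\<And>j. \<forall>\<^sub>F x in nhds (tl_coord p). partial j \<mu> x = 0"
    and a: "\<And>j. smooth_at (tl_coord p) (a j)" and ym: "\<forall>\<^sub>F x in nhds (tl_coord p). ym_current g a i x = 0"
  shows "\<forall>\<^sub>F z in nhds p. tym (gmod \<mu> g) (\<lambda>j z. a j (tl_coord z)) i z = 0"
proof -
  have "\<forall>\<^sub>F x in nhds (tl_coord p). \<forall>j. smooth_at x (a j)"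
    using smooth_at_eventually[OF a] by (intro eventually_all_finite)
  from eventually_tl[OF this] have sa: "\<forall>\<^sub>F z in nhds p. \<forall>j. smooth_at (tl_coord z) (a j)" .
  then have sa2: "\<forall>\<^sub>F z in nhds p. \<forall>\<^sub>F y in nhds z. \<forall>j. smooth_at (tl_coord y) (a j)"
    by (simp add: eventually_eventually)
  show ?thesis
    using near einstein_expr_gmod_zero(1)[OF c] sa sa2 eventually_tl[OF ym]
  proof eventually_elim
    case (elim z)
    let ?a = "\<lambda>j z. a j (tl_coord z)" and ?x = "tl_coord z"
    have T: "tcurv ?a k l z = curv a k l ?x" for k l using elim(3) by (intro tcurv_tl) simp
    have Te: "\<forall>\<^sub>F y in nhds z. tcurv ?a k l y = curv a k l (tl_coord y)" for k l
      using elim(4) by eventually_elim (intro tcurv_tl, simp)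
    have sc: "smooth_at ?x (curv a k l)" for k l using elim(3) by (intro smooth_at_curv) simp
    have P: "partial (Some j) (tcurv ?a k l) z = partial j (curv a k l) ?x" for j k l
      unfolding partial_cong[OF Te] by (simp add: partial_tl_comp sc)
    have I: "matrix_inv (gmod \<mu> g z) = (1 / (phi \<mu> z)\<^sup>2) *\<^sub>R matrix_inv (g ?x)"
      unfolding gmod_def using elim(1) by (intro matrix_inv_scaleR) auto
    have "tym (gmod \<mu> g) ?a i z = (1 / (phi \<mu> z)\<^sup>2) *\<^sub>R ym_current g a i ?x"
      using elim(2) by (simp add: tym_def ym_current_def cov_curv_def P T I scaleR_sum_right)
    then show ?case using elim(5) by simp
  qed
qed

lemma boundary_current_zero:
  fixes G :: "real^'n option \<Rightarrow> real^'n option^'n option" and A q :: "'n option \<Rightarrow> real^'n option \<Rightarrow> real^'r::finite^'r"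
    and a :: "'n \<Rightarrow> real^'n \<Rightarrow> real^'r^'r"
  assumes d: "datum p G A q" and N: "normal CARD('n) p G" and b: "cg (Suc 0) p (tang G) (\<lambda>z. g (tl_coord z))"
    and A0: "vo CARD('n) p (A None)" and a: "\<And>j. smooth_at (tl_coord p) (a j)"
    and Aa: "\<And>j. cg (Suc 0) p (A (Some j)) (\<lambda>z. a j (tl_coord z))"
    and ym: "\<And>j. \<forall>\<^sub>F x in nhds (tl_coord p). ym_current g a j x = 0"
  shows "q (Some i) p = 0"
proof -
  let ?n = "CARD('n)" and ?h = "tang G" and ?A = "\<lambda>j. A (Some j)" and ?a = "\<lambda>j z. a j (tl_coord z)"
  let ?F = "\<lambda>l. curv A None (Some l)"
  note dh = datum_tang_det[OF d]
  note sA = datumD(6)[OF d]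
  have sh: "smooth_at p ?h" by (intro smooth_intros datumD(2)[OF d])
  have sF: "smooth_at p (?F l)" for l by (intro smooth_at_curv sA)
  have sa: "smooth_at p (?a j)" for j by (rule smooth_at_tl_comp[OF a])
  have cG: "cg ?n p G (collar_metric ?h)" by (rule normal_cg_collar_metric[OF d N])
  have db: "det (collar_metric ?h p) \<noteq> 0" by (rule collar_metric_inv(2)[where h = ?h and z = p, OF dh])
  note mu0 = expansion(1)[OF d N b] and ch = expansion(2)[OF d N b]
  have tz: "vo m p (tym (gmod \<mu> g) ?a l)" for m l
    by (rule vo_cong[OF _ vo_zero]) (use tym_gmod_zero[OF mu0 a ym] in eventually_elim, simp)
  have sym_h: "\<forall>\<^sub>F z in nhds p. transpose (?h z) = ?h z"
    using datumD(3)[OF d]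
  proof eventually_elim
    case (elim z)
    have "G z $ a $ b = G z $ b $ a" for a b using elim by (metis transpose_nth)
    then show ?case by (simp add: tang_def vec_eq_iff transpose_def)
  qed
  \<comment> \<open>As A_0 is O(r^n), F_0l is the r-derivative of A_l to this order; the orders of F
    and of A - a thus differ by one.\<close>
  have FA: "cg ?n p (?F l) (partial None (A (Some l)))" for l
  proof (rule cgI[OF sF smooth_at_partial[OF sA]])
    have "vo ?n p (\<lambda>z. - partial (Some l) (A None) z + A None z ** A (Some l) z - A (Some l) z ** A None z)"
      by (intro vo_diff vo_add vo_minus vo_partial_Some A0 vo_matmul_left vo_matmul_right sA)
    then show "vo ?n p (\<lambda>z. ?F l z - partial None (A (Some l)) z)"
      by (rule vo_eq) (simp add: curv_def)
  qed
  have da: "vo m p (partial None (?a l))" for m l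
  proof (rule vo_cong[OF _ vo_zero])
    have "\<forall>\<^sub>F z in nhds p. smooth_at (tl_coord z) (a l)" by (rule eventually_tl[OF smooth_at_eventually[OF a]])
    then show "\<forall>\<^sub>F z in nhds p. 0 = partial None (?a l) z"
      by eventually_elim (simp add: partial_tl_comp)
  qed
  \<comment> \<open>If A agrees with a to order k + 1, then F is O(r^k), and the tangential equation
    reduces to r^(n-3) q = (k + 3 - n) F modulo O(r^(k+1)). Here k comes from r dF/dr and 3 - n from
    \<open>sing_ym_collar_metric\<close>.\<close>
  have step: "vo (Suc k) p (\<lambda>z. z $ None ^ (?n - 3) *\<^sub>R q (Some l) z - (real k + 3 - real ?n) *\<^sub>R ?F l z)" and vF: "vo k p (?F l)"
    if c: "\<And>j. cg (Suc k) p (A (Some j)) (?a j)" and k: "Suc k \<le> ?n" for k l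
  proof -
    show vF: "vo k p (?F l)" for l
    proof (rule cg_vo[OF cg_le[OF FA]])
      show "vo k p (partial None (A (Some l)))" by (rule cg_vo[OF cg_partial_None[OF c] da])
    qed (use k in simp)
    let ?K = "\<lambda>z. matrix_inv (?h z) ** euler ?h z"
    have vK: "vo (Suc 0) p ?K" by (intro vo_matmul_right vo_1_euler smooth_at_matrix_inv sh dh)
    have "vo (Suc k) p (\<lambda>z. ?K z $ m $ l *\<^sub>R ?F m z)" for m
      using vo_scaleR[OF vo_nth[OF vo_nth[OF vK]] vF] by (simp del: vo.simps)
    then have v1: "vo (Suc k) p (\<lambda>z. \<Sum>m\<in>UNIV. ?K z $ m $ l *\<^sub>R ?F m z)" by (rule vo_sum)
    have "vo (Suc 0) p (tau ?h)" unfolding tau_def[abs_def] by (intro vo_sum vo_nth vK)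
    then have "vo (Suc 0) p (\<lambda>z. tau ?h z / 2)" using vo_mult_left[of "Suc 0" p "tau ?h" "\<lambda>z. 1/2"] by (simp add: smooth_at_const del: vo.simps)
    from vo_scaleR[OF this vF] have v2: "vo (Suc k) p (\<lambda>z. (tau ?h z / 2) *\<^sub>R ?F l z)" by (simp del: vo.simps)
    have v3: "vo (Suc k) p (\<lambda>z. z $ None *\<^sub>R (A None z ** ?F l z - ?F l z ** A None z))"
      by (intro vo_r_scaleR vo_diff vo_matmul_left vo_matmul_right vF sA)
    have "vo (Suc k) p (tym ?h ?A l)"
      by (rule cg_vo[OF cg_tym[OF cg_le[OF ch] dh gmod_det c] tz]) (use k in simp)
    then have v4: "vo (Suc k) p (\<lambda>z. z $ None *\<^sub>R tym ?h ?A l z)"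
      using vo_le[OF vo_r_scaleR, of "Suc k" p "tym ?h ?A l" "Suc k"] by (simp del: vo.simps)
    have v5: "vo (Suc k) p (\<lambda>z. euler (?F l) z - real k *\<^sub>R ?F l z)" by (rule vo_euler[OF vF])
    have "vo (Suc k) p (\<lambda>z. (euler (?F l) z - real k *\<^sub>R ?F l z) - (\<Sum>m\<in>UNIV. ?K z $ m $ l *\<^sub>R ?F m z)
        + (tau ?h z / 2) *\<^sub>R ?F l z + z $ None *\<^sub>R (A None z ** ?F l z - ?F l z ** A None z) + z $ None *\<^sub>R tym ?h ?A l z)"
      by (intro vo_add vo_diff[OF v5 v1] v2 v3 v4)
    moreover have "\<forall>\<^sub>F z in nhds p. (euler (?F l) z - real k *\<^sub>R ?F l z) - (\<Sum>m\<in>UNIV. ?K z $ m $ l *\<^sub>R ?F m z)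
        + (tau ?h z / 2) *\<^sub>R ?F l z + z $ None *\<^sub>R (A None z ** ?F l z - ?F l z ** A None z) + z $ None *\<^sub>R tym ?h ?A l z
        = sing_ym (collar_metric ?h) A (Some l) z - (real k + 3 - real ?n) *\<^sub>R ?F l z"
      using sing_lc_collar_metric_eventually[OF sh dh] sym_h
      by eventually_elim (simp add: sing_ym_collar_metric algebra_simps)
    ultimately have 1: "vo (Suc k) p (\<lambda>z. sing_ym (collar_metric ?h) A (Some l) z - (real k + 3 - real ?n) *\<^sub>R ?F l z)"
      by (rule vo_cong[rotated])
    have "cg (Suc k) p (\<lambda>z. z $ None ^ (?n - 3) *\<^sub>R q (Some l) z) (sing_ym G A (Some l))"
      by (rule cg_sym[OF datum_sing_ym[OF d]]) (use n4 in simp)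
    moreover have "cg (Suc k) p (sing_ym G A (Some l)) (sing_ym (collar_metric ?h) A (Some l))"
      by (rule cg_sing_ym[OF cg_le[OF cG k] datumD(5)[OF d] db sA])
    ultimately have "vo (Suc k) p (\<lambda>z. z $ None ^ (?n - 3) *\<^sub>R q (Some l) z - sing_ym (collar_metric ?h) A (Some l) z)"
      using cg_trans cgD(3) by blast
    from vo_add[OF this 1] show "vo (Suc k) p (\<lambda>z. z $ None ^ (?n - 3) *\<^sub>R q (Some l) z - (real k + 3 - real ?n) *\<^sub>R ?F l z)"
      by (rule vo_eq) simp
  qed
  have rq: "vo (?n - 3) p (\<lambda>z. z $ None ^ (?n - 3) *\<^sub>R q (Some l) z)" for l
    by (intro vo_scaleR_left vo_r_power datumD(7)[OF d])
  have cA: "cg (Suc k) p (A (Some j)) (?a j)" if "k \<le> ?n - 3" for k j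
    using that
  proof (induction k arbitrary: j)
    case 0
    show ?case by (rule Aa)
  next
    case (Suc k)
    have c: "cg (Suc k) p (A (Some l)) (?a l)" for l using Suc by simp
    have "vo (Suc k) p (\<lambda>z. z $ None ^ (?n - 3) *\<^sub>R q (Some j) z)" by (rule vo_le[OF rq Suc.prems])
    moreover have "vo (Suc k) p (\<lambda>z. z $ None ^ (?n - 3) *\<^sub>R q (Some j) z - (real k + 3 - real ?n) *\<^sub>R ?F j z)"
      by (rule step[OF c]) (use Suc.prems in simp)
    ultimately have "vo (Suc k) p (\<lambda>z. (real k + 3 - real ?n) *\<^sub>R ?F j z)"
      using vo_diff by fastforce
    \<comment> \<open>Here k < n - 3, so the factor k + 3 - n is nonzero and F gains an order, which
      integrates to one more order for A.\<close>
    then have "vo (Suc k) p (?F j)" by (rule vo_cancel_const[rotated]) (use Suc.prems in simp)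
    then have "vo (Suc k) p (partial None (A (Some j)))"
      by (rule cg_vo[OF cg_le[OF cg_sym[OF FA]], rotated]) (use Suc.prems in simp)
    then have "cg (Suc k) p (partial None (A (Some j))) (partial None (?a j))"
      using da by (intro cgI vo_diff smooth_at_partial sA sa)
    then show ?case by (rule cg_partial_NoneD[OF Aa])
  qed
  text \<open>At this order the factor \<open>k + 3 - n\<close> of \<open>F\<close> vanishes.\<close>
  let ?k = "?n - 3"
  have "vo (Suc ?k) p (\<lambda>z. z $ None ^ ?k *\<^sub>R q (Some i) z - (real ?k + 3 - real ?n) *\<^sub>R ?F i z)"
    by (rule step) (use cA n4 in auto)
  then have "vo (?k + Suc 0) p (\<lambda>z. z $ None ^ ?k *\<^sub>R q (Some i) z)"
    using n4 by (simp add: of_nat_diff del: vo.simps)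
  from vo_SucD(1)[OF vo_cancel_r_power[OF datumD(7)[OF d] this]]
  have "p $ None = 0 \<longrightarrow> q (Some i) p = 0" by (rule eventually_nhds_x_imp_x)
  then show ?thesis using p by simp
qed

end

section \<open>The defining function and the Schouten tensor\<close>

lemma metric_trace_self:
  fixes g :: "real^'k::finite \<Rightarrow> real^'k^'k"
  assumes "det (g x) \<noteq> 0" "transpose (g x) = g x"
  shows "metric_trace g g x = real CARD('k)"
proof -
  have "metric_trace g g x = (\<Sum>a\<in>UNIV. (matrix_inv (g x) ** transpose (g x)) $ a $ a)"
    by (simp add: metric_trace_def matmul_nth transpose_nth)
  also have "\<dots> = real CARD('k)"
    by (simp add: assms(2) matrix_inv_both(2)[OF assms(1)] mat_def)
  finally show ?thesis .
qed

lemma metric_trace_lin: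
  "h x = c *\<^sub>R h1 x + d *\<^sub>R h2 x \<Longrightarrow> metric_trace g h x = c * metric_trace g h1 x + d * metric_trace g h2 x"
  by (simp add: metric_trace_def algebra_simps sum.distrib sum_distrib_left)

text \<open>The definition of the Schouten tensor is inverted through its trace R / (2 (k - 1)),
  where k is the dimension and R the scalar curvature.\<close>

lemma ricci_schouten:
  fixes g :: "real^'k::finite \<Rightarrow> real^'k^'k"
  assumes g: "det (g x) \<noteq> 0" "transpose (g x) = g x" and k: "3 \<le> CARD('k)"
  shows "ricci g x = (real CARD('k) - 2) *\<^sub>R schouten g x + metric_trace g (schouten g) x *\<^sub>R g x"
proof -
  let ?k = "real CARD('k)" and ?R = "metric_trace g (ricci g) x"
  have k': "?k - 2 \<noteq> 0" "?k - 1 \<noteq> 0" using k by auto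
  have "schouten g x = (1 / (?k - 2)) *\<^sub>R ricci g x + (- ?R / (2 * (?k - 1) * (?k - 2))) *\<^sub>R g x"
    using k' by (simp add: schouten_def scaleR_diff_right divide_simps)
  from metric_trace_lin[where h = "schouten g" and ?h1.0 = "ricci g" and ?h2.0 = g, OF this, of g]
  have "metric_trace g (schouten g) x = ?R / (?k - 2) - ?R / (2 * (?k - 1) * (?k - 2)) * ?k"
    by (simp add: metric_trace_self[where g = g, OF g])
  also have "\<dots> = ?R / (2 * (?k - 1))"
    using k' by (simp add: divide_simps) (simp add: algebra_simps)
  finally show ?thesis
    using k' by (simp add: schouten_def)
qed

text \<open>The trace part of a tensor is conformally invariant. For the singular metric it can be
  computed with the smooth representative, which keeps the remainder of the Ricci equation smooth up
  to the boundary.\<close>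

lemma metric_trace_scale_metric:
  assumes "c \<noteq> 0" "det (B x) \<noteq> 0" "g x = c *\<^sub>R B x"
  shows "metric_trace g h x *\<^sub>R g x = metric_trace B h x *\<^sub>R B x"
proof -
  have "metric_trace g h x = (1 / c) * metric_trace B h x"
    using assms by (simp add: metric_trace_def matrix_inv_scaleR sum_distrib_left)
  then show ?thesis using assms by simp
qed

text \<open>In dimension k = n + 1, P = - g/2 corresponds to Ric = - (k - 1) g = - n g; this is the
  form that \<open>datum\<close> uses.\<close>

lemma schouten_half:
  fixes g :: "real^'k::finite \<Rightarrow> real^'k^'k"
  assumes g: "det (g x) \<noteq> 0" "transpose (g x) = g x" and k: "3 \<le> CARD('k)"
    and Q: "schouten g x + (1/2) *\<^sub>R g x = c *\<^sub>R Q x"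
  shows "ricci g x + (real CARD('k) - 1) *\<^sub>R g x = c *\<^sub>R ((real CARD('k) - 2) *\<^sub>R Q x + metric_trace g Q x *\<^sub>R g x)"
proof -
  have P: "schouten g x = c *\<^sub>R Q x + (- 1/2) *\<^sub>R g x" using Q by (simp add: algebra_simps)
  have T: "metric_trace g (schouten g) x = c * metric_trace g Q x - real CARD('k) / 2"
    using metric_trace_lin[where h = "schouten g" and ?h1.0 = Q and ?h2.0 = g, OF P, of g] by (simp add: metric_trace_self[where g = g, OF g])
  have R: "ricci g x = (real CARD('k) - 2) *\<^sub>R (c *\<^sub>R Q x + (- 1/2) *\<^sub>R g x) + (c * metric_trace g Q x - real CARD('k) / 2) *\<^sub>R g x"
    unfolding ricci_schouten[where g = g, OF g k] T P ..
  show ?thesis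
    unfolding R by (simp add: vec_eq_iff field_simps)
qed

lemma smooth_at_metric_trace [smooth_intros]:
  assumes "smooth_at x g" "det (g x) \<noteq> 0" "smooth_at x h"
  shows "smooth_at x (metric_trace g h)"
  unfolding metric_trace_def[abs_def] using assms by (intro smooth_intros)

lemma smooth_at_schouten [smooth_intros]:
  assumes "smooth_at x g" "det (g x) \<noteq> 0"
  shows "smooth_at x (schouten g)"
  unfolding schouten_def[abs_def] divide_inverse using assms by (intro smooth_intros smooth_at_ricci)

text \<open>With S = r \<sigma> up to sign, \<gamma> = S^(-2) B = r^(-2) (B / \<sigma>^2): the
  coordinate r takes over as defining function, and \<sigma> is moved into the smooth
  metric.\<close>

lemma einstein_local_datum:
  fixes p :: "real^'n::finite option" and B \<gamma> Q :: "real^'n option \<Rightarrow> real^'n option^'n option" and S :: "real^'n option \<Rightarrow> real"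
    and A q :: "'n option \<Rightarrow> real^'n option \<Rightarrow> real^'r::finite^'r"
  assumes p: "p $ None = 0" and n: "2 \<le> CARD('n)" and even: "even CARD('n)"
    and B: "smooth_at p B" "\<forall>\<^sub>F z in nhds p. transpose (B z) = B z" "\<forall>v. v \<noteq> 0 \<longrightarrow> v \<bullet> (B p *v v) > 0"
    and S: "smooth_at p S" "\<forall>\<^sub>F z in nhds p. z $ None = 0 \<longrightarrow> S z = 0" "partial None S p \<noteq> 0"
    and BS: "\<forall>\<^sub>F z in nhds p. z $ None > 0 \<longrightarrow> B z = (S z)\<^sup>2 *\<^sub>R \<gamma> z"
    and Q: "smooth_at p Q" "\<forall>\<^sub>F z in nhds p. z $ None > 0 \<longrightarrow> schouten \<gamma> z + (1/2) *\<^sub>R \<gamma> z = S z ^ (CARD('n) - 2) *\<^sub>R Q z"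
    and A: "\<And>a. smooth_at p (A a)" and q: "\<And>a. smooth_at p (q a)"
    and ym: "\<And>a. \<forall>\<^sub>F z in nhds p. z $ None > 0 \<longrightarrow> ym_current \<gamma> A a z = S z ^ (CARD('n) - 2) *\<^sub>R q a z"
  shows "\<exists>\<sigma>. smooth_at p \<sigma> \<and> \<sigma> p > 0 \<and> datum p (\<lambda>z. (1 / (\<sigma> z)\<^sup>2) *\<^sub>R B z) A (\<lambda>a z. \<sigma> z ^ (CARD('n) - 2) *\<^sub>R q a z)"
proof -
  let ?n = "CARD('n)"
  obtain \<sigma>0 where \<sigma>0: "smooth_at p \<sigma>0" "\<forall>\<^sub>F z in nhds p. S z = z $ None * \<sigma>0 z"
    using smooth_at_factor[OF p S(1,2)] by (elim exE conjE)
  have "partial None S p = partial None (\<lambda>z. z $ None * \<sigma>0 z) p" by (rule partial_cong[OF \<sigma>0(2)])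
  also have "\<dots> = \<sigma>0 p" by (simp add: partial_mult \<sigma>0(1) p smooth_intros)
  finally have nz: "\<sigma>0 p \<noteq> 0" using S(3) by simp
  text \<open>As \<open>n\<close> is even, only even powers of \<open>S\<close> occur, so its sign is irrelevant.\<close>
  define \<sigma> where "\<sigma> z = sgn (\<sigma>0 p) * \<sigma>0 z" for z
  have \<sigma>: "smooth_at p \<sigma>" unfolding \<sigma>_def[abs_def] by (intro smooth_intros \<sigma>0)
  have \<sigma>p: "\<sigma> p > 0" using nz by (simp add: \<sigma>_def sgn_if)
  have sq: "(S z)\<^sup>2 = (z $ None)\<^sup>2 * (\<sigma> z)\<^sup>2" "S z ^ (?n - 2) = z $ None ^ (?n - 2) * \<sigma> z ^ (?n - 2)"
    if "S z = z $ None * \<sigma>0 z" for z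
    using that even n nz by (simp_all add: \<sigma>_def power_mult_distrib sgn_if)
  have \<sigma>e: "\<forall>\<^sub>F z in nhds p. \<sigma> z \<noteq> 0" by (rule eventually_nonzero[OF \<sigma>]) (use \<sigma>p in simp)
  let ?G = "\<lambda>z. (1 / (\<sigma> z)\<^sup>2) *\<^sub>R B z"
  have dB: "det (B p) \<noteq> 0" by (rule posdef_det_nz[OF B(3)[rule_format]])
  have Be: "\<forall>\<^sub>F z in nhds p. det (B z) \<noteq> 0" by (rule eventually_nonzero[OF smooth_at_det[OF B(1)] dB])
  have sG: "smooth_at p ?G" by (intro smooth_intros \<sigma> B(1)) (use \<sigma>p in simp_all)
  have eqs: "\<forall>\<^sub>F z in nhds p. z $ None > 0 \<longrightarrow> \<gamma> z = sing ?G z"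
    using BS \<sigma>0(2) \<sigma>e
  proof eventually_elim
    case (elim z)
    have e: "(z $ None * \<sigma>0 z)\<^sup>2 = (z $ None)\<^sup>2 * (\<sigma> z)\<^sup>2" using sq(1)[OF elim(2)] elim(2) by simp
    show ?case using elim(1-3) by (auto simp: sing_def e)
  qed
  \<comment> \<open>Curvature needs equality in a neighbourhood of each point; this holds since r >
    0 is an open condition.\<close>
  have eqs2: "\<forall>\<^sub>F z in nhds p. z $ None > 0 \<longrightarrow> (\<forall>\<^sub>F y in nhds z. \<gamma> y = sing ?G y)"
  proof -
    have "\<forall>\<^sub>F z in nhds p. \<forall>\<^sub>F y in nhds z. y $ None > 0 \<longrightarrow> \<gamma> y = sing ?G y" using eqs by (simp add: eventually_eventually)
    then show ?thesis
    proof eventually_elim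
      case (elim z)
      show ?case
      proof
        assume "z $ None > 0"
        from eventually_pos[OF smooth_at_nth[OF smooth_at_ident] this] elim show "\<forall>\<^sub>F y in nhds z. \<gamma> y = sing ?G y" by eventually_elim simp
      qed
    qed
  qed
  \<comment> \<open>The remainder for the Ricci tensor according to \<open>schouten_half\<close> in
    dimension n + 1, with the trace taken in B instead of \<gamma>.\<close>
  let ?Q = "\<lambda>z. \<sigma> z ^ (?n - 2) *\<^sub>R ((real ?n - 1) *\<^sub>R Q z + metric_trace B Q z *\<^sub>R B z)"
  have "datum p ?G A (\<lambda>a z. \<sigma> z ^ (?n - 2) *\<^sub>R q a z)"
    unfolding datum_def
  proof (intro conjI allI impI exI[of _ ?Q])
    show "\<forall>\<^sub>F z in nhds p. transpose (?G z) = ?G z"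
      using B(2) by eventually_elim (simp add: transpose_distribs)
    show "v \<bullet> (?G p *v v) > 0" if "v \<noteq> 0" for v
      using B(3)[rule_format, OF that] \<sigma>p by (simp add: scaleR_matrix_vector_assoc[symmetric])
    show "smooth_at p ?Q" by (intro smooth_intros \<sigma> B(1) Q(1) dB)
    show "\<forall>\<^sub>F z in nhds p. z $ None > 0 \<longrightarrow> ricci (sing ?G) z + real ?n *\<^sub>R sing ?G z = z $ None ^ (?n - 2) *\<^sub>R ?Q z"
      using eqs2 BS Q(2) \<sigma>0(2) \<sigma>e Be B(2)
    proof eventually_elim
      case (elim z)
      show ?case
      proof
        assume r: "z $ None > 0"
        have e: "\<forall>\<^sub>F y in nhds z. \<gamma> y = sing ?G y" using elim(1) r by simp
        have ez: "sing ?G z = \<gamma> z" using eventually_nhds_x_imp_x[OF e] by simp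
        have Sz: "S z \<noteq> 0" using elim(4,5) r by (auto simp: \<sigma>_def)
        have g: "\<gamma> z = (1 / (S z)\<^sup>2) *\<^sub>R B z" using elim(2) r Sz by simp
        have "ricci \<gamma> z + (real CARD('n option) - 1) *\<^sub>R \<gamma> z =
          S z ^ (?n - 2) *\<^sub>R ((real CARD('n option) - 2) *\<^sub>R Q z + metric_trace \<gamma> Q z *\<^sub>R \<gamma> z)"
        proof (rule schouten_half)
          show "det (\<gamma> z) \<noteq> 0" unfolding g by (rule det_scaleR_nz) (use Sz elim(6) in auto)
          show "transpose (\<gamma> z) = \<gamma> z" unfolding g using elim(7) by (simp add: transpose_distribs)
        qed (use elim(3) r n in auto)
        also have "metric_trace \<gamma> Q z *\<^sub>R \<gamma> z = metric_trace B Q z *\<^sub>R B z"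
          by (rule metric_trace_scale_metric[where g = \<gamma> and B = B, OF _ _ g]) (use Sz elim(6) in auto)
        finally show "ricci (sing ?G) z + real ?n *\<^sub>R sing ?G z = z $ None ^ (?n - 2) *\<^sub>R ?Q z"
          unfolding ez ricci_cong[OF e, symmetric] by (simp add: sq(2)[OF elim(4)] algebra_simps)
      qed
    qed
    show "\<forall>\<^sub>F z in nhds p. z $ None > 0 \<longrightarrow> ym_current (sing ?G) A a z = z $ None ^ (?n - 2) *\<^sub>R \<sigma> z ^ (?n - 2) *\<^sub>R q a z" for a
      using eqs2 ym[of a] \<sigma>0(2)
    proof eventually_elim
      case (elim z)
      show ?case
      proof
        assume r: "z $ None > 0"
        have e: "\<forall>\<^sub>F y in nhds z. \<gamma> y = sing ?G y" using elim(1) r by simp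
        have "ym_current (sing ?G) A a z = ym_current \<gamma> A a z"
          by (rule ym_current_cong[symmetric, OF e]) simp
        then show "ym_current (sing ?G) A a z = z $ None ^ (?n - 2) *\<^sub>R \<sigma> z ^ (?n - 2) *\<^sub>R q a z"
          using elim(2) r by (simp add: sq(2)[OF elim(3)])
      qed
    qed
    show "smooth_at p (\<lambda>z. \<sigma> z ^ (?n - 2) *\<^sub>R q a z)" for a by (intro smooth_intros \<sigma> q)
  qed (use p sG A in auto)
  then show ?thesis using \<sigma> \<sigma>p by (intro exI[of _ \<sigma>] conjI)
qed

text \<open>B, S, Q, A and q are smooth extensions across the boundary. They are tied to the
  geometry on one side only: by equations for r > 0 and by boundary values at r = 0.\<close>

lemma (in einstein_boundary) local_current_zero:
  fixes B \<gamma> Q :: "real^'n option \<Rightarrow> real^'n option^'n option" and S :: "real^'n option \<Rightarrow> real"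
    and A q :: "'n option \<Rightarrow> real^'n option \<Rightarrow> real^'r::finite^'r" and a :: "'n \<Rightarrow> real^'n \<Rightarrow> real^'r^'r"
  assumes even: "even CARD('n)"
    and B: "smooth_at p B" "\<forall>\<^sub>F z in nhds p. transpose (B z) = B z" "\<forall>v. v \<noteq> 0 \<longrightarrow> v \<bullet> (B p *v v) > 0"
    and S: "smooth_at p S" "\<forall>\<^sub>F z in nhds p. z $ None = 0 \<longrightarrow> S z = 0" "partial None S p \<noteq> 0"
    and BS: "\<forall>\<^sub>F z in nhds p. z $ None > 0 \<longrightarrow> B z = (S z)\<^sup>2 *\<^sub>R \<gamma> z"
    and Q: "smooth_at p Q" "\<forall>\<^sub>F z in nhds p. z $ None > 0 \<longrightarrow> schouten \<gamma> z + (1/2) *\<^sub>R \<gamma> z = S z ^ (CARD('n) - 2) *\<^sub>R Q z"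
    and A: "\<And>a. smooth_at p (A a)" and q: "\<And>a. smooth_at p (q a)"
    and ymA: "\<And>a. \<forall>\<^sub>F z in nhds p. z $ None > 0 \<longrightarrow> ym_current \<gamma> A a z = S z ^ (CARD('n) - 2) *\<^sub>R q a z"
    and Bg: "\<forall>\<^sub>F z in nhds p. z $ None = 0 \<longrightarrow> tang B z = g (tl_coord z)"
    and a: "\<And>j. smooth_at (tl_coord p) (a j)" and Aa: "\<And>j. \<forall>\<^sub>F z in nhds p. z $ None = 0 \<longrightarrow> A (Some j) z = a j (tl_coord z)"
    and ym: "\<And>j. \<forall>\<^sub>F x in nhds (tl_coord p). ym_current g a j x = 0"
  shows "q (Some i) p = 0"
proof -
  have n2: "2 \<le> CARD('n)" using n4 by simp
  obtain \<sigma> where \<sigma>: "smooth_at p \<sigma>" "\<sigma> p > 0" and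
    d: "datum p (\<lambda>z. (1 / (\<sigma> z)\<^sup>2) *\<^sub>R B z) A (\<lambda>a z. \<sigma> z ^ (CARD('n) - 2) *\<^sub>R q a z)"
    using einstein_local_datum[OF p n2 even B S BS Q A q ymA] by (elim exE conjE)
  \<comment> \<open>Passing from S to r has rescaled the boundary metric by \<sigma>^(-2); stage 0
    with this factor restores g.\<close>
  let ?\<zeta> = "\<lambda>z. inverse (\<sigma> z)"
  have \<zeta>: "smooth_at p ?\<zeta>" "?\<zeta> p > 0" using \<sigma> by (auto intro: smooth_intros)
  obtain G1 A1 q1 where 1: "datum p G1 A1 q1" "\<forall>i. vo (Suc 0) p (\<lambda>z. G1 z $ None $ Some i)"
    "cg (Suc 0) p (tang G1) (\<lambda>z. (1 / (?\<zeta> z)\<^sup>2) *\<^sub>R tang (\<lambda>z. (1 / (\<sigma> z)\<^sup>2) *\<^sub>R B z) z)"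
    "\<forall>i. cg (Suc 0) p (A1 (Some i)) (A (Some i))"
    "\<forall>i. q1 (Some i) p = ?\<zeta> p ^ (CARD('n) - 2) *\<^sub>R \<sigma> p ^ (CARD('n) - 2) *\<^sub>R q (Some i) p"
    using stage_zero[OF d \<zeta>] by (elim exE conjE)
  have "normal (Suc 0) p G1" by (rule normal_one[OF 1(1) n2]) (use 1(2) in blast)
  from normalize_metric[OF 1(1) this, of "CARD('n) - 1"]
  obtain G2 A2 q2 where 2: "datum p G2 A2 q2" "normal (Suc (CARD('n) - 1)) p G2"
    "cg (Suc 0) p (tang G2) (tang G1)" "\<forall>i. cg (Suc 0) p (A2 (Some i)) (A1 (Some i))" "\<forall>i. q2 (Some i) p = q1 (Some i) p"
    by (elim exE conjE)
  from normalize_connection[OF 2(1), of "CARD('n)"]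
  obtain A3 q3 where 3: "datum p G2 A3 q3" "vo CARD('n) p (A3 None)"
    "\<forall>i. cg (Suc 0) p (A3 (Some i)) (A2 (Some i))" "\<forall>a. q3 a p = q2 a p"
    by (elim exE conjE)
  have N: "normal CARD('n) p G2" using 2(2) n2 by simp
  have "cg (Suc 0) p (\<lambda>z. (1 / (?\<zeta> z)\<^sup>2) *\<^sub>R tang (\<lambda>z. (1 / (\<sigma> z)\<^sup>2) *\<^sub>R B z) z) (\<lambda>z. g (tl_coord z))"
  proof (rule cg_Suc_0I)
    show "smooth_at p (\<lambda>z. (1 / (?\<zeta> z)\<^sup>2) *\<^sub>R tang (\<lambda>z. (1 / (\<sigma> z)\<^sup>2) *\<^sub>R B z) z)" by (rule cgD(2)[OF 1(3)])
    show "smooth_at p (\<lambda>z. g (tl_coord z))" by (rule smooth_at_tl_comp[OF g])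
    show "\<forall>\<^sub>F z in nhds p. z $ None = 0 \<longrightarrow> (1 / (?\<zeta> z)\<^sup>2) *\<^sub>R tang (\<lambda>z. (1 / (\<sigma> z)\<^sup>2) *\<^sub>R B z) z = g (tl_coord z)"
      using Bg eventually_pos[OF \<sigma>]
    proof eventually_elim
      case (elim z)
      have "tang (\<lambda>z. (1 / (\<sigma> z)\<^sup>2) *\<^sub>R B z) z = (1 / (\<sigma> z)\<^sup>2) *\<^sub>R tang B z"
        by (simp add: tang_def vec_eq_iff)
      then show ?case using elim by (simp add: power_inverse)
    qed
  qed
  from cg_trans[OF 2(3) cg_trans[OF 1(3) this]] have b: "cg (Suc 0) p (tang G2) (\<lambda>z. g (tl_coord z))" .
  have "cg (Suc 0) p (A3 (Some j)) (\<lambda>z. a j (tl_coord z))" for j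
  proof (rule cg_trans)
    show "cg (Suc 0) p (A3 (Some j)) (A (Some j))"
      using cg_trans[OF spec[OF 3(3), of j] cg_trans[OF spec[OF 2(4), of j] spec[OF 1(4), of j]]] .
    show "cg (Suc 0) p (A (Some j)) (\<lambda>z. a j (tl_coord z))"
      by (rule cg_Suc_0I[OF A smooth_at_tl_comp[OF a] Aa])
  qed
  from boundary_current_zero[OF 3(1) N b 3(2) a this ym] have "q3 (Some i) p = 0" .
  \<comment> \<open>At p the value of q has only been multiplied by powers of \<sigma> and \<zeta>;
    the later normalisations preserve its tangential boundary values.\<close>
  then show ?thesis using 3(4) 2(5) 1(5) \<sigma>(2) by simp
qed

section \<open>Passage to charts\<close>

lemma crd_iff:
  assumes h: "homeomorphism (fst c) (crd c UNIV) (snd c) (pt c)"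
  shows "y \<in> crd c B \<longleftrightarrow> y \<in> crd c UNIV \<and> pt c y \<in> B"
proof
  assume "y \<in> crd c B"
  then obtain q where q: "q \<in> fst c" "q \<in> B" "y = snd c q" by (auto simp: crd_def)
  then show "y \<in> crd c UNIV \<and> pt c y \<in> B" using homeomorphism_apply1[OF h q(1)] by (auto simp: crd_def)
next
  assume y: "y \<in> crd c UNIV \<and> pt c y \<in> B"
  then have "pt c y \<in> fst c" "snd c (pt c y) = y"
    using h by (auto simp: homeomorphism_def)
  then show "y \<in> crd c B" using y unfolding crd_def by (intro image_eqI[of _ _ "pt c y"]) auto
qed

lemma crd_collar:
  assumes h: "homeomorphism (fst c) (crd c UNIV) (snd c) (pt c)"
  shows "z \<in> crd (collar_chart \<epsilon> c) B \<longleftrightarrow> 0 \<le> z $ None \<and> z $ None < \<epsilon> \<and> tl_coord z \<in> crd c UNIV \<and> (z $ None, pt c (tl_coord z)) \<in> B"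
proof
  assume "z \<in> crd (collar_chart \<epsilon> c) B"
  then obtain t q where tq: "0 \<le> t" "t < \<epsilon>" "q \<in> fst c" "(t, q) \<in> B" "z = cons_coord t (snd c q)"
    by (auto simp: crd_def collar_chart_def)
  then show "0 \<le> z $ None \<and> z $ None < \<epsilon> \<and> tl_coord z \<in> crd c UNIV \<and> (z $ None, pt c (tl_coord z)) \<in> B"
    using homeomorphism_apply1[OF h tq(3)] by (auto simp: crd_def)
next
  assume z: "0 \<le> z $ None \<and> z $ None < \<epsilon> \<and> tl_coord z \<in> crd c UNIV \<and> (z $ None, pt c (tl_coord z)) \<in> B"
  then have q: "pt c (tl_coord z) \<in> fst c" "snd c (pt c (tl_coord z)) = tl_coord z"
    using h by (auto simp: homeomorphism_def)
  have "z = (\<lambda>(t, p). cons_coord t (snd c p)) (z $ None, pt c (tl_coord z))"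
    by (simp add: q cons_tl_coord)
  then show "z \<in> crd (collar_chart \<epsilon> c) B"
    using z q unfolding crd_def collar_chart_def by (intro image_eqI) auto
qed

text \<open>\<open>pt\<close> chooses a preimage, so its value is known only through injectivity of
  the collar chart: the coordinate \<open>None\<close> recovers t, and the others recover the point
  of M.\<close>

lemma pt_collar:
  assumes h: "homeomorphism (fst c) (crd c UNIV) (snd c) (pt c)" and y: "y \<in> crd c UNIV" and t: "0 \<le> t" "t < \<epsilon>"
  shows "pt (collar_chart \<epsilon> c) (cons_coord t y) = (t, pt c y)"
  unfolding pt_def[of "collar_chart \<epsilon> c"]
proof (rule inv_into_f_eq)
  have q: "pt c y \<in> fst c" "snd c (pt c y) = y" using h y by (auto simp: homeomorphism_def)
  show "(t, pt c y) \<in> fst (collar_chart \<epsilon> c)" "snd (collar_chart \<epsilon> c) (t, pt c y) = cons_coord t y"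
    using q t by (auto simp: collar_chart_def)
  show "inj_on (snd (collar_chart \<epsilon> c)) (fst (collar_chart \<epsilon> c))"
  proof (rule inj_onI)
    fix u v assume uv: "u \<in> fst (collar_chart \<epsilon> c)" "v \<in> fst (collar_chart \<epsilon> c)"
      and e: "snd (collar_chart \<epsilon> c) u = snd (collar_chart \<epsilon> c) v"
    have e': "cons_coord (fst u) (snd c (snd u)) = cons_coord (fst v) (snd c (snd v))"
      using e by (simp add: collar_chart_def case_prod_unfold)
    have "fst u = fst v" using arg_cong[OF e', of "\<lambda>z. z $ None"] by simp
    moreover have "snd c (snd u) = snd c (snd v)" using arg_cong[OF e', of tl_coord] by simp
    moreover have "snd u \<in> fst c" "snd v \<in> fst c" using uv by (auto simp: collar_chart_def)
    ultimately show "u = v" using homeomorphism_apply1[OF h] by (metis prod_eqI)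
  qed
qed

text \<open>The passage from fields on a half-space to germs: around a boundary point one extension,
  defined on both sides, carries the derivatives of all orders.\<close>

lemma smooth_on_extension:
  assumes "smooth_on S f" "x \<in> S"
  shows "\<exists>h. smooth_at x h \<and> (\<forall>\<^sub>F y in nhds x. y \<in> S \<longrightarrow> f y = h y)"
proof -
  obtain W h where W: "open W" "x \<in> W" "\<forall>m. Ck_on m W h" "\<forall>y\<in>S \<inter> W. f y = h y"
    using assms unfolding smooth_on_def by meson
  have "\<forall>\<^sub>F y in nhds x. y \<in> W" by (rule eventually_nhds_in_open[OF W(1,2)])
  then have "\<forall>\<^sub>F y in nhds x. y \<in> S \<longrightarrow> f y = h y" by eventually_elim (use W(4) in auto)
  moreover have "smooth_at x h" unfolding smooth_at_def using W(1-3) by blast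
  ultimately show ?thesis by blast
qed

lemma smooth_on_eventually:
  assumes "smooth_on S f" "\<forall>\<^sub>F y in nhds x. y \<in> S"
  shows "smooth_at x f"
proof -
  obtain h where h: "smooth_at x h" "\<forall>\<^sub>F y in nhds x. y \<in> S \<longrightarrow> f y = h y"
    using smooth_on_extension[OF assms(1) eventually_nhds_x_imp_x[OF assms(2)]] by blast
  show ?thesis by (rule smooth_at_cong[OF _ h(1)]) (use h(2) assms(2) in eventually_elim, simp)
qed

text \<open>S contains short segments from p in every positive coordinate direction. So the
  derivative within S is unique and is that of any smooth extension.\<close>

lemma pd_half_space:
  fixes p :: "real^'n::finite option"
  assumes p: "p $ None = 0" "p \<in> S" and S: "\<forall>\<^sub>F z in nhds p. 0 \<le> z $ None \<longrightarrow> z \<in> S"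
    and h: "smooth_at p h" "\<forall>\<^sub>F z in nhds p. z \<in> S \<longrightarrow> f z = h z"
  shows "pd S f a p = partial a h p"
proof -
  have D: "(h has_derivative frechet_derivative h (at p)) (at p)"
    using smooth_at_differentiable[OF h(1)] by (simp add: frechet_derivative_works)
  obtain d where d: "d > 0" "\<And>z. dist z p < d \<Longrightarrow> z \<in> S \<Longrightarrow> f z = h z"
    using h(2) unfolding eventually_nhds_metric by blast
  have Df: "(f has_derivative frechet_derivative h (at p)) (at p within S)"
    by (rule has_derivative_transform_within[OF has_derivative_at_withinI[OF D] d(1) p(2)]) (use d(2) in auto)
  obtain e0 where e0: "e0 > 0" "\<And>z. dist z p < e0 \<Longrightarrow> 0 \<le> z $ None \<Longrightarrow> z \<in> S"
    using S unfolding eventually_nhds_metric by blast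
  have Df': "(f has_derivative frechet_derivative f (at p within S)) (at p within S)"
    using Df frechet_derivative_works differentiable_def by blast
  have "frechet_derivative f (at p within S) = frechet_derivative h (at p)"
  proof (rule frechet_derivative_unique_within[OF Df' Df])
    fix i :: "real^'n option" and e :: real
    assume i: "i \<in> Basis" and e: "e > 0"
    obtain k where k: "i = axis k 1" using i by (auto simp: Basis_vec_def)
    let ?d = "min e e0 / 2"
    have "p + ?d *\<^sub>R i \<in> S"
    proof (rule e0(2))
      show "dist (p + ?d *\<^sub>R i) p < e0" using e e0(1) i by (simp add: dist_norm)
      show "0 \<le> (p + ?d *\<^sub>R i) $ None" using p e e0(1) by (simp add: k axis_def)
    qed
    then show "\<exists>d. 0 < \<bar>d\<bar> \<and> \<bar>d\<bar> < e \<and> p + d *\<^sub>R i \<in> S"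
      using e e0(1) by (intro exI[of _ ?d]) auto
  qed
  then show ?thesis by (simp add: pd_def)
qed

lemma surj_det_nz:
  fixes H :: "real^'r::finite^'r"
  assumes "\<And>w. \<exists>v. w = H *v v"
  shows "det H \<noteq> 0"
proof -
  have "surj ((*v) H)" using assms by (auto simp: surj_def)
  then obtain B where "H ** B = mat 1" using matrix_right_invertible_surjective by blast
  then show ?thesis by (rule matrix_inv_unique(2))
qed

text \<open>\<iota> maps the fibre over P onto the fibre over (0, P), so in trivialisations every
  vector is attained.\<close>

lemma bundle_extension_det:
  fixes VM :: "('m::topological_space, 'e, 'r::finite) vbundle" and At :: "('m, 'n::finite) chart set"
  assumes E: "bundle_extension At \<epsilon> VM VX \<iota>" and \<tau>: "\<tau> \<in> trivs VM" and \<sigma>: "\<sigma> \<in> trivs VX"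
    and P: "P \<in> fst \<tau>" "(0, P) \<in> fst \<sigma>"
  shows "det (fibre_matrix (proj VM) \<tau> \<sigma> \<iota> P) \<noteq> 0"
proof (rule surj_det_nz)
  fix w :: "real^'r"
  have bij: "bij_betw (\<lambda>e. (proj VX e, snd \<sigma> e)) (proj VX -` fst \<sigma>) (fst \<sigma> \<times> UNIV)"
    using E \<sigma> unfolding bundle_extension_def vector_bundle_def by blast
  have "((0, P), w) \<in> (\<lambda>e. (proj VX e, snd \<sigma> e)) ` (proj VX -` fst \<sigma>)"
    unfolding bij_betw_imp_surj_on[OF bij] using P by simp
  then obtain e' where e': "proj VX e' = (0, P)" "snd \<sigma> e' = w" by auto
  have "bij_betw \<iota> UNIV (proj VX -` ({0} \<times> UNIV))" using E unfolding bundle_extension_def by blast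
  then have "e' \<in> range \<iota>" using e'(1) by (simp add: bij_betw_imp_surj_on)
  then obtain e where e: "e' = \<iota> e" by blast
  have "proj VX (\<iota> e) = (0, proj VM e)" using E unfolding bundle_extension_def by blast
  then have pe: "proj VM e = P" using e' e by simp
  have "snd \<sigma> (\<iota> e) = fibre_matrix (proj VM) \<tau> \<sigma> \<iota> (proj VM e) *v snd \<tau> e"
    using E \<tau> \<sigma> P pe unfolding bundle_extension_def by blast
  then show "\<exists>v. w = fibre_matrix (proj VM) \<tau> \<sigma> \<iota> P *v v" using e e'(2) pe by blast
qed

lemma einstein_ricci:
  fixes g :: "real^'n::finite \<Rightarrow> real^'n^'n"
  assumes g: "det (g x) \<noteq> 0" "transpose (g x) = g x" and n: "3 \<le> CARD('n)"
    and e: "schouten g x - (metric_trace g (schouten g) x / real CARD('n)) *\<^sub>R g x = 0"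
  shows "ricci g x = (2 * (real CARD('n) - 1) * (metric_trace g (schouten g) x / real CARD('n))) *\<^sub>R g x"
proof -
  have P: "schouten g x = (metric_trace g (schouten g) x / real CARD('n)) *\<^sub>R g x" using e by simp
  have "ricci g x = (real CARD('n) - 2) *\<^sub>R schouten g x + metric_trace g (schouten g) x *\<^sub>R g x"
    by (rule ricci_schouten[where g = g, OF g n])
  also have "\<dots> = ((real CARD('n) - 2) * (metric_trace g (schouten g) x / real CARD('n)) + metric_trace g (schouten g) x) *\<^sub>R g x"
    by (subst P) (simp add: algebra_simps)
  also have "(real CARD('n) - 2) * (metric_trace g (schouten g) x / real CARD('n)) + metric_trace g (schouten g) x
     = 2 * (real CARD('n) - 1) * (metric_trace g (schouten g) x / real CARD('n))"
    using n by (simp add: field_simps)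
  finally show ?thesis .
qed

text \<open>In coordinates, an open part of the collar contains a half-ball around each of its
  boundary points. This turns membership in chart domains into eventual statements for r >=
  0.\<close>

lemma eventually_collar_crd:
  fixes c :: "('m::topological_space, 'n::finite) chart"
  assumes op: "open (crd c UNIV)" and h: "homeomorphism (fst c) (crd c UNIV) (snd c) (pt c)"
    and \<epsilon>: "\<epsilon> > 0" and x: "x \<in> crd c UNIV"
    and U: "openin (top_of_set (collar \<epsilon>)) U" "(0, pt c x) \<in> U"
  shows "\<forall>\<^sub>F z in nhds (cons_coord 0 x). 0 \<le> z $ None \<longrightarrow> z \<in> crd (collar_chart \<epsilon> c) U"
proof -
  let ?p = "cons_coord 0 x"
  obtain T where T: "open T" "U = collar \<epsilon> \<inter> T" using U(1) by (auto simp: openin_open)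
  have "continuous_on (crd c UNIV) (pt c)" using h by (auto simp: homeomorphism_def)
  then have "isCont (pt c) x" using op x by (simp add: continuous_on_eq_continuous_at)
  then have "(pt c \<longlongrightarrow> pt c x) (nhds x)" using continuous_within tendsto_at_iff_tendsto_nhds by blast
  moreover have "filterlim tl_coord (nhds x) (nhds ?p)"
  proof -
    have "isCont tl_coord ?p" by (rule smooth_at_continuous[OF smooth_at_tl_coord])
    then have "(tl_coord \<longlongrightarrow> tl_coord ?p) (nhds ?p)" using continuous_within tendsto_at_iff_tendsto_nhds by blast
    then show ?thesis by simp
  qed
  ultimately have t1: "((\<lambda>z. pt c (tl_coord z)) \<longlongrightarrow> pt c x) (nhds ?p)"
    by (rule filterlim_compose)
  have "isCont (\<lambda>z. z $ None) ?p" by (intro continuous_intros)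
  then have "((\<lambda>z. z $ None) \<longlongrightarrow> ?p $ None) (nhds ?p)" using continuous_within tendsto_at_iff_tendsto_nhds by blast
  then have t2: "((\<lambda>z. z $ None) \<longlongrightarrow> 0) (nhds ?p)" by simp
  have "((\<lambda>z. (z $ None, pt c (tl_coord z))) \<longlongrightarrow> (0, pt c x)) (nhds ?p)"
    by (rule tendsto_Pair[OF t2 t1])
  then have "\<forall>\<^sub>F z in nhds ?p. (z $ None, pt c (tl_coord z)) \<in> T"
    using T U(2) by (auto elim: topological_tendstoD)
  moreover have "\<forall>\<^sub>F z in nhds ?p. z $ None < \<epsilon>" using order_tendstoD(2)[OF t2 \<epsilon>] .
  moreover have "\<forall>\<^sub>F z in nhds ?p. tl_coord z \<in> crd c UNIV"
    by (rule eventually_tl) (simp add: eventually_nhds_in_open op x)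
  ultimately show ?thesis
    by eventually_elim (auto simp: crd_collar[OF h] T(2) collar_def)
qed

theorem theorem1p4:
  fixes At :: "('m::{t2_space, second_countable_topology}, 'n::finite) chart set"
    and C :: "('m, 'n) metric set"
    and VM :: "('m, 'e, 'r::finite) vbundle"
    and g\<^sub>E :: "('m, 'n) metric"
    and A :: "('m, 'n, 'e, 'r) connection"
    and \<epsilon> :: real
    and s :: "real \<times> 'm \<Rightarrow> real"
    and gp :: "(real \<times> 'm, 'n option) metric"
    and VX :: "(real \<times> 'm, 'f, 'r) vbundle"
    and \<iota> :: "'e \<Rightarrow> 'f"
    and AX :: "(real \<times> 'm, 'n option, 'f, 'r) connection"
    and k :: "('m, 'n) chart \<Rightarrow> ('m, 'e, 'r) triv \<Rightarrow> 'n \<Rightarrow> real^'n \<Rightarrow> real^'r^'r"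
  assumes "CARD('n) \<ge> 4" and "even CARD('n)"
    and "smooth_manifold At"
    and "conformal_structure At C"
    and "vector_bundle At UNIV VM"
    and "g\<^sub>E \<in> C" and "einstein_metric At g\<^sub>E"
    and "connection At VM A" and "yang_mills At VM g\<^sub>E A"
    and "conformal_ym_current At C VM g\<^sub>E A \<epsilon> s gp VX \<iota> AX k"
  shows "\<forall>c\<in>At. \<forall>\<tau>\<in>trivs VM. \<forall>x\<in>crd c (fst \<tau>). \<forall>i. k c \<tau> i x = 0"
proof (intro ballI allI)
  fix c \<tau> x i
  assume c: "c \<in> At" and \<tau>: "\<tau> \<in> trivs VM" and x: "x \<in> crd c (fst \<tau>)"
  let ?n = "CARD('n)" and ?cc = "collar_chart \<epsilon> c" and ?p = "cons_coord 0 x" and ?P = "pt c x"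
  let ?X = "crd ?cc UNIV"
  have cc: "?cc \<in> collar_chart \<epsilon> ` At" using c by simp
  have op: "open (crd c UNIV)" and hom: "homeomorphism (fst c) (crd c UNIV) (snd c) (pt c)"
    using assms(3) c by (auto simp: smooth_manifold_def)
  note ct = crd_collar[OF hom] and ci = crd_iff[OF hom]
  have xU: "x \<in> crd c UNIV" and P\<tau>: "?P \<in> fst \<tau>" using x ci by blast+
  have PE: "poincare_einstein At C g\<^sub>E \<epsilon> s gp" and BE: "bundle_extension At \<epsilon> VM VX \<iota>"
    and CE: "connection_extension At \<epsilon> VM VX \<iota> A AX"
    using assms(10) unfolding conformal_ym_current_def by blast+
  have \<epsilon>: "\<epsilon> > 0" and df: "defining_function At \<epsilon> s" using PE unfolding poincare_einstein_def by blast+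
  obtain gbar where gb: "riemannian_metric (collar_chart \<epsilon> ` At) (collar \<epsilon>) gbar"
    "\<And>x. x \<in> crd ?cc (collar_interior \<epsilon>) \<Longrightarrow> gbar ?cc x = (s (pt ?cc x))\<^sup>2 *\<^sub>R gp ?cc x"
    "induces At \<epsilon> gbar g\<^sub>E"
    using PE cc unfolding poincare_einstein_def by blast
  obtain Q where Q: "smooth_on (crd ?cc (collar \<epsilon>)) Q"
    "\<And>x. x \<in> crd ?cc (collar_interior \<epsilon>) \<Longrightarrow> schouten (gp ?cc) x + (1/2) *\<^sub>R gp ?cc x = s (pt ?cc x) ^ (?n - 2) *\<^sub>R Q x"
    using PE cc unfolding poincare_einstein_def by blast
  have vX: "vector_bundle (collar_chart \<epsilon> ` At) (collar \<epsilon>) VX" using BE unfolding bundle_extension_def by blast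
  have "(0, ?P) \<in> \<Union> (fst ` trivs VX)" using vX \<epsilon> unfolding vector_bundle_def by (simp add: collar_def)
  \<comment> \<open>The trivialisations of VX need not restrict to those of VM. The extension is
    studied in one around (0, P) and compared with \<tau> through the matrix H below.\<close>
  then obtain \<sigma> where \<sigma>: "\<sigma> \<in> trivs VX" "(0, ?P) \<in> fst \<sigma>" by blast
  have \<sigma>op: "openin (top_of_set (collar \<epsilon>)) (fst \<sigma>)" using vX \<sigma>(1) unfolding vector_bundle_def by blast
  then have \<sigma>sub: "fst \<sigma> \<subseteq> collar \<epsilon>" using openin_subset[OF \<sigma>op] by simp
  from assms(10) c \<sigma>(1) obtain q where q: "\<And>a. smooth_on (crd ?cc (fst \<sigma>)) (q a)"
    "\<And>a x. x \<in> crd ?cc (fst \<sigma> \<inter> collar_interior \<epsilon>) \<Longrightarrow>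
       ym_current (gp ?cc) (AX ?cc \<sigma>) a x = s (pt ?cc x) ^ (?n - 2) *\<^sub>R q a x"
    "\<And>\<tau> x i. \<tau> \<in> trivs VM \<Longrightarrow> x \<in> crd c (fst \<tau> \<inter> Pair 0 -` fst \<sigma>) \<Longrightarrow>
       q (Some i) (cons_coord 0 x) ** fibre_matrix (proj VM) \<tau> \<sigma> \<iota> (pt c x) = fibre_matrix (proj VM) \<tau> \<sigma> \<iota> (pt c x) ** k c \<tau> i x"
    unfolding conformal_ym_current_def Let_def by meson
  have inW: "\<forall>\<^sub>F z in nhds ?p. 0 \<le> z $ None \<longrightarrow> z \<in> crd ?cc (fst \<sigma>)"
    by (rule eventually_collar_crd[OF op hom \<epsilon> xU \<sigma>op \<sigma>(2)])
  have mono: "z \<in> crd ?cc V" if "z \<in> crd ?cc U" "U \<subseteq> V" for z U V using that by (auto simp: crd_def)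
  have collar_crd: "crd ?cc (collar \<epsilon>) = ?X" by (auto simp: ct collar_def)
  have inX: "\<forall>\<^sub>F z in nhds ?p. 0 \<le> z $ None \<longrightarrow> z \<in> ?X"
    using inW by eventually_elim (use mono in auto)
  have pW: "?p \<in> crd ?cc (fst \<sigma>)" using eventually_nhds_x_imp_x[OF inW] by simp
  have pX: "?p \<in> ?X" using mono[OF pW] by simp
  have intr: "z \<in> crd ?cc (fst \<sigma> \<inter> collar_interior \<epsilon>)" "z \<in> crd ?cc (collar_interior \<epsilon>)"
    if "z \<in> crd ?cc (fst \<sigma>)" "z $ None > 0" for z
    using that by (auto simp: ct collar_interior_def)

  have sA: "smooth_on (crd ?cc (fst \<sigma>)) (AX ?cc \<sigma> a)" for a
    using CE cc \<sigma>(1) unfolding connection_extension_def connection_def by blast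
  have "\<forall>a. \<exists>h. smooth_at ?p h \<and> (\<forall>\<^sub>F z in nhds ?p. z \<in> crd ?cc (fst \<sigma>) \<longrightarrow> AX ?cc \<sigma> a z = h z)"
    using smooth_on_extension[OF sA pW] by blast
  from choice[OF this] obtain A' where A': "\<And>a. smooth_at ?p (A' a)"
    "\<And>a. \<forall>\<^sub>F z in nhds ?p. z \<in> crd ?cc (fst \<sigma>) \<longrightarrow> AX ?cc \<sigma> a z = A' a z" by blast
  have "\<forall>a. \<exists>h. smooth_at ?p h \<and> (\<forall>\<^sub>F z in nhds ?p. z \<in> crd ?cc (fst \<sigma>) \<longrightarrow> q a z = h z)"
    using smooth_on_extension[OF q(1) pW] by blast
  from choice[OF this] obtain q' where q': "\<And>a. smooth_at ?p (q' a)"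
    "\<And>a. \<forall>\<^sub>F z in nhds ?p. z \<in> crd ?cc (fst \<sigma>) \<longrightarrow> q a z = q' a z" by blast
  obtain Q' where Q': "smooth_at ?p Q'" "\<forall>\<^sub>F z in nhds ?p. z \<in> ?X \<longrightarrow> Q z = Q' z"
    using smooth_on_extension[OF Q(1)] pX unfolding collar_crd by blast
  have "smooth_on ?X (s \<circ> pt ?cc)" using df cc unfolding defining_function_def smooth_function_def by blast
  from smooth_on_extension[OF this pX]
  obtain S where S: "smooth_at ?p S" "\<forall>\<^sub>F z in nhds ?p. z \<in> ?X \<longrightarrow> s (pt ?cc z) = S z" by auto
  have ptX: "pt ?cc z = (z $ None, pt c (tl_coord z))" if "z \<in> ?X" for z
    using that pt_collar[OF hom, of "tl_coord z" "z $ None" \<epsilon>] by (simp add: ct cons_tl_coord)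
  have "smooth_on ?X (gbar ?cc)" using gb(1) cc unfolding riemannian_metric_def collar_crd[symmetric] by blast
  from smooth_on_extension[OF this pX]
  obtain hB where hB: "smooth_at ?p hB" "\<forall>\<^sub>F z in nhds ?p. z \<in> ?X \<longrightarrow> gbar ?cc z = hB z" by blast
  have gbs: "transpose (gbar ?cc z) = gbar ?cc z" "v \<noteq> 0 \<Longrightarrow> v \<bullet> (gbar ?cc z *v v) > 0" if "z \<in> ?X" for z v
    using gb(1) cc that unfolding riemannian_metric_def collar_crd[symmetric] by blast+
  \<comment> \<open>The extension is symmetrised because symmetry is given only for r >= 0 but is
    required in a full neighbourhood.\<close>
  define B where "B z = (1/2) *\<^sub>R (hB z + transpose (hB z))" for z
  have BX: "\<forall>\<^sub>F z in nhds ?p. z \<in> ?X \<longrightarrow> B z = gbar ?cc z"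
    using hB(2)
  proof eventually_elim
    case (elim z)
    show ?case
    proof
      assume z: "z \<in> ?X"
      have "hB z = gbar ?cc z" using elim z by simp
      then have "B z = (1/2) *\<^sub>R (gbar ?cc z + gbar ?cc z)" by (simp add: B_def gbs(1)[OF z])
      then show "B z = gbar ?cc z" by (simp add: vec_eq_iff)
    qed
  qed
  have Bp: "B ?p = gbar ?cc ?p" using eventually_nhds_x_imp_x[OF BX] pX by simp

  have rg: "riemannian_metric At UNIV g\<^sub>E"
    using assms(4,6) unfolding conformal_structure_def conformal_class_def by blast
  have gs: "smooth_on (crd c UNIV) (g\<^sub>E c)" "\<And>y. y \<in> crd c UNIV \<Longrightarrow> transpose (g\<^sub>E c y) = g\<^sub>E c y"
    "\<And>y v. y \<in> crd c UNIV \<Longrightarrow> v \<noteq> 0 \<Longrightarrow> v \<bullet> (g\<^sub>E c y *v v) > 0"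
    using rg c unfolding riemannian_metric_def by blast+
  have Ux: "\<forall>\<^sub>F y in nhds x. y \<in> crd c UNIV" by (rule eventually_nhds_in_open[OF op xU])
  have sg: "smooth_at x (g\<^sub>E c)" by (rule smooth_on_eventually[OF gs(1) Ux])
  have dg: "det (g\<^sub>E c y) \<noteq> 0" if "y \<in> crd c UNIV" for y by (rule posdef_det_nz[OF gs(3)[OF that]])
  \<comment> \<open>The factor in P = \<mu> g, read off from the trace; at this point it is a
    function.\<close>
  define \<mu> where "\<mu> y = metric_trace (g\<^sub>E c) (schouten (g\<^sub>E c)) y / real ?n" for y
  have s\<mu>: "smooth_at x \<mu>" unfolding \<mu>_def[abs_def] using assms(1)
    by (intro smooth_intros sg dg xU) auto
  interpret einstein_boundary ?p "g\<^sub>E c" \<mu>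
  proof
    show "\<forall>\<^sub>F y in nhds (tl_coord ?p). ricci (g\<^sub>E c) y = (2 * (real ?n - 1) * \<mu> y) *\<^sub>R g\<^sub>E c y"
      using Ux unfolding tl_cons_coord
    proof eventually_elim
      case (elim y)
      show ?case unfolding \<mu>_def
        by (rule einstein_ricci) (use assms(1,7) c elim in \<open>auto simp: dg gs(2) einstein_metric_def\<close>)
    qed
    show "\<forall>\<^sub>F y in nhds (tl_coord ?p). transpose (g\<^sub>E c y) = g\<^sub>E c y"
      using Ux unfolding tl_cons_coord by eventually_elim (rule gs(2))
  qed (use assms(1) sg s\<mu> dg xU in auto)

  \<comment> \<open>The boundary connection in the trivialisation of VX. It is gauge equivalent to
    \<open>A c \<tau>\<close> by H, hence Yang-Mills as well.\<close>
  define a where "a j y = AX ?cc \<sigma> (Some j) (cons_coord 0 y)" for j y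
  have inWx: "\<forall>\<^sub>F y in nhds x. cons_coord 0 y \<in> crd ?cc (fst \<sigma>)"
  proof -
    have "\<forall>\<^sub>F y in nhds x. 0 \<le> cons_coord 0 y $ None \<longrightarrow> cons_coord 0 y \<in> crd ?cc (fst \<sigma>)"
      by (rule eventually_nhds_comp[OF smooth_at_cons_coord inW])
    then show ?thesis by simp
  qed
  have sa: "smooth_at x (a j)" for j
  proof (rule smooth_at_cong)
    show "smooth_at x (\<lambda>y. A' (Some j) (cons_coord 0 y))"
      by (rule smooth_at_compose[OF smooth_at_cons_coord A'(1)])
    show "\<forall>\<^sub>F y in nhds x. A' (Some j) (cons_coord 0 y) = a j y"
      using inWx eventually_nhds_comp[OF smooth_at_cons_coord A'(2)[of "Some j"]]
      by eventually_elim (simp add: a_def)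
  qed
  define H where "H = fibre_matrix (proj VM) \<tau> \<sigma> \<iota> \<circ> pt c"
  have "\<forall>\<^sub>F y in nhds x. y \<in> crd c (fst \<tau>)"
  proof -
    have "open (fst \<tau>)" using assms(5) \<tau> unfolding vector_bundle_def by auto
    moreover have "isCont (pt c) x"
      using hom op xU by (simp add: homeomorphism_def continuous_on_eq_continuous_at)
    then have "(pt c \<longlongrightarrow> ?P) (nhds x)" using continuous_within tendsto_at_iff_tendsto_nhds by blast
    ultimately have "\<forall>\<^sub>F y in nhds x. pt c y \<in> fst \<tau>" using P\<tau> by (auto elim: topological_tendstoD)
    then show ?thesis using Ux by eventually_elim (simp add: ci[of _ "fst \<tau>"])
  qed
  then have Vx: "\<forall>\<^sub>F y in nhds x. y \<in> crd c (fst \<tau> \<inter> Pair 0 -` fst \<sigma>) \<and> y \<in> crd c (fst \<tau>)"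
    using inWx
  proof eventually_elim
    case (elim y)
    then show ?case using ci[of y "fst \<tau>"] ci[of y "fst \<tau> \<inter> Pair 0 -` fst \<sigma>"] by (simp add: ct)
  qed
  have Vx': "\<forall>\<^sub>F y in nhds x. y \<in> crd c (fst \<tau> \<inter> Pair 0 -` fst \<sigma>)" "\<forall>\<^sub>F y in nhds x. y \<in> crd c (fst \<tau>)"
    using Vx by (auto elim: eventually_mono)
  have "smooth_on (crd c (fst \<tau> \<inter> Pair 0 -` fst \<sigma>)) H"
    using BE c \<tau> \<sigma>(1) unfolding bundle_extension_def H_def by blast
  then have sH: "smooth_at x H" by (rule smooth_on_eventually[OF _ Vx'(1)])
  have "smooth_on (crd c (fst \<tau>)) (A c \<tau> j)" for j using assms(8) c \<tau> unfolding connection_def by blast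
  then have sAc: "smooth_at x (A c \<tau> j)" for j by (rule smooth_on_eventually[OF _ Vx'(2)])
  have dH: "\<forall>\<^sub>F y in nhds x. partial j H y = H y ** A c \<tau> j y - a j y ** H y" for j
    using Vx'(1) by eventually_elim (use CE c \<tau> \<sigma>(1) in \<open>auto simp: connection_extension_def Let_def H_def a_def\<close>)
  have Hnz: "det (H y) \<noteq> 0" if "y \<in> crd c (fst \<tau> \<inter> Pair 0 -` fst \<sigma>)" for y
    unfolding H_def comp_def using that ci[of y "fst \<tau> \<inter> Pair 0 -` fst \<sigma>"]
    by (intro bundle_extension_det[OF BE \<tau> \<sigma>(1)]) auto
  have ym: "\<forall>\<^sub>F y in nhds x. ym_current (g\<^sub>E c) a j y = 0" for j
  proof -
    have e1: "\<forall>\<^sub>F y in nhds x. smooth_at y H" by (rule smooth_at_eventually[OF sH])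
    have e2: "\<forall>\<^sub>F y in nhds x. \<forall>j. smooth_at y (A c \<tau> j)" "\<forall>\<^sub>F y in nhds x. \<forall>j. smooth_at y (a j)"
      using smooth_at_eventually[OF sAc] smooth_at_eventually[OF sa] by (auto intro: eventually_all_finite)
    have "\<forall>\<^sub>F y in nhds x. \<forall>j. partial j H y = H y ** A c \<tau> j y - a j y ** H y"
      using dH by (intro eventually_all_finite)
    then have e3: "\<forall>\<^sub>F y in nhds x. \<forall>\<^sub>F w in nhds y. \<forall>j. partial j H w = H w ** A c \<tau> j w - a j w ** H w"
      by (simp add: eventually_eventually)
    show ?thesis
      using e1 e2 e3 Vx
    proof eventually_elim
      case (elim y)
      have "H y ** ym_current (g\<^sub>E c) (A c \<tau>) j y = ym_current (g\<^sub>E c) a j y ** H y"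
        by (rule ym_current_gauge) (use elim in \<open>auto elim: eventually_mono\<close>)
      moreover have "ym_current (g\<^sub>E c) (A c \<tau>) j y = 0" using assms(9) c \<tau> elim(5) unfolding yang_mills_def by blast
      ultimately have "ym_current (g\<^sub>E c) a j y ** H y = 0" by simp
      then have "ym_current (g\<^sub>E c) a j y ** (H y ** matrix_inv (H y)) = 0" by (simp add: matrix_mul_assoc)
      then show ?case using Hnz elim(5) by (simp add: matrix_inv_both)
    qed
  qed

  have S0: "\<forall>\<^sub>F z in nhds ?p. z $ None = 0 \<longrightarrow> S z = 0"
    using S(2) inX
  proof eventually_elim
    case (elim z)
    have "s (pt ?cc z) = 0" if "z $ None = 0" "z \<in> ?X"
      using df that \<epsilon> unfolding defining_function_def by (simp add: ptX collar_def)
    then show ?case using elim by auto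
  qed
  have "q' (Some i) ?p = 0"
  proof (rule local_current_zero[where B = B and S = S and \<gamma> = "gp ?cc" and Q = Q' and A = A' and a = a])
    show "smooth_at ?p B" unfolding B_def[abs_def] by (intro smooth_intros hB(1))
    show "\<forall>\<^sub>F z in nhds ?p. transpose (B z) = B z"
      by (intro always_eventually allI) (simp add: B_def transpose_distribs add.commute)
    show "\<forall>v. v \<noteq> 0 \<longrightarrow> v \<bullet> (B ?p *v v) > 0" unfolding Bp using gbs(2)[OF pX] by blast
    \<comment> \<open>The differential of the defining function is nonzero on the boundary. Its
      tangential part vanishes there, so the normal derivative does not.\<close>
    show "partial None S ?p \<noteq> 0"
    proof
      assume z: "partial None S ?p = 0"
      have "vo (Suc 0) ?p S" by (rule vo_SucI[OF S(1) S0]) (simp add: smooth_at_partial S(1))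
      from vo_SucD(1)[OF vo_partial_Some[OF this]]
      have "partial (Some j) S ?p = 0" for j using eventually_nhds_x_imp_x by fastforce
      then have "partial b S ?p = 0" for b using z by (cases b) auto
      moreover have "pd ?X (s \<circ> pt ?cc) b ?p = partial b S ?p" for b
        by (rule pd_half_space) (use pX inX S in auto)
      moreover have "?p \<in> crd ?cc ({0} \<times> UNIV)" using pX by (simp add: ct)
      then obtain b where "pd ?X (s \<circ> pt ?cc) b ?p \<noteq> 0" using df cc unfolding defining_function_def by blast
      ultimately show False by simp
    qed
    show "\<forall>\<^sub>F z in nhds ?p. z $ None > 0 \<longrightarrow> B z = (S z)\<^sup>2 *\<^sub>R gp ?cc z"
      using inW inX BX S(2)
      by eventually_elim (use gb(2) intr in auto)
    show "\<forall>\<^sub>F z in nhds ?p. z $ None > 0 \<longrightarrow> schouten (gp ?cc) z + (1/2) *\<^sub>R gp ?cc z = S z ^ (?n - 2) *\<^sub>R Q' z"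
      using inW inX Q'(2) S(2)
      by eventually_elim (use Q(2) intr in auto)
    show "\<forall>\<^sub>F z in nhds ?p. z $ None > 0 \<longrightarrow> ym_current (gp ?cc) A' b z = S z ^ (?n - 2) *\<^sub>R q' b z" for b
    proof -
      have "\<forall>\<^sub>F z in nhds ?p. \<forall>b. 0 < z $ None \<longrightarrow> A' b z = AX ?cc \<sigma> b z"
      proof (rule eventually_all_finite)
        show "\<forall>\<^sub>F z in nhds ?p. 0 < z $ None \<longrightarrow> A' b z = AX ?cc \<sigma> b z" for b
          using inW A'(2)[of b] by eventually_elim auto
      qed
      then have "\<forall>\<^sub>F z in nhds ?p. \<forall>\<^sub>F w in nhds z. \<forall>b. 0 < w $ None \<longrightarrow> A' b w = AX ?cc \<sigma> b w"
        by (simp add: eventually_eventually)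
      then show ?thesis
        using inW inX S(2) q'(2)[of b]
      proof eventually_elim
        case (elim z)
        show ?case
        proof
          assume r: "0 < z $ None"
          have "\<forall>\<^sub>F w in nhds z. A' b w = AX ?cc \<sigma> b w" for b
            using elim(1) eventually_pos[OF smooth_at_nth[OF smooth_at_ident] r] by eventually_elim auto
          then have "ym_current (gp ?cc) A' b z = ym_current (gp ?cc) (AX ?cc \<sigma>) b z"
            by (intro ym_current_cong) auto
          then show "ym_current (gp ?cc) A' b z = S z ^ (?n - 2) *\<^sub>R q' b z"
            using elim(2-5) r q(2)[OF intr(1)] by auto
        qed
      qed
    qed
    show "\<forall>\<^sub>F z in nhds ?p. z $ None = 0 \<longrightarrow> tang B z = g\<^sub>E c (tl_coord z)"
      using inX BX
    proof eventually_elim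
      case (elim z)
      show ?case
      proof
        assume r: "z $ None = 0"
        then have z: "z \<in> ?X" using elim(1) by simp
        then have y: "tl_coord z \<in> crd c UNIV" by (simp add: ct)
        have "z = cons_coord 0 (tl_coord z)" using cons_tl_coord[of z] r by simp
        then have "gbar ?cc z $ Some i $ Some j = g\<^sub>E c (tl_coord z) $ i $ j" for i j
          using gb(3) c y unfolding induces_def by metis
        then show "tang B z = g\<^sub>E c (tl_coord z)" using elim(2) z by (simp add: tang_def vec_eq_iff)
      qed
    qed
    show "\<forall>\<^sub>F z in nhds ?p. z $ None = 0 \<longrightarrow> A' (Some j) z = a j (tl_coord z)" for j
      using inW A'(2)[of "Some j"]
    proof eventually_elim
      case (elim z)
      show ?case
      proof
        assume r: "z $ None = 0"
        have "cons_coord 0 (tl_coord z) = z" using cons_tl_coord[of z] r by simp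
        then show "A' (Some j) z = a j (tl_coord z)" using elim r by (simp add: a_def)
      qed
    qed
  qed (use assms(2) S(1) S0 Q'(1) A'(1) q'(1) sa ym in auto)
  moreover have "q (Some i) ?p = q' (Some i) ?p" using eventually_nhds_x_imp_x[OF q'(2)] pW by simp
  moreover have xV: "x \<in> crd c (fst \<tau> \<inter> Pair 0 -` fst \<sigma>)" by (rule eventually_nhds_x_imp_x[OF Vx'(1)])
  \<comment> \<open>The values of the current are carried to VM by q H = H k; as H is invertible, k
    vanishes with q.\<close>
  ultimately have "H x ** k c \<tau> i x = 0" using q(3)[OF \<tau> xV, of i] by (simp add: H_def)
  then have "(matrix_inv (H x) ** H x) ** k c \<tau> i x = 0" by (simp add: matrix_mul_assoc[symmetric])
  then show "k c \<tau> i x = 0" using Hnz[OF xV] by (simp add: matrix_inv_both)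
qed

end
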